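(* Let $n\in\mathbb N$ ($n\geq 1$), and let $G_n=SU(2)\times\cdots\times SU(2)$, $2^n$-times. Then $A_{\gamma^n}(SU(2))$ is a unital, infinite-dimensional Arens regular closed subalgebra of the Fourier algebra $A(G_n)$.
   Context: $SU(2)$ is the group of $2\times2$ unitary matrices with determinant $1$. For a compact group $G$, $A(G)$ is its Fourier algebra, $A(G)=\{f\in C(G):\sum_{\pi\in\widehat G}d_\pi\|\widehat f(\pi)\|_1<\infty\}$ with this sum as norm and pointwise multiplication ($d_\pi=\dim\pi$, $\widehat f(\pi)=\int_Gf(t)\overline\pi(t)\,dt$, $\|\cdot\|_1$ the trace-class norm). For a compact group $G$ and a function $w$ on $G\times G$ let $\check Qw(s)=\int_Gw(st,t^{-1})\,dt$ (normalized Haar measure). Put $A_{\gamma^0}(G)=A(G)$ and, recursively for all compact groups $G$, $A_{\gamma^{n+1}}(G)=\check Q(A_{\gamma^n}(G\times G))$ for $n\ge0$, with the quotient norm ($A_{\gamma^1}=A_\gamma$). The map $\check N$, $\check Nu(s,t)=u(st)$, is an isometric algebra homomorphism from $A_{\gamma^{n+1}}(G)$ into $A_{\gamma^n}(G\times G)$; by iterating these embeddings, $A_{\gamma^n}(G)$ is identified with a subalgebra of $A(G\times\cdots\times G)$ ($2^n$ factors), and it is in this sense that it is a closed subalgebra. A Banach algebra $A$ is Arens regular if the first and second Arens products on $A^{**}$ coincide. *)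

theory Defs
  imports
    "HOL-Analysis.Analysis"
    "HOL-Algebra.Coset"
    "HOL-Algebra.Product_Groups"
    "HOL-Library.Function_Algebras"
    "Jordan_Normal_Form.Schur_Decomposition"
begin

section \<open>Conventions\<close>

text \<open>
  A compact group is given by a group \<open>G\<close> in the sense of \<^theory>\<open>HOL-Algebra.Group\<close> and an
  abstract topology \<open>T\<close> with \<open>topspace T = carrier G\<close>.
  A complex normed space is given by a set \<open>V\<close> of complex-valued functions, closed under the
  pointwise operations, with a norm \<open>N\<close> that only matters on \<open>V\<close>.  So that the pointwise operations
  on total functions are the right ones, a function on a set \<open>X\<close> is always
  represented by its extension by \<open>0\<close> outside \<open>X\<close>; for the dual space, \<open>X\<close> is itself a
  set of functions.  Every complex normed space has such a form (embed it into its bidual).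
\<close>

definition zero_ext :: "'x set \<Rightarrow> ('x \<Rightarrow> complex) \<Rightarrow> 'x \<Rightarrow> complex" where
  "zero_ext X f = (\<lambda>x. if x \<in> X then f x else 0)"

definition cscale :: "complex \<Rightarrow> ('x \<Rightarrow> complex) \<Rightarrow> 'x \<Rightarrow> complex" where
  "cscale c f = (\<lambda>x. c * f x)"

section \<open>Banach algebras and Arens regularity\<close>

definition norm_on :: "('x \<Rightarrow> complex) set \<Rightarrow> (('x \<Rightarrow> complex) \<Rightarrow> real) \<Rightarrow> bool" where
  "norm_on V N \<longleftrightarrow>
     (\<forall>f\<in>V. 0 \<le> N f \<and> (N f = 0 \<longleftrightarrow> f = 0)) \<and>
     (\<forall>c. \<forall>f\<in>V. N (cscale c f) = cmod c * N f) \<and>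
     (\<forall>f\<in>V. \<forall>g\<in>V. N (f + g) \<le> N f + N g)"

definition complete_on :: "('x \<Rightarrow> complex) set \<Rightarrow> (('x \<Rightarrow> complex) \<Rightarrow> real) \<Rightarrow> bool" where
  "complete_on V N \<longleftrightarrow>
     (\<forall>F :: nat \<Rightarrow> 'x \<Rightarrow> complex.
        (\<forall>k. F k \<in> V) \<and> (\<forall>e>0. \<exists>K. \<forall>j\<ge>K. \<forall>k\<ge>K. N (F j - F k) < e) \<longrightarrow>
        (\<exists>f\<in>V. (\<lambda>k. N (F k - f)) \<longlonglongrightarrow> 0))"

definition banach_algebra_on ::
  "('x \<Rightarrow> complex) set \<Rightarrow> (('x \<Rightarrow> complex) \<Rightarrow> real) \<Rightarrow>
   (('x \<Rightarrow> complex) \<Rightarrow> ('x \<Rightarrow> complex) \<Rightarrow> ('x \<Rightarrow> complex)) \<Rightarrow> bool" where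
  "banach_algebra_on V N mul \<longleftrightarrow>
     Modules.module.subspace cscale V \<and> norm_on V N \<and> complete_on V N \<and>
     (\<forall>f\<in>V. \<forall>g\<in>V. mul f g \<in> V \<and> N (mul f g) \<le> N f * N g) \<and>
     (\<forall>f\<in>V. \<forall>g\<in>V. \<forall>h\<in>V.
        mul (mul f g) h = mul f (mul g h) \<and>
        mul (f + g) h = mul f h + mul g h \<and> mul f (g + h) = mul f g + mul f h) \<and>
     (\<forall>c. \<forall>f\<in>V. \<forall>g\<in>V.
        mul (cscale c f) g = cscale c (mul f g) \<and> mul f (cscale c g) = cscale c (mul f g))"

definition dual_space ::
  "('x \<Rightarrow> complex) set \<Rightarrow> (('x \<Rightarrow> complex) \<Rightarrow> real) \<Rightarrow> (('x \<Rightarrow> complex) \<Rightarrow> complex) set" where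
  "dual_space V N =
     {\<phi>. (\<forall>f. f \<notin> V \<longrightarrow> \<phi> f = 0) \<and>
         (\<forall>f\<in>V. \<forall>g\<in>V. \<phi> (f + g) = \<phi> f + \<phi> g) \<and>
         (\<forall>c. \<forall>f\<in>V. \<phi> (cscale c f) = c * \<phi> f) \<and>
         (\<exists>C. \<forall>f\<in>V. cmod (\<phi> f) \<le> C * N f)}"

definition dual_norm ::
  "('x \<Rightarrow> complex) set \<Rightarrow> (('x \<Rightarrow> complex) \<Rightarrow> real) \<Rightarrow> (('x \<Rightarrow> complex) \<Rightarrow> complex) \<Rightarrow> real" where
  "dual_norm V N \<phi> = (SUP f\<in>{f\<in>V. N f \<le> 1}. cmod (\<phi> f))"

definition bidual_space ::
  "('x \<Rightarrow> complex) set \<Rightarrow> (('x \<Rightarrow> complex) \<Rightarrow> real) \<Rightarrow>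
   ((('x \<Rightarrow> complex) \<Rightarrow> complex) \<Rightarrow> complex) set" where
  "bidual_space V N = dual_space (dual_space V N) (dual_norm V N)"

text \<open>
  First product \<open>m \<box> n\<close>, built from
  \<open>\<langle>\<phi>\<cdot>f, g\<rangle> = \<langle>\<phi>, f g\<rangle>\<close>, \<open>\<langle>n\<cdot>\<phi>, f\<rangle> = \<langle>n, \<phi>\<cdot>f\<rangle>\<close>, \<open>\<langle>m \<box> n, \<phi>\<rangle> = \<langle>m, n\<cdot>\<phi>\<rangle>\<close>;
  second product \<open>m \<diamond> n\<close>, built from
  \<open>\<langle>f\<cdot>\<phi>, g\<rangle> = \<langle>\<phi>, g f\<rangle>\<close>, \<open>\<langle>\<phi>\<cdot>m, f\<rangle> = \<langle>m, f\<cdot>\<phi>\<rangle>\<close>, \<open>\<langle>m \<diamond> n, \<phi>\<rangle> = \<langle>n, \<phi>\<cdot>m\<rangle>\<close>.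
\<close>

definition arens_first where
  "arens_first V N mul m n =
     zero_ext (dual_space V N)
       (\<lambda>\<phi>. m (zero_ext V (\<lambda>f. n (zero_ext V (\<lambda>g. \<phi> (mul f g))))))"

definition arens_second where
  "arens_second V N mul m n =
     zero_ext (dual_space V N)
       (\<lambda>\<phi>. n (zero_ext V (\<lambda>f. m (zero_ext V (\<lambda>g. \<phi> (mul g f))))))"

definition arens_regular ::
  "('x \<Rightarrow> complex) set \<Rightarrow> (('x \<Rightarrow> complex) \<Rightarrow> real) \<Rightarrow>
   (('x \<Rightarrow> complex) \<Rightarrow> ('x \<Rightarrow> complex) \<Rightarrow> ('x \<Rightarrow> complex)) \<Rightarrow> bool" where
  "arens_regular V N mul \<longleftrightarrow>
     banach_algebra_on V N mul \<and>
     (\<forall>m\<in>bidual_space V N. \<forall>n\<in>bidual_space V N.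
        arens_first V N mul m n = arens_second V N mul m n)"

definition unital_on ::
  "('x \<Rightarrow> complex) set \<Rightarrow>
   (('x \<Rightarrow> complex) \<Rightarrow> ('x \<Rightarrow> complex) \<Rightarrow> ('x \<Rightarrow> complex)) \<Rightarrow> bool" where
  "unital_on V mul \<longleftrightarrow> (\<exists>e\<in>V. \<forall>f\<in>V. mul e f = f \<and> mul f e = f)"

definition infinite_dimensional :: "('x \<Rightarrow> complex) set \<Rightarrow> bool" where
  "infinite_dimensional V \<longleftrightarrow> \<not> (\<exists>S. finite S \<and> S \<subseteq> V \<and> V \<subseteq> Modules.module.span cscale S)"

definition closed_subalgebra ::
  "('x \<Rightarrow> complex) set \<Rightarrow> ('x \<Rightarrow> complex) set \<Rightarrow> (('x \<Rightarrow> complex) \<Rightarrow> real) \<Rightarrow>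
   (('x \<Rightarrow> complex) \<Rightarrow> ('x \<Rightarrow> complex) \<Rightarrow> ('x \<Rightarrow> complex)) \<Rightarrow> bool" where
  "closed_subalgebra B V N mul \<longleftrightarrow>
     B \<subseteq> V \<and> Modules.module.subspace cscale B \<and> (\<forall>f\<in>B. \<forall>g\<in>B. mul f g \<in> B) \<and>
     (\<forall>(F :: nat \<Rightarrow> 'x \<Rightarrow> complex) f.
        (\<forall>k. F k \<in> B) \<and> f \<in> V \<and> (\<lambda>k. N (F k - f)) \<longlonglongrightarrow> 0 \<longrightarrow> f \<in> B)"

definition isometric_algebra_hom where
  "isometric_algebra_hom V N mul V' N' mul' J \<longleftrightarrow>
     (\<forall>f\<in>V. J f \<in> V' \<and> N' (J f) = N f) \<and>
     (\<forall>f\<in>V. \<forall>g\<in>V. J (f + g) = J f + J g \<and> J (mul f g) = mul' (J f) (J g)) \<and>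
     (\<forall>c. \<forall>f\<in>V. J (cscale c f) = cscale c (J f))"

section \<open>Haar measure, the dual object and the Fourier algebra of a compact group\<close>

definition haar_measure :: "('g, 'r) monoid_scheme \<Rightarrow> 'g topology \<Rightarrow> 'g measure" where
  "haar_measure G T = (THE M.
     sets M = sets (sigma (topspace T) {U. openin T U}) \<and>
     emeasure M (topspace T) = 1 \<and>
     (\<forall>x\<in>carrier G. \<forall>E\<in>sets M. emeasure M (x <#\<^bsub>G\<^esub> E) = emeasure M E) \<and>
     (\<forall>E\<in>sets M. emeasure M E = (INF U\<in>{U. openin T U \<and> E \<subseteq> U}. emeasure M U)))"

definition unitary_mat :: "nat \<Rightarrow> complex mat \<Rightarrow> bool" where
  "unitary_mat d A \<longleftrightarrow>
     A \<in> carrier_mat d d \<and> A * mat_adjoint A = 1\<^sub>m d \<and> mat_adjoint A * A = 1\<^sub>m d"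

definition rep_dim :: "('g, 'r) monoid_scheme \<Rightarrow> ('g \<Rightarrow> complex mat) \<Rightarrow> nat" where
  "rep_dim G \<pi> = dim_row (\<pi> \<one>\<^bsub>G\<^esub>)"

definition unitary_rep ::
  "('g, 'r) monoid_scheme \<Rightarrow> 'g topology \<Rightarrow> ('g \<Rightarrow> complex mat) \<Rightarrow> bool" where
  "unitary_rep G T \<pi> \<longleftrightarrow>
     (\<forall>x\<in>carrier G. unitary_mat (rep_dim G \<pi>) (\<pi> x)) \<and>
     (\<forall>x\<in>carrier G. \<forall>y\<in>carrier G. \<pi> (x \<otimes>\<^bsub>G\<^esub> y) = \<pi> x * \<pi> y) \<and>
     (\<forall>i<rep_dim G \<pi>. \<forall>j<rep_dim G \<pi>. continuous_map T euclidean (\<lambda>x. \<pi> x $$ (i, j)))"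

definition irreducible_rep :: "('g, 'r) monoid_scheme \<Rightarrow> ('g \<Rightarrow> complex mat) \<Rightarrow> bool" where
  "irreducible_rep G \<pi> \<longleftrightarrow>
     0 < rep_dim G \<pi> \<and>
     (\<forall>W. VectorSpace.subspace class_ring W (module_vec TYPE(complex) (rep_dim G \<pi>)) \<and>
          (\<forall>x\<in>carrier G. \<forall>v\<in>W. \<pi> x *\<^sub>v v \<in> W) \<longrightarrow>
          W = {0\<^sub>v (rep_dim G \<pi>)} \<or> W = carrier_vec (rep_dim G \<pi>))"

definition equivalent_reps ::
  "('g, 'r) monoid_scheme \<Rightarrow> ('g \<Rightarrow> complex mat) \<Rightarrow> ('g \<Rightarrow> complex mat) \<Rightarrow> bool" where
  "equivalent_reps G \<pi> \<rho> \<longleftrightarrow>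
     rep_dim G \<pi> = rep_dim G \<rho> \<and>
     (\<exists>S. unitary_mat (rep_dim G \<pi>) S \<and> (\<forall>x\<in>carrier G. S * \<pi> x = \<rho> x * S))"

text \<open>
  Irreducible unitary representations of a compact group are finite-dimensional, so
  matrix representations suffice for the dual object.
\<close>

definition irreps :: "('g, 'r) monoid_scheme \<Rightarrow> 'g topology \<Rightarrow> ('g \<Rightarrow> complex mat) set" where
  "irreps G T = {\<pi>. unitary_rep G T \<pi> \<and> irreducible_rep G \<pi>}"

definition dual_object ::
  "('g, 'r) monoid_scheme \<Rightarrow> 'g topology \<Rightarrow> ('g \<Rightarrow> complex mat) set set" where
  "dual_object G T =
     irreps G T // {(\<pi>, \<rho>). \<pi> \<in> irreps G T \<and> \<rho> \<in> irreps G T \<and> equivalent_reps G \<pi> \<rho>}"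

definition representative :: "('g \<Rightarrow> complex mat) set \<Rightarrow> 'g \<Rightarrow> complex mat" where
  "representative c = (SOME \<pi>. \<pi> \<in> c)"

definition fourier_coeff ::
  "('g, 'r) monoid_scheme \<Rightarrow> 'g topology \<Rightarrow> ('g \<Rightarrow> complex) \<Rightarrow> ('g \<Rightarrow> complex mat) \<Rightarrow>
   complex mat" where
  "fourier_coeff G T f \<pi> =
     Matrix.mat (rep_dim G \<pi>) (rep_dim G \<pi>)
       (\<lambda>(i, j). \<integral>t. f t * cnj (\<pi> t $$ (i, j)) \<partial>haar_measure G T)"

definition positive_semidefinite :: "nat \<Rightarrow> complex mat \<Rightarrow> bool" where
  "positive_semidefinite d A \<longleftrightarrow>
     A \<in> carrier_mat d d \<and> (\<forall>v\<in>carrier_vec d. (A *\<^sub>v v) \<bullet>c v \<in> \<real>\<^sub>\<ge>\<^sub>0)"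

text \<open>The absolute value \<open>\<bar>A\<bar> = sqrt (A\<^sup>* A)\<close> of a square matrix, and the trace-class norm \<open>tr \<bar>A\<bar>\<close>.\<close>

definition mat_abs :: "complex mat \<Rightarrow> complex mat" where
  "mat_abs A = (THE R. positive_semidefinite (dim_col A) R \<and> R * R = mat_adjoint A * A)"

definition trace_norm :: "complex mat \<Rightarrow> real" where
  "trace_norm A = Re (sum_list (diag_mat (mat_abs A)))"

definition fourier_term ::
  "('g, 'r) monoid_scheme \<Rightarrow> 'g topology \<Rightarrow> ('g \<Rightarrow> complex) \<Rightarrow> ('g \<Rightarrow> complex mat) set \<Rightarrow> real" where
  "fourier_term G T f c =
     real (rep_dim G (representative c)) * trace_norm (fourier_coeff G T f (representative c))"

definition fourier_algebra ::
  "('g, 'r) monoid_scheme \<Rightarrow> 'g topology \<Rightarrow> ('g \<Rightarrow> complex) set" where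
  "fourier_algebra G T =
     {f. continuous_map T euclidean f \<and> (\<forall>x. x \<notin> carrier G \<longrightarrow> f x = 0) \<and>
         fourier_term G T f summable_on dual_object G T}"

definition fourier_norm ::
  "('g, 'r) monoid_scheme \<Rightarrow> 'g topology \<Rightarrow> ('g \<Rightarrow> complex) \<Rightarrow> real" where
  "fourier_norm G T f = infsum (fourier_term G T f) (dual_object G T)"

section \<open>The algebras \<open>A\<^bsub>\<gamma>\<^esub>\<^sup>n\<close>\<close>

text \<open>
  The recursion \<open>G \<mapsto> G \<times> G\<close> would change the type at every step.  It is therefore carried out on
  the powers \<open>K\<^sup>m\<close> of an arbitrary compact group \<open>(K, T)\<close>, all living on the type
  \<^typ>\<open>nat \<Rightarrow> 'a\<close>, where \<open>K\<^sup>m \<times> K\<^sup>m\<close> is \<open>K\<^sup>2\<^sup>m\<close>: a pair \<open>(s, t)\<close> is the concatenation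
  \<open>pow_pair m s t\<close>.  The group \<open>K\<close> itself is \<open>K\<^sup>1\<close>.
\<close>

definition pow_group :: "('a, 'r) monoid_scheme \<Rightarrow> nat \<Rightarrow> (nat \<Rightarrow> 'a) monoid" where
  "pow_group K m = product_group {..<m} (\<lambda>_. K)"

definition pow_top :: "'a topology \<Rightarrow> nat \<Rightarrow> (nat \<Rightarrow> 'a) topology" where
  "pow_top T m = product_topology (\<lambda>_. T) {..<m}"

definition pow_pair :: "nat \<Rightarrow> (nat \<Rightarrow> 'a) \<Rightarrow> (nat \<Rightarrow> 'a) \<Rightarrow> nat \<Rightarrow> 'a" where
  "pow_pair m s t = (\<lambda>i\<in>{..<2 * m}. if i < m then s i else t (i - m))"

definition pow_fst :: "nat \<Rightarrow> (nat \<Rightarrow> 'a) \<Rightarrow> nat \<Rightarrow> 'a" where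
  "pow_fst m x = (\<lambda>i\<in>{..<m}. x i)"

definition pow_snd :: "nat \<Rightarrow> (nat \<Rightarrow> 'a) \<Rightarrow> nat \<Rightarrow> 'a" where
  "pow_snd m x = (\<lambda>i\<in>{..<m}. x (m + i))"

text \<open>\<open>Q w (s) = \<integral> w (s t, t\<^sup>-\<^sup>1) dt\<close> on \<open>G = K\<^sup>m\<close>, for \<open>w\<close> on \<open>G \<times> G\<close>, and \<open>N u (s, t) = u (s t)\<close>.\<close>

definition Q_check ::
  "('a, 'r) monoid_scheme \<Rightarrow> 'a topology \<Rightarrow> nat \<Rightarrow> ((nat \<Rightarrow> 'a) \<Rightarrow> complex) \<Rightarrow> (nat \<Rightarrow> 'a) \<Rightarrow> complex"
  where
  "Q_check K T m w =
     (let G = pow_group K m in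
      zero_ext (carrier G)
        (\<lambda>s. \<integral>t. w (pow_pair m (s \<otimes>\<^bsub>G\<^esub> t) (inv\<^bsub>G\<^esub> t)) \<partial>haar_measure G (pow_top T m)))"

definition N_check ::
  "('a, 'r) monoid_scheme \<Rightarrow> nat \<Rightarrow> ((nat \<Rightarrow> 'a) \<Rightarrow> complex) \<Rightarrow> (nat \<Rightarrow> 'a) \<Rightarrow> complex" where
  "N_check K m u =
     zero_ext (carrier (pow_group K (2 * m)))
       (\<lambda>x. u (pow_fst m x \<otimes>\<^bsub>pow_group K m\<^esub> pow_snd m x))"

text \<open>
  \<open>A_gamma K T n m\<close> and \<open>A_gamma_norm K T n m\<close> are \<open>A\<^bsub>\<gamma>\<^esub>\<^sup>n(K\<^sup>m)\<close> and its (quotient) norm;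
  \<open>gamma_embed K n m\<close> is the iterate of the maps \<open>N\<close>, from functions on \<open>K\<^sup>m\<close> to functions on the
  product of \<open>2\<^sup>n\<close> copies of \<open>K\<^sup>m\<close>.
\<close>

fun A_gamma ::
  "('a, 'r) monoid_scheme \<Rightarrow> 'a topology \<Rightarrow> nat \<Rightarrow> nat \<Rightarrow> ((nat \<Rightarrow> 'a) \<Rightarrow> complex) set" where
  "A_gamma K T 0 m = fourier_algebra (pow_group K m) (pow_top T m)"
| "A_gamma K T (Suc n) m = Q_check K T m ` A_gamma K T n (2 * m)"

fun A_gamma_norm ::
  "('a, 'r) monoid_scheme \<Rightarrow> 'a topology \<Rightarrow> nat \<Rightarrow> nat \<Rightarrow> ((nat \<Rightarrow> 'a) \<Rightarrow> complex) \<Rightarrow> real" where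
  "A_gamma_norm K T 0 m u = fourier_norm (pow_group K m) (pow_top T m) u"
| "A_gamma_norm K T (Suc n) m u =
     (INF w\<in>{w \<in> A_gamma K T n (2 * m). Q_check K T m w = u}. A_gamma_norm K T n (2 * m) w)"

fun gamma_embed ::
  "('a, 'r) monoid_scheme \<Rightarrow> nat \<Rightarrow> nat \<Rightarrow> ((nat \<Rightarrow> 'a) \<Rightarrow> complex) \<Rightarrow> (nat \<Rightarrow> 'a) \<Rightarrow> complex" where
  "gamma_embed K 0 m u = u"
| "gamma_embed K (Suc n) m u = gamma_embed K n (2 * m) (N_check K m u)"

section \<open>\<open>SU(2)\<close>\<close>

definition conj_transpose :: "complex ^ 'n ^ 'n \<Rightarrow> complex ^ 'n ^ 'n" where
  "conj_transpose A = (\<chi> i j. cnj (A $ j $ i))"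

definition SU2 :: "(complex ^ 2 ^ 2) monoid" where
  "SU2 = \<lparr>carrier = {A. conj_transpose A ** A = Finite_Cartesian_Product.mat 1 \<and>
                        A ** conj_transpose A = Finite_Cartesian_Product.mat 1 \<and>
                        Determinants.det A = 1},
          monoid.mult = (**),
          one = Finite_Cartesian_Product.mat 1\<rparr>"

definition SU2_top :: "(complex ^ 2 ^ 2) topology" where
  "SU2_top = subtopology euclidean (carrier SU2)"

end

theory Submission
 imports Defs "HOL-Probability.Probability_Measure"
begin

text \<open>Every algebra is described by a convex set of functions.  An atom of a compact group is a coefficient
 \<open>\<langle>s(x) u, v\<rangle>\<close> of a unitary matrix representation with \<open>u, v\<close> of norm at most \<open>1\<close>, and \<open>Conv G r\<close> is the
 uniform closure of the combinations of atoms with coefficients of total modulus at most \<open>r\<close>.  Schur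
 orthogonality, trace duality and completeness of the representations show that the ball of radius
 \<open>r\<close> of \<open>A(G)\<close> is \<open>Conv G r\<close> (\<open>fourier_algebra_iff\<close>, \<open>fourier_norm_le_iff\<close>).

 On \<open>G \<times> G\<close>, the composition of \<open>Q\<close> and \<open>N\<close> is an average of two-sided translations, and averages of
 this kind preserve \<open>Conv\<close> (\<open>Conv_average\<close>).  By induction, the ball of radius \<open>r\<close> of \<open>A\<^bsub>\<gamma>\<^esub>\<^sup>n\<close> consists of
 the functions whose composition with the product of all \<open>2\<^sup>n\<close> factors lies in \<open>Conv\<close>
 (\<open>A_gamma_iff\<close>, \<open>A_gamma_norm_le_iff\<close>).  This composition is the embedding, so it is isometric; its
 range is closed because a limit of functions that are constant on the fibres of the product map is
 constant on them too.

 For Arens regularity, the norm of \<open>A\<^bsub>\<gamma>\<^esub>\<^sup>n(G)\<close> is the sum of the terms of the norm of \<open>A(G)\<close>, weighted by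
 \<open>d\<^sub>k\<close> to the power \<open>2\<^sup>n - 1\<close> (\<open>gamma_ball_iff\<close>).  For \<open>SU(2)\<close> the dimensions are \<open>d\<^sub>k = k + 1\<close>, and the product
 of the components \<open>k\<close> and \<open>l\<close> of two functions has components at most \<open>k + l\<close>.  As
 \<open>(k + l + 1) / ((k + 1) (l + 1))\<close> tends to \<open>0\<close> for \<open>k, l \<rightarrow> \<infinity>\<close>, products of tails are small
 (\<open>truncation_product\<close>): in norm, the multiplication is a limit of bilinear maps to which only finitely
 many components of one of the factors contribute, and for those the order in which two elements of
 the bidual are applied does not matter (\<open>arens_regular_finite_rank\<close>).\<close>
abbreviation cont_on :: "('g :: topological_space, 'r) monoid_scheme => ('g => 'b :: topological_space) => bool" where
 "cont_on G \<equiv> continuous_on (carrier G)"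

lemmas sum_eqI = sum.cong[OF refl] and integral_eqI = Bochner_Integration.integral_cong[OF refl] and cintros = continuous_intros

section \<open>Hermitian forms and the singular value decomposition\<close>

definition ip :: "nat => (nat => complex) => (nat => complex) => complex" where
 "ip d u v = (SUM i<d. u i * cnj (v i))"

definition nrm :: "nat => (nat => complex) => real" where
 "nrm d u = sqrt (SUM i<d. (cmod (u i))^2)"

definition mv :: "nat => (nat => nat => complex) => (nat => complex) => nat => complex" where
 "mv d C u = (%i. SUM j<d. C i j * u j)"

definition orthonormal :: "nat => nat => (nat => nat => complex) => bool" where
 "orthonormal d r v \<longleftrightarrow> (ALL a<r. ALL b<r. ip d (v a) (v b) = (if a = b then 1 else 0))"

lemma nrm_ge_0 [simp]: "0 <= nrm d u" by (simp add: nrm_def sum_nonneg)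

lemma nrm_sq: "(nrm d u)^2 = (SUM i<d. (cmod (u i))^2)" by (simp add: nrm_def sum_nonneg)

lemma ip_self: "ip d u u = of_real ((nrm d u)^2)"
 unfolding nrm_sq ip_def by (simp add: complex_norm_square[symmetric] del: of_real_power)

lemma cnj_ip: "cnj (ip d u v) = ip d v u" by (simp add: ip_def mult.commute)

lemma ip_add_left: "ip d (%i. u i + u' i) v = ip d u v + ip d u' v" by (simp add: ip_def algebra_simps sum.distrib)

lemma ip_add_right: "ip d u (%i. v i + v' i) = ip d u v + ip d u v'" by (simp add: ip_def algebra_simps sum.distrib)

lemma ip_diff_left: "ip d (%i. u i - u' i) v = ip d u v - ip d u' v" by (simp add: ip_def algebra_simps sum_subtractf)

lemma ip_scale_left: "ip d (%i. c * u i) v = c * ip d u v" by (simp add: ip_def algebra_simps sum_distrib_left)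

lemma ip_scale_right: "ip d u (%i. c * v i) = cnj c * ip d u v" by (simp add: ip_def algebra_simps sum_distrib_left)

lemma ip_sum_left: "ip d (%i. SUM a:A. f a i) v = (SUM a:A. ip d (f a) v)"
 unfolding ip_def by (subst sum.swap) (simp add: sum_distrib_right)

lemma ip_cong: "(!!i. i < d ==> u i = u' i) ==> (!!i. i < d ==> v i = v' i) ==> ip d u v = ip d u' v'"
 unfolding ip_def by (intro sum.cong) auto

lemma nrm_cong: "(!!i. i < d ==> u i = u' i) ==> nrm d u = nrm d u'"
 unfolding nrm_def by simp

lemma nrm_eq_0: "nrm d u = 0 \<longleftrightarrow> (ALL i<d. u i = 0)" by (auto simp: nrm_def sum_nonneg_eq_0_iff)

lemma nrm_scale: "nrm d (%i. c * u i) = cmod c * nrm d u"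
 unfolding nrm_def by (simp add: norm_mult power_mult_distrib sum_distrib_left[symmetric] real_sqrt_mult)

lemma ip_cauchy_schwarz: "cmod (ip d u v) <= nrm d u * nrm d v"
proof -
 have "cmod (ip d u v) <= (SUM i<d. \<bar>cmod (u i)\<bar> * \<bar>cmod (v i)\<bar>)"
  unfolding ip_def by (rule order_trans[OF norm_sum]) (simp add: norm_mult)
 also have "... <= L2_set (%i. cmod (u i)) {..<d} * L2_set (%i. cmod (v i)) {..<d}" by (rule L2_set_mult_ineq)
 finally show ?thesis by (simp add: nrm_def L2_set_def)
qed

lemma nrm_unit_component: "nrm d u = 1 ==> i < d ==> cmod (u i) <= 1"
proof -
 assume "nrm d u = 1" "i < d"
 hence "(cmod (u i))^2 <= (nrm d u)^2"
  unfolding nrm_sq by (intro member_le_sum) auto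
 thus ?thesis using \<open>nrm d u = 1\<close> power2_le_imp_le[of "cmod (u i)" 1] by simp
qed

lemma ip_std_right: "j < d ==> ip d u (%i. if i = j then 1 else 0) = u j"
 by (simp add: ip_def if_distrib[of cnj] if_distrib[of "%x. _ * x"] cong: if_cong)

lemma bessel_defect:
 assumes "orthonormal d r v"
 defines "y \<equiv> %j i. (if i = j then 1 else 0) - (SUM a<r. cnj (v a j) * v a i)"
 shows "!!j b. j < d ==> b < r ==> ip d (y j) (v b) = 0"
  and "(SUM j<d. (nrm d (y j))^2) = real d - real r"
proof -
 have o: "ip d (v a) (v b) = (if a = b then 1 else 0)" if "a < r" "b < r" for a b
  using assms that by (simp add: orthonormal_def)
 have e: "ip d (%i. if i = j then 1 else 0) u = cnj (u j)" if "j < d" for j u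
  using ip_std_right[OF that, of u] cnj_ip by metis
 show 1: "ip d (y j) (v b) = 0" if "j < d" "b < r" for j b
 proof -
  have "ip d (y j) (v b) = cnj (v b j) - (SUM a<r. cnj (v a j) * ip d (v a) (v b))"
  unfolding y_def ip_diff_left e[OF that(1)] ip_sum_left ip_scale_left ..
  also have "(SUM a<r. cnj (v a j) * ip d (v a) (v b)) = (SUM a<r. if a = b then cnj (v a j) else 0)"
  using that o by (intro sum.cong) auto
  finally show ?thesis using that by simp
 qed
 have 2: "(nrm d (y j))^2 = 1 - (SUM a<r. (cmod (v a j))^2)" if "j < d" for j
 proof -
  have "complex_of_real ((nrm d (y j))^2) = ip d (y j) (y j)" by (simp only: ip_self)
  also have "... = cnj (ip d (y j) (y j))" by (simp add: cnj_ip)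
  also have "ip d (y j) (y j) = ip d (%i. (if i = j then 1 else 0) - (SUM a<r. cnj (v a j) * v a i)) (y j)"
  by (simp add: y_def)
  also have "... = cnj (y j j) - (SUM a<r. cnj (v a j) * ip d (v a) (y j))"
  unfolding ip_diff_left e[OF that] ip_sum_left ip_scale_left ..
  also have "(SUM a<r. cnj (v a j) * ip d (v a) (y j)) = 0"
  by (intro sum.neutral) (metis 1 cnj_ip complex_cnj_zero lessThan_iff mult_zero_right that)
  also have "cnj (cnj (y j j) - 0) = 1 - (SUM a<r. cnj (v a j) * v a j)" by (simp add: y_def)
  also have "... = complex_of_real (1 - (SUM a<r. (cmod (v a j))^2))"
  by (simp only: of_real_diff of_real_sum complex_norm_square) (simp add: mult.commute)
  finally show ?thesis by (simp only: of_real_eq_iff)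
 qed
 have 3: "(SUM j<d. (cmod (v a j))^2) = 1" if "a < r" for a
  using o[OF that that] unfolding ip_self nrm_sq by (simp only: of_real_eq_1_iff if_True refl)
 have "(SUM j<d. (nrm d (y j))^2) = (SUM j<d. 1 - (SUM a<r. (cmod (v a j))^2))"
  using 2 by simp
 also have "... = real d - (SUM a<r. SUM j<d. (cmod (v a j))^2)" by (simp add: sum_subtractf) (rule sum.swap)
 also have "... = real d - real r" using 3 by simp
 finally show "(SUM j<d. (nrm d (y j))^2) = real d - real r" .
qed

lemma orthonormal_le: "orthonormal d r v ==> r <= d"
 using bessel_defect(2)[of d r v] sum_nonneg[of "{..<d}" "%j. (nrm d (%i. (if i = j then 1 else 0) - (SUM a<r. cnj (v a j) * v a i)))^2"] by simp

lemma orthonormal_extend: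
 assumes "orthonormal d r v" "r < d"
 shows "EX w. nrm d w = 1 & (ALL a<r. ip d w (v a) = 0) & (ALL i>=d. w i = 0)"
proof -
 define y where "y = (%j i. (if i = j then 1 else 0) - (SUM a<r. cnj (v a j) * v a i))"
 have "EX j<d. nrm d (y j) ~= 0"
 proof (rule ccontr)
  assume "~ ?thesis"
  hence "(SUM j<d. (nrm d (y j))^2) = 0" by simp
  moreover have "(SUM j<d. (nrm d (y j))^2) = real d - real r"
  using bessel_defect(2)[OF assms(1)] by (simp only: y_def)
  ultimately show False using assms(2) by linarith
 qed
 then obtain j where j: "j < d" "nrm d (y j) ~= 0" by blast
 define w where "w = (%i. if i < d then of_real (inverse (nrm d (y j))) * y j i else 0)"
 have "nrm d w = nrm d (%i. of_real (inverse (nrm d (y j))) * y j i)" by (rule nrm_cong) (simp add: w_def)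
 also have "... = 1" unfolding nrm_scale using j by (simp add: norm_inverse)
 finally have 1: "nrm d w = 1" .
 have "ip d w (v a) = 0" if "a < r" for a
 proof -
  have "ip d w (v a) = ip d (%i. of_real (inverse (nrm d (y j))) * y j i) (v a)" by (rule ip_cong) (simp_all add: w_def)
  moreover have "ip d (y j) (v a) = 0" unfolding y_def by (rule bessel_defect(1)[OF assms(1) j(1) that])
  hence "ip d (%i. of_real (inverse (nrm d (y j))) * y j i) (v a) = 0"
  unfolding ip_scale_left by simp
  ultimately show ?thesis by simp
 qed
 with 1 show ?thesis by (intro exI[of _ w]) (auto simp: w_def)
qed

lemma orthonormal_resolution:
 assumes "orthonormal d d v" "i < d" "j < d"
 shows "(SUM a<d. v a i * cnj (v a j)) = (if i = j then 1 else 0)"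
proof -
 define y where "y = (%j i. (if i = j then 1 else 0) - (SUM a<d. cnj (v a j) * v a i))"
 have "(SUM j<d. (nrm d (y j))^2) = 0"
  using bessel_defect(2)[OF assms(1)] by (simp add: y_def)
 hence "nrm d (y j) = 0" using assms(3) by (simp add: sum_nonneg_eq_0_iff)
 hence "y j i = 0" using assms(2) by (simp add: nrm_eq_0)
 thus ?thesis by (simp add: y_def mult.commute)
qed

lemma orthonormal_expand:
 assumes "orthonormal d d v" "i < d"
 shows "u i = (SUM a<d. ip d u (v a) * v a i)"
proof -
 have "(SUM a<d. ip d u (v a) * v a i) = (SUM a<d. SUM j<d. u j * cnj (v a j) * v a i)"
  by (simp add: ip_def sum_distrib_right)
 also have "... = (SUM j<d. u j * (SUM a<d. v a i * cnj (v a j)))" by (subst sum.swap) (simp add: sum_distrib_left mult_ac)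
 also have "... = (SUM j<d. u j * (if i = j then 1 else 0))"
  using orthonormal_resolution[OF assms] by simp
 also have "... = u i" using assms(2) by (simp add: if_distrib[of "%x. _ * x"] cong: if_cong)
 finally show ?thesis by simp
qed

lemma mv_add: "mv d C (%i. u i + v i) = (%i. mv d C u i + mv d C v i)" by (simp add: mv_def algebra_simps sum.distrib)

lemma mv_scale: "mv d C (%i. c * u i) = (%i. c * mv d C u i)" by (simp add: mv_def algebra_simps sum_distrib_left)

lemma mv_cong: "(!!j. j < d ==> u j = u' j) ==> mv d C u = mv d C u'" by (simp add: mv_def)

lemma ip_mv_hermitian:
 assumes "!!i j. i < d ==> j < d ==> H i j = cnj (H j i)"
 shows "ip d (mv d H u) v = cnj (ip d (mv d H v) u)"
proof -
 have "cnj (ip d (mv d H v) u) = (SUM i<d. SUM j<d. cnj (H i j) * cnj (v j) * u i)"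
  unfolding ip_def mv_def cnj_sum complex_cnj_mult complex_cnj_cnj sum_distrib_right ..
 also have "... = (SUM j<d. SUM i<d. H j i * u i * cnj (v j))"
  proof (subst sum.swap, intro sum.cong refl)
  fix i j assume "j : {..<d}" "i : {..<d}"
  hence "cnj (H i j) = H j i" using assms[of j i] by simp
  thus "cnj (H i j) * cnj (v j) * u i = H j i * u i * cnj (v j)" by simp
 qed
 also have "... = ip d (mv d H u) v" unfolding ip_def mv_def sum_distrib_right ..
 finally show ?thesis by simp
qed

text \<open>A unit vector that maximises a Hermitian form on the orthogonal complement of
 \<open>v 0, \<dots>, v (r - 1)\<close> is conjugate, for this form, to everything orthogonal to it in that
 complement: this is the vanishing of the first variation.\<close>
lemma hermitian_form_maximiser:
 assumes H: "!!i j. i < d ==> j < d ==> H i j = cnj (H j i)"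
  and v: "orthonormal d r v" "r < d"
 shows "EX w. nrm d w = 1 & (ALL a<r. ip d w (v a) = 0) &
  (ALL z. (ALL a<r. ip d z (v a) = 0) --> ip d z w = 0 --> ip d (mv d H z) w = 0)"
proof -
 define h where "h = (%x y. ip d (mv d H x) y)"
 define B :: "(nat => complex) set" where "B = PiE UNIV (%i. if i < d then cball 0 1 else {0})"
 define S where "S = B Int {w. nrm d w = 1} Int (\<Inter>a\<in>{..<r}. {w. ip d w (v a) = 0})"
 have "compactin (product_topology (%_. euclidean) UNIV) B"
  unfolding B_def by (subst compactin_PiE) auto
 hence cB: "compact B" by (simp add: euclidean_product_topology)
 have c1: "continuous_on A (%w::nat=>complex. w i)" for i A
  by (rule continuous_on_subset[OF continuous_on_product_coordinates]) simp
 have "closed {w. nrm d w = 1}" unfolding nrm_def by (intro closed_Collect_eq cintros c1)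
 moreover have "closed {w. ip d w (v a) = 0}" for a unfolding ip_def by (intro closed_Collect_eq cintros c1)
 ultimately have cS: "compact S" unfolding S_def by (intro compact_Int_closed cB) auto
 have "S ~= {}"
 proof -
  obtain w where w: "nrm d w = 1" "ALL a<r. ip d w (v a) = 0" "ALL i>=d. w i = 0"
  using orthonormal_extend[OF v] by blast
  hence "w : S" by (auto simp: S_def B_def nrm_unit_component)
  thus ?thesis by blast
 qed
 moreover have "continuous_on S (%w. Re (h w w))"
  unfolding h_def ip_def mv_def by (intro cintros c1)
 ultimately obtain w where w: "w : S" "!!y. y : S ==> Re (h y y) <= Re (h w w)"
  using continuous_attains_sup[OF cS] by blast
 have w1: "nrm d w = 1" "!!a. a < r ==> ip d w (v a) = 0" using w(1) by (auto simp: S_def)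
 define Q where "Q = Re (h w w)"
 have bound: "Re (h x x) <= Q * (nrm d x)^2" if x: "!!a. a < r ==> ip d x (v a) = 0" for x
 proof (cases "nrm d x = 0")
  case True
  hence "h x x = 0" unfolding h_def ip_def mv_def by (auto simp: nrm_eq_0)
  thus ?thesis using True by simp
 next
  case False
  define c where "c = inverse (nrm d x)"
  define y where "y = (%i. if i < d then of_real c * x i else 0)"
  have ye: "!!i. i < d ==> y i = of_real c * x i" by (simp add: y_def)
  have "nrm d y = nrm d (%i. of_real c * x i)" by (rule nrm_cong) (simp add: y_def)
  hence n: "nrm d y = 1" using False by (simp add: nrm_scale c_def norm_inverse)
  have "ip d y (v a) = 0" if "a < r" for a
  proof -
  have "ip d y (v a) = ip d (%i. of_real c * x i) (v a)" by (rule ip_cong) (simp_all add: y_def)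
  thus ?thesis using x[OF that] by (simp add: ip_scale_left)
  qed
  moreover have "y : B" unfolding B_def by (auto simp: nrm_unit_component[OF n]) (simp add: y_def)
  ultimately have "y : S" using n by (simp add: S_def)
  hence "Re (h y y) <= Q" using w(2) by (simp add: Q_def)
  moreover have "h y y = of_real (c^2) * h x x"
  proof -
  have "h y y = ip d (mv d H (%i. of_real c * x i)) (%i. of_real c * x i)"
  unfolding h_def using ye mv_cong[of d y "%i. of_real c * x i" H] by (intro ip_cong) auto
  thus ?thesis unfolding mv_scale ip_scale_left ip_scale_right by (simp add: h_def power2_eq_square)
  qed
  ultimately have "c^2 * Re (h x x) <= Q" by simp
  moreover have "0 < nrm d x" using False nrm_ge_0[of d x] by linarith
  ultimately show ?thesis by (simp add: c_def power2_eq_square field_simps)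
 qed
 have "h z w = 0" if z: "!!a. a < r ==> ip d z (v a) = 0" "ip d z w = 0" for z
 proof (rule ccontr)
  define A where "A = h z w"
  assume "h z w ~= 0"
  hence A: "cmod A > 0" by (simp add: A_def)
  define K where "K = Q * (nrm d z)^2 - Re (h z z)"
  have main: "2 * t * (cmod A)^2 <= t^2 * (cmod A)^2 * K" for t :: real
  proof -
  define c where "c = of_real t * cnj A"
  define x where "x = (%i. w i + c * z i)"
  have "ip d x (v a) = 0" if "a < r" for a
  unfolding x_def ip_add_left ip_scale_left using z w1 that by simp
  hence b: "Re (h x x) <= Q * (nrm d x)^2" by (rule bound)
  have hw: "h w z = cnj A" unfolding A_def h_def by (rule ip_mv_hermitian[of d H, OF H])
  have "h x x = h w w + c * h z w + (cnj c * h w z + (cnj c * c) * h z z)"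
  unfolding h_def x_def mv_add mv_scale ip_add_left ip_add_right ip_scale_left ip_scale_right by (simp add: algebra_simps)
  moreover have "c * h z w = of_real (t * (cmod A)^2)"
  unfolding c_def A_def[symmetric] of_real_mult complex_norm_square by (simp only: mult_ac)
  moreover have "cnj c * h w z = of_real (t * (cmod A)^2)"
  unfolding c_def hw of_real_mult complex_norm_square by (simp add: mult.commute mult.left_commute)
  moreover have cc: "cnj c * c = of_real (t^2 * (cmod A)^2)"
  proof -
  have "cnj c * c = of_real ((cmod c)^2)" by (simp only: complex_norm_square mult.commute)
  also have "(cmod c)^2 = t^2 * (cmod A)^2" by (simp add: c_def norm_mult power_mult_distrib)
  finally show ?thesis .
  qed
  ultimately have 1: "Re (h x x) = Q + 2 * t * (cmod A)^2 + t^2 * (cmod A)^2 * Re (h z z)"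
  by (simp only: plus_complex.sel times_complex.sel Re_complex_of_real Im_complex_of_real) (simp add: Q_def)
  have "ip d w z = 0" using z(2) cnj_ip[of d z w] by simp
  hence "ip d x x = ip d w w + cnj c * c * ip d z z"
  unfolding x_def ip_add_left ip_add_right ip_scale_left ip_scale_right using z(2) by (simp add: algebra_simps)
  hence "complex_of_real ((nrm d x)^2) = of_real (1 + t^2 * (cmod A)^2 * (nrm d z)^2)"
  unfolding ip_self cc using w1(1) by simp
  hence 2: "(nrm d x)^2 = 1 + t^2 * (cmod A)^2 * (nrm d z)^2" by (simp only: of_real_eq_iff)
  show ?thesis using b unfolding 1 2 K_def by (simp add: algebra_simps)
  qed
  define t where "t = 1 / (\<bar>K\<bar> + 1)"
  have t: "t > 0" "t * K < 2"
  proof -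
  show "t > 0" by (simp add: t_def)
  have "t * K <= t * \<bar>K\<bar>" using \<open>t > 0\<close> by (intro mult_left_mono) auto
  also have "... < 2" by (simp add: t_def field_simps)
  finally show "t * K < 2" .
  qed
  have "t * (cmod A)^2 * 2 <= t * (cmod A)^2 * (t * K)" using main[of t] by (simp add: power2_eq_square mult_ac)
  thus False using t A by (simp add: mult_le_cancel_left_pos)
 qed
 thus ?thesis using w1 unfolding h_def by blast
qed

lemma hermitian_form_diagonal:
 assumes H: "!!i j. i < d ==> j < d ==> H i j = cnj (H j i)"
 shows "EX v. orthonormal d d v & (ALL a<d. ALL b<d. a ~= b --> ip d (mv d H (v a)) (v b) = 0)"
proof -
 have "r <= d ==> EX v. orthonormal d r v &
  (ALL a<r. ALL z. (ALL b<=a. ip d z (v b) = 0) --> ip d (mv d H z) (v a) = 0)" for r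
 proof (induction r)
  case 0
  thus ?case by (auto simp: orthonormal_def)
 next
  case (Suc r)
  then obtain v where v: "orthonormal d r v"
  "!!a z. a < r ==> (ALL b<=a. ip d z (v b) = 0) ==> ip d (mv d H z) (v a) = 0" by auto
  obtain w where w: "nrm d w = 1" "!!a. a<r ==> ip d w (v a) = 0"
  "!!z. (ALL a<r. ip d z (v a) = 0) ==> ip d z w = 0 ==> ip d (mv d H z) w = 0"
  using hermitian_form_maximiser[of d H r v, OF H v(1)] Suc.prems by (metis Suc_le_lessD)
  have w': "ip d (v a) w = 0" if "a < r" for a
  using w(2)[OF that] cnj_ip[of d w "v a"] by simp
  have ww: "ip d w w = 1" using w(1) by (simp add: ip_self)
  define v' where "v' = (%a. if a < r then v a else w)"
  have "orthonormal d (Suc r) v'"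
  using v(1) w(2) w' ww unfolding orthonormal_def v'_def by (auto simp: less_Suc_eq)
  moreover have "ip d (mv d H z) (v' a) = 0" if "a < Suc r" "ALL b<=a. ip d z (v' b) = 0" for a z
  proof (cases "a < r")
  case True
  thus ?thesis using that v(2)[of a z] by (auto simp: v'_def)
  next
  case False
  hence "a = r" using that by simp
  moreover have "ip d z (v b) = 0" if "b < r" for b
  using \<open>ALL b<=a. ip d z (v' b) = 0\<close> that \<open>a = r\<close> by (auto simp: v'_def dest: spec[of _ b])
  ultimately show ?thesis using that(2) w(3)[of z] by (auto simp: v'_def)
  qed
  ultimately show ?case by blast
 qed
 from this[of d] obtain v where v: "orthonormal d d v"
  "!!a z. a < d ==> (ALL b<=a. ip d z (v b) = 0) ==> ip d (mv d H z) (v a) = 0" by auto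
 have lt: "ip d (mv d H (v a)) (v b) = 0" if "a < d" "b < a" for a b
  using v(1) that by (intro v(2)) (auto simp: orthonormal_def)
 have "ip d (mv d H (v a)) (v b) = 0" if "a < d" "b < d" "a ~= b" for a b
 proof (cases "b < a")
  case False
  hence "ip d (mv d H (v b)) (v a) = 0" using lt[of b a] that by simp
  thus ?thesis by (subst ip_mv_hermitian[of d H, OF H]) simp_all
 qed (use lt that in auto)
 thus ?thesis using v(1) by (intro exI[of _ v] conjI) auto
qed

lemma hermitian_spectral:
 assumes H: "!!i j. i < d ==> j < d ==> H i j = cnj (H j i)"
 shows "EX v. orthonormal d d v & (ALL i<d. ALL j<d. H i j =
  (SUM a<d. of_real (Re (ip d (mv d H (v a)) (v a))) * v a i * cnj (v a j)))"
proof -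
 obtain v where v: "orthonormal d d v"
  "!!a b. a<d ==> b<d ==> a ~= b ==> ip d (mv d H (v a)) (v b) = 0"
  using hermitian_form_diagonal[of d H, OF H] by blast
 have re: "of_real (Re (ip d (mv d H (v a)) (v a))) = ip d (mv d H (v a)) (v a)" for a
  using ip_mv_hermitian[of d H "v a" "v a", OF H] by (metis Reals_cnj_iff of_real_Re)
 have eig: "mv d H (v a) i = ip d (mv d H (v a)) (v a) * v a i" if "a < d" "i < d" for a i
 proof -
  have "mv d H (v a) i = (SUM b<d. ip d (mv d H (v a)) (v b) * v b i)" by (rule orthonormal_expand[OF v(1) that(2)])
  also have "... = (SUM b<d. if b = a then ip d (mv d H (v a)) (v a) * v a i else 0)"
  using v(2) that by (intro sum.cong) auto
  finally show ?thesis using that by simp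
 qed
 have "H i j = (SUM a<d. of_real (Re (ip d (mv d H (v a)) (v a))) * v a i * cnj (v a j))"
  if "i < d" "j < d" for i j
 proof -
  have "(SUM a<d. of_real (Re (ip d (mv d H (v a)) (v a))) * v a i * cnj (v a j))
  = (SUM a<d. mv d H (v a) i * cnj (v a j))" by (intro sum.cong refl) (simp only: re eig[OF _ that(1)] lessThan_iff)
  also have "... = (SUM a<d. SUM k<d. H i k * (v a k * cnj (v a j)))"
  unfolding mv_def sum_distrib_right mult.assoc ..
  also have "... = (SUM k<d. H i k * (SUM a<d. v a k * cnj (v a j)))" by (subst sum.swap) (simp add: sum_distrib_left)
  also have "... = (SUM k<d. H i k * (if k = j then 1 else 0))"
  by (intro sum.cong refl) (simp only: orthonormal_resolution[OF v(1) _ that(2)] lessThan_iff)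
  also have "... = H i j" using that by (simp add: if_distrib[of "%x. H i _ * x"] cong: if_cong)
  finally show ?thesis by (rule sym)
 qed
 thus ?thesis using v(1) by (intro exI[of _ v] conjI) auto
qed

definition mm :: "nat => (nat => nat => complex) => (nat => nat => complex) => nat => nat => complex" where
 "mm d A B = (%i j. SUM k<d. A i k * B k j)"

definition adj :: "(nat => nat => complex) => nat => nat => complex" where
 "adj A = (%i j. cnj (A j i))"

definition fmat :: "nat => (nat => nat => complex) => complex mat" where
 "fmat d A = Matrix.mat d d (%(i, j). A i j)"

definition tnorm :: "nat => (nat => nat => complex) => real" where
 "tnorm d A = trace_norm (fmat d A)"

definition partial_isometry :: "nat => (nat => nat => complex) => bool" where
 "partial_isometry d X \<longleftrightarrow> (ALL i<d. ALL j<d. mm d (mm d X (adj X)) X i j = X i j)"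

lemma fmat_carrier [simp]: "fmat d A : carrier_mat d d"
 and fmat_dim [simp]: "dim_row (fmat d A) = d" "dim_col (fmat d A) = d"
 and fmat_index [simp]: "i < d ==> j < d ==> fmat d A $$ (i, j) = A i j" by (auto simp: fmat_def)

lemma fmat_eqI: "(!!i j. i < d ==> j < d ==> A i j = B i j) ==> fmat d A = fmat d B" by (rule eq_matI) auto

lemma fmat_cong: "(!!i j. i < d ==> j < d ==> A i j = B i j) ==> tnorm d A = tnorm d B" by (metis fmat_eqI tnorm_def)

lemma fmat_mult: "fmat d A * fmat d B = fmat d (mm d A B)"
 by (rule eq_matI) (auto simp: mm_def scalar_prod_def atLeast0LessThan)

lemma fmat_adjoint: "mat_adjoint (fmat d A) = fmat d (adj A)"
 by (rule eq_matI) (auto simp: mat_adjoint_def adj_def mat_of_rows_index)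

lemma fmat_of_carrier: "M : carrier_mat d d ==> M = fmat d (%i j. M $$ (i, j))" by (rule eq_matI) auto

lemma mm_assoc: "mm d (mm d A B) C = mm d A (mm d B C)"
 unfolding mm_def sum_distrib_left sum_distrib_right by (intro ext, subst sum.swap) (simp add: mult.assoc)

lemma mv_mm: "mv d (mm d A B) u = mv d A (mv d B u)"
 unfolding mm_def mv_def sum_distrib_left sum_distrib_right by (intro ext, subst sum.swap) (simp add: mult.assoc)

lemma mm_cong: "(!!k. k < d ==> A i k = A' i k) ==> (!!k. k < d ==> B k j = B' k j) ==> mm d A B i j = mm d A' B' i j"
 by (simp add: mm_def)

lemma ip_mv_adj: "ip d (mv d A u) v = ip d u (mv d (adj A) v)"
proof -
 have "ip d (mv d A u) v = (SUM i<d. SUM j<d. A i j * u j * cnj (v i))"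
  unfolding ip_def mv_def sum_distrib_right ..
 also have "... = (SUM j<d. SUM i<d. u j * (A i j * cnj (v i)))" by (subst sum.swap) (simp add: mult_ac)
 also have "... = ip d u (mv d (adj A) v)"
  unfolding ip_def mv_def adj_def cnj_sum complex_cnj_mult complex_cnj_cnj sum_distrib_left ..
 finally show ?thesis .
qed

lemma nrm_le_of_projection:
 assumes "ip d (mv d Y w) w = ip d (mv d Y w) (mv d Y w)"
 shows "Re (ip d (mv d Y w) w) <= (nrm d w)^2"
proof -
 have "complex_of_real ((nrm d (mv d Y w))^2) = ip d (mv d Y w) w"
  using assms by (simp only: ip_self)
 hence 1: "Re (ip d (mv d Y w) w) = (nrm d (mv d Y w))^2" by (metis Re_complex_of_real)
 have "(nrm d (mv d Y w))^2 <= cmod (ip d (mv d Y w) w)"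
  using 1 complex_Re_le_cmod[of "ip d (mv d Y w) w"] by simp
 also have "... <= nrm d (mv d Y w) * nrm d w" by (rule ip_cauchy_schwarz)
 finally have "nrm d (mv d Y w) * nrm d (mv d Y w) <= nrm d (mv d Y w) * nrm d w" by (simp add: power2_eq_square)
 hence "nrm d (mv d Y w) <= nrm d w" by (cases "nrm d (mv d Y w) = 0") (auto simp: mult_le_cancel_left less_le)
 thus ?thesis unfolding 1 by (intro power_mono) auto
qed

lemma partial_isometry_contraction:
 assumes "partial_isometry d X"
 shows "nrm d (mv d X w) <= nrm d w"
proof -
 define Y where "Y = mm d (adj X) X"
 have X: "mv d X (mv d Y w) i = mv d X w i" if "i < d" for i
 proof -
  have "mv d X (mv d Y w) i = mv d (mm d (mm d X (adj X)) X) w i" by (simp only: Y_def mm_assoc mv_mm)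
  thus ?thesis using assms that by (simp add: mv_def partial_isometry_def)
 qed
 have adj2: "adj (adj X) = X" by (simp add: adj_def)
 have s: "ip d (mv d Y w) z = ip d (mv d X w) (mv d X z)" for z
  unfolding Y_def mv_mm by (subst ip_mv_adj) (simp add: adj2)
 have "ip d (mv d Y w) (mv d Y w) = ip d (mv d X w) (mv d X (mv d Y w))" by (rule s)
 also have "... = ip d (mv d X w) (mv d X w)" using X by (intro ip_cong) auto
 also have "... = ip d (mv d Y w) w" by (simp add: s)
 finally have "Re (ip d (mv d Y w) w) <= (nrm d w)^2" by (intro nrm_le_of_projection) simp
 hence "(nrm d (mv d X w))^2 <= (nrm d w)^2" by (simp add: s ip_self)
 thus ?thesis by (rule power2_le_imp_le) simp
qed

lemma positive_semidefinite_fmat: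
 "positive_semidefinite d (fmat d A) \<longleftrightarrow> (ALL u. ip d (mv d A u) u : \<real>\<^sub>\<ge>\<^sub>0)"
proof -
 have 1: "(fmat d A *\<^sub>v v) \<bullet>c v = ip d (mv d A (%i. vec_index v i)) (%i. vec_index v i)" if "v : carrier_vec d" for v
  using that by (auto simp: ip_def mv_def scalar_prod_def atLeast0LessThan intro!: sum.cong)
 have 2: "ip d (mv d A u) u = (fmat d A *\<^sub>v Matrix.vec d u) \<bullet>c Matrix.vec d u" for u
  unfolding 1[OF vec_carrier] by (rule ip_cong) (simp_all add: mv_def)
 show ?thesis
 proof
  assume "positive_semidefinite d (fmat d A)"
  thus "ALL u. ip d (mv d A u) u : \<real>\<^sub>\<ge>\<^sub>0"
  unfolding positive_semidefinite_def 2 by (meson vec_carrier)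
 next
  assume "ALL u. ip d (mv d A u) u : \<real>\<^sub>\<ge>\<^sub>0"
  thus "positive_semidefinite d (fmat d A)"
  unfolding positive_semidefinite_def by (intro conjI ballI) (simp_all only: 1 fmat_carrier)
 qed
qed

lemma psd_hermitian:
 assumes psd: "!!u. ip d (mv d A u) u : \<real>\<^sub>\<ge>\<^sub>0" and ij: "i < d" "j < d"
 shows "A i j = cnj (A j i)"
proof -
 define e :: "nat => nat => complex" where "e = (%j i. if i = j then 1 else 0)"
 have r: "Im (ip d (mv d A u) u) = 0" for u using psd[of u] by (auto simp: complex_nonneg_Reals_iff)
 have me: "mv d A (e j) = (%i. A i j)" if "j < d" for j
  using that by (simp add: mv_def e_def if_distrib[of "%x. A _ _ * x"] cong: if_cong)
 have E: "ip d (mv d A (e j)) (e i) = A i j" if "i < d" "j < d" for i j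
  unfolding me[OF that(2)] unfolding e_def by (rule ip_std_right[OF that(1)])
 have expand: "ip d (mv d A (%k. e i k + c * e j k)) (%k. e i k + c * e j k)
  = A i i + cnj c * A j i + c * A i j + c * cnj c * A j j" for c
  unfolding mv_add mv_scale ip_add_left ip_add_right ip_scale_left ip_scale_right by (simp add: E ij algebra_simps)
 have d: "Im (A i i) = 0" "Im (A j j) = 0" using r[of "e i"] r[of "e j"] E ij by auto
 have "Im (A j i + A i j) = 0" using r[of "%k. e i k + 1 * e j k"] unfolding expand using d by simp
 moreover have "Re (A i j) - Re (A j i) = 0" using r[of "%k. e i k + \<i> * e j k"] unfolding expand using d by simp
 ultimately show ?thesis by (simp add: complex_eq_iff)
qed

lemma outer_mm:
 assumes "!!i k. i < d ==> k < d ==> A i k = (SUM a<d. al a * x a i * cnj (y a k))"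
  and "!!k j. k < d ==> j < d ==> B k j = (SUM b<d. be b * z b k * cnj (w b j))"
  and "i < d" "j < d"
 shows "mm d A B i j = (SUM a<d. SUM b<d. al a * be b * ip d (z b) (y a) * (x a i * cnj (w b j)))"
proof -
 have "mm d A B i j = (SUM k<d. SUM a<d. SUM b<d. (al a * x a i * cnj (y a k)) * (be b * z b k * cnj (w b j)))"
  unfolding mm_def by (intro sum.cong refl) (simp add: assms sum_product)
 also have "... = (SUM a<d. SUM b<d. SUM k<d. (al a * x a i * cnj (y a k)) * (be b * z b k * cnj (w b j)))"
  by (rule trans[OF sum.swap], rule sum_eqI, rule sum.swap)
 also have "... = (SUM a<d. SUM b<d. al a * be b * ip d (z b) (y a) * (x a i * cnj (w b j)))"
  unfolding ip_def sum_distrib_left sum_distrib_right by (intro sum.cong refl) (simp only: mult_ac)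
 finally show ?thesis .
qed

lemma outer_mv:
 assumes "!!i k. i < d ==> k < d ==> A i k = (SUM a<d. al a * x a i * cnj (y a k))" "i < d"
 shows "mv d A u i = (SUM a<d. al a * ip d u (y a) * x a i)"
proof -
 have "mv d A u i = (SUM k<d. SUM a<d. al a * x a i * cnj (y a k) * u k)"
  unfolding mv_def by (intro sum.cong refl) (simp add: assms sum_distrib_right)
 also have "... = (SUM a<d. SUM k<d. al a * x a i * cnj (y a k) * u k)" by (rule sum.swap)
 also have "... = (SUM a<d. al a * ip d u (y a) * x a i)"
  unfolding ip_def sum_distrib_left sum_distrib_right by (intro sum.cong refl) (simp only: mult_ac)
 finally show ?thesis .
qed

lemma sum_delta2:
 "(SUM a<d. SUM b<d. f a b * (if a = b then 1 else 0) * g a b) = (SUM a<(d::nat). f a a * (g a a :: complex))"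
 by (intro sum.cong refl) (simp add: if_distrib[of "%x. f _ _ * x * _"] cong: if_cong)

text \<open>The positive square root is unique: an eigenvector of any positive root \<open>B\<close> for the value
 \<open>\<mu>\<close> is orthogonal to every eigenvector of \<open>A\<close> for a value other than \<open>\<mu>\<close>, because both
 square to the same matrix.\<close>
lemma psd_root_unique:
 assumes v: "orthonormal d d v" and s: "!!a. a < d ==> 0 <= s a"
  and A: "!!i j. i < d ==> j < d ==> A i j = (SUM a<d. of_real (s a) * v a i * cnj (v a j))"
  and B: "!!u. ip d (mv d B u) u : \<real>\<^sub>\<ge>\<^sub>0"
  and sq: "!!i j. i < d ==> j < d ==> mm d B B i j = mm d A A i j"
  and ij: "i < d" "j < d"
 shows "B i j = A i j"
proof -
 have hB: "B i j = cnj (B j i)" if "i < d" "j < d" for i j by (rule psd_hermitian[OF B that])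
 obtain w where w: "orthonormal d d w" and
  wB: "!!i j. i < d ==> j < d ==> B i j = (SUM a<d. of_real (Re (ip d (mv d B (w a)) (w a))) * w a i * cnj (w a j))"
  using hermitian_spectral[of d B, OF hB] by blast
 define mu where "mu = (%a. Re (ip d (mv d B (w a)) (w a)))"
 have mu: "mu a >= 0" for a using B[of "w a"] by (auto simp: mu_def complex_nonneg_Reals_iff)
 have wB: "B i j = (SUM a<d. of_real (mu a) * w a i * cnj (w a j))" if "i < d" "j < d" for i j
  unfolding mu_def by (rule wB[OF that])
 have Bw: "mv d B (w b) i = mu b * w b i" if "b < d" "i < d" for b i
 proof -
  have "mv d B (w b) i = (SUM a<d. mu a * ip d (w b) (w a) * w a i)"
  by (rule outer_mv[of d B "%a. of_real (mu a)" w w, OF wB that(2)])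
  also have "... = (SUM a<d. if a = b then mu b * w b i else 0)"
  using w that by (intro sum.cong) (auto simp: orthonormal_def)
  finally show ?thesis using that by simp
 qed
 have ipA: "ip d (mv d A x) (v a) = s a * ip d x (v a)" if "a < d" for x a
 proof -
  have "ip d (mv d A x) (v a) = ip d (%i. SUM b<d. of_real (s b) * ip d x (v b) * v b i) (v a)"
  using outer_mv[of d A "%a. of_real (s a)" v v, OF A] by (intro ip_cong) auto
  also have "... = (SUM b<d. of_real (s b) * ip d x (v b) * ip d (v b) (v a))"
  unfolding ip_sum_left ip_scale_left ..
  also have "... = (SUM b<d. if b = a then of_real (s a) * ip d x (v a) else 0)"
  using v that by (intro sum.cong) (auto simp: orthonormal_def)
  finally show ?thesis using that by simp
 qed
 have Aw: "mv d A (w b) i = mu b * w b i" if b: "b < d" and i: "i < d" for b i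
 proof -
  have *: "s a * ip d (w b) (v a) = mu b * ip d (w b) (v a)" if a: "a < d" for a
  proof -
  have "s a * (s a * ip d (w b) (v a)) = ip d (mv d (mm d A A) (w b)) (v a)" by (simp add: mv_mm ipA a)
  also have "... = ip d (mv d (mm d B B) (w b)) (v a)" by (intro ip_cong) (simp_all add: mv_def sq)
  also have "... = ip d (%i. mu b * (mu b * w b i)) (v a)"
  proof (intro ip_cong refl)
  fix i assume i: "i < d"
  have "mv d (mm d B B) (w b) i = mv d B (%i. mu b * w b i) i"
  unfolding mv_mm using Bw[OF b] by (intro fun_cong[OF mv_cong]) auto
  thus "mv d (mm d B B) (w b) i = mu b * (mu b * w b i)"
  unfolding mv_scale using Bw[OF b i] by simp
  qed
  also have "... = mu b * (mu b * ip d (w b) (v a))" unfolding ip_scale_left ..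
  finally have "(complex_of_real (s a) * s a - mu b * mu b) * ip d (w b) (v a) = 0" by (simp add: algebra_simps)
  hence "of_real (s a * s a - mu b * mu b) = (0::complex) | ip d (w b) (v a) = 0" by auto
  hence "s a * s a = mu b * mu b | ip d (w b) (v a) = 0" by (auto simp only: of_real_eq_0_iff)
  moreover have "s a = mu b" if "s a * s a = mu b * mu b"
  using that s[OF a] mu[of b] by (metis abs_of_nonneg real_sqrt_abs2)
  ultimately show ?thesis by auto
  qed
  have "mv d A (w b) i = (SUM a<d. of_real (s a) * ip d (w b) (v a) * v a i)" by (rule outer_mv[OF A i])
  also have "... = (SUM a<d. mu b * (ip d (w b) (v a) * v a i))"
  using * by (intro sum.cong) (auto simp: mult.assoc[symmetric])
  also have "... = mu b * w b i"
  unfolding sum_distrib_left[symmetric] using orthonormal_expand[OF v i] by simp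
  finally show ?thesis .
 qed
 have exp: "D i j = (SUM b<d. mv d D (w b) i * cnj (w b j))" for D
 proof -
  have "(SUM b<d. mv d D (w b) i * cnj (w b j)) = (SUM b<d. SUM k<d. D i k * (w b k * cnj (w b j)))"
  unfolding mv_def sum_distrib_right mult.assoc ..
  also have "... = (SUM k<d. D i k * (SUM b<d. w b k * cnj (w b j)))" by (subst sum.swap) (simp add: sum_distrib_left)
  also have "... = (SUM k<d. D i k * (if k = j then 1 else 0))"
  by (intro sum.cong refl) (simp only: orthonormal_resolution[OF w _ ij(2)] lessThan_iff)
  finally show ?thesis using ij by (simp add: if_distrib[of "%x. D i _ * x"] cong: if_cong)
 qed
 show ?thesis unfolding exp[of A] exp[of B] using Aw Bw ij by simp
qed

lemma singular_value_decomposition: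
 "EX s u v. (ALL a<d. 0 <= s a) & orthonormal d d v &
  (ALL a<d. ALL b<d. ip d (u a) (u b) = (if a = b & s a ~= 0 then 1 else 0)) &
  (ALL i<d. ALL j<d. C i j = (SUM a<d. of_real (s a) * u a i * cnj (v a j))) &
  tnorm d C = (SUM a<d. s a)"
proof -
 define H where "H = mm d (adj C) C"
 have H: "H i j = cnj (H j i)" for i j by (simp add: H_def mm_def adj_def mult.commute)
 have adj2: "adj (adj C) = C" by (simp add: adj_def)
 have hf: "ip d (mv d H x) y = ip d (mv d C x) (mv d C y)" for x y
  unfolding H_def mv_mm by (subst ip_mv_adj) (simp add: adj2)
 obtain v where v: "orthonormal d d v"
  and vo: "!!a b. a<d ==> b<d ==> a ~= b ==> ip d (mv d C (v a)) (mv d C (v b)) = 0"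
  using hermitian_form_diagonal[of d H, OF H] unfolding hf by blast
 define s where "s = (%a. nrm d (mv d C (v a)))"
 define u where "u = (%a i. of_real (inverse (s a)) * mv d C (v a) i)"
 have s0: "0 <= s a" for a by (simp add: s_def)
 have su: "of_real (s a) * u a i = mv d C (v a) i" if "i < d" for a i
  using that by (cases "s a = 0") (auto simp: u_def s_def nrm_eq_0)
 have uo: "ip d (u a) (u b) = (if a = b & s a ~= 0 then 1 else 0)" if "a < d" "b < d" for a b
 proof (cases "a = b")
  case True
  have "ip d (u a) (u a) = of_real (inverse (s a) * inverse (s a) * (s a)^2)"
  by (simp add: u_def ip_scale_left ip_scale_right ip_self) (simp add: s_def)
  also have "inverse (s a) * inverse (s a) * (s a)^2 = (if s a ~= 0 then 1 else 0)"
  by (cases "s a = 0") (simp_all add: power2_eq_square divide_simps)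
  finally show ?thesis using True by simp
 next
  case False
  thus ?thesis using vo[OF that False] unfolding u_def ip_scale_left ip_scale_right by simp
 qed
 have C: "C i j = (SUM a<d. of_real (s a) * u a i * cnj (v a j))" if ij: "i < d" "j < d" for i j
 proof -
  have "(SUM a<d. of_real (s a) * u a i * cnj (v a j)) = (SUM b<d. SUM k<d. C i k * (v b k * cnj (v b j)))"
  unfolding su[OF ij(1)] unfolding mv_def sum_distrib_right mult.assoc ..
  also have "... = (SUM k<d. C i k * (SUM b<d. v b k * cnj (v b j)))" by (subst sum.swap) (simp add: sum_distrib_left)
  also have "... = (SUM k<d. C i k * (if k = j then 1 else 0))"
  by (intro sum.cong refl) (simp only: orthonormal_resolution[OF v _ ij(2)] lessThan_iff)
  finally show ?thesis using ij by (simp add: if_distrib[of "%x. C i _ * x"] cong: if_cong)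
 qed
 define R where "R = (%i j. SUM a<d. of_real (s a) * v a i * cnj (v a j))"
 have vv: "ip d (v b) (v a) = (if a = b then 1 else 0)" if "a < d" "b < d" for a b
  using v that by (simp add: orthonormal_def)
 have RR: "mm d R R i j = H i j" if ij: "i < d" "j < d" for i j
 proof -
  have "mm d R R i j = (SUM a<d. SUM b<d. of_real (s a) * of_real (s b) * ip d (v b) (v a) * (v a i * cnj (v b j)))"
  by (rule outer_mm[OF _ _ ij]) (simp_all add: R_def)
  also have "... = (SUM a<d. SUM b<d. of_real (s a) * of_real (s b) * ip d (u b) (u a) * (v a i * cnj (v b j)))"
  by (intro sum.cong refl) (simp add: uo vv)
  also have "... = H i j" unfolding H_def
  proof (rule outer_mm[OF _ _ ij, symmetric])
  show "adj C i k = (SUM a<d. complex_of_real (s a) * v a i * cnj (u a k))" if "i < d" "k < d" for i k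
  unfolding adj_def C[OF that(2,1)] cnj_sum by (intro sum.cong refl) (simp add: mult_ac)
  qed (simp_all add: C)
  finally show ?thesis .
 qed
 have Rp: "ip d (mv d R x) x : \<real>\<^sub>\<ge>\<^sub>0" for x
 proof -
  have "ip d (mv d R x) x = ip d (%i. SUM a<d. of_real (s a) * ip d x (v a) * v a i) x"
  by (intro ip_cong refl outer_mv) (simp add: R_def)
  also have "... = (SUM a<d. of_real (s a) * (ip d x (v a) * cnj (ip d x (v a))))"
  unfolding ip_sum_left ip_scale_left by (simp add: cnj_ip mult.assoc)
  also have "... = of_real (SUM a<d. s a * (cmod (ip d x (v a)))^2)"
  by (simp only: complex_norm_square[symmetric] of_real_mult[symmetric] of_real_sum)
  also have "... : \<real>\<^sub>\<ge>\<^sub>0" unfolding nonneg_Reals_of_real_iff using s0 by (intro sum_nonneg mult_nonneg_nonneg) auto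
  finally show ?thesis .
 qed
 have "mat_abs (fmat d C) = fmat d R"
  unfolding mat_abs_def fmat_dim fmat_adjoint fmat_mult H_def[symmetric]
 proof (rule the_equality)
  show "positive_semidefinite d (fmat d R) & fmat d R * fmat d R = fmat d H"
  unfolding positive_semidefinite_fmat fmat_mult using Rp RR by (auto intro: fmat_eqI)
 next
  fix M assume M: "positive_semidefinite d M & M * M = fmat d H"
  define B where "B = (%i j. M $$ (i, j))"
  have MB: "M = fmat d B" unfolding B_def using M by (intro fmat_of_carrier) (auto simp: positive_semidefinite_def)
  have "ip d (mv d B x) x : \<real>\<^sub>\<ge>\<^sub>0" for x using M unfolding MB positive_semidefinite_fmat by blast
  moreover have "mm d B B i j = mm d R R i j" if "i < d" "j < d" for i j
  proof -
  have "fmat d (mm d B B) $$ (i, j) = fmat d H $$ (i, j)" using M unfolding MB fmat_mult by simp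
  thus ?thesis using that RR by simp
  qed
  ultimately have "B i j = R i j" if "i < d" "j < d" for i j
  using that s0 by (intro psd_root_unique[of d v s R B, OF v]) (auto simp: R_def)
  thus "M = fmat d R" unfolding MB by (rule fmat_eqI)
 qed
 hence "tnorm d C = Re (SUM i<d. R i i)"
  by (simp add: tnorm_def trace_norm_def diag_mat_def sum_list_sum_nth atLeast0LessThan)
 also have "(SUM i<d. R i i) = (SUM a<d. of_real (s a) * ip d (v a) (v a))"
  unfolding R_def ip_def sum_distrib_left by (subst sum.swap) (simp add: mult.assoc)
 also have "... = of_real (SUM a<d. s a)" by (simp add: vv)
 finally have "tnorm d C = (SUM a<d. s a)" by simp
 thus ?thesis using s0 v uo C by (intro exI[of _ s] exI[of _ u] exI[of _ v]) auto
qed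

definition pairing :: "nat => (nat => nat => complex) => (nat => nat => complex) => complex" where
 "pairing d C X = (SUM i<d. SUM j<d. C i j * cnj (X i j))"

lemma pairing_outer:
 assumes "!!i j. i < d ==> j < d ==> C i j = (SUM a:A. s a * x a i * cnj (y a j))"
 shows "pairing d C X = (SUM a:A. s a * ip d (x a) (mv d X (y a)))"
proof -
 have "pairing d C X = (SUM i<d. SUM j<d. SUM a:A. s a * x a i * cnj (y a j) * cnj (X i j))"
  unfolding pairing_def by (intro sum.cong refl) (simp add: assms sum_distrib_right)
 also have "... = (SUM i<d. SUM a:A. SUM j<d. s a * x a i * cnj (y a j) * cnj (X i j))" by (intro sum.cong refl sum.swap)
 also have "... = (SUM a:A. SUM i<d. SUM j<d. s a * x a i * cnj (y a j) * cnj (X i j))" by (rule sum.swap)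
 also have "... = (SUM a:A. s a * ip d (x a) (mv d X (y a)))"
  unfolding ip_def mv_def cnj_sum complex_cnj_mult sum_distrib_left by (intro sum.cong refl) (simp only: mult_ac)
 finally show ?thesis .
qed

text \<open>Trace duality.  The supremum of \<open>pairing d C\<close> over the unit ball of the operator norm is
 attained at a partial isometry, the polar part of \<open>C\<close>.\<close>
lemma tnorm_attained: "EX X. partial_isometry d X & pairing d C X = of_real (tnorm d C)"
proof -
 obtain s u v where s: "!!a. a < d ==> 0 <= s a" and v: "orthonormal d d v"
  and u: "!!a b. a < d ==> b < d ==> ip d (u a) (u b) = (if a = b & s a ~= 0 then 1 else 0)"
  and C: "!!i j. i < d ==> j < d ==> C i j = (SUM a<d. of_real (s a) * u a i * cnj (v a j))"
  and t: "tnorm d C = (SUM a<d. s a)"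
  using singular_value_decomposition[of d C] by blast
 have vv: "ip d (v b) (v a) = (if a = b then 1 else 0)" if "a < d" "b < d" for a b
  using v that by (simp add: orthonormal_def)
 define X where "X = (%i j. SUM a<d. u a i * cnj (v a j))"
 have X: "X i j = (SUM a<d. 1 * u a i * cnj (v a j))" for i j by (simp add: X_def)
 have adjX: "adj X i j = (SUM a<d. 1 * v a i * cnj (u a j))" for i j by (simp add: X_def adj_def mult.commute)
 have XX: "mm d X (adj X) i j = (SUM a<d. 1 * u a i * cnj (u a j))" if ij: "i < d" "j < d" for i j
 proof -
  have "mm d X (adj X) i j = (SUM a<d. SUM b<d. 1 * 1 * ip d (v b) (v a) * (u a i * cnj (u b j)))"
  by (rule outer_mm[OF X adjX ij])
  also have "... = (SUM a<d. SUM b<d. 1 * (if a = b then 1 else 0) * (u a i * cnj (u b j)))"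
  by (intro sum.cong refl) (simp add: vv)
  finally show ?thesis unfolding sum_delta2 by simp
 qed
 have u0: "u a i = 0" if "s a = 0" "a < d" "i < d" for a i
  using u[of a a] that by (simp add: ip_self nrm_eq_0)
 have "mm d (mm d X (adj X)) X i j = X i j" if ij: "i < d" "j < d" for i j
 proof -
  have "mm d (mm d X (adj X)) X i j = (SUM a<d. SUM b<d. 1 * 1 * ip d (u b) (u a) * (u a i * cnj (v b j)))"
  by (rule outer_mm[OF XX X ij])
  also have "... = (SUM a<d. SUM b<d. 1 * (if a = b then 1 else 0) * (u a i * cnj (v b j)))"
  using u u0 ij by (intro sum.cong refl) auto
  finally show ?thesis unfolding sum_delta2 by (simp add: X_def)
 qed
 moreover have "pairing d C X = of_real (tnorm d C)"
 proof -
  have "mv d X (v a) i = u a i" if "a < d" "i < d" for a i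
  proof -
  have "mv d X (v a) i = (SUM b<d. 1 * ip d (v a) (v b) * u b i)" by (rule outer_mv[OF X that(2)])
  also have "... = (SUM b<d. if b = a then u a i else 0)" using vv that by (intro sum.cong) auto
  finally show ?thesis using that by simp
  qed
  hence "ip d (u a) (mv d X (v a)) = ip d (u a) (u a)" if "a < d" for a
  using that by (intro ip_cong) auto
  hence *: "of_real (s a) * ip d (u a) (mv d X (v a)) = of_real (s a)" if "a < d" for a
  using u that by auto
  have "(SUM a<d. of_real (s a) * ip d (u a) (mv d X (v a))) = of_real (SUM a<d. s a)"
  unfolding of_real_sum by (intro sum.cong refl *) simp
  thus ?thesis using pairing_outer[of d C "%a. of_real (s a)" u v "{..<d}", OF C] t by simp
 qed
 ultimately show ?thesis unfolding partial_isometry_def by blast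
qed

lemma tnorm_le:
 assumes "!!X. partial_isometry d X ==> cmod (pairing d C X) <= r"
 shows "tnorm d C <= r"
proof -
 obtain X where X: "partial_isometry d X" "pairing d C X = of_real (tnorm d C)"
  using tnorm_attained by blast
 show ?thesis using assms[OF X(1)] unfolding X(2) by simp
qed

lemma tnorm_ge_0: "0 <= tnorm d C"
proof -
 obtain s u v where s: "ALL a<d. 0 <= s a" and "orthonormal d d v"
  and "ALL a<d. ALL b<d. ip d (u a) (u b) = (if a = b & s a ~= 0 then 1 else 0)"
  and "ALL i<d. ALL j<d. C i j = (SUM a<d. of_real (s a) * u a i * cnj (v a j))"
  and t: "tnorm d C = (SUM a<d. s a)"
  using singular_value_decomposition[of d C] by (elim exE conjE)
 show ?thesis unfolding t using s by (intro sum_nonneg) simp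
qed

lemma tnorm_outer_le:
 assumes "!!i j. i < d ==> j < d ==> C i j = (SUM a:A. s a * x a i * cnj (y a j))"
 shows "tnorm d C <= (SUM a:A. cmod (s a) * (nrm d (x a) * nrm d (y a)))"
proof (rule tnorm_le)
 fix X assume X: "partial_isometry d X"
 have "cmod (pairing d C X) <= (SUM a:A. cmod (s a * ip d (x a) (mv d X (y a))))"
  by (subst pairing_outer[of d C s x y A], rule assms) (assumption, assumption, rule norm_sum)
 also have "... <= (SUM a:A. cmod (s a) * (nrm d (x a) * nrm d (y a)))"
 proof (intro sum_mono)
  fix a
  have "cmod (ip d (x a) (mv d X (y a))) <= nrm d (x a) * nrm d (mv d X (y a))" by (rule ip_cauchy_schwarz)
  also have "... <= nrm d (x a) * nrm d (y a)" by (intro mult_left_mono partial_isometry_contraction[OF X]) simp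
  finally show "cmod (s a * ip d (x a) (mv d X (y a))) <= cmod (s a) * (nrm d (x a) * nrm d (y a))"
  by (simp add: norm_mult mult_left_mono)
 qed
 finally show "cmod (pairing d C X) <= (SUM a:A. cmod (s a) * (nrm d (x a) * nrm d (y a)))" .
qed

lemma tnorm_decomposition:
 "EX s u v. (ALL a<d. 0 <= s a) & (ALL a<d. nrm d (u a) <= 1) & (ALL a<d. nrm d (v a) <= 1) &
  (ALL i<d. ALL j<d. C i j = (SUM a<d. of_real (s a) * u a i * cnj (v a j))) &
  tnorm d C = (SUM a<d. s a)"
proof -
 obtain s u v where s: "ALL a<d. 0 <= s a" and v: "orthonormal d d v"
  and u: "ALL a<d. ALL b<d. ip d (u a) (u b) = (if a = b & s a ~= 0 then 1 else 0)"
  and C: "ALL i<d. ALL j<d. C i j = (SUM a<d. of_real (s a) * u a i * cnj (v a j))"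
  and t: "tnorm d C = (SUM a<d. s a)"
  using singular_value_decomposition[of d C] by (elim exE conjE)
 have n: "nrm d x <= 1" if "ip d x x = 1 | ip d x x = 0" for x
 proof -
  have "(nrm d x)^2 = 1 | (nrm d x)^2 = 0"
  using that by (simp only: ip_self of_real_eq_1_iff of_real_eq_0_iff)
  thus ?thesis by (auto simp: power2_eq_1_iff)
 qed
 have o: "ip d (u a) (u a) = 1 | ip d (u a) (u a) = 0" "ip d (v a) (v a) = 1" if "a < d" for a
  using u v that by (simp_all add: orthonormal_def)
 have "ALL a<d. nrm d (u a) <= 1" "ALL a<d. nrm d (v a) <= 1"
  using n o by simp_all
 with s C t show ?thesis by (intro exI[of _ s] exI[of _ u] exI[of _ v] conjI)
qed

section \<open>Compact groups with their Haar measure\<close>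

instance prod :: (polish_space, polish_space) polish_space ..

lemma sets_eq_by_identity:
 assumes "(%x. x) : measurable A B" "(%x. x) : measurable B A"
 shows "sets A = sets B"
proof -
 have "space A = space B"
  using measurable_space[OF assms(1)] measurable_space[OF assms(2)] by blast
 hence "E : sets B" if "E : sets A" for E
  using measurable_sets[OF assms(2) that] sets.sets_into_space[OF that] by (simp add: Int_absorb2)
 moreover from \<open>space A = space B\<close> have "E : sets A" if "E : sets B" for E
  using measurable_sets[OF assms(1) that] sets.sets_into_space[OF that] by (simp add: Int_absorb2)
 ultimately show ?thesis by blast
qed

lemma measurable_restrict_borel_id:
 assumes "sets M = sets (restrict_space borel S)"
 shows "(%x. x) : measurable M borel" "space M = S"
proof -
 have "(%x. x) : measurable (restrict_space borel S) borel" by (intro measurable_restrict_space1) simp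
 thus "(%x. x) : measurable M borel" using measurable_cong_sets[OF assms refl] by blast
 show "space M = S" using sets_eq_imp_space_eq[OF assms] by (simp add: space_restrict_space)
qed

lemma measurable_into_restrict_borel:
 assumes "sets M = sets (restrict_space borel S)" "f : borel_measurable N" "f : space N \<rightarrow> S"
 shows "f : measurable N M"
proof -
 have "f : measurable N (restrict_space borel S)" by (rule measurable_restrict_space2) (use assms in auto)
 thus ?thesis using measurable_cong_sets[OF refl assms(1)] by blast
qed

lemma borel_measurable_continuous_on_sets:
 assumes "sets M = sets (restrict_space borel S)" "continuous_on S f"
 shows "f : borel_measurable M"
 using borel_measurable_continuous_on_restrict[OF assms(2)] measurable_cong_sets[OF assms(1) refl] by blast

lemma sets_pair_restrict_borel:
 fixes M :: "'a::second_countable_topology measure" and N :: "'b::second_countable_topology measure"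
 assumes M: "sets M = sets (restrict_space borel S)" and N: "sets N = sets (restrict_space borel S')"
 shows "sets (M \<Otimes>\<^sub>M N) = sets (restrict_space borel (S \<times> S'))"
proof (rule sets_eq_by_identity)
 have "(%p. (fst p, snd p)) : borel_measurable (M \<Otimes>\<^sub>M N)"
  by (intro borel_measurable_Pair measurable_compose[OF measurable_fst measurable_restrict_borel_id(1)[OF M]]
  measurable_compose[OF measurable_snd measurable_restrict_borel_id(1)[OF N]])
 thus "(%x. x) : measurable (M \<Otimes>\<^sub>M N) (restrict_space borel (S \<times> S'))"
  by (intro measurable_restrict_space2)
  (auto simp: space_pair_measure measurable_restrict_borel_id(2)[OF M] measurable_restrict_borel_id(2)[OF N])
next
 have 1: "fst : measurable (restrict_space borel (S \<times> S')) M" by (rule measurable_into_restrict_borel[OF M])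
  (auto simp: space_restrict_space intro!: measurable_restrict_space1 borel_measurable_continuous_onI cintros)
 have 2: "snd : measurable (restrict_space borel (S \<times> S')) N" by (rule measurable_into_restrict_borel[OF N])
  (auto simp: space_restrict_space intro!: measurable_restrict_space1 borel_measurable_continuous_onI cintros)
 show "(%x. x) : measurable (restrict_space borel (S \<times> S')) (M \<Otimes>\<^sub>M N)"
  using measurable_Pair[OF 1 2] by simp
qed

lemma sets_sigma_openin:
 fixes S :: "'a::topological_space set"
 assumes "S : sets borel"
 shows "sets (sigma S {U. openin (top_of_set S) U}) = sets (restrict_space borel S)"
proof -
 have "sets (restrict_space borel S) = (\<inter>) S ` sigma_sets UNIV {U. open U}"
  by (simp add: sets_restrict_space borel_def)
 also have "... = sigma_sets S ((\<inter>) S ` {U. open U})"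
  using assms by (intro sigma_sets_Int) (auto simp: borel_def)
 also have "(\<inter>) S ` {U. open U} = {U. openin (top_of_set S) U}"
  unfolding openin_open image_def by blast
 finally have "sets (restrict_space borel S) = sigma_sets S {U. openin (top_of_set S) U}" .
 moreover have "sets (sigma S {U. openin (top_of_set S) U}) = sigma_sets S {U. openin (top_of_set S) U}"
  by (rule sets_measure_of) (use openin_imp_subset in blast)
 ultimately show ?thesis by (simp only:)
qed

lemma continuous_on_parametric_integral:
 fixes f :: "'a::metric_space \<times> 'b::metric_space => complex"
 assumes N: "finite_measure N" "sets N = sets (restrict_space borel S')"
  and S: "compact S" "compact S'" and f: "continuous_on (S \<times> S') f"
 shows "continuous_on S (%x. LINT y|N. f (x, y))"
proof -
 have sp: "space N = S'" by (rule measurable_restrict_borel_id(2)[OF N(2)])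
 obtain B where B: "!!p. p : S \<times> S' ==> norm (f p) <= B"
  using compact_imp_bounded[OF compact_continuous_image[OF f compact_Times[OF S]]] by (auto simp: bounded_iff)
 have meas: "(%y. f (x, y)) : borel_measurable N" if "x : S" for x
 proof (rule borel_measurable_continuous_on_sets[OF N(2)])
  have "continuous_on S' (f o (%y. (x, y)))"
  by (intro continuous_on_compose cintros continuous_on_subset[OF f]) (use that in auto)
  thus "continuous_on S' (%y. f (x, y))" by (simp add: o_def)
 qed
 show ?thesis unfolding continuous_on_sequentially
 proof (intro ballI allI impI)
  fix X a assume a: "a : S" and X: "(ALL n. X n : S) & X \<longlonglongrightarrow> a"
  have "(%n. LINT y|N. f (X n, y)) \<longlonglongrightarrow> (LINT y|N. f (a, y))"
  proof (rule integral_dominated_convergence[where w = "%_. B"])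
  show "(%y. f (a, y)) : borel_measurable N" by (rule meas[OF a])
  show "!!n. (%y. f (X n, y)) : borel_measurable N" using meas X by blast
  show "integrable N (%_. B)" by (rule finite_measure.integrable_const[OF N(1)])
  show "AE y in N. (%n. f (X n, y)) \<longlonglongrightarrow> f (a, y)"
  proof (rule AE_I2)
  fix y assume "y : space N"
  hence y: "y : S'" by (simp add: sp)
  have "(%n. (X n, y)) \<longlonglongrightarrow> (a, y)" using X by (intro tendsto_intros) auto
  thus "(%n. f (X n, y)) \<longlonglongrightarrow> f (a, y)"
  by (rule continuous_on_tendsto_compose[OF f]) (use X a y in simp_all)
  qed
  show "!!n. AE y in N. norm (f (X n, y)) <= B" using B X by (auto simp: sp intro!: AE_I2)
  qed
  thus "((%x. LINT y|N. f (x, y)) o X) \<longlonglongrightarrow> (LINT y|N. f (a, y))" by (simp add: o_def)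
 qed
qed

lemma Fubini_continuous:
 fixes f :: "'a::{metric_space, second_countable_topology} \<times> 'b::{metric_space, second_countable_topology} => complex"
 assumes M: "finite_measure M" "sets M = sets (restrict_space borel S)"
  and N: "finite_measure N" "sets N = sets (restrict_space borel S')"
  and S: "compact S" "compact S'" and f: "continuous_on (S \<times> S') f"
 shows "(LINT x|M. (LINT y|N. f (x, y))) = (LINT y|N. (LINT x|M. f (x, y)))"
  and "(\<integral>p. f p \<partial>(M \<Otimes>\<^sub>M N)) = (LINT x|M. (LINT y|N. f (x, y)))"
proof -
 interpret M: finite_measure M by fact
 interpret N: finite_measure N by fact
 interpret P: pair_sigma_finite M N ..
 interpret MN: finite_measure "M \<Otimes>\<^sub>M N" by (rule finite_measure_pair_measure) fact+
 have s: "sets (M \<Otimes>\<^sub>M N) = sets (restrict_space borel (S \<times> S'))"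
  by (rule sets_pair_restrict_borel[OF M(2) N(2)])
 obtain B where B: "!!p. p : S \<times> S' ==> norm (f p) <= B"
  using compact_imp_bounded[OF compact_continuous_image[OF f compact_Times[OF S]]] by (auto simp: bounded_iff)
 have i: "integrable (M \<Otimes>\<^sub>M N) f" by (rule MN.integrable_const_bound[of _ B])
  (use B borel_measurable_continuous_on_sets[OF s f] measurable_restrict_borel_id(2)[OF s] in \<open>auto intro!: AE_I2\<close>)
 have i': "integrable (M \<Otimes>\<^sub>M N) (case_prod (%x y. f (x, y)))" using i by (simp add: split_beta')
 show "(LINT x|M. (LINT y|N. f (x, y))) = (LINT y|N. (LINT x|M. f (x, y)))"
  using P.Fubini_integral[OF i'] by simp
 show "(\<integral>p. f p \<partial>(M \<Otimes>\<^sub>M N)) = (LINT x|M. (LINT y|N. f (x, y)))"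
  using P.integral_fst'[OF i] by simp
qed

locale haar_group = group G for G :: "('g::polish_space, 'r) monoid_scheme" (structure) +
 fixes M :: "'g measure"
 assumes compact_carrier: "compact (carrier G)"
  and continuous_mult: "continuous_on (carrier G \<times> carrier G) (%p. fst p \<otimes> snd p)"
  and continuous_inv: "cont_on G (%x. inv x)"
  and sets_M: "sets M = sets (restrict_space borel (carrier G))"
  and total_mass: "emeasure M (carrier G) = 1"
  and left_invariant: "!!x. x : carrier G ==> distr M M (%y. x \<otimes> y) = M"
begin

lemma space_M: "space M = carrier G" by (rule measurable_restrict_borel_id(2)[OF sets_M])

sublocale prob_space M by standard (simp add: space_M total_mass)

lemma continuous_on_translate:
 assumes "a : carrier G" "b : carrier G"
 shows "cont_on G (%x. a \<otimes> x)" "cont_on G (%x. x \<otimes> b)"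
proof -
 have "cont_on G ((%p. fst p \<otimes> snd p) o (%x. (a, x)))"
  by (intro continuous_on_compose cintros continuous_on_subset[OF continuous_mult]) (use assms in auto)
 thus "cont_on G (%x. a \<otimes> x)" by (simp add: o_def)
 have "cont_on G ((%p. fst p \<otimes> snd p) o (%x. (x, b)))"
  by (intro continuous_on_compose cintros continuous_on_subset[OF continuous_mult]) (use assms in auto)
 thus "cont_on G (%x. x \<otimes> b)" by (simp add: o_def)
qed

lemma continuous_on_mult2:
 assumes "continuous_on A f" "continuous_on A g" "f ` A \<subseteq> carrier G" "g ` A \<subseteq> carrier G"
 shows "continuous_on A (%x. f x \<otimes> g x)"
proof -
 have "continuous_on A ((%p. fst p \<otimes> snd p) o (%x. (f x, g x)))"
  by (intro continuous_on_compose cintros assms continuous_on_subset[OF continuous_mult]) (use assms in auto)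
 thus ?thesis by (simp add: o_def)
qed

lemma measurable_cont_self:
 assumes "cont_on G f" "f ` carrier G \<subseteq> carrier G"
 shows "f : measurable M M"
 by (rule measurable_into_restrict_borel[OF sets_M borel_measurable_continuous_on_sets[OF sets_M assms(1)]])
  (use assms space_M in auto)

lemma measurable_cont:
 "cont_on G f ==> f : borel_measurable M" by (rule borel_measurable_continuous_on_sets[OF sets_M])

lemma integrable_cont:
 fixes f :: "'g => 'b::{banach, second_countable_topology}"
 assumes "cont_on G f"
 shows "integrable M f"
proof -
 obtain B where B: "!!p. p : carrier G ==> norm (f p) <= B"
  using compact_imp_bounded[OF compact_continuous_image[OF assms compact_carrier]] by (auto simp: bounded_iff)
 show ?thesis
  by (rule integrable_const_bound[of _ B]) (use B space_M measurable_cont[OF assms] in \<open>auto intro!: AE_I2\<close>)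
qed

lemma norm_integral_le:
 fixes f :: "'g => complex"
 assumes "cont_on G f" "!!x. x : carrier G ==> norm (f x) <= B"
 shows "norm (LINT x|M. f x) <= B"
proof -
 have "norm (LINT x|M. f x) <= (LINT x|M. norm (f x))" by (rule integral_norm_bound)
 also have "... <= (LINT x|M. B)"
  using integrable_cont[OF assms(1)] assms(2) by (intro integral_mono) (auto simp: space_M)
 also have "... = B" by (simp add: prob_space)
 finally show ?thesis .
qed

text \<open>Any left invariant probability measure is the image of \<open>M\<close> under inversion: integrate the
 indicator of \<open>E\<close> at \<open>x y\<close>, in both orders, against the right invariant image of \<open>M\<close> in \<open>x\<close> and
 the given measure in \<open>y\<close>.  Applied to \<open>M\<close> itself this gives uniqueness and unimodularity at once.\<close>
lemma left_invariant_eq_inverse_image: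
 assumes L: "sets L = sets M" "emeasure L (carrier G) = 1"
  and inv_L: "!!x. x : carrier G ==> distr L L (%y. x \<otimes> y) = L"
 shows "L = distr M M (%x. inv x)"
proof (rule measure_eqI)
 define R where "R = distr M M (%x. inv x)"
 have minv: "(%x. inv x) : measurable M M" by (rule measurable_cont_self) (auto simp: continuous_inv)
 have sR: "sets R = sets M" by (simp add: R_def)
 have spL: "space L = carrier G" using L(1) space_M sets_eq_imp_space_eq by metis
 have spR: "space R = carrier G" by (simp add: R_def space_M)
 interpret L: prob_space L by standard (simp add: spL L)
 interpret R: prob_space R unfolding R_def by (rule prob_space_distr[OF minv])
 interpret RL: pair_sigma_finite R L ..
 have mt: "(%y. x \<otimes> y) : measurable M M" "(%y. y \<otimes> x) : measurable M M" if "x : carrier G" for x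
  using that by (auto intro!: measurable_cont_self continuous_on_translate)
 have right: "distr R R (%x. x \<otimes> y) = R" if y: "y : carrier G" for y
 proof -
  have "distr R R (%x. x \<otimes> y) = distr M M ((%x. x \<otimes> y) o (%x. inv x))"
  unfolding R_def using mt[OF y] minv by (subst distr_distr) (auto intro!: distr_cong)
  also have "... = distr M M ((%x. inv x) o (%x. inv y \<otimes> x))"
  by (intro distr_cong) (use y space_M in \<open>auto simp: inv_mult_group\<close>)
  also have "... = distr (distr M M (%x. inv y \<otimes> x)) M (%x. inv x)"
  using mt[of "inv y"] y minv by (subst distr_distr) auto
  also have "... = R" unfolding R_def using left_invariant[of "inv y"] y by simp
  finally show ?thesis .
 qed
 show "sets L = sets (distr M M (%x. inv x))" by (simp add: L)
 fix E assume "E : sets L"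
 hence E: "E : sets M" by (simp add: L)
 have sp2: "sets (R \<Otimes>\<^sub>M L) = sets (restrict_space borel (carrier G \<times> carrier G))"
  by (rule sets_pair_restrict_borel) (simp_all add: sR L sets_M)
 have "(%p. fst p \<otimes> snd p) : measurable (R \<Otimes>\<^sub>M L) M"
  by (rule measurable_into_restrict_borel[OF sets_M borel_measurable_continuous_on_sets[OF sp2 continuous_mult]])
  (auto simp: space_pair_measure spR spL)
 hence m: "(%p. indicator E (fst p \<otimes> snd p) :: ennreal) : borel_measurable (R \<Otimes>\<^sub>M L)"
  using E by measurable
 have 1: "(\<integral>\<^sup>+y. indicator E (x \<otimes> y) \<partial>L) = emeasure L E" if x: "x : carrier G" for x
 proof -
  have mx: "(%y. x \<otimes> y) : measurable L L"
  using mt(1)[OF x] measurable_cong_sets[OF L(1) L(1)] by blast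
  have "(\<integral>\<^sup>+y. indicator E (x \<otimes> y) \<partial>L) = (\<integral>\<^sup>+y. indicator E y \<partial>distr L L (%y. x \<otimes> y))"
  using E L mx by (subst nn_integral_distr) auto
  thus ?thesis using inv_L[OF x] E L by simp
 qed
 have 2: "(\<integral>\<^sup>+x. indicator E (x \<otimes> y) \<partial>R) = emeasure R E" if y: "y : carrier G" for y
 proof -
  have my: "(%x. x \<otimes> y) : measurable R R"
  using mt(2)[OF y] measurable_cong_sets[OF sR sR] by blast
  have "(\<integral>\<^sup>+x. indicator E (x \<otimes> y) \<partial>R) = (\<integral>\<^sup>+x. indicator E x \<partial>distr R R (%x. x \<otimes> y))"
  using E sR my by (subst nn_integral_distr) auto
  thus ?thesis using right[OF y] E sR by simp
 qed
 have "(\<integral>\<^sup>+x. (\<integral>\<^sup>+y. indicator E (x \<otimes> y) \<partial>L) \<partial>R) = (\<integral>\<^sup>+x. emeasure L E \<partial>R)"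
  by (rule nn_integral_cong) (simp add: 1 spR)
 hence a: "(\<integral>\<^sup>+x. (\<integral>\<^sup>+y. indicator E (x \<otimes> y) \<partial>L) \<partial>R) = emeasure L E"
  by (simp add: R.emeasure_space_1)
 have "(\<integral>\<^sup>+y. (\<integral>\<^sup>+x. indicator E (x \<otimes> y) \<partial>R) \<partial>L) = (\<integral>\<^sup>+y. emeasure R E \<partial>L)"
  by (rule nn_integral_cong) (simp add: 2 spL)
 hence b: "(\<integral>\<^sup>+y. (\<integral>\<^sup>+x. indicator E (x \<otimes> y) \<partial>R) \<partial>L) = emeasure R E"
  by (simp add: L.emeasure_space_1)
 show "emeasure L E = emeasure (distr M M (%x. inv x)) E"
  using RL.Fubini[OF m] a b unfolding R_def by simp
qed

lemma inverse_image: "distr M M (%x. inv x) = M"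
 using left_invariant_eq_inverse_image[OF refl total_mass left_invariant] by simp

lemma haar_unique:
 assumes "sets L = sets M" "emeasure L (carrier G) = 1"
  and "!!x. x : carrier G ==> distr L L (%y. x \<otimes> y) = L"
 shows "L = M"
 using left_invariant_eq_inverse_image[OF assms] inverse_image by simp

lemma integral_left:
 assumes f: "cont_on G f" and x: "x : carrier G"
 shows "(LINT y|M. f (x \<otimes> y)) = (LINT y|M. (f y :: complex))"
proof -
 have "(LINT y|M. f y) = (\<integral>y. f y \<partial>distr M M (%y. x \<otimes> y))" using left_invariant[OF x] by simp
 also have "... = (LINT y|M. f (x \<otimes> y))"
  by (rule integral_distr) (use x in \<open>auto intro!: measurable_cont_self continuous_on_translate measurable_cont f\<close>)
 finally show ?thesis by simp
qed

lemma integral_inv: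
 assumes f: "cont_on G f"
 shows "(LINT y|M. f (inv y)) = (LINT y|M. (f y :: complex))"
proof -
 have "(LINT y|M. f y) = (\<integral>y. f y \<partial>distr M M (%y. inv y))" using inverse_image by simp
 also have "... = (LINT y|M. f (inv y))"
  by (rule integral_distr) (auto intro!: measurable_cont_self continuous_inv measurable_cont f)
 finally show ?thesis by simp
qed

lemma integral_right:
 assumes f: "cont_on G f" and x: "x : carrier G"
 shows "(LINT y|M. f (y \<otimes> x)) = (LINT y|M. (f y :: complex))"
proof -
 have c: "cont_on G (%y. f (inv y))"
  using continuous_on_compose2[OF f continuous_inv] by auto
 have c2: "cont_on G (%y. f (y \<otimes> x))"
  using continuous_on_compose2[OF f continuous_on_translate(2)[OF x x]] x by auto
 have "(LINT y|M. f (y \<otimes> x)) = (LINT y|M. f (inv y \<otimes> x))"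
  using integral_inv[OF c2] by simp
 also have "... = (LINT y|M. f (inv (inv x \<otimes> y)))"
  by (rule Bochner_Integration.integral_cong) (use x space_M in \<open>auto simp: inv_mult_group\<close>)
 also have "... = (LINT y|M. f (inv y))" using integral_left[OF c, of "inv x"] x by simp
 also have "... = (LINT y|M. f y)" by (rule integral_inv[OF f])
 finally show ?thesis .
qed

lemma coset_eq_vimage:
 assumes "x : carrier G" "E \<subseteq> carrier G"
 shows "x <# E = (%y. inv x \<otimes> y) -` E Int carrier G"
proof (intro equalityI subsetI)
 fix z assume "z : x <# E"
 then obtain h where "h : E" "z = x \<otimes> h" by (auto simp: l_coset_def)
 thus "z : (%y. inv x \<otimes> y) -` E Int carrier G"
  using assms by (auto simp: inv_solve_left' m_assoc[symmetric])
next
 fix z assume z: "z : (%y. inv x \<otimes> y) -` E Int carrier G"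
 hence "z = x \<otimes> (inv x \<otimes> z)" using assms by (simp add: m_assoc[symmetric])
 thus "z : x <# E" using z by (auto simp: l_coset_def)
qed

lemma carrier_borel: "carrier G : sets borel"
 using compact_carrier by (simp add: borel_compact)

lemma haar_outer_regular:
 assumes E: "E : sets M"
 shows "emeasure M E = (INF U\<in>{U. openin (top_of_set (carrier G)) U & E \<subseteq> U}. emeasure M U)"
proof -
 define N where "N = distr M borel (%x. x)"
 have id: "(%x. x) : measurable M borel" by (rule measurable_restrict_borel_id(1)[OF sets_M])
 have NE: "emeasure N B = emeasure M (B Int carrier G)" if "B : sets borel" for B
  unfolding N_def using that id by (subst emeasure_distr) (auto simp: space_M)
 have Eb: "E : sets borel" "E \<subseteq> carrier G"
  using E carrier_borel unfolding sets_M by (auto simp: sets_restrict_space_iff)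
 have "emeasure M E = emeasure N E" using NE[OF Eb(1)] Eb(2) by (simp add: Int_absorb2)
 also have "... = (INF U\<in>{U. E \<subseteq> U & open U}. emeasure N U)"
 proof (rule outer_regular)
  show "sets N = sets borel" by (simp add: N_def)
  have "emeasure N (space N) <= emeasure M (space M)"
  using NE[of UNIV] by (simp add: N_def space_M)
  thus "emeasure N (space N) ~= \<infinity>" using emeasure_finite[of "space M"] by (auto simp: top_unique)
 qed (rule Eb)
 also have "... = (INF U\<in>{U. openin (top_of_set (carrier G)) U & E \<subseteq> U}. emeasure M U)"
 proof (rule antisym)
  show "(INF U\<in>{U. E \<subseteq> U & open U}. emeasure N U) <= (INF U\<in>{U. openin (top_of_set (carrier G)) U & E \<subseteq> U}. emeasure M U)"
  proof (rule INF_greatest)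
  fix U assume "U : {U. openin (top_of_set (carrier G)) U & E \<subseteq> U}"
  then obtain V where V: "open V" "U = carrier G Int V" "E \<subseteq> U" by (auto simp: openin_open)
  have "(INF U\<in>{U. E \<subseteq> U & open U}. emeasure N U) <= emeasure N V" using V by (intro INF_lower) auto
  also have "... = emeasure M U" using NE[of V] V by (simp add: Int_commute)
  finally show "(INF U\<in>{U. E \<subseteq> U & open U}. emeasure N U) <= emeasure M U" .
  qed
  show "(INF U\<in>{U. openin (top_of_set (carrier G)) U & E \<subseteq> U}. emeasure M U) <= (INF U\<in>{U. E \<subseteq> U & open U}. emeasure N U)"
  proof (rule INF_greatest)
  fix V assume V: "V : {U. E \<subseteq> U & open U}"
  hence "(INF U\<in>{U. openin (top_of_set (carrier G)) U & E \<subseteq> U}. emeasure M U) <= emeasure M (carrier G Int V)"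
  using Eb by (intro INF_lower) (auto simp: openin_open)
  also have "... = emeasure N V" using NE[of V] V by (simp add: Int_commute)
  finally show "(INF U\<in>{U. openin (top_of_set (carrier G)) U & E \<subseteq> U}. emeasure M U) <= emeasure N V" .
  qed
 qed
 finally show ?thesis .
qed

lemma haar_measure_eq: "haar_measure G (top_of_set (carrier G)) = M"
 unfolding haar_measure_def topspace_euclidean_subtopology sets_sigma_openin[OF carrier_borel]
proof (rule the_equality)
 have "emeasure M (x <# E) = emeasure M E" if x: "x : carrier G" and E: "E : sets M" for x E
 proof -
  have "E \<subseteq> carrier G" using sets.sets_into_space[OF E] space_M by simp
  hence "emeasure M (x <# E) = emeasure (distr M M (%y. inv x \<otimes> y)) E"
  using x E by (subst emeasure_distr)
  (auto simp: coset_eq_vimage space_M intro!: measurable_cont_self continuous_on_translate)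
  thus ?thesis using left_invariant[of "inv x"] x by simp
 qed
 thus "sets M = sets (restrict_space borel (carrier G)) & emeasure M (carrier G) = 1 &
  (ALL x:carrier G. ALL E:sets M. emeasure M (x <# E) = emeasure M E) &
  (ALL E:sets M. emeasure M E = (INF U\<in>{U. openin (top_of_set (carrier G)) U & E \<subseteq> U}. emeasure M U))"
  using sets_M total_mass haar_outer_regular by blast
next
 fix L assume L: "sets L = sets (restrict_space borel (carrier G)) & emeasure L (carrier G) = 1 &
  (ALL x:carrier G. ALL E:sets L. emeasure L (x <# E) = emeasure L E) &
  (ALL E:sets L. emeasure L E = (INF U\<in>{U. openin (top_of_set (carrier G)) U & E \<subseteq> U}. emeasure L U))"
 hence sL: "sets L = sets M" by (simp add: sets_M)
 have spL: "space L = carrier G" using sL space_M sets_eq_imp_space_eq by metis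
 show "L = M"
 proof (rule haar_unique[OF sL])
  show "emeasure L (carrier G) = 1" using L by blast
  fix x assume x: "x : carrier G"
  have "(%y. x \<otimes> y) : measurable M M"
  using x by (auto intro!: measurable_cont_self continuous_on_translate)
  hence m: "(%y. x \<otimes> y) : measurable L L" using measurable_cong_sets[OF sL sL] by blast
  show "distr L L (%y. x \<otimes> y) = L"
  proof (rule measure_eqI)
  fix E assume "E : sets (distr L L (%y. x \<otimes> y))"
  hence E: "E : sets L" by simp
  hence "E \<subseteq> carrier G" using sets.sets_into_space[OF E] spL by simp
  hence "emeasure (distr L L (%y. x \<otimes> y)) E = emeasure L (inv x <# E)"
  using x E m by (subst emeasure_distr) (auto simp: coset_eq_vimage spL)
  also have "... = emeasure L E" using L x E inv_closed[OF x] by blast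
  finally show "emeasure (distr L L (%y. x \<otimes> y)) E = emeasure L E" .
  qed simp
 qed
qed

text \<open>Haar measure charges every nonempty open set, since finitely many translates of it cover.\<close>

lemma integral_zero_imp_zero:
 fixes f :: "'g => real"
 assumes f: "cont_on G f" and pos: "!!x. x : carrier G ==> 0 <= f x"
  and int: "(LINT x|M. f x) = 0" and x: "x : carrier G"
 shows "f x = 0"
proof (rule ccontr)
 assume "f x ~= 0"
 hence fx: "f x > 0" using pos[OF x] by simp
 define V where "V = (%a. {y : carrier G. 0 < f (a \<otimes> y)})"
 have cont: "cont_on G (%y. f (a \<otimes> y))" if "a : carrier G" for a
  using continuous_on_compose2[OF f continuous_on_translate(1)[OF that that]] that by auto
 have op: "openin (top_of_set (carrier G)) (V a)" if "a : carrier G" for a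
 proof -
  have "openin (top_of_set (carrier G)) (carrier G Int (%y. f (a \<otimes> y)) -` {0<..})"
  by (rule continuous_openin_preimage_gen[OF cont[OF that]]) simp
  moreover have "carrier G Int (%y. f (a \<otimes> y)) -` {0<..} = V a" by (auto simp: V_def)
  ultimately show ?thesis by (simp only:)
 qed
 have ae: "AE y in M. f y = 0"
 proof -
  have "AE y in M. 0 <= f y" by (rule AE_I2) (simp add: space_M pos)
  from integral_nonneg_eq_0_iff_AE[OF integrable_cont[OF f] this] int show ?thesis by simp
 qed
 have null: "V a : null_sets M" if a: "a : carrier G" for a
 proof -
  have ma: "(%y. a \<otimes> y) : measurable M M"
  using a by (auto intro!: measurable_cont_self continuous_on_translate)
  have mf: "f : borel_measurable M" by (rule measurable_cont[OF f])
  have "AE y in distr M M (%y. a \<otimes> y). f y = 0" by (subst left_invariant[OF a]) (rule ae)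
  hence "AE y in M. f (a \<otimes> y) = 0"
  using mf by (subst (asm) AE_distr_iff[OF ma]) auto
  hence "AE y in M. y ~: V a" by eventually_elim (simp add: V_def)
  moreover have "V a : sets M"
  proof -
  have "(%y. f (a \<otimes> y)) : borel_measurable M" by (rule measurable_cont[OF cont[OF a]])
  hence "{y : space M. 0 < f (a \<otimes> y)} : sets M" by measurable
  thus ?thesis by (simp only: V_def space_M)
  qed
  ultimately show ?thesis by (simp add: AE_iff_null_sets)
 qed
 have "carrier G \<subseteq> \<Union>(V ` carrier G)"
 proof
  fix y assume y: "y : carrier G"
  have "(x \<otimes> inv y) \<otimes> y = x" using x y by (simp add: m_assoc)
  hence "y : V (x \<otimes> inv y)" using y fx by (simp add: V_def)
  thus "y : \<Union>(V ` carrier G)" using x y by (intro UN_I[of "x \<otimes> inv y"]) simp_all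
 qed
 then obtain D where D: "D \<subseteq> V ` carrier G" "finite D" "carrier G \<subseteq> \<Union>D"
 proof -
  have "ALL c:V ` carrier G. openin (top_of_set (carrier G)) c" using op by blast
  thus thesis
  using compact_carrier[unfolded compact_eq_openin_cover, THEN spec[of _ "V ` carrier G"]]
  \<open>carrier G \<subseteq> \<Union>(V ` carrier G)\<close> that by meson
 qed
 have "\<Union>D : null_sets M" using D null by (intro null_sets.finite_Union) auto
 hence "carrier G : null_sets M" proof -
  have "\<Union>D = carrier G" using D(1,3) by (auto simp: V_def)
  thus ?thesis using \<open>\<Union>D : null_sets M\<close> by simp
 qed
 thus False using total_mass by (auto simp: null_sets_def)
qed

end

section \<open>Coefficient functions of unitary matrix representations\<close>

definition unirep :: "('g::topological_space, 'r) monoid_scheme => nat => ('g => nat => nat => complex) => bool" where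
 "unirep G d s \<longleftrightarrow>
  (ALL x:carrier G. ALL y:carrier G. ALL i<d. ALL j<d. s (x \<otimes>\<^bsub>G\<^esub> y) i j = mm d (s x) (s y) i j) &
  (ALL x:carrier G. ALL i<d. ALL j<d. s (inv\<^bsub>G\<^esub> x) i j = cnj (s x j i)) &
  (ALL i<d. ALL j<d. s \<one>\<^bsub>G\<^esub> i j = (if i = j then 1 else 0)) &
  (ALL i<d. ALL j<d. cont_on G (%x. s x i j))"

definition coef :: "nat => ('g => nat => nat => complex) => (nat => complex) => (nat => complex) => 'g => complex" where
 "coef d s u v x = ip d (mv d (s x) u) v"

definition atoms :: "('g::topological_space, 'r) monoid_scheme => ('g => complex) set" where
 "atoms G = {h. EX d s u v. unirep G d s & nrm d u <= 1 & nrm d v <= 1 &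
  (ALL x:carrier G. h x = coef d s u v x)}"

definition ahull :: "('g::topological_space, 'r) monoid_scheme => real => ('g => complex) set" where
 "ahull G r = {h. EX (n::nat) c a. (ALL q<n. a q : atoms G) & (SUM q<n. cmod (c q)) <= r &
  (ALL x:carrier G. h x = (SUM q<n. c q * a q x))}"

text \<open>As will turn out, the closed ball of radius \<open>r\<close> of \<open>A(G)\<close>.  Unlike Fourier coefficients, this form of it
 is visibly compatible with products, translations and averages.\<close>
definition Conv :: "('g::topological_space, 'r) monoid_scheme => real => ('g => complex) set" where
 "Conv G r = {f. ALL e>0. EX h:ahull G r. ALL x:carrier G. cmod (f x - h x) <= e}"

lemma unirepD:
 assumes "unirep G d s"
 shows "!!x y i j. x : carrier G ==> y : carrier G ==> i < d ==> j < d ==> s (x \<otimes>\<^bsub>G\<^esub> y) i j = mm d (s x) (s y) i j"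
  and "!!x i j. x : carrier G ==> i < d ==> j < d ==> s (inv\<^bsub>G\<^esub> x) i j = cnj (s x j i)"
  and "!!i j. i < d ==> j < d ==> s \<one>\<^bsub>G\<^esub> i j = (if i = j then 1 else 0)"
  and "!!i j. i < d ==> j < d ==> cont_on G (%x. s x i j)"
 using assms unfolding unirep_def by simp_all

lemma unirep_isometry:
 assumes "Group.group G" "unirep G d s" "x : carrier G"
 shows "nrm d (mv d (s x) u) = nrm d u"
proof -
 interpret Group.group G by fact
 have "ip d (mv d (s x) u) (mv d (s x) u) = ip d u (mv d (adj (s x)) (mv d (s x) u))" by (rule ip_mv_adj)
 also have "... = ip d u u"
 proof (rule ip_cong[OF refl])
  fix i assume i: "i < d"
  have "mv d (adj (s x)) (mv d (s x) u) i = mv d (mm d (adj (s x)) (s x)) u i" by (simp add: mv_mm)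
  also have "... = (SUM j<d. (if i = j then 1 else 0) * u j)"
  unfolding mv_def
  proof (intro sum.cong refl)
  fix j assume "j : {..<d}"
  hence j: "j < d" by simp
  have "mm d (adj (s x)) (s x) i j = mm d (s (inv\<^bsub>G\<^esub> x)) (s x) i j"
  by (rule mm_cong) (simp_all add: adj_def unirepD(2)[OF assms(2,3) i])
  also have "... = s (inv\<^bsub>G\<^esub> x \<otimes>\<^bsub>G\<^esub> x) i j"
  using unirepD(1)[OF assms(2) inv_closed[OF assms(3)] assms(3) i j] by simp
  also have "... = (if i = j then 1 else 0)"
  using unirepD(3)[OF assms(2) i j] assms(3) by simp
  finally show "mm d (adj (s x)) (s x) i j * u j = (if i = j then 1 else 0) * u j" by simp
  qed
  also have "... = u i" using i by (simp add: if_distrib[of "%x. x * _"] cong: if_cong)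
  finally show "mv d (adj (s x)) (mv d (s x) u) i = u i" .
 qed
 finally have "(nrm d (mv d (s x) u))^2 = (nrm d u)^2" by (simp only: ip_self of_real_eq_iff)
 thus ?thesis by (simp add: power2_eq_iff_nonneg)
qed

lemma coef_expand: "coef d s u v x = (SUM i<d. SUM j<d. s x i j * u j * cnj (v i))"
 unfolding coef_def ip_def mv_def sum_distrib_right ..

lemma coef_bound:
 assumes "Group.group G" "unirep G d s" "x : carrier G"
 shows "cmod (coef d s u v x) <= nrm d u * nrm d v"
 unfolding coef_def using ip_cauchy_schwarz[of d "mv d (s x) u" v] unirep_isometry[OF assms] by simp

lemma continuous_on_coef:
 assumes "unirep G d s"
 shows "cont_on G (coef d s u v)"
 unfolding coef_expand[abs_def] by (intro cintros unirepD(4)[OF assms]) auto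

lemma unirep_entry_bound:
 assumes "Group.group G" "unirep G d s" "x : carrier G" "i < d" "j < d"
 shows "cmod (s x i j) <= 1"
proof -
 define e :: "nat => nat => complex" where "e = (%k l. if l = k then 1 else 0)"
 have n: "nrm d (e k) = 1" if "k < d" for k
 proof -
  have "ip d (e k) (e k) = 1" using ip_std_right[OF that, of "e k"] unfolding e_def by simp
  hence "(nrm d (e k))^2 = 1" by (simp only: ip_self of_real_eq_1_iff)
  thus ?thesis using nrm_ge_0[of d "e k"] by (auto simp: power2_eq_1_iff)
 qed
 have "mv d (s x) (e j) = (%i. s x i j)"
  using assms(5) by (simp add: mv_def e_def if_distrib[of "%z. s x _ _ * z"] cong: if_cong)
 hence "coef d s (e j) (e i) x = s x i j"
  unfolding coef_def e_def using ip_std_right[OF assms(4)] by simp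
 thus ?thesis using coef_bound[OF assms(1-3), of "e j" "e i"] n assms(4,5) by simp
qed

lemma atomsI: "unirep G d s ==> nrm d u <= 1 ==> nrm d v <= 1 ==> coef d s u v : atoms G"
 unfolding atoms_def by (intro CollectI exI[of _ d] exI[of _ s] exI[of _ u] exI[of _ v]) simp

lemma atomsE:
 assumes "h : atoms G"
 obtains d s u v where "unirep G d s" "nrm d u <= 1" "nrm d v <= 1" "!!x. x : carrier G ==> h x = coef d s u v x"
 using assms unfolding atoms_def mem_Collect_eq by (elim exE conjE) (rule that, auto)

lemma atom_bound:
 assumes "Group.group G" "h : atoms G" "x : carrier G"
 shows "cmod (h x) <= 1"
proof -
 obtain d s u v where "unirep G d s" "nrm d u <= 1" "nrm d v <= 1" "!!x. x : carrier G ==> h x = coef d s u v x"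
  by (rule atomsE[OF assms(2)]) blast
 hence "cmod (h x) <= nrm d u * nrm d v" using coef_bound[OF assms(1) _ assms(3)] assms(3) by simp
 also have "... <= 1 * 1" using \<open>nrm d u <= 1\<close> \<open>nrm d v <= 1\<close> by (intro mult_mono) auto
 finally show ?thesis by simp
qed

lemma atom_continuous:
 assumes "h : atoms G"
 shows "cont_on G h"
proof -
 obtain d s u v where "unirep G d s" "nrm d u <= 1" "nrm d v <= 1" "!!x. x : carrier G ==> h x = coef d s u v x"
  by (rule atomsE[OF assms]) blast
 thus ?thesis using continuous_on_coef[of G d s u v] continuous_on_cong[of "carrier G" "carrier G" h "coef d s u v"] by simp
qed

lemma hullI:
 fixes I :: "'i set"
 assumes "finite I" "!!q. q : I ==> a q : atoms G" "(SUM q:I. cmod (c q)) <= r"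
  "!!x. x : carrier G ==> h x = (SUM q:I. c q * a q x)"
 shows "h : ahull G r"
proof -
 obtain e where e: "bij_betw e {0..<card I} I" using ex_bij_betw_nat_finite[OF assms(1)] by blast
 hence e: "bij_betw e {..<card I} I" by (simp add: atLeast0LessThan)
 have s: "(SUM q<card I. f (e q)) = sum f I" for f :: "'i => real" by (rule sum.reindex_bij_betw[OF e])
 have s2: "(SUM q<card I. f (e q)) = sum f I" for f :: "'i => complex" by (rule sum.reindex_bij_betw[OF e])
 have "ALL q<card I. a (e q) : atoms G" using assms(2) bij_betwE[OF e] by simp
 moreover have "(SUM q<card I. cmod (c (e q))) <= r" using s[of "%q. cmod (c q)"] assms(3) by simp
 moreover have "ALL x:carrier G. h x = (SUM q<card I. c (e q) * a (e q) x)"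
  using assms(4) s2[of "%q. c q * a q _"] by simp
 ultimately show ?thesis unfolding ahull_def
  by (intro CollectI exI[of _ "card I"] exI[of _ "%q. c (e q)"] exI[of _ "%q. a (e q)"] conjI)
qed

lemma hullE:
 assumes "h : ahull G r"
 obtains n :: nat and c a where "!!q. q < n ==> a q : atoms G" "(SUM q<n. cmod (c q)) <= r"
  "!!x. x : carrier G ==> h x = (SUM q<n. c q * a q x)"
 using assms unfolding ahull_def mem_Collect_eq by (elim exE conjE) (rule that, auto)

lemma hull_ge_0:
 assumes "h : ahull G r"
 shows "0 <= r"
proof -
 obtain n :: nat and c a where "!!q. q < n ==> a q : atoms G" and c: "(SUM q<n. cmod (c q)) <= r"
  and "!!x. x : carrier G ==> h x = (SUM q<n. c q * a q x)" using assms by (rule hullE) blast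
 have "0 <= (SUM q<n. cmod (c q))" by (rule sum_nonneg) simp
 thus ?thesis using c by linarith
qed

lemma hull_mono:
 assumes "h : ahull G r" "r <= r'"
 shows "h : ahull G r'"
proof -
 obtain n :: nat and c a where h: "!!q. q < n ==> a q : atoms G" "(SUM q<n. cmod (c q)) <= r"
  "!!x. x : carrier G ==> h x = (SUM q<n. c q * a q x)" using assms(1) by (rule hullE) blast
 show ?thesis by (rule hullI[of "{..<n}" a G c]) (use h assms(2) in simp_all)
qed

lemma hull_cong: "h : ahull G r ==> (!!x. x : carrier G ==> h' x = h x) ==> h' : ahull G r"
 unfolding ahull_def by simp

lemma hull_bound:
 assumes "Group.group G" "h : ahull G r" "x : carrier G"
 shows "cmod (h x) <= r"
proof -
 obtain n :: nat and c a where h: "!!q. q < n ==> a q : atoms G" "(SUM q<n. cmod (c q)) <= r"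
  "!!x. x : carrier G ==> h x = (SUM q<n. c q * a q x)" using assms(2) by (rule hullE) blast
 have "cmod (h x) <= (SUM q<n. cmod (c q * a q x))" unfolding h(3)[OF assms(3)] by (rule norm_sum)
 also have "... <= (SUM q<n. cmod (c q))"
  using atom_bound[OF assms(1) h(1) assms(3)] by (intro sum_mono) (simp add: norm_mult mult_left_le)
 finally show ?thesis using h(2) by linarith
qed

lemma hull_continuous:
 assumes "h : ahull G r"
 shows "cont_on G h"
proof -
 obtain n :: nat and c a where h: "!!q. q < n ==> a q : atoms G" "(SUM q<n. cmod (c q)) <= r"
  "!!x. x : carrier G ==> h x = (SUM q<n. c q * a q x)" using assms by (rule hullE) blast
 have "cont_on G (%x. SUM q<n. c q * a q x)" by (intro cintros atom_continuous h(1)) simp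
 thus ?thesis by (rule continuous_on_eq) (simp add: h(3))
qed

lemma hull_add:
 assumes "h : ahull G r" "h' : ahull G r'"
 shows "(%x. h x + h' x) : ahull G (r + r')"
proof -
 obtain n :: nat and c a where h: "!!q. q < n ==> a q : atoms G" "(SUM q<n. cmod (c q)) <= r"
  "!!x. x : carrier G ==> h x = (SUM q<n. c q * a q x)" using assms(1) by (rule hullE) blast
 obtain n' :: nat and c' a' where h': "!!q. q < n' ==> a' q : atoms G" "(SUM q<n'. cmod (c' q)) <= r'"
  "!!x. x : carrier G ==> h' x = (SUM q<n'. c' q * a' q x)" using assms(2) by (rule hullE) blast
 show ?thesis
 proof (rule hullI[of "{..<n} <+> {..<n'}" "case_sum a a'" G "case_sum c c'"])
  show "(SUM q:{..<n} <+> {..<n'}. cmod (case_sum c c' q)) <= r + r'"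
  using h(2) h'(2) by (simp add: sum.Plus)
  show "h x + h' x = (SUM q:{..<n} <+> {..<n'}. case_sum c c' q * case_sum a a' q x)" if "x : carrier G" for x
  using h(3)[OF that] h'(3)[OF that] by (simp add: sum.Plus)
 qed (use h(1) h'(1) in auto)
qed

lemma hull_scale:
 assumes "h : ahull G r"
 shows "(%x. b * h x) : ahull G (cmod b * r)"
proof -
 obtain n :: nat and c a where h: "!!q. q < n ==> a q : atoms G" "(SUM q<n. cmod (c q)) <= r"
  "!!x. x : carrier G ==> h x = (SUM q<n. c q * a q x)" using assms(1) by (rule hullE) blast
 show ?thesis
 proof (rule hullI[of "{..<n}" a G "%q. b * c q"])
  show "(SUM q<n. cmod (b * c q)) <= cmod b * r"
  using h(2) by (simp add: norm_mult sum_distrib_left[symmetric] mult_left_mono)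
  show "b * h x = (SUM q<n. b * c q * a q x)" if "x : carrier G" for x
  unfolding h(3)[OF that] sum_distrib_left mult.assoc ..
 qed (use h(1) in auto)
qed

lemma atom_in_hull: "h : atoms G ==> h : ahull G 1" by (rule hullI[of "{0::nat}" "%_. h" G "%_. 1"]) auto

lemma zero_in_hull: "0 <= r ==> (%x. 0) : ahull G r" by (rule hullI[of "{}::nat set" "%_ _. 0" G "%_. 1"]) auto

lemma hull_sum:
 assumes "finite I" "!!i. i : I ==> h i : ahull G (r i)"
 shows "(%x. SUM i:I. h i x) : ahull G (SUM i:I. r i)"
 using assms
proof (induction I rule: finite_induct)
 case empty
 thus ?case using zero_in_hull[of 0 G] by simp
next
 case (insert i I)
 have "(%x. h i x + (SUM i:I. h i x)) : ahull G (r i + (SUM i:I. r i))" by (intro hull_add insert) (use insert in auto)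
 thus ?case using insert by simp
qed

text \<open>Products are coefficients of tensor products, indexed by \<open>a div e\<close> and \<open>a mod e\<close>.\<close>

lemma sum_lessThan_mult:
 "(SUM a<d * (e::nat). f a) = (SUM i<d. SUM j<e. (f (i * e + j) :: 'a::comm_monoid_add))"
proof -
 have "(SUM a<d * e. f a) = (SUM i<d. sum f {i * e..<i * e + e})" by (simp add: sum.nat_group)
 also have "... = (SUM i<d. SUM j<e. f (i * e + j))"
 proof (rule sum_eqI)
  fix i
  have "sum f {0 + i * e..<e + i * e} = (SUM j:{0..<e}. f (j + i * e))" by (rule sum.shift_bounds_nat_ivl)
  thus "sum f {i * e..<i * e + e} = (SUM j<e. f (i * e + j))" by (simp add: atLeast0LessThan add.commute)
 qed
 finally show ?thesis .
qed

lemma div_mod_index: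
 fixes j e :: nat
 assumes "j < e"
 shows "(i * e + j) div e = i" "(i * e + j) mod e = j"
 using assms by simp_all

lemma index_split:
 fixes a d e :: nat
 assumes "a < d * e"
 shows "a div e < d" "a mod e < e" "0 < e"
proof -
 show "0 < e" using assms by (cases e) auto
 thus "a mod e < e" by simp
 show "a div e < d" using assms by (simp add: less_mult_imp_div_less)
qed

definition ktensor :: "nat => (nat => nat => complex) => (nat => nat => complex) => nat => nat => complex" where
 "ktensor e A B = (%a b. A (a div e) (b div e) * B (a mod e) (b mod e))"

definition vtensor :: "nat => (nat => complex) => (nat => complex) => nat => complex" where
 "vtensor e u v = (%a. u (a div e) * v (a mod e))"

lemma mm_ktensor:
 assumes "a < d * e" "b < d * e"
 shows "mm (d * e) (ktensor e A B) (ktensor e A' B') a b = ktensor e (mm d A A') (mm e B B') a b"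
proof -
 have "mm (d * e) (ktensor e A B) (ktensor e A' B') a b =
  (SUM i<d. SUM j<e. (A (a div e) i * A' i (b div e)) * (B (a mod e) j * B' j (b mod e)))"
  unfolding mm_def sum_lessThan_mult ktensor_def by (intro sum.cong refl) (simp add: div_mod_index)
 also have "... = ktensor e (mm d A A') (mm e B B') a b"
  unfolding ktensor_def mm_def sum_product ..
 finally show ?thesis .
qed

lemma ip_vtensor: "ip (d * e) (vtensor e u v) (vtensor e u' v') = ip d u u' * ip e v v'"
proof -
 have "ip (d * e) (vtensor e u v) (vtensor e u' v') = (SUM i<d. SUM j<e. (u i * cnj (u' i)) * (v j * cnj (v' j)))"
  unfolding ip_def sum_lessThan_mult vtensor_def by (intro sum.cong refl) (simp add: div_mod_index)
 thus ?thesis unfolding ip_def sum_product .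
qed

lemma nrm_vtensor: "nrm (d * e) (vtensor e u v) = nrm d u * nrm e v"
proof -
 have "complex_of_real ((nrm (d * e) (vtensor e u v))^2) = of_real ((nrm d u * nrm e v)^2)"
  using ip_vtensor[of d e u v u v] by (simp add: ip_self power_mult_distrib)
 hence "(nrm (d * e) (vtensor e u v))^2 = (nrm d u * nrm e v)^2" by (simp only: of_real_eq_iff)
 thus ?thesis by (simp add: power2_eq_iff_nonneg)
qed

lemma mv_ktensor:
 assumes "a < d * e"
 shows "mv (d * e) (ktensor e A B) (vtensor e u v) a = vtensor e (mv d A u) (mv e B v) a"
proof -
 have "mv (d * e) (ktensor e A B) (vtensor e u v) a =
  (SUM i<d. SUM j<e. (A (a div e) i * u i) * (B (a mod e) j * v j))"
  unfolding mv_def sum_lessThan_mult ktensor_def vtensor_def by (intro sum.cong refl) (simp add: div_mod_index)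
 also have "... = vtensor e (mv d A u) (mv e B v) a"
  unfolding vtensor_def mv_def sum_product ..
 finally show ?thesis .
qed

lemma unirep_ktensor:
 assumes s: "unirep G d s" and t: "unirep G e t"
 shows "unirep G (d * e) (%x. ktensor e (s x) (t x))"
 unfolding unirep_def
proof (intro conjI ballI allI impI)
 fix a b assume ab: "a < d * e" "b < d * e"
 note [simp] = index_split[OF ab(1)] index_split[OF ab(2)]
 { fix x y assume "x : carrier G" "y : carrier G"
  thus "ktensor e (s (x \<otimes>\<^bsub>G\<^esub> y)) (t (x \<otimes>\<^bsub>G\<^esub> y)) a b = mm (d * e) (ktensor e (s x) (t x)) (ktensor e (s y) (t y)) a b"
  unfolding mm_ktensor[OF ab] by (simp add: ktensor_def unirepD(1)[OF s] unirepD(1)[OF t]) }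
 { fix x assume "x : carrier G"
  thus "ktensor e (s (inv\<^bsub>G\<^esub> x)) (t (inv\<^bsub>G\<^esub> x)) a b = cnj (ktensor e (s x) (t x) b a)"
  by (simp add: ktensor_def unirepD(2)[OF s] unirepD(2)[OF t]) }
 show "ktensor e (s \<one>\<^bsub>G\<^esub>) (t \<one>\<^bsub>G\<^esub>) a b = (if a = b then 1 else 0)"
 proof -
  have "a = b \<longleftrightarrow> a div e = b div e & a mod e = b mod e" by (metis div_mult_mod_eq)
  thus ?thesis by (simp add: ktensor_def unirepD(3)[OF s] unirepD(3)[OF t])
 qed
 show "cont_on G (%x. ktensor e (s x) (t x) a b)"
  unfolding ktensor_def by (intro cintros unirepD(4)[OF s] unirepD(4)[OF t]) simp_all
qed

lemma atom_mult:
 assumes "h : atoms G" "h' : atoms G"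
 shows "(%x. h x * h' x) : atoms G"
proof -
 obtain d s u v where 1: "unirep G d s" "nrm d u <= 1" "nrm d v <= 1" "!!x. x : carrier G ==> h x = coef d s u v x"
  by (rule atomsE[OF assms(1)]) blast
 obtain d' s' u' v' where 2: "unirep G d' s'" "nrm d' u' <= 1" "nrm d' v' <= 1" "!!x. x : carrier G ==> h' x = coef d' s' u' v' x"
  by (rule atomsE[OF assms(2)]) blast
 have n: "nrm (d * d') (vtensor d' u u') <= 1" "nrm (d * d') (vtensor d' v v') <= 1"
  unfolding nrm_vtensor using 1(2,3) 2(2,3) by (simp_all add: mult_le_one)
 have "h x * h' x = coef (d * d') (%x. ktensor d' (s x) (s' x)) (vtensor d' u u') (vtensor d' v v') x" if "x : carrier G" for x
 proof -
  have "coef (d * d') (%x. ktensor d' (s x) (s' x)) (vtensor d' u u') (vtensor d' v v') x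
  = ip (d * d') (vtensor d' (mv d (s x) u) (mv d' (s' x) u')) (vtensor d' v v')"
  unfolding coef_def by (rule ip_cong) (simp_all add: mv_ktensor)
  thus ?thesis unfolding 1(4)[OF that] 2(4)[OF that] ip_vtensor coef_def by simp
 qed
 thus ?thesis unfolding atoms_def mem_Collect_eq
  by (intro exI conjI ballI) (rule unirep_ktensor[OF 1(1) 2(1)], rule n(1), rule n(2), assumption)
qed

lemma hull_mult:
 assumes "h : ahull G r" "h' : ahull G r'"
 shows "(%x. h x * h' x) : ahull G (r * r')"
proof -
 obtain n :: nat and c a where h: "!!q. q < n ==> a q : atoms G" "(SUM q<n. cmod (c q)) <= r"
  "!!x. x : carrier G ==> h x = (SUM q<n. c q * a q x)" using assms(1) by (rule hullE) blast
 obtain n' :: nat and c' a' where h': "!!q. q < n' ==> a' q : atoms G" "(SUM q<n'. cmod (c' q)) <= r'"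
  "!!x. x : carrier G ==> h' x = (SUM q<n'. c' q * a' q x)" using assms(2) by (rule hullE) blast
 show ?thesis
 proof (rule hullI[of "{..<n} \<times> {..<n'}" "%(p, q). %x. a p x * a' q x" G "%(p, q). c p * c' q"])
  have "(SUM q:{..<n} \<times> {..<n'}. cmod (case q of (p, q) => c p * c' q)) = (SUM p<n. cmod (c p)) * (SUM q<n'. cmod (c' q))"
  by (simp add: sum_product sum.cartesian_product norm_mult split_beta)
  also have "... <= r * r'" using h(2) h'(2) hull_ge_0[OF assms(1)] by (intro mult_mono) (auto intro: sum_nonneg)
  finally show "(SUM q:{..<n} \<times> {..<n'}. cmod (case q of (p, q) => c p * c' q)) <= r * r'" .
  show "h x * h' x = (SUM q:{..<n} \<times> {..<n'}. (case q of (p, q) => c p * c' q) * (case q of (p, q) => %x. a p x * a' q x) x)"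
  if "x : carrier G" for x
  unfolding h(3)[OF that] h'(3)[OF that] sum_product sum.cartesian_product
  by (intro sum.cong refl) (simp add: split_beta mult_ac)
  show "(case q of (p, q) => %x. a p x * a' q x) : atoms G" if "q : {..<n} \<times> {..<n'}" for q
  using atom_mult[OF h(1) h'(1)] that by (simp add: split_beta mem_Times_iff)
 qed simp
qed

lemma one_in_atoms: "(%x. 1) : atoms G"
proof -
 have "unirep G 1 (%x i j. 1)" by (auto simp: unirep_def mm_def)
 moreover have "nrm 1 (%i. 1) = 1" by (simp add: nrm_def)
 moreover have "coef 1 (%x i j. 1) (%i. 1) (%i. 1) = (%x::'a. 1)" by (simp add: coef_expand[abs_def])
 ultimately show ?thesis using atomsI[of G 1 "%x i j. 1" "%i. 1" "%i. 1"] by simp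
qed

lemma ConvI: "(!!e. e > 0 ==> EX h:ahull G r. ALL x:carrier G. cmod (f x - h x) <= e) ==> f : Conv G r"
 unfolding Conv_def by simp

lemma ConvE:
 assumes "f : Conv G r" "e > 0"
 obtains h where "h : ahull G r" "!!x. x : carrier G ==> cmod (f x - h x) <= e"
 using assms unfolding Conv_def by auto

lemma hull_subset_Conv: "h : ahull G r ==> h : Conv G r" by (rule ConvI) (rule bexI[of _ h], auto)

lemma Conv_ge_0: "f : Conv G r ==> 0 <= r" by (rule ConvE[of f G r 1]) (use hull_ge_0 in auto)

lemma Conv_cong: "f : Conv G r ==> (!!x. x : carrier G ==> f' x = f x) ==> f' : Conv G r"
 unfolding Conv_def by simp

lemma Conv_bound:
 assumes "Group.group G" "f : Conv G r" "x : carrier G"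
 shows "cmod (f x) <= r"
proof (rule field_le_epsilon)
 fix e :: real assume "e > 0"
 obtain h where h: "h : ahull G r" "!!x. x : carrier G ==> cmod (f x - h x) <= e"
  using ConvE[OF assms(2) \<open>e > 0\<close>] by blast
 have "cmod (f x) <= cmod (h x) + cmod (f x - h x)" using norm_triangle_ineq[of "h x" "f x - h x"] by simp
 also have "... <= r + e" using h(2)[OF assms(3)] hull_bound[OF assms(1) h(1) assms(3)] by linarith
 finally show "cmod (f x) <= r + e" .
qed

lemma Conv_continuous:
 assumes "f : Conv G r"
 shows "cont_on G f"
proof -
 have "EX h:ahull G r. ALL x:carrier G. cmod (f x - h x) <= inverse (real (Suc n))" for n
  by (rule ConvE[OF assms, of "inverse (real (Suc n))"]) auto
 then obtain h where h: "!!n. h n : ahull G r" "!!n x. x : carrier G ==> cmod (f x - h n x) <= inverse (real (Suc n))"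
  by (metis (no_types, lifting))
 have "uniform_limit (carrier G) h f sequentially"
 proof (rule uniform_limitI)
  fix e :: real assume "e > 0"
  hence "\<forall>\<^sub>F n in sequentially. inverse (real (Suc n)) < e"
  using order_tendstoD(2)[OF LIMSEQ_inverse_real_of_nat] by blast
  thus "\<forall>\<^sub>F n in sequentially. ALL x:carrier G. dist (h n x) (f x) < e"
  proof eventually_elim
  case (elim n)
  show ?case
  proof
  fix x assume "x : carrier G"
  hence "cmod (f x - h n x) < e" using h(2)[of x n] elim by linarith
  thus "dist (h n x) (f x) < e" by (simp add: dist_norm norm_minus_commute)
  qed
  qed
 qed
 thus ?thesis by (rule uniform_limit_theorem[rotated]) (auto intro: hull_continuous h(1) always_eventually)
qed

lemma Conv_add:
 assumes "f : Conv G r" "f' : Conv G r'"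
 shows "(%x. f x + f' x) : Conv G (r + r')"
proof (rule ConvI)
 fix e :: real assume "e > 0"
 hence e: "e / 2 > 0" by simp
 obtain h where h: "h : ahull G r" "!!x. x : carrier G ==> cmod (f x - h x) <= e / 2"
  using ConvE[OF assms(1) e] by blast
 obtain h' where h': "h' : ahull G r'" "!!x. x : carrier G ==> cmod (f' x - h' x) <= e / 2"
  using ConvE[OF assms(2) e] by blast
 have "cmod (f x + f' x - (h x + h' x)) <= e" if "x : carrier G" for x
  using norm_diff_triangle_ineq[of "f x" "f' x" "h x" "h' x"] h(2)[OF that] h'(2)[OF that] by simp
 thus "EX h:ahull G (r + r'). ALL x:carrier G. cmod (f x + f' x - h x) <= e"
  by (intro bexI[OF _ hull_add[OF h(1) h'(1)]]) blast
qed

lemma Conv_scale: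
 assumes "f : Conv G r"
 shows "(%x. b * f x) : Conv G (cmod b * r)"
proof (rule ConvI)
 fix e :: real assume "e > 0"
 hence e: "e / (cmod b + 1) > 0" by (simp add: add_nonneg_pos)
 obtain h where h: "h : ahull G r" "!!x. x : carrier G ==> cmod (f x - h x) <= e / (cmod b + 1)"
  using ConvE[OF assms(1) e] by blast
 have "cmod (b * f x - b * h x) <= e" if "x : carrier G" for x
 proof -
  have "cmod (b * f x - b * h x) = cmod b * cmod (f x - h x)" by (simp add: right_diff_distrib[symmetric] norm_mult)
  also have "... <= (cmod b + 1) * (e / (cmod b + 1))" using h(2)[OF that] by (intro mult_mono) auto
  also have "... = e" using norm_ge_zero[of b] by (simp add: add_nonneg_eq_0_iff)
  finally show ?thesis .
 qed
 thus "EX h:ahull G (cmod b * r). ALL x:carrier G. cmod (b * f x - h x) <= e" by (intro bexI[OF _ hull_scale[OF h(1)]]) blast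
qed

lemma Conv_uniform_closed:
 assumes "!!e. e > 0 ==> EX g:Conv G r. ALL x:carrier G. cmod (f x - g x) <= e"
 shows "f : Conv G r"
proof (rule ConvI)
 fix e :: real assume "e > 0"
 hence e: "e / 2 > 0" by simp
 obtain g where g: "g : Conv G r" "ALL x:carrier G. cmod (f x - g x) <= e / 2" using assms[OF e] by blast
 obtain h where h: "h : ahull G r" "!!x. x : carrier G ==> cmod (g x - h x) <= e / 2"
  using ConvE[OF g(1) e] by blast
 have "cmod (f x - h x) <= e" if "x : carrier G" for x
 proof -
  have "cmod (f x - h x) <= cmod (f x - g x) + cmod (g x - h x)"
  using norm_triangle_ineq[of "f x - g x" "g x - h x"] by simp
  moreover have "cmod (f x - g x) <= e / 2" using g(2) that by (rule bspec)
  ultimately show ?thesis using h(2)[OF that] by linarith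
 qed
 thus "EX h:ahull G r. ALL x:carrier G. cmod (f x - h x) <= e" using h(1) by blast
qed

lemma Conv_mult:
 assumes G: "Group.group G" and f: "f : Conv G r" "f' : Conv G r'"
 shows "(%x. f x * f' x) : Conv G (r * r')"
proof (rule ConvI)
 fix e :: real assume "e > 0"
 have r: "0 <= r" "0 <= r'" using f by (auto dest: Conv_ge_0)
 define K where "K = r + r' + 1"
 have K: "K > 0" using r by (simp add: K_def)
 hence e: "e / K > 0" using \<open>e > 0\<close> by simp
 obtain h where h: "h : ahull G r" "!!x. x : carrier G ==> cmod (f x - h x) <= e / K"
  using ConvE[OF f(1) e] by blast
 obtain h' where h': "h' : ahull G r'" "!!x. x : carrier G ==> cmod (f' x - h' x) <= e / K"
  using ConvE[OF f(2) e] by blast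
 have "cmod (f x * f' x - h x * h' x) <= e" if x: "x : carrier G" for x
 proof -
  have "f x * f' x - h x * h' x = (f x - h x) * f' x + h x * (f' x - h' x)" by (simp add: algebra_simps)
  hence "cmod (f x * f' x - h x * h' x) <= cmod (f x - h x) * cmod (f' x) + cmod (h x) * cmod (f' x - h' x)"
  using norm_triangle_ineq[of "(f x - h x) * f' x" "h x * (f' x - h' x)"] by (simp add: norm_mult)
  also have "... <= e / K * r' + r * (e / K)"
  using h(2)[OF x] h'(2)[OF x] Conv_bound[OF G f(2) x] hull_bound[OF G h(1) x] r e by (intro add_mono mult_mono) auto
  also have "... = e / K * (r + r')" by (simp only: distrib_left mult.commute[of r] add.commute)
  also have "... <= e / K * K" using e by (intro mult_left_mono) (auto simp: K_def)
  also have "... = e" using K by simp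
  finally show ?thesis .
 qed
 thus "EX h:ahull G (r * r'). ALL x:carrier G. cmod (f x * f' x - h x) <= e"
  by (intro bexI[OF _ hull_mult[OF h(1) h'(1)]]) blast
qed

lemma Conv_right_continuous:
 assumes G: "Group.group G" and f: "!!e. e > 0 ==> f : Conv G (r + e)" and r: "0 <= r"
 shows "f : Conv G r"
proof (rule Conv_uniform_closed)
 fix e :: real assume e: "e > 0"
 have fe: "f : Conv G (r + e)" by (rule f[OF e])
 define t where "t = r / (r + e)"
 have t: "0 <= t" "t <= 1" "t * (r + e) = r" "(1 - t) * (r + e) = e"
  using r e by (auto simp: t_def field_simps)
 have 1: "(%x. of_real t * f x) : Conv G r" using Conv_scale[OF fe, of "of_real t"] t by simp
 have "cmod (f x - of_real t * f x) <= e" if "x : carrier G" for x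
 proof -
  have "f x - of_real t * f x = of_real (1 - t) * f x" by (simp add: algebra_simps)
  hence "cmod (f x - of_real t * f x) = (1 - t) * cmod (f x)" using t by (simp only: norm_mult norm_of_real abs_of_nonneg diff_ge_0_iff_ge)
  also have "... <= (1 - t) * (r + e)" using Conv_bound[OF G fe that] t by (intro mult_left_mono) auto
  finally show ?thesis using t by simp
 qed
 thus "EX g:Conv G r. ALL x:carrier G. cmod (f x - g x) <= e" by (intro bexI[OF _ 1]) simp
qed

text \<open>A singular value decomposition of \<open>C\<close> writes the function as a combination of atoms whose
 coefficients are the singular values.\<close>
lemma matrix_coefficients_in_hull:
 assumes rep: "unirep G d s"
 shows "(%x. SUM i<d. SUM j<d. C i j * s x i j) : ahull G (tnorm d C)"
proof -
 obtain sg u v where s: "ALL a<d. 0 <= sg a" and u: "ALL a<d. nrm d (u a) <= 1" and v: "ALL a<d. nrm d (v a) <= 1"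
  and C: "ALL i<d. ALL j<d. C i j = (SUM a<d. of_real (sg a) * u a i * cnj (v a j))"
  and t: "tnorm d C = (SUM a<d. sg a)"
  using tnorm_decomposition[of d C] by (elim exE conjE)
 have nc: "nrm d (%i. cnj (w i)) = nrm d w" for w by (simp add: nrm_def)
 show ?thesis
 proof (rule hullI[of "{..<d}" "%a. coef d s (%i. cnj (v a i)) (%i. cnj (u a i))" G "%a. of_real (sg a)"])
  show "coef d s (%i. cnj (v a i)) (%i. cnj (u a i)) : atoms G" if "a : {..<d}" for a
  using that u v by (intro atomsI rep) (simp_all add: nc)
  show "(SUM a<d. cmod (of_real (sg a))) <= tnorm d C"
  using s unfolding t by (intro sum_mono) simp
  fix x
  have "(SUM i<d. SUM j<d. C i j * s x i j) = (SUM i<d. SUM j<d. SUM a<d. of_real (sg a) * (s x i j * cnj (v a j) * u a i))"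
  using C by (intro sum.cong refl) (simp add: sum_distrib_right sum_distrib_left mult_ac)
  also have "... = (SUM i<d. SUM a<d. SUM j<d. of_real (sg a) * (s x i j * cnj (v a j) * u a i))"
  by (rule sum_eqI, rule sum.swap)
  also have "... = (SUM a<d. SUM i<d. SUM j<d. of_real (sg a) * (s x i j * cnj (v a j) * u a i))" by (rule sum.swap)
  also have "... = (SUM a<d. of_real (sg a) * coef d s (%i. cnj (v a i)) (%i. cnj (u a i)) x)"
  unfolding coef_expand sum_distrib_left complex_cnj_cnj ..
  finally show "(SUM i<d. SUM j<d. C i j * s x i j) = (SUM a<d. of_real (sg a) * coef d s (%i. cnj (v a i)) (%i. cnj (u a i)) x)" .
 qed simp
qed

section \<open>Schur orthogonality and the dual of the Fourier algebra\<close>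

definition tpoly :: "'k set => ('k => nat) => ('k => 'g => nat => nat => complex) => ('k => nat => nat => complex) => 'g => complex" where
 "tpoly F D s X x = (SUM k:F. of_nat (D k) * (SUM i<D k. SUM j<D k. X k i j * s k x i j))"

context haar_group
begin

definition schur :: "'k set => ('k => nat) => ('k => 'g => nat => nat => complex) => bool" where
 "schur F D s \<longleftrightarrow> (ALL k:F. 0 < D k & unirep G (D k) (s k)) &
  (ALL k:F. ALL l:F. ALL i<D k. ALL j<D k. ALL m<D l. ALL n<D l.
  (LINT x|M. s k x i j * cnj (s l x m n)) = (if k = l & i = m & j = n then 1 / of_nat (D k) else 0))"

lemma schurD:
 assumes "schur F D s"
 shows "!!k. k : F ==> 0 < D k" "!!k. k : F ==> unirep G (D k) (s k)"
  and "!!k l i j m n. k : F ==> l : F ==> i < D k ==> j < D k ==> m < D l ==> n < D l ==>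
  (LINT x|M. s k x i j * cnj (s l x m n)) = (if k = l & i = m & j = n then 1 / of_nat (D k) else 0)"
 using assms unfolding schur_def by simp_all

lemma schur_subset: "schur F D s ==> F' \<subseteq> F ==> schur F' D s"
 unfolding schur_def by (simp add: subset_iff)

lemma integral_sum_cont:
 fixes f :: "'i => 'g => complex"
 assumes "!!i. i : I ==> cont_on G (f i)"
 shows "(LINT x|M. (SUM i:I. f i x)) = (SUM i:I. LINT x|M. f i x)"
 by (rule Bochner_Integration.integral_sum) (rule integrable_cont[OF assms])

text \<open>The average of \<open>s x E (t x)\<^sup>*\<close> over \<open>x\<close>, for a matrix unit \<open>E\<close>, intertwines \<open>t\<close> and \<open>s\<close>.\<close>
lemma integral_intertwines:
 assumes s: "unirep G n s" and t: "unirep G e t" and y: "y : carrier G"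
  and ab: "a < n" "b < n" and ij: "i < e" "j < e"
 shows "(SUM c<n. s y a c * (LINT x|M. s x c b * cnj (t x i j))) = (SUM m<e. (LINT x|M. s x a b * cnj (t x m j)) * t y m i)"
proof -
 note cst = unirepD(4)[OF s] unirepD(4)[OF t]
 have iy: "inv y : carrier G" using y by simp
 have "(LINT x|M. (SUM c<n. s y a c * (s x c b * cnj (t x i j)))) = (SUM c<n. LINT x|M. s y a c * (s x c b * cnj (t x i j)))"
  by (rule integral_sum_cont) (intro cintros cst ab ij; simp)
 hence "(SUM c<n. s y a c * (LINT x|M. s x c b * cnj (t x i j))) = (LINT x|M. (SUM c<n. s y a c * (s x c b * cnj (t x i j))))" by simp
 also have "... = (LINT x|M. s (y \<otimes> x) a b * cnj (t (inv y \<otimes> (y \<otimes> x)) i j))"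
  by (rule Bochner_Integration.integral_cong)
  (simp_all only: space_M unirepD(1)[OF s y _ ab] mm_def sum_distrib_right mult.assoc[symmetric] m_assoc[symmetric] iy y l_inv l_one)
 also have "... = (LINT x|M. s x a b * cnj (t (inv y \<otimes> x) i j))" by (rule integral_left[OF _ y])
  (intro cintros cst ab continuous_on_compose2[OF unirepD(4)[OF t ij] continuous_on_translate(1)[OF iy iy]], use iy in auto)
 also have "... = (LINT x|M. (SUM m<e. (s x a b * cnj (t x m j)) * t y m i))"
 proof (rule integral_eqI)
  fix x assume "x : space M"
  hence x: "x : carrier G" by (simp add: space_M)
  have "cnj (t (inv y \<otimes> x) i j) = (SUM m<e. t y m i * cnj (t x m j))"
  unfolding unirepD(1)[OF t iy x ij] mm_def cnj_sum complex_cnj_mult by (rule sum_eqI) (use unirepD(2)[OF t y ij(1)] in simp)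
  thus "s x a b * cnj (t (inv y \<otimes> x) i j) = (SUM m<e. (s x a b * cnj (t x m j)) * t y m i)"
  by (simp only: sum_distrib_left mult_ac)
 qed
 also have "... = (SUM m<e. LINT x|M. (s x a b * cnj (t x m j)) * t y m i)"
  by (rule integral_sum_cont) (intro cintros cst ab ij; simp)
 finally show ?thesis by simp
qed

lemma continuous_on_tpoly:
 assumes "finite F" "!!k. k : F ==> unirep G (D k) (s k)"
 shows "cont_on G (tpoly F D s X)"
 unfolding tpoly_def[abs_def] by (intro cintros unirepD(4)[OF assms(2)]) auto

lemma integral_tpoly:
 assumes F: "finite F" "!!k. k : F ==> unirep G (D k) (s k)" and f: "cont_on G f"
 shows "(LINT x|M. f x * cnj (tpoly F D s X x)) =
  (SUM k:F. of_nat (D k) * (SUM i<D k. SUM j<D k. cnj (X k i j) * (LINT x|M. f x * cnj (s k x i j))))"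
proof -
 have c: "cont_on G (%x. b * (f x * cnj (s k x i j)))" if "k : F" "i < D k" "j < D k" for k i j b
  by (intro cintros f unirepD(4)[OF F(2)] that)
 have "(LINT x|M. f x * cnj (tpoly F D s X x)) = (LINT x|M. (SUM k:F. SUM i<D k. SUM j<D k. (of_nat (D k) * cnj (X k i j)) * (f x * cnj (s k x i j))))"
  unfolding tpoly_def cnj_sum complex_cnj_mult sum_distrib_left complex_cnj_of_nat
  by (intro Bochner_Integration.integral_cong refl sum.cong) (simp only: mult_ac)
 also have "... = (SUM k:F. LINT x|M. (SUM i<D k. SUM j<D k. (of_nat (D k) * cnj (X k i j)) * (f x * cnj (s k x i j))))"
  by (intro integral_sum_cont cintros c) auto
 also have "... = (SUM k:F. SUM i<D k. LINT x|M. (SUM j<D k. (of_nat (D k) * cnj (X k i j)) * (f x * cnj (s k x i j))))"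
  by (rule sum_eqI, intro integral_sum_cont cintros c) auto
 also have "... = (SUM k:F. SUM i<D k. SUM j<D k. LINT x|M. (of_nat (D k) * cnj (X k i j)) * (f x * cnj (s k x i j)))"
  by (rule sum_eqI, rule sum_eqI, intro integral_sum_cont c) auto
 finally show ?thesis unfolding sum_distrib_left integral_mult_right_zero mult.assoc .
qed

lemma schur_coefficient:
 assumes F: "finite F" and s: "schur F D s" and k: "k : F" "i < D k" "j < D k"
 shows "(LINT x|M. s k x i j * cnj (tpoly F D s X x)) = cnj (X k i j)"
proof -
 have "(LINT x|M. s k x i j * cnj (tpoly F D s X x)) =
  (SUM l:F. of_nat (D l) * (SUM m<D l. SUM n<D l. cnj (X l m n) * (LINT x|M. s k x i j * cnj (s l x m n))))"
  by (rule integral_tpoly[OF F schurD(2)[OF s] unirepD(4)[OF schurD(2)[OF s k(1)] k(2,3)]])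
 also have "... = (SUM l:F. if k = l then cnj (X k i j) else 0)"
 proof (rule sum_eqI)
  fix l assume l: "l : F"
  have "(SUM m<D l. SUM n<D l. cnj (X l m n) * (LINT x|M. s k x i j * cnj (s l x m n)))
  = (SUM m<D l. SUM n<D l. if m = i then (if n = j then (if k = l then cnj (X l i j) / of_nat (D k) else 0) else 0) else 0)"
  by (intro sum.cong refl) (simp add: schurD(3)[OF s k(1) l k(2,3)])
  also have "... = (SUM m<D l. if m = i then (SUM n<D l. if n = j then (if k = l then cnj (X l i j) / of_nat (D k) else 0) else 0) else 0)"
  by (intro sum.cong refl) simp
  also have "... = (if k = l then cnj (X k i j) / of_nat (D k) else 0)"
  using k by (cases "k = l") (simp_all add: sum.delta)
  finally show "of_nat (D l) * (SUM m<D l. SUM n<D l. cnj (X l m n) * (LINT x|M. s k x i j * cnj (s l x m n))) = (if k = l then cnj (X k i j) else 0)"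
  using schurD(1)[OF s k(1)] by (cases "k = l") simp_all
 qed
 finally show ?thesis using F k by simp
qed

text \<open>For a representation \<open>t\<close>, the operators \<open>E k i j = D k * \<integral> t x * cnj (s k x i j)\<close> form a system of
 matrix units, so \<open>X \<mapsto> \<integral> t x * cnj (tpoly F D s X x)\<close> is multiplicative and preserves adjoints.  It
 therefore sends partial isometries to partial isometries, which are contractions.\<close>
lemma schur_partial_isometry_bound:
 assumes F: "finite F" and s: "schur F D s" and t: "unirep G d t"
  and X: "!!k. k : F ==> partial_isometry (D k) (X k)"
 shows "cmod (LINT x|M. coef d t u v x * cnj (tpoly F D s X x)) <= nrm d u * nrm d v"
proof -
 note ct = unirepD(4)[OF t]
 note us = schurD(2)[OF s]
 note cs = unirepD(4)[OF us]
 define E where "E = (%k i j a b. of_nat (D k) * (LINT x|M. t x a b * cnj (s k x i j)))"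
 define T where "T = (%X a b. LINT x|M. t x a b * cnj (tpoly F D s X x))"
 have TE: "T X a b = (SUM k:F. SUM i<D k. SUM j<D k. cnj (X k i j) * E k i j a b)" if ab: "a < d" "b < d" for X a b
 proof -
  have "T X a b = (SUM k:F. of_nat (D k) * (SUM i<D k. SUM j<D k. cnj (X k i j) * (LINT x|M. t x a b * cnj (s k x i j))))"
  unfolding T_def by (rule integral_tpoly[OF F us ct[OF ab]])
  thus ?thesis unfolding E_def sum_distrib_left by (simp only: mult_ac)
 qed
 have Et: "mm d (E k i j) (t y) a b = (SUM m<D k. s k y j m * E k i m a b)"
  if k: "k : F" "i < D k" "j < D k" and ab: "a < d" "b < d" and y: "y : carrier G" for k i j a b y
 proof -
  have cf: "cont_on G (%x. SUM c<d. t x a c * t y c b * cnj (s k x i j))" by (intro cintros ct cs k ab) auto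
  have "mm d (E k i j) (t y) a b = of_nat (D k) * (SUM c<d. LINT x|M. t x a c * t y c b * cnj (s k x i j))"
  unfolding mm_def E_def sum_distrib_left by (rule sum_eqI, subst mult.assoc, subst integral_mult_left_zero[symmetric])
  (simp only: mult_ac)
  also have "(SUM c<d. LINT x|M. t x a c * t y c b * cnj (s k x i j)) = (LINT x|M. (SUM c<d. t x a c * t y c b * cnj (s k x i j)))"
  by (rule integral_sum_cont[symmetric]) (intro cintros ct cs k ab, simp)
  also have "... = (LINT x|M. t (x \<otimes> y) a b * cnj (s k ((x \<otimes> y) \<otimes> inv y) i j))"
  proof (rule integral_eqI)
  fix x assume "x : space M"
  hence x: "x : carrier G" by (simp add: space_M)
  hence "(x \<otimes> y) \<otimes> inv y = x" using y by (simp add: m_assoc)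
  thus "(SUM c<d. t x a c * t y c b * cnj (s k x i j)) = t (x \<otimes> y) a b * cnj (s k ((x \<otimes> y) \<otimes> inv y) i j)"
  using unirepD(1)[OF t x y ab] by (simp add: mm_def sum_distrib_right)
  qed
  also have "... = (LINT x|M. t x a b * cnj (s k (x \<otimes> inv y) i j))"
  using y by (intro integral_right[of "%x. t x a b * cnj (s k (x \<otimes> inv y) i j)"] cintros ct ab
  continuous_on_compose2[OF cs[OF k] continuous_on_translate(2)[of "inv y" "inv y"]]) auto
  also have "... = (LINT x|M. (SUM m<D k. s k y j m * (t x a b * cnj (s k x i m))))"
  proof (rule integral_eqI)
  fix x assume "x : space M"
  hence x: "x : carrier G" by (simp add: space_M)
  have "s k (x \<otimes> inv y) i j = (SUM m<D k. s k x i m * cnj (s k y j m))"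
  using unirepD(1)[OF us[OF k(1)] x inv_closed[OF y] k(2,3)] unirepD(2)[OF us[OF k(1)] y _ k(3)] by (simp add: mm_def)
  thus "t x a b * cnj (s k (x \<otimes> inv y) i j) = (SUM m<D k. s k y j m * (t x a b * cnj (s k x i m)))"
  by (simp add: sum_distrib_left mult_ac)
  qed
  also have "... = (SUM m<D k. s k y j m * (LINT x|M. t x a b * cnj (s k x i m)))"
  by (subst integral_sum_cont) (intro cintros ct cs k ab, simp, simp)
  finally show ?thesis unfolding E_def sum_distrib_left by (simp add: mult_ac)
 qed
 have ET: "mm d (E k i j) (T Z) a b = (SUM n<D k. cnj (Z k j n) * E k i n a b)"
  if k: "k : F" "i < D k" "j < D k" and ab: "a < d" "b < d" for k i j Z a b
 proof -
  have ctp: "cont_on G (%y. cnj (tpoly F D s Z y))" by (intro cintros continuous_on_tpoly F us)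
  have "mm d (E k i j) (T Z) a b = (SUM c<d. LINT y|M. E k i j a c * (t y c b * cnj (tpoly F D s Z y)))"
  unfolding mm_def T_def by simp
  also have "... = (LINT y|M. (SUM c<d. E k i j a c * (t y c b * cnj (tpoly F D s Z y))))"
  by (rule integral_sum_cont[symmetric]) (intro cintros ct ctp ab, simp)
  also have "... = (LINT y|M. (SUM m<D k. E k i m a b * (s k y j m * cnj (tpoly F D s Z y))))"
  proof (rule integral_eqI)
  fix y assume "y : space M"
  hence y: "y : carrier G" by (simp add: space_M)
  have "(SUM c<d. E k i j a c * (t y c b * cnj (tpoly F D s Z y))) = mm d (E k i j) (t y) a b * cnj (tpoly F D s Z y)"
  unfolding mm_def sum_distrib_right mult.assoc ..
  also have "... = (SUM m<D k. E k i m a b * (s k y j m * cnj (tpoly F D s Z y)))"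
  unfolding Et[OF k ab y] sum_distrib_right by (intro sum.cong refl) (simp only: mult_ac)
  finally show "(SUM c<d. E k i j a c * (t y c b * cnj (tpoly F D s Z y))) = (SUM m<D k. E k i m a b * (s k y j m * cnj (tpoly F D s Z y)))" .
  qed
  also have "... = (SUM m<D k. LINT y|M. E k i m a b * (s k y j m * cnj (tpoly F D s Z y)))"
  by (rule integral_sum_cont) (intro cintros cs ctp k, simp)
  also have "... = (SUM m<D k. E k i m a b * cnj (Z k j m))"
  by (intro sum.cong refl) (simp add: schur_coefficient[OF F s k(1,3)])
  finally show ?thesis by (simp add: mult.commute)
 qed
 have TT: "mm d (T Y) (T Z) a b = T (%k. mm (D k) (Y k) (Z k)) a b" if ab: "a < d" "b < d" for Y Z a b
 proof -
  have "mm d (T Y) (T Z) a b = (SUM c<d. (SUM k:F. SUM i<D k. SUM j<D k. cnj (Y k i j) * E k i j a c) * T Z c b)"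
  unfolding mm_def by (intro sum.cong refl) (simp add: TE ab)
  also have "... = (SUM c<d. SUM k:F. SUM i<D k. SUM j<D k. cnj (Y k i j) * (E k i j a c * T Z c b))"
  unfolding sum_distrib_right mult.assoc ..
  also have "... = (SUM k:F. SUM i<D k. SUM j<D k. SUM c<d. cnj (Y k i j) * (E k i j a c * T Z c b))"
  apply (rule trans[OF sum.swap], rule sum_eqI)
  apply (rule trans[OF sum.swap], rule sum_eqI) by (rule sum.swap)
  also have "... = (SUM k:F. SUM i<D k. SUM j<D k. cnj (Y k i j) * mm d (E k i j) (T Z) a b)"
  unfolding mm_def sum_distrib_left ..
  also have "... = (SUM k:F. SUM i<D k. SUM j<D k. SUM n<D k. cnj (Y k i j) * (cnj (Z k j n) * E k i n a b))"
  by (intro sum.cong refl) (simp add: ET ab sum_distrib_left)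
  also have "... = (SUM k:F. SUM i<D k. SUM n<D k. SUM j<D k. cnj (Y k i j) * (cnj (Z k j n) * E k i n a b))"
  by (rule sum_eqI, rule sum_eqI, rule sum.swap)
  also have "... = (SUM k:F. SUM i<D k. SUM n<D k. cnj (mm (D k) (Y k) (Z k) i n) * E k i n a b)"
  unfolding mm_def cnj_sum complex_cnj_mult sum_distrib_right mult.assoc ..
  also have "... = T (%k. mm (D k) (Y k) (Z k)) a b" unfolding TE[OF ab] ..
  finally show ?thesis .
 qed
 have Ea: "cnj (E k i j b a) = E k j i a b" if k: "k : F" "i < D k" "j < D k" and ab: "a < d" "b < d" for k i j a b
 proof -
  have "cnj (E k i j b a) = of_nat (D k) * (LINT x|M. cnj (t x b a) * s k x i j)"
  unfolding E_def by (simp flip: Bochner_Integration.integral_cnj)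
  also have "(LINT x|M. cnj (t x b a) * s k x i j) = (LINT x|M. t (inv x) a b * cnj (s k (inv x) j i))" by (rule integral_eqI)
  (simp add: space_M unirepD(2)[OF t _ ab] unirepD(2)[OF us[OF k(1)] _ k(3,2)])
  also have "... = (LINT x|M. t x a b * cnj (s k x j i))" by (rule integral_inv) (intro cintros ct cs k ab)
  finally show ?thesis unfolding E_def .
 qed
 have Ta: "adj (T Y) a b = T (%k. adj (Y k)) a b" if ab: "a < d" "b < d" for Y a b
 proof -
  have "adj (T Y) a b = (SUM k:F. SUM i<D k. SUM j<D k. Y k i j * E k j i a b)"
  unfolding adj_def TE[OF ab(2,1)] cnj_sum complex_cnj_mult complex_cnj_cnj by (intro sum.cong refl) (simp add: Ea ab)
  also have "... = (SUM k:F. SUM j<D k. SUM i<D k. Y k i j * E k j i a b)" by (rule sum_eqI, rule sum.swap)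
  finally show ?thesis unfolding TE[OF ab] adj_def by simp
 qed
 have Tc: "T Y a b = T Y' a b" if "!!k i j. k : F ==> i < D k ==> j < D k ==> Y k i j = Y' k i j" "a < d" "b < d" for Y Y' a b
  unfolding TE[OF that(2,3)] by (intro sum.cong refl) (simp add: that(1))
 have "partial_isometry d (T X)"
  unfolding partial_isometry_def
 proof (intro allI impI)
  fix a b assume ab: "a < d" "b < d"
  have "mm d (mm d (T X) (adj (T X))) (T X) a b = mm d (T (%k. mm (D k) (X k) (adj (X k)))) (T X) a b"
  proof (rule mm_cong[OF _ refl])
  fix c assume c: "c < d"
  have "mm d (T X) (adj (T X)) a c = mm d (T X) (T (%k. adj (X k))) a c" by (rule mm_cong[OF refl]) (simp add: Ta c)
  thus "mm d (T X) (adj (T X)) a c = T (%k. mm (D k) (X k) (adj (X k))) a c" by (simp add: TT ab c)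
  qed
  also have "... = T (%k. mm (D k) (mm (D k) (X k) (adj (X k))) (X k)) a b" by (rule TT[OF ab])
  also have "... = T X a b" by (rule Tc) (use X ab in \<open>simp_all add: partial_isometry_def\<close>)
  finally show "mm d (mm d (T X) (adj (T X))) (T X) a b = T X a b" .
 qed
 hence c: "nrm d (mv d (T X) u) <= nrm d u" by (rule partial_isometry_contraction)
 have ctp: "cont_on G (%y. cnj (tpoly F D s X y))" by (intro cintros continuous_on_tpoly F us)
 have "(LINT x|M. coef d t u v x * cnj (tpoly F D s X x)) = (LINT x|M. (SUM i<d. SUM j<d. (u j * cnj (v i)) * (t x i j * cnj (tpoly F D s X x))))"
  unfolding coef_expand sum_distrib_right by (intro Bochner_Integration.integral_cong refl sum.cong) (simp only: mult_ac)
 also have "... = (SUM i<d. LINT x|M. (SUM j<d. (u j * cnj (v i)) * (t x i j * cnj (tpoly F D s X x))))"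
  by (rule integral_sum_cont) (intro cintros ct ctp, auto)
 also have "... = (SUM i<d. SUM j<d. LINT x|M. (u j * cnj (v i)) * (t x i j * cnj (tpoly F D s X x)))"
  by (rule sum_eqI, rule integral_sum_cont) (intro cintros ct ctp, auto)
 also have "... = (SUM i<d. SUM j<d. T X i j * u j * cnj (v i))"
  unfolding T_def integral_mult_right_zero by (intro sum.cong refl) (simp only: mult_ac)
 also have "... = ip d (mv d (T X) u) v" unfolding ip_def mv_def sum_distrib_right ..
 finally have "cmod (LINT x|M. coef d t u v x * cnj (tpoly F D s X x)) = cmod (ip d (mv d (T X) u) v)" by simp
 also have "... <= nrm d (mv d (T X) u) * nrm d v" by (rule ip_cauchy_schwarz)
 also have "... <= nrm d u * nrm d v" by (intro mult_right_mono c) simp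
 finally show ?thesis .
qed

text \<open>The densities of the functionals of norm at most \<open>1\<close> on \<open>A(G)\<close>.\<close>
definition dual_ball :: "('g => complex) set" where
 "dual_ball = {p. cont_on G p & (ALL h:atoms G. cmod (LINT x|M. h x * cnj (p x)) <= 1)}"

lemma tpoly_in_dual_ball:
 assumes F: "finite F" and s: "schur F D s" and X: "!!k. k : F ==> partial_isometry (D k) (X k)"
 shows "tpoly F D s X : dual_ball"
 unfolding dual_ball_def
proof (intro CollectI conjI ballI)
 show "cont_on G (tpoly F D s X)" by (rule continuous_on_tpoly[OF F schurD(2)[OF s]])
 fix h assume "h : atoms G"
 then obtain d t u v where h: "unirep G d t" "nrm d u <= 1" "nrm d v <= 1" "!!x. x : carrier G ==> h x = coef d t u v x"
  by (rule atomsE) blast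
 have "(LINT x|M. h x * cnj (tpoly F D s X x)) = (LINT x|M. coef d t u v x * cnj (tpoly F D s X x))"
  by (rule Bochner_Integration.integral_cong) (simp_all add: h space_M)
 hence "cmod (LINT x|M. h x * cnj (tpoly F D s X x)) <= nrm d u * nrm d v"
  using schur_partial_isometry_bound[of F D s d t X u v, OF F s h(1) X] by simp
 also have "... <= 1" using h(2,3) by (simp add: mult_le_one)
 finally show "cmod (LINT x|M. h x * cnj (tpoly F D s X x)) <= 1" .
qed

lemma dual_ball_hull:
 assumes p: "p : dual_ball" and h: "h : ahull G r"
 shows "cmod (LINT x|M. h x * cnj (p x)) <= r"
proof -
 obtain n :: nat and c a where h: "!!q. q < n ==> a q : atoms G" "(SUM q<n. cmod (c q)) <= r"
  "!!x. x : carrier G ==> h x = (SUM q<n. c q * a q x)" using h by (rule hullE) blast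
 have cp: "cont_on G (%x. cnj (p x))" using p by (auto simp: dual_ball_def intro: cintros)
 have "(LINT x|M. h x * cnj (p x)) = (LINT x|M. (SUM q<n. c q * (a q x * cnj (p x))))"
  by (rule Bochner_Integration.integral_cong) (simp_all add: space_M h(3) sum_distrib_right mult.assoc)
 also have "... = (SUM q<n. LINT x|M. c q * (a q x * cnj (p x)))"
  by (rule integral_sum_cont) (intro cintros cp atom_continuous h(1), simp)
 finally have "cmod (LINT x|M. h x * cnj (p x)) <= (SUM q<n. cmod (c q * (LINT x|M. a q x * cnj (p x))))"
  by (simp add: norm_sum)
 also have "... <= (SUM q<n. cmod (c q))"
  using h(1) p by (intro sum_mono) (simp add: norm_mult mult_left_le dual_ball_def)
 finally show ?thesis using h(2) by linarith
qed

lemma dual_ball_Conv: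
 assumes p: "p : dual_ball" and f: "f : Conv G r"
 shows "cmod (LINT x|M. f x * cnj (p x)) <= r"
proof (rule field_le_epsilon)
 fix e :: real assume "e > 0"
 have cp: "cont_on G p" using p by (simp add: dual_ball_def)
 obtain B where B: "!!x. x : carrier G ==> cmod (p x) <= B" "B > 0"
  using compact_imp_bounded[OF compact_continuous_image[OF cp compact_carrier]] by (auto simp: bounded_pos)
 hence e: "e / B > 0" using \<open>e > 0\<close> by simp
 obtain h where h: "h : ahull G r" "!!x. x : carrier G ==> cmod (f x - h x) <= e / B"
  using ConvE[OF f e] by blast
 note cont = Conv_continuous[OF f] hull_continuous[OF h(1)] cp
 have "(LINT x|M. f x * cnj (p x)) = (LINT x|M. h x * cnj (p x) + (f x - h x) * cnj (p x))" by (simp add: algebra_simps)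
 also have "... = (LINT x|M. h x * cnj (p x)) + (LINT x|M. (f x - h x) * cnj (p x))"
  by (rule Bochner_Integration.integral_add) (intro integrable_cont cintros cont)+
 finally have "cmod (LINT x|M. f x * cnj (p x)) <= cmod (LINT x|M. h x * cnj (p x)) + cmod (LINT x|M. (f x - h x) * cnj (p x))"
  by (simp add: norm_triangle_ineq)
 also have "cmod (LINT x|M. (f x - h x) * cnj (p x)) <= e / B * B"
 proof (rule norm_integral_le)
  show "cont_on G (%x. (f x - h x) * cnj (p x))" by (intro cintros cont)
  show "cmod ((f x - h x) * cnj (p x)) <= e / B * B" if "x : carrier G" for x
  unfolding norm_mult complex_mod_cnj using h(2)[OF that] B that e by (intro mult_mono) auto
 qed
 also have "e / B * B = e" using B by simp
 finally show "cmod (LINT x|M. f x * cnj (p x)) <= r + e"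
  using dual_ball_hull[OF p h(1)] by linarith
qed

end

text \<open>A family of pairwise inequivalent irreducible representations, given by matrix entries, whose
 coefficients are complete.  That the family exhausts the dual object is proved from this.\<close>
locale peter_weyl = haar_group G M for G :: "('g::polish_space, 'r) monoid_scheme" (structure) and M +
 fixes d :: "nat => nat" and \<pi> :: "nat => 'g => nat => nat => complex"
 assumes schur_UNIV: "schur UNIV d \<pi>"
  and complete: "!!f x. cont_on G f ==>
  (!!k i j. i < d k ==> j < d k ==> (LINT x|M. f x * cnj (\<pi> k x i j)) = 0) ==> x : carrier G ==> f x = 0"
begin

lemma schur_any: "schur F d \<pi>" by (rule schur_subset[OF schur_UNIV]) simp

lemma dim_pos: "0 < d k" and rep: "unirep G (d k) (\<pi> k)"
 using schurD(1,2)[OF schur_UNIV] by simp_all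

lemmas continuous_on_rep = unirepD(4)[OF rep]

definition fc :: "('g => complex) => nat => nat => nat => complex" where
 "fc f k i j = (LINT x|M. f x * cnj (\<pi> k x i j))"

definition ft :: "('g => complex) => nat => real" where
 "ft f k = real (d k) * tnorm (d k) (fc f k)"

definition block :: "('g => complex) => nat => 'g => complex" where
 "block f k = tpoly {k} d \<pi> (fc f)"

lemma ft_ge_0: "0 <= ft f k" by (simp add: ft_def tnorm_ge_0)

lemma sum_ft_pairing:
 assumes F: "finite F" and f: "cont_on G f"
 shows "EX X. (ALL k:F. partial_isometry (d k) (X k)) &
  (LINT x|M. f x * cnj (tpoly F d \<pi> (%k i j. of_real (w k) * X k i j) x)) = of_real (SUM k:F. w k * ft f k)"
proof -
 have "ALL k. EX X. partial_isometry (d k) X & pairing (d k) (fc f k) X = of_real (tnorm (d k) (fc f k))"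
  using tnorm_attained by blast
 then obtain X where X: "!!k. partial_isometry (d k) (X k)" "!!k. pairing (d k) (fc f k) (X k) = of_real (tnorm (d k) (fc f k))" by metis
 have "(LINT x|M. f x * cnj (tpoly F d \<pi> (%k i j. of_real (w k) * X k i j) x)) =
  (SUM k:F. of_nat (d k) * (SUM i<d k. SUM j<d k. cnj (of_real (w k) * X k i j) * fc f k i j))"
  unfolding fc_def by (rule integral_tpoly[OF F rep f])
 also have "... = (SUM k:F. of_real (w k) * (of_nat (d k) * pairing (d k) (fc f k) (X k)))"
  unfolding pairing_def sum_distrib_left complex_cnj_mult complex_cnj_complex_of_real
  by (intro sum.cong refl) (simp only: mult_ac)
 also have "... = of_real (SUM k:F. w k * ft f k)" by (simp add: X(2) ft_def)
 finally show ?thesis using X(1) by (intro exI[of _ X]) simp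
qed

lemma Conv_imp_sum_ft:
 assumes f: "f : Conv G r" and F: "finite F"
 shows "(SUM k:F. ft f k) <= r"
proof -
 obtain X where X: "ALL k:F. partial_isometry (d k) (X k)"
  "(LINT x|M. f x * cnj (tpoly F d \<pi> (%k i j. of_real 1 * X k i j) x)) = of_real (SUM k:F. 1 * ft f k)"
  using sum_ft_pairing[OF F Conv_continuous[OF f], of "%_. 1"] by blast
 have "tpoly F d \<pi> X : dual_ball" using X(1) by (intro tpoly_in_dual_ball F schur_any) simp
 from dual_ball_Conv[OF this f] have "cmod (complex_of_real (SUM k:F. ft f k)) <= r"
  using X(2) by (simp only: of_real_1 mult_1_left)
 thus ?thesis by (simp only: norm_of_real)
qed

lemma block_in_hull: "block f k : ahull G (ft f k)"
 using hull_scale[OF matrix_coefficients_in_hull[OF rep[of k], of "fc f k"], of "of_nat (d k)"]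
 by (simp add: block_def tpoly_def[abs_def] ft_def)

lemma fc_sum_block:
 assumes F: "finite F" "k : F" and ij: "i < d k" "j < d k"
 shows "(LINT x|M. (SUM l:F. block f l x) * cnj (\<pi> k x i j)) = fc f k i j"
proof -
 have "(LINT x|M. \<pi> k x i j * cnj (tpoly F d \<pi> (fc f) x)) = cnj (fc f k i j)"
  by (rule schur_coefficient[OF F(1) schur_any F(2) ij])
 hence "cnj (LINT x|M. \<pi> k x i j * cnj (tpoly F d \<pi> (fc f) x)) = fc f k i j" by simp
 moreover have "tpoly F d \<pi> (fc f) x = (SUM l:F. block f l x)" for x by (simp add: tpoly_def block_def)
 ultimately show ?thesis by (simp add: mult.commute flip: Bochner_Integration.integral_cnj)
qed

lemma continuous_on_block: "cont_on G (block f k)" by (rule hull_continuous[OF block_in_hull])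

text \<open>Fourier inversion: if the terms \<open>ft f k\<close> are summable, the blocks sum uniformly to a continuous
 function with the coefficients of \<open>f\<close>, which is \<open>f\<close> by completeness.\<close>
lemma fourier_inversion:
 assumes f: "cont_on G f" and r: "!!N. (SUM k<N. ft f k) <= r"
 shows "uniform_limit (carrier G) (%N x. SUM k<N. block f k x) f sequentially"
proof -
 have sm: "summable (ft f)" by (rule summableI_nonneg_bounded[of _ r]) (use ft_ge_0 r in auto)
 define g where "g = (%x. \<Sum>k. block f k x)"
 have ul: "uniform_limit (carrier G) (%N x. SUM k<N. block f k x) g sequentially"
  unfolding g_def by (rule Weierstrass_m_test[of _ _ "ft f", OF hull_bound[OF is_group block_in_hull] sm])
 have cg: "cont_on G g" by (rule uniform_limit_theorem[OF always_eventually ul]) (auto intro!: cintros continuous_on_block)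
 have "(LINT x|M. (f x - g x) * cnj (\<pi> k x i j)) = 0" if ij: "i < d k" "j < d k" for k i j
 proof -
  have "cmod (LINT x|M. (f x - g x) * cnj (\<pi> k x i j)) <= 0"
  proof (rule field_le_epsilon)
  fix e :: real assume "e > 0"
  hence "\<forall>\<^sub>F N in sequentially. ALL x:carrier G. dist (SUM k<N. block f k x) (g x) < e"
  using ul by (simp add: uniform_limit_iff)
  then obtain N0 where N0: "!!N. N >= N0 ==> ALL x:carrier G. dist (SUM k<N. block f k x) (g x) < e"
  unfolding eventually_sequentially by blast
  define N where "N = max N0 (Suc k)"
  define S where "S = (%x. SUM k<N. block f k x)"
  have cS: "cont_on G S" unfolding S_def by (intro cintros continuous_on_block)
  have close: "cmod (S x - g x) <= e" if "x : carrier G" for x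
  using N0[of N] that unfolding S_def by (simp add: N_def dist_norm less_imp_le)
  note cont = f cg cS continuous_on_rep[OF ij]
  have "(LINT x|M. (f x - g x) * cnj (\<pi> k x i j)) = (LINT x|M. (f x * cnj (\<pi> k x i j) - S x * cnj (\<pi> k x i j)) + (S x - g x) * cnj (\<pi> k x i j))"
  by (simp add: algebra_simps)
  also have "... = (LINT x|M. f x * cnj (\<pi> k x i j)) - (LINT x|M. S x * cnj (\<pi> k x i j)) + (LINT x|M. (S x - g x) * cnj (\<pi> k x i j))"
  by (subst Bochner_Integration.integral_add, (intro integrable_cont cintros cont)+,
  subst Bochner_Integration.integral_diff, (intro integrable_cont cintros cont)+, rule refl)
  also have "(LINT x|M. S x * cnj (\<pi> k x i j)) = fc f k i j"
  unfolding S_def by (rule fc_sum_block) (use ij in \<open>auto simp: N_def\<close>)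
  finally have "(LINT x|M. (f x - g x) * cnj (\<pi> k x i j)) = (LINT x|M. (S x - g x) * cnj (\<pi> k x i j))"
  by (simp add: fc_def)
  moreover have "cmod (LINT x|M. (S x - g x) * cnj (\<pi> k x i j)) <= e"
  proof (rule norm_integral_le)
  show "cont_on G (%x. (S x - g x) * cnj (\<pi> k x i j))" by (intro cintros cont)
  show "cmod ((S x - g x) * cnj (\<pi> k x i j)) <= e" if x: "x : carrier G" for x
  proof -
  have "cmod (S x - g x) * cmod (\<pi> k x i j) <= e * 1"
  using close[OF x] unirep_entry_bound[OF is_group rep x ij] \<open>e > 0\<close> by (intro mult_mono) auto
  thus ?thesis by (simp add: norm_mult)
  qed
  qed
  ultimately show "cmod (LINT x|M. (f x - g x) * cnj (\<pi> k x i j)) <= 0 + e" by simp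
  qed
  thus ?thesis by simp
 qed
 hence "f x - g x = 0" if "x : carrier G" for x
  using that by (intro complete[of "%x. f x - g x"] cintros f cg) auto
 hence "g x = f x" if "x : carrier G" for x using that by simp
 thus ?thesis using uniform_limit_cong'[of "carrier G" "%N x. SUM k<N. block f k x" "%N x. SUM k<N. block f k x" g f sequentially] ul by simp
qed

lemma sum_ft_imp_Conv:
 assumes f: "cont_on G f" and r: "!!N. (SUM k<N. ft f k) <= r"
 shows "f : Conv G r"
proof (rule ConvI)
 fix e :: real assume "e > 0"
 hence "\<forall>\<^sub>F N in sequentially. ALL x:carrier G. dist (SUM k<N. block f k x) (f x) < e"
  using fourier_inversion[OF f r] by (simp add: uniform_limit_iff)
 then obtain N where N: "ALL x:carrier G. dist (SUM k<N. block f k x) (f x) < e"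
  unfolding eventually_sequentially by blast
 have "(%x. SUM k<N. block f k x) : ahull G (SUM k<N. ft f k)" by (rule hull_sum) (auto intro: block_in_hull)
 hence "(%x. SUM k<N. block f k x) : ahull G r" by (rule hull_mono[OF _ r])
 moreover have "ALL x:carrier G. cmod (f x - (SUM k<N. block f k x)) <= e"
  using N by (simp add: dist_norm norm_minus_commute less_imp_le)
 ultimately show "EX h:ahull G r. ALL x:carrier G. cmod (f x - h x) <= e" by (intro bexI[of _ "%x. SUM k<N. block f k x"])
qed

lemma Conv_iff_sum_ft:
 "f : Conv G r \<longleftrightarrow> cont_on G f & (ALL N. (SUM k<N. ft f k) <= r)"
proof
 assume "f : Conv G r"
 thus "cont_on G f & (ALL N. (SUM k<N. ft f k) <= r)"
  using Conv_continuous[of f G r] Conv_imp_sum_ft[of f r "{..<_}"] by simp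
qed (simp add: sum_ft_imp_Conv)

end

section \<open>The dual object and the Fourier algebra\<close>

lemma sum_delta_mult:
 fixes c :: complex
 assumes "finite A" "a : A"
 shows "(SUM j:A. f j * (if j = a then c else 0)) = f a * c"
proof -
 have "(SUM j:A. f j * (if j = a then c else 0)) = (SUM j:A. if j = a then f a * c else 0)" by (rule sum.cong) auto
 thus ?thesis using assms by simp
qed

lemma mv_contraction_of_isometry:
 assumes "!!i j. i < n ==> j < n ==> mm n (adj V) V i j = (if i = j then 1 else 0)"
 shows "nrm n (mv n V w) = nrm n w"
proof -
 have "ip n (mv n V w) (mv n V w) = ip n w (mv n (mm n (adj V) V) w)"
  unfolding mv_mm by (rule ip_mv_adj)
 also have "... = ip n w w"
 proof (rule ip_cong[OF refl])
  fix i assume i: "i < n"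
  have "mv n (mm n (adj V) V) w i = (SUM j<n. (if i = j then 1 else 0) * w j)"
  unfolding mv_def by (rule sum_eqI) (simp add: assms[OF i])
  also have "... = w i" using i by (simp add: if_distrib[of "%x. x * _"] cong: if_cong)
  finally show "mv n (mm n (adj V) V) w i = w i" .
 qed
 finally have "(nrm n (mv n V w))^2 = (nrm n w)^2" by (simp only: ip_self of_real_eq_iff)
 thus ?thesis by (simp add: power2_eq_iff_nonneg)
qed

lemma mm_id:
 assumes "!!i j. i < n ==> j < n ==> I i j = (if i = j then 1 else 0)"
 shows "i < n ==> mm n I A i j = A i j" "j < n ==> mm n A I i j = A i j"
proof -
 assume i: "i < n"
 have "mm n I A i j = (SUM k<n. (if i = k then 1 else 0) * A k j)"
  unfolding mm_def by (rule sum_eqI) (simp add: assms[OF i])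
 thus "mm n I A i j = A i j" using i by (simp add: if_distrib[of "%x. x * _"] cong: if_cong)
next
 assume j: "j < n"
 have "mm n A I i j = (SUM k<n. A i k * (if k = j then 1 else 0))"
  unfolding mm_def by (rule sum_eqI) (simp add: assms[OF _ j])
 thus "mm n A I i j = A i j" using j by (simp add: if_distrib[of "%x. A i _ * x"] cong: if_cong)
qed

lemma tnorm_conjugate_le:
 assumes "!!w. nrm d (mv d V w) = nrm d w"
 shows "tnorm d (mm d (mm d V C) (adj V)) <= tnorm d C"
proof -
 obtain s u v where s: "ALL a<d. 0 <= s a" and u: "ALL a<d. nrm d (u a) <= 1" and v: "ALL a<d. nrm d (v a) <= 1"
  and C: "ALL i<d. ALL j<d. C i j = (SUM a<d. of_real (s a) * u a i * cnj (v a j))"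
  and t: "tnorm d C = (SUM a<d. s a)"
  using tnorm_decomposition[of d C] by (elim exE conjE)
 have E: "mm d (mm d V C) (adj V) i j = (SUM a<d. of_real (s a) * mv d V (u a) i * cnj (mv d V (v a) j))" for i j
 proof -
  have VC: "mm d V C i k = (SUM a<d. of_real (s a) * mv d V (u a) i * cnj (v a k))" if k: "k < d" for k
  proof -
  have "mm d V C i k = (SUM l<d. SUM a<d. of_real (s a) * (V i l * u a l) * cnj (v a k))"
  unfolding mm_def using C k by (intro sum.cong refl) (simp add: sum_distrib_left mult_ac)
  also have "... = (SUM a<d. SUM l<d. of_real (s a) * (V i l * u a l) * cnj (v a k))" by (rule sum.swap)
  finally show ?thesis unfolding mv_def sum_distrib_left sum_distrib_right .
  qed
  have "mm d (mm d V C) (adj V) i j = (SUM k<d. SUM a<d. of_real (s a) * mv d V (u a) i * (cnj (V j k) * cnj (v a k)))"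
  unfolding mm_def[of d "mm d V C"] adj_def by (intro sum.cong refl) (simp add: VC sum_distrib_left mult_ac)
  also have "... = (SUM a<d. SUM k<d. of_real (s a) * mv d V (u a) i * (cnj (V j k) * cnj (v a k)))" by (rule sum.swap)
  finally show ?thesis unfolding mv_def[of d V "v _"] cnj_sum complex_cnj_mult sum_distrib_left .
 qed
 have "tnorm d (mm d (mm d V C) (adj V)) <= (SUM a<d. cmod (of_real (s a)) * (nrm d (mv d V (u a)) * nrm d (mv d V (v a))))"
  by (rule tnorm_outer_le) (rule E)
 also have "... <= (SUM a<d. s a)"
 proof (rule sum_mono)
  fix a assume "a : {..<d}"
  hence "nrm d (u a) * nrm d (v a) <= 1" "0 <= s a" using s u v by (simp_all add: mult_le_one)
  thus "cmod (of_real (s a)) * (nrm d (mv d V (u a)) * nrm d (mv d V (v a))) <= s a" by (simp add: assms mult_left_le)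
 qed
 finally show ?thesis using t by simp
qed

lemma tnorm_conjugate:
 assumes V: "!!i j. i < d ==> j < d ==> mm d (adj V) V i j = (if i = j then 1 else 0)"
  and V': "!!i j. i < d ==> j < d ==> mm d V (adj V) i j = (if i = j then 1 else 0)"
 shows "tnorm d (mm d (mm d V C) (adj V)) = tnorm d C"
proof (rule antisym)
 have aa: "adj (adj V) = V" by (simp add: adj_def)
 show "tnorm d (mm d (mm d V C) (adj V)) <= tnorm d C" by (rule tnorm_conjugate_le[OF mv_contraction_of_isometry[OF V]])
 have "tnorm d C = tnorm d (mm d (mm d (adj V) (mm d (mm d V C) (adj V))) (adj (adj V)))"
 proof (rule fmat_cong)
  fix i j assume ij: "i < d" "j < d"
  have "mm d (mm d (adj V) (mm d (mm d V C) (adj V))) (adj (adj V)) i j = mm d (mm d (adj V) V) (mm d C (mm d (adj V) V)) i j"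
  by (simp add: aa mm_assoc)
  also have "... = mm d C (mm d (adj V) V) i j" by (rule mm_id(1)[OF V ij(1)])
  also have "... = C i j" by (rule mm_id(2)[OF V ij(2)])
  finally show "C i j = mm d (mm d (adj V) (mm d (mm d V C) (adj V))) (adj (adj V)) i j" by simp
 qed
 also have "... <= tnorm d (mm d (mm d V C) (adj V))"
  by (rule tnorm_conjugate_le[OF mv_contraction_of_isometry]) (simp add: aa V')
 finally show "tnorm d C <= tnorm d (mm d (mm d V C) (adj V))" .
qed

text \<open>A proper subspace of \<open>\<complex>\<^sup>n\<close> has a nonzero orthogonal vector: an orthonormal family in the subspace
 of maximal length spans it, and what is left of an outside vector is orthogonal to the family.\<close>
lemma proper_subspace_orthogonal:
 fixes W :: "(nat => complex) set"
 assumes zero: "(%_. 0) : W" and add: "!!u v. u : W ==> v : W ==> (%i. u i + v i) : W"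
  and scale: "!!c u. u : W ==> (%i. c * u i) : W"
  and local: "!!u v. u : W ==> (!!i. i < n ==> u i = v i) ==> v : W"
  and proper: "u ~: W"
 shows "EX y. nrm n y ~= 0 & (ALL z:W. ip n z y = 0)"
proof -
 define P where "P = (%r. EX v. orthonormal n r v & (ALL a<r. v a : W))"
 have "P 0" by (simp add: P_def orthonormal_def)
 moreover have "ALL r. P r --> r <= n" unfolding P_def using orthonormal_le by blast
 ultimately have g: "P (GREATEST r. P r)" "!!r. P r ==> r <= (GREATEST r. P r)"
  using GreatestI_nat[of P 0 n] Greatest_le_nat[of P _ n] by auto
 define r where "r = (GREATEST r. P r)"
 have nP: "~ P (Suc r)" using g(2)[of "Suc r"] by (auto simp: r_def)
 obtain v where v: "orthonormal n r v" "!!a. a < r ==> v a : W"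
 proof -
  have "P r" using g(1) by (simp only: r_def)
  thus thesis unfolding P_def using that by blast
 qed
 define pr where "pr = (%z i. SUM a<r. ip n z (v a) * v a i)"
 have prW: "pr z : W" for z
 proof -
  have "(%i. SUM a<m. ip n z (v a) * v a i) : W" if "m <= r" for m
  using that
  proof (induction m)
  case (Suc m)
  thus ?case using add[OF Suc.IH scale[OF v(2)[of m], of "ip n z (v m)"]] by simp
  qed (simp add: zero)
  thus ?thesis unfolding pr_def by simp
 qed
 define rs where "rs = (%z i. z i + (-1) * pr z i)"
 have rso: "ip n (rs z) (v b) = 0" if "b < r" for z b
 proof -
  have "ip n (rs z) (v b) = ip n z (v b) - (SUM a<r. ip n z (v a) * ip n (v a) (v b))"
  unfolding rs_def ip_add_left ip_scale_left pr_def ip_sum_left by simp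
  also have "(SUM a<r. ip n z (v a) * ip n (v a) (v b)) = (SUM a<r. if a = b then ip n z (v b) else 0)"
  using v(1) that by (intro sum.cong refl) (auto simp: orthonormal_def)
  finally show ?thesis using that by simp
 qed
 have rs0: "nrm n (rs z) = 0" if z: "z : W" for z
 proof (rule ccontr)
  assume nz: "nrm n (rs z) ~= 0"
  define w where "w = (%i. of_real (inverse (nrm n (rs z))) * rs z i)"
  have "rs z : W" unfolding rs_def by (rule add[OF z scale[OF prW]])
  hence wW: "w : W" unfolding w_def by (rule scale)
  have w1: "ip n w w = 1"
  proof -
  have "ip n w w = of_real (inverse (nrm n (rs z)) * (inverse (nrm n (rs z)) * (nrm n (rs z))^2))"
  by (simp add: w_def ip_scale_left ip_scale_right ip_self)
  also have "inverse (nrm n (rs z)) * (inverse (nrm n (rs z)) * (nrm n (rs z))^2) = 1"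
  using nz by (simp add: power2_eq_square divide_simps)
  finally show ?thesis by simp
  qed
  have w0: "ip n w (v b) = 0" "ip n (v b) w = 0" if "b < r" for b
  proof -
  show "ip n w (v b) = 0" using rso[OF that] by (simp add: w_def ip_scale_left)
  thus "ip n (v b) w = 0" using cnj_ip[of n w "v b"] by simp
  qed
  define v' where "v' = (%a. if a < r then v a else w)"
  have "orthonormal n (Suc r) v'"
  using v(1) w1 w0 unfolding orthonormal_def v'_def by (auto simp: less_Suc_eq)
  moreover have "ALL a<Suc r. v' a : W" using v(2) wW by (auto simp: v'_def)
  ultimately show False using nP unfolding P_def by blast
 qed
 have "nrm n (rs u) ~= 0"
 proof
  assume "nrm n (rs u) = 0"
  hence "pr u i = u i" if "i < n" for i using that by (simp add: nrm_eq_0 rs_def)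
  thus False using local[OF prW[of u], of u] proper by blast
 qed
 moreover have "ip n z (rs u) = 0" if z: "z : W" for z
 proof -
  have "ip n z (rs u) = ip n (pr z) (rs u)"
  using rs0[OF z] by (intro ip_cong refl) (simp add: nrm_eq_0 rs_def)
  also have "... = (SUM a<r. ip n z (v a) * ip n (v a) (rs u))"
  unfolding pr_def ip_sum_left ip_scale_left ..
  also have "... = 0"
  proof (rule sum.neutral, rule ballI)
  fix a assume "a : {..<r}"
  hence "ip n (v a) (rs u) = 0" using rso[of a u] cnj_ip[of n "rs u" "v a"] by simp
  thus "ip n z (v a) * ip n (v a) (rs u) = 0" by simp
  qed
  finally show ?thesis .
 qed
 ultimately show ?thesis by blast
qed

lemma subspace_module_vec_iff:
 "VectorSpace.subspace class_ring W (module_vec TYPE(complex) n) \<longleftrightarrow>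
  W \<subseteq> carrier_vec n & 0\<^sub>v n : W & (ALL u:W. ALL v:W. u + v : W) & (ALL c. ALL u:W. c \<cdot>\<^sub>v u : W)"
 unfolding VectorSpace.subspace_def submodule_def by (auto simp: vec_vs vec_module module_vec_simps class_ring_simps)

lemma unitary_mat_fmat:
 "unitary_mat n (fmat n A) \<longleftrightarrow>
  (ALL i<n. ALL j<n. mm n A (adj A) i j = (if i = j then 1 else 0)) &
  (ALL i<n. ALL j<n. mm n (adj A) A i j = (if i = j then 1 else 0))"
proof -
 have "fmat n B = 1\<^sub>m n \<longleftrightarrow> (ALL i<n. ALL j<n. B i j = (if i = j then 1 else 0))" for B
 proof
  assume "fmat n B = 1\<^sub>m n"
  thus "ALL i<n. ALL j<n. B i j = (if i = j then 1 else 0)" by (metis fmat_index index_one_mat(1))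
 qed (auto intro: eq_matI)
 thus ?thesis unfolding unitary_mat_def fmat_adjoint fmat_mult by simp
qed

lemma unitary_matD:
 assumes "unitary_mat n A"
 shows "A : carrier_mat n n" "A * mat_adjoint A = 1\<^sub>m n" "mat_adjoint A * A = 1\<^sub>m n" "mat_adjoint A : carrier_mat n n"
  and "A = fmat n (%i j. A $$ (i, j))"
proof -
 show 1: "A : carrier_mat n n" "A * mat_adjoint A = 1\<^sub>m n" "mat_adjoint A * A = 1\<^sub>m n"
  using assms by (simp_all add: unitary_mat_def)
 show 2: "A = fmat n (%i j. A $$ (i, j))" by (rule fmat_of_carrier[OF 1(1)])
 show "mat_adjoint A : carrier_mat n n" by (subst 2) (simp add: fmat_adjoint)
qed

lemma adj_adj: "adj (adj A) = A" by (simp add: adj_def)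

context haar_group
begin

lemma unitary_rep_imp_unirep:
 assumes "unitary_rep G (top_of_set (carrier G)) rh"
 shows "unirep G (rep_dim G rh) (%x i j. rh x $$ (i, j))"
proof -
 define n where "n = rep_dim G rh"
 have u: "unitary_mat n (rh x)" if "x : carrier G" for x
  using assms that by (simp add: unitary_rep_def n_def)
 have m: "rh (x \<otimes> y) = rh x * rh y" if "x : carrier G" "y : carrier G" for x y
  using assms that by (simp add: unitary_rep_def)
 have one: "rh \<one> = 1\<^sub>m n"
 proof -
  note U = unitary_matD[OF u[OF one_closed]]
  have "rh \<one> = rh \<one> * (rh \<one> * mat_adjoint (rh \<one>))" using U by simp
  also have "... = (rh \<one> * rh \<one>) * mat_adjoint (rh \<one>)" using U by (simp add: assoc_mult_mat[of _ n n _ n _ n])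
  also have "... = 1\<^sub>m n" using U m[OF one_closed one_closed] by simp
  finally show ?thesis .
 qed
 have inv: "rh (inv x) = mat_adjoint (rh x)" if x: "x : carrier G" for x
 proof -
  note U = unitary_matD[OF u[OF x]] and U' = unitary_matD[OF u[OF inv_closed[OF x]]]
  have mid: "rh (inv x) * rh x = 1\<^sub>m n" using m[OF inv_closed[OF x] x] one x by simp
  have "rh (inv x) = rh (inv x) * (rh x * mat_adjoint (rh x))"
  unfolding U(2) by (rule right_mult_one_mat[OF U'(1), symmetric])
  also have "... = (rh (inv x) * rh x) * mat_adjoint (rh x)" by (rule assoc_mult_mat[OF U'(1) U(1) U(4), symmetric])
  also have "... = mat_adjoint (rh x)" unfolding mid by (rule left_mult_one_mat[OF U(4)])
  finally show ?thesis .
 qed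
 show ?thesis unfolding unirep_def n_def[symmetric]
 proof (intro conjI ballI allI impI)
  fix i j assume ij: "i < n" "j < n"
  { fix x y assume xy: "x : carrier G" "y : carrier G"
  have "rh (x \<otimes> y) = fmat n (mm n (%i j. rh x $$ (i, j)) (%i j. rh y $$ (i, j)))"
  unfolding m[OF xy] fmat_mult[symmetric] using unitary_matD(5)[OF u] xy by simp
  thus "rh (x \<otimes> y) $$ (i, j) = mm n (%i j. rh x $$ (i, j)) (%i j. rh y $$ (i, j)) i j" using ij by simp }
  { fix x assume x: "x : carrier G"
  have "rh (inv x) = fmat n (adj (%i j. rh x $$ (i, j)))"
  unfolding inv[OF x] fmat_adjoint[symmetric] using unitary_matD(5)[OF u[OF x]] by simp
  thus "rh (inv x) $$ (i, j) = cnj (rh x $$ (j, i))" using ij by (simp add: adj_def) }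
  show "rh \<one> $$ (i, j) = (if i = j then 1 else 0)" using ij by (simp add: one)
  show "cont_on G (%x. rh x $$ (i, j))"
  using assms ij by (simp add: unitary_rep_def n_def)
 qed
qed

lemma unirep_unitary:
 assumes s: "unirep G n s" and x: "x : carrier G" and ij: "i < n" "j < n"
 shows "mm n (s x) (adj (s x)) i j = (if i = j then 1 else 0)" "mm n (adj (s x)) (s x) i j = (if i = j then 1 else 0)"
proof -
 have "mm n (s x) (adj (s x)) i j = mm n (s x) (s (inv x)) i j"
  by (rule mm_cong) (simp_all add: adj_def unirepD(2)[OF s x _ ij(2)])
 also have "... = s (x \<otimes> inv x) i j" using unirepD(1)[OF s x inv_closed[OF x] ij] by simp
 finally show "mm n (s x) (adj (s x)) i j = (if i = j then 1 else 0)" using unirepD(3)[OF s ij] x by simp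
 have "mm n (adj (s x)) (s x) i j = mm n (s (inv x)) (s x) i j"
  by (rule mm_cong) (simp_all add: adj_def unirepD(2)[OF s x ij(1)])
 also have "... = s (inv x \<otimes> x) i j" using unirepD(1)[OF s inv_closed[OF x] x ij] by simp
 finally show "mm n (adj (s x)) (s x) i j = (if i = j then 1 else 0)" using unirepD(3)[OF s ij] x by simp
qed

lemma unirep_imp_unitary_rep:
 assumes s: "unirep G n s"
 shows "unitary_rep G (top_of_set (carrier G)) (%x. fmat n (s x))" "rep_dim G (%x. fmat n (s x)) = n"
proof -
 show d: "rep_dim G (%x. fmat n (s x)) = n" by (simp add: rep_dim_def)
 show "unitary_rep G (top_of_set (carrier G)) (%x. fmat n (s x))"
  unfolding unitary_rep_def d
 proof (intro conjI ballI allI impI)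
  fix x assume x: "x : carrier G"
  show "unitary_mat n (fmat n (s x))" unfolding unitary_mat_fmat using unirep_unitary[OF s x] by simp
  fix y assume y: "y : carrier G"
  show "fmat n (s (x \<otimes> y)) = fmat n (s x) * fmat n (s y)"
  unfolding fmat_mult using unirepD(1)[OF s x y] by (intro fmat_eqI)
 next
  fix i j assume "i < n" "j < n"
  thus "continuous_map (top_of_set (carrier G)) euclidean (%x. fmat n (s x) $$ (i, j))"
  using unirepD(4)[OF s] by simp
 qed
qed

end

context peter_weyl
begin

abbreviation repmat :: "nat => 'g => complex mat" where
 "repmat k \<equiv> %x. fmat (d k) (\<pi> k x)"

lemma repmat_irrep: "repmat k : irreps G (top_of_set (carrier G))"
proof -
 note u = unirep_imp_unitary_rep[OF rep[of k]]
 have H: "W = {0\<^sub>v (d k)} | W = carrier_vec (d k)"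
  if W: "VectorSpace.subspace class_ring W (module_vec TYPE(complex) (d k))"
  and inv: "!!x v. x : carrier G ==> v : W ==> fmat (d k) (\<pi> k x) *\<^sub>v v : W" for W
 proof (rule ccontr)
  assume c: "~ (W = {0\<^sub>v (d k)} | W = carrier_vec (d k))"
  have W': "W \<subseteq> carrier_vec (d k)" "0\<^sub>v (d k) : W" "!!u v. u : W ==> v : W ==> u + v : W" "!!c u. u : W ==> c \<cdot>\<^sub>v u : W"
  using W unfolding subspace_module_vec_iff by simp_all
  define V where "V = {u. Matrix.vec (d k) u : W}"
  obtain w where w: "w : W" "w ~= 0\<^sub>v (d k)" using c W'(2) by blast
  obtain u where u: "u : carrier_vec (d k)" "u ~: W" using c W'(1) by blast
  have vv: "Matrix.vec (d k) (vec_index z) = z" if "z : carrier_vec (d k)" for z :: "complex Matrix.vec"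
  using that by (intro eq_vecI) auto
  have "EX y. nrm (d k) y ~= 0 & (ALL z:V. ip (d k) z y = 0)"
  proof (rule proper_subspace_orthogonal)
  have "Matrix.vec (d k) (%_. 0::complex) = 0\<^sub>v (d k)" by (intro eq_vecI) auto
  thus "(%_. 0) : V" using W'(2) by (simp add: V_def)
  show "(%i. a i + b i) : V" if "a : V" "b : V" for a b
  proof -
  have "Matrix.vec (d k) (%i. a i + b i) = Matrix.vec (d k) a + Matrix.vec (d k) b" by (intro eq_vecI) auto
  thus ?thesis using W'(3) that by (simp add: V_def)
  qed
  show "(%i. b * a i) : V" if "a : V" for a b
  proof -
  have "Matrix.vec (d k) (%i. b * a i) = b \<cdot>\<^sub>v Matrix.vec (d k) a" by (intro eq_vecI) auto
  thus ?thesis using W'(4) that by (simp add: V_def)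
  qed
  show "b : V" if "a : V" "!!i. i < d k ==> a i = b i" for a b
  proof -
  have "Matrix.vec (d k) a = Matrix.vec (d k) b" using that(2) by (intro eq_vecI) auto
  thus ?thesis using that(1) by (simp add: V_def)
  qed
  show "vec_index u ~: V" using u vv by (simp add: V_def)
  qed
  then obtain y where y: "nrm (d k) y ~= 0" "!!z. z : V ==> ip (d k) z y = 0" by blast
  have z: "coef (d k) (\<pi> k) (vec_index w) y x = 0" if x: "x : carrier G" for x
  proof -
  have "Matrix.vec (d k) (mv (d k) (\<pi> k x) (vec_index w)) = fmat (d k) (\<pi> k x) *\<^sub>v w"
  using w(1) W'(1) by (intro eq_vecI) (auto simp: mv_def scalar_prod_def atLeast0LessThan intro!: sum.cong)
  hence "mv (d k) (\<pi> k x) (vec_index w) : V" using inv[OF x w(1)] by (simp add: V_def)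
  thus ?thesis unfolding coef_def by (rule y(2))
  qed
  have wy: "vec_index w n * cnj (y m) = 0" if mn: "m < d k" "n < d k" for m n
  proof -
  have "0 = (LINT x|M. coef (d k) (\<pi> k) (vec_index w) y x * cnj (\<pi> k x m n))"
  by (subst Bochner_Integration.integral_cong[of M M _ "%_. 0"]) (auto simp: z space_M)
  also have "... = (LINT x|M. (SUM i<d k. SUM j<d k. (vec_index w j * cnj (y i)) * (\<pi> k x i j * cnj (\<pi> k x m n))))"
  unfolding coef_expand sum_distrib_right by (simp only: mult_ac)
  also have "... = (SUM i<d k. LINT x|M. (SUM j<d k. (vec_index w j * cnj (y i)) * (\<pi> k x i j * cnj (\<pi> k x m n))))"
  by (intro integral_sum_cont cintros continuous_on_rep mn) auto
  also have "... = (SUM i<d k. SUM j<d k. LINT x|M. (vec_index w j * cnj (y i)) * (\<pi> k x i j * cnj (\<pi> k x m n)))"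
  by (rule sum_eqI, intro integral_sum_cont cintros continuous_on_rep mn) auto
  also have "... = (SUM i<d k. SUM j<d k. (vec_index w j * cnj (y i) * (if i = m then 1 / of_nat (d k) else 0)) * (if j = n then 1 else 0))"
  by (intro sum.cong refl) (simp add: schurD(3)[OF schur_UNIV UNIV_I UNIV_I _ _ mn])
  also have "... = (SUM i<d k. (vec_index w n * cnj (y i)) * (if i = m then 1 / of_nat (d k) else 0))"
  using mn by (simp only: sum_delta_mult finite_lessThan lessThan_iff mult_1_right)
  also have "... = vec_index w n * cnj (y m) / of_nat (d k)"
  using mn by (simp only: sum_delta_mult finite_lessThan lessThan_iff) simp
  finally show ?thesis using dim_pos[of k] by simp
  qed
  obtain m where m: "m < d k" "y m ~= 0" using y(1) by (auto simp: nrm_eq_0)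
  hence "vec_index w n = 0" if "n < d k" for n using wy[OF m(1) that] by simp
  hence "w = 0\<^sub>v (d k)" using w(1) W'(1) by (intro eq_vecI) auto
  thus False using w(2) by simp
 qed
 show ?thesis unfolding irreps_def irreducible_rep_def mem_Collect_eq u(2)
 proof (intro conjI allI impI)
  show "unitary_rep G (top_of_set (carrier G)) (repmat k)" by (rule u(1))
  show "0 < d k" by (rule dim_pos)
  fix W assume A: "VectorSpace.subspace class_ring W (module_vec TYPE(complex) (d k)) &
  (ALL x:carrier G. ALL v:W. repmat k x *\<^sub>v v : W)"
  show "W = {0\<^sub>v (d k)} | W = carrier_vec (d k)" by (rule H[OF conjunct1[OF A]]) (use conjunct2[OF A] in simp)
 qed
qed

text \<open>By completeness some \<open>\<pi> k\<close> is not orthogonal to \<open>\<rho>\<close>, which gives a nonzero intertwiner \<open>S\<close>.  The matrix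
 \<open>S\<^sup>* S\<close> is its own average over the group, hence scalar, and the range of \<open>S\<close> is invariant.\<close>
lemma irrep_equivalent:
 assumes rh: "rh : irreps G (top_of_set (carrier G))"
 shows "EX k. equivalent_reps G (repmat k) rh"
proof -
 define n where "n = rep_dim G rh"
 define s where "s = (%x i j. rh x $$ (i, j))"
 have ur: "unitary_rep G (top_of_set (carrier G)) rh" and irr: "irreducible_rep G rh"
  using rh by (simp_all add: irreps_def)
 have s: "unirep G n s" unfolding n_def s_def by (rule unitary_rep_imp_unirep[OF ur])
 have n0: "0 < n" using irr by (simp add: irreducible_rep_def n_def)
 have rhs: "rh x = fmat n (s x)" if "x : carrier G" for x
  unfolding s_def by (rule unitary_matD(5)) (use ur that in \<open>simp add: unitary_rep_def n_def\<close>)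
 note cs = unirepD(4)[OF s]
 have "EX k i j. i < d k & j < d k & (LINT x|M. s x 0 0 * cnj (\<pi> k x i j)) ~= 0"
 proof (rule ccontr)
  assume "~ ?thesis"
  hence "s \<one> 0 0 = 0" by (intro complete[of "%x. s x 0 0"] cs n0) auto
  thus False using unirepD(3)[OF s n0 n0] by simp
 qed
 then obtain k i0 j0 where k: "i0 < d k" "j0 < d k" "(LINT x|M. s x 0 0 * cnj (\<pi> k x i0 j0)) ~= 0" by blast
 define S where "S = (%a i. LINT x|M. s x a 0 * cnj (\<pi> k x i j0))"
 have S: "(SUM c<n. s y a c * S c i) = (SUM m<d k. S a m * \<pi> k y m i)" if "y : carrier G" "a < n" "i < d k" for y a i
  unfolding S_def by (rule integral_intertwines[OF s rep that(1,2) n0 that(3) k(2)])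
 define Y where "Y = (%i j. SUM a<n. cnj (S a i) * S a j)"
 define c where "c = (SUM m<d k. SUM a<n. (cmod (S a m))^2) / real (d k)"
 have Yy: "Y i j = (SUM m<d k. SUM l<d k. Y m l * (\<pi> k y l j * cnj (\<pi> k y m i)))" if y: "y : carrier G" and ij: "i < d k" "j < d k" for y i j
 proof -
  have "(SUM m<d k. SUM l<d k. Y m l * (\<pi> k y l j * cnj (\<pi> k y m i))) = (SUM m<d k. SUM l<d k. SUM a<n. cnj (S a m * \<pi> k y m i) * (S a l * \<pi> k y l j))"
  unfolding Y_def sum_distrib_right by (intro sum.cong refl) (simp add: mult_ac)
  also have "... = (SUM m<d k. SUM a<n. SUM l<d k. cnj (S a m * \<pi> k y m i) * (S a l * \<pi> k y l j))"
  by (rule sum_eqI, rule sum.swap)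
  also have "... = (SUM a<n. SUM m<d k. SUM l<d k. cnj (S a m * \<pi> k y m i) * (S a l * \<pi> k y l j))" by (rule sum.swap)
  also have "... = (SUM a<n. cnj (SUM c<n. s y a c * S c i) * (SUM c<n. s y a c * S c j))"
  proof (rule sum_eqI)
  fix a assume "a : {..<n}"
  hence a: "a < n" by simp
  show "(SUM m<d k. SUM l<d k. cnj (S a m * \<pi> k y m i) * (S a l * \<pi> k y l j)) = cnj (SUM c<n. s y a c * S c i) * (SUM c<n. s y a c * S c j)"
  unfolding S[OF y a ij(1)] S[OF y a ij(2)] cnj_sum sum_product ..
  qed
  also have "... = ip n (mv n (s y) (%c. S c j)) (mv n (s y) (%c. S c i))"
  unfolding ip_def mv_def by (simp only: mult.commute)
  also have "... = ip n (%c. S c j) (mv n (mm n (adj (s y)) (s y)) (%c. S c i))"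
  unfolding mv_mm by (rule ip_mv_adj)
  also have "... = ip n (%c. S c j) (%c. S c i)"
  proof (rule ip_cong[OF refl])
  fix b assume b: "b < n"
  have "mv n (mm n (adj (s y)) (s y)) (%c. S c i) b = (SUM c<n. (if b = c then 1 else 0) * S c i)"
  unfolding mv_def by (rule sum_eqI) (simp add: unirep_unitary(2)[OF s y b])
  thus "mv n (mm n (adj (s y)) (s y)) (%c. S c i) b = S b i"
  using b by (simp add: if_distrib[of "%x. x * _"] cong: if_cong)
  qed
  also have "... = Y i j" unfolding Y_def ip_def by (simp only: mult.commute)
  finally show ?thesis by simp
 qed
 have YY: "Y i j = (if i = j then of_real c else 0)" if ij: "i < d k" "j < d k" for i j
 proof -
  have "Y i j = (LINT y|M. Y i j)" by (simp add: prob_space)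
  also have "... = (LINT y|M. (SUM m<d k. SUM l<d k. Y m l * (\<pi> k y l j * cnj (\<pi> k y m i))))"
  by (rule integral_eqI, rule Yy[OF _ ij]) (simp add: space_M)
  also have "... = (SUM m<d k. LINT y|M. (SUM l<d k. Y m l * (\<pi> k y l j * cnj (\<pi> k y m i))))"
  by (intro integral_sum_cont cintros continuous_on_rep ij) auto
  also have "... = (SUM m<d k. SUM l<d k. LINT y|M. Y m l * (\<pi> k y l j * cnj (\<pi> k y m i)))"
  by (rule sum_eqI, intro integral_sum_cont cintros continuous_on_rep ij) auto
  also have "... = (SUM m<d k. SUM l<d k. if l = m then (if i = j then Y m m / of_nat (d k) else 0) else 0)"
  by (intro sum.cong refl) (use ij in \<open>auto simp: schurD(3)[OF schur_UNIV]\<close>)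
  also have "... = (SUM m<d k. if i = j then Y m m / of_nat (d k) else 0)" by (intro sum.cong refl) simp
  also have "... = (if i = j then (SUM m<d k. Y m m) / of_nat (d k) else 0)" by (simp add: sum_divide_distrib)
  also have "(SUM m<d k. Y m m) = of_real (SUM m<d k. SUM a<n. (cmod (S a m))^2)"
  unfolding Y_def by (simp only: of_real_sum complex_norm_square mult.commute)
  finally show ?thesis unfolding c_def by simp
 qed
 have c: "c > 0"
 proof -
  have "0 < (cmod (S 0 i0))^2" using k(3) by (simp add: S_def)
  also have "... <= (SUM a<n. (cmod (S a i0))^2)" using n0 by (intro member_le_sum) auto
  also have "... <= (SUM m<d k. SUM a<n. (cmod (S a m))^2)" using k(1) by (intro member_le_sum) (auto intro: sum_nonneg)
  finally show ?thesis using dim_pos[of k] by (simp add: c_def)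
 qed
 define U where "U = (%a i. of_real (inverse (sqrt c)) * S a i)"
 have UU: "(SUM a<n. cnj (U a i) * U a j) = (if i = j then 1 else 0)" if ij: "i < d k" "j < d k" for i j
 proof -
  have "(SUM a<n. cnj (U a i) * U a j) = of_real (inverse (sqrt c) * inverse (sqrt c)) * Y i j"
  unfolding U_def Y_def sum_distrib_left by (intro sum.cong refl) (simp add: mult_ac)
  also have "inverse (sqrt c) * inverse (sqrt c) = inverse c" using c by (simp flip: inverse_mult_distrib)
  finally show ?thesis using YY[OF ij] c by simp
 qed
 have Ui: "(SUM c<n. s y a c * U c i) = (SUM m<d k. U a m * \<pi> k y m i)" if "y : carrier G" "a < n" "i < d k" for y a i
 proof -
  have "(SUM c<n. s y a c * U c i) = of_real (inverse (sqrt c)) * (SUM c<n. s y a c * S c i)"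
  unfolding U_def sum_distrib_left by (intro sum.cong refl) (simp only: mult_ac)
  also have "... = (SUM m<d k. U a m * \<pi> k y m i)"
  unfolding S[OF that] unfolding U_def sum_distrib_left by (intro sum.cong refl) (simp only: mult_ac)
  finally show ?thesis .
 qed
 define W where "W = (%v. Matrix.vec n (%a. SUM i<d k. U a i * v i)) ` (UNIV :: (nat => complex) set)"
 have "W = carrier_vec n"
 proof -
  have sub: "VectorSpace.subspace class_ring W (module_vec TYPE(complex) n)"
  unfolding subspace_module_vec_iff
  proof (intro conjI ballI allI)
  show "W \<subseteq> carrier_vec n" by (auto simp: W_def)
  show "0\<^sub>v n : W" unfolding W_def by (rule image_eqI[of _ _ "%_. 0"]) (auto intro: eq_vecI)
  fix u assume "u : W"
  then obtain u' where u: "u = Matrix.vec n (%a. SUM i<d k. U a i * u' i)" by (auto simp: W_def)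
  show "c \<cdot>\<^sub>v u : W" for c unfolding W_def u
  by (rule image_eqI[of _ _ "%i. c * u' i"]) (auto intro!: eq_vecI simp: sum_distrib_left mult_ac)
  fix v assume "v : W"
  then obtain v' where v: "v = Matrix.vec n (%a. SUM i<d k. U a i * v' i)" by (auto simp: W_def)
  show "u + v : W" unfolding W_def u v
  by (rule image_eqI[of _ _ "%i. u' i + v' i"]) (auto intro!: eq_vecI simp: distrib_left sum.distrib)
  qed
  have inv: "rh x *\<^sub>v w : W" if x: "x : carrier G" and "w : W" for x w
  proof -
  obtain v where w: "w = Matrix.vec n (%a. SUM i<d k. U a i * v i)" using \<open>w : W\<close> by (auto simp: W_def)
  show ?thesis unfolding W_def
  proof (rule image_eqI[of _ _ "mv (d k) (\<pi> k x) v"])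
  show "rh x *\<^sub>v w = Matrix.vec n (%a. SUM i<d k. U a i * mv (d k) (\<pi> k x) v i)"
  proof (rule eq_vecI)
  fix a assume "a < dim_vec (Matrix.vec n (%a. SUM i<d k. U a i * mv (d k) (\<pi> k x) v i))"
  hence a: "a < n" by simp
  have "vec_index (rh x *\<^sub>v w) a = (SUM c<n. s x a c * (SUM i<d k. U c i * v i))"
  using a by (simp add: rhs[OF x] w scalar_prod_def atLeast0LessThan)
  also have "... = (SUM c<n. SUM i<d k. s x a c * U c i * v i)" by (simp add: sum_distrib_left mult.assoc)
  also have "... = (SUM i<d k. SUM c<n. s x a c * U c i * v i)" by (rule sum.swap)
  also have "... = (SUM i<d k. (SUM m<d k. U a m * \<pi> k x m i) * v i)"
  by (rule sum_eqI) (simp add: Ui[OF x a, symmetric] sum_distrib_right)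
  also have "... = (SUM i<d k. SUM m<d k. U a m * (\<pi> k x m i * v i))" by (simp add: sum_distrib_right mult.assoc)
  also have "... = (SUM m<d k. SUM i<d k. U a m * (\<pi> k x m i * v i))" by (rule sum.swap)
  also have "... = (SUM i<d k. U a i * mv (d k) (\<pi> k x) v i)" by (simp add: mv_def sum_distrib_left)
  finally show "vec_index (rh x *\<^sub>v w) a = vec_index (Matrix.vec n (%a. SUM i<d k. U a i * mv (d k) (\<pi> k x) v i)) a"
  using a by simp
  qed (simp add: rhs[OF x])
  qed simp
  qed
  have "W ~= {0\<^sub>v n}"
  proof
  assume W0: "W = {0\<^sub>v n}"
  have "U a i0 = 0" if "a < n" for a
  proof -
  have "Matrix.vec n (%a. SUM i<d k. U a i * (if i = i0 then 1 else 0)) : W" unfolding W_def by (rule rangeI)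
  hence "vec_index (Matrix.vec n (%a. SUM i<d k. U a i * (if i = i0 then 1 else 0))) a = 0"
  using W0 that by simp
  thus ?thesis using that k(1) by (simp add: if_distrib[of "%x. U a _ * x"] cong: if_cong)
  qed
  thus False using UU[OF k(1) k(1)] by simp
  qed
  moreover have "W = {0\<^sub>v n} | W = carrier_vec n"
  using irr[unfolded irreducible_rep_def n_def[symmetric], THEN conjunct2, THEN spec[of _ W]]
  by (rule mp) (intro conjI ballI sub inv)
  ultimately show ?thesis by simp
 qed
 have UU': "(SUM i<d k. U a i * cnj (U b i)) = (if a = b then 1 else 0)" if ab: "a < n" "b < n" for a b
 proof -
  have "Matrix.vec n (%a. if a = b then 1 else 0 :: complex) : W" using \<open>W = carrier_vec n\<close> by simp
  then obtain v where "Matrix.vec n (%a. if a = b then 1 else 0 :: complex) = Matrix.vec n (%a. SUM i<d k. U a i * v i)"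
  by (auto simp: W_def)
  hence v: "(SUM i<d k. U a i * v i) = (if a = b then 1 else 0)" if "a < n" for a
  proof -
  have "vec_index (Matrix.vec n (%a. if a = b then 1 else 0 :: complex)) a = vec_index (Matrix.vec n (%a. SUM i<d k. U a i * v i)) a"
  using \<open>Matrix.vec n (%a. if a = b then 1 else 0 :: complex) = Matrix.vec n (%a. SUM i<d k. U a i * v i)\<close> by (simp only:)
  thus ?thesis using that by simp
  qed
  have "cnj (U b i) = v i" if i: "i < d k" for i
  proof -
  have "cnj (U b i) = (SUM a<n. cnj (U a i) * (if a = b then 1 else 0))"
  using ab by (simp add: if_distrib[of "%x. cnj (U _ i) * x"] cong: if_cong)
  also have "... = (SUM a<n. SUM j<d k. cnj (U a i) * U a j * v j)"
  by (intro sum.cong refl) (simp add: v[symmetric] sum_distrib_left mult.assoc)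
  also have "... = (SUM j<d k. (SUM a<n. cnj (U a i) * U a j) * v j)" by (subst sum.swap) (simp add: sum_distrib_right)
  also have "... = (SUM j<d k. (if i = j then 1 else 0) * v j)" by (rule sum_eqI) (simp add: UU[OF i])
  also have "... = v i" using i by (simp add: if_distrib[of "%x. x * _"] cong: if_cong)
  finally show ?thesis .
  qed
  thus ?thesis using v[OF ab(1)] by simp
 qed
 have dn: "d k = n"
 proof -
  have "complex_of_nat n = (SUM a<n. SUM i<d k. U a i * cnj (U a i))" by (simp add: UU')
  also have "... = (SUM i<d k. SUM a<n. cnj (U a i) * U a i)" by (subst sum.swap) (simp only: mult.commute)
  also have "... = complex_of_nat (d k)" by (simp add: UU)
  finally show ?thesis by (simp only: of_nat_eq_iff)
 qed
 have "equivalent_reps G (repmat k) rh"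
  unfolding equivalent_reps_def
 proof (intro conjI exI[of _ "fmat n U"] ballI)
  show "rep_dim G (repmat k) = rep_dim G rh" using dn by (simp add: rep_dim_def n_def[symmetric] flip: n_def) (simp add: n_def rep_dim_def)
  have "unitary_mat n (fmat n U)" unfolding unitary_mat_fmat using UU UU' dn by (simp add: mm_def adj_def)
  thus "unitary_mat (rep_dim G (repmat k)) (fmat n U)" using dn by (simp add: rep_dim_def)
  show "fmat n U * repmat k x = rh x * fmat n U" if x: "x : carrier G" for x
  unfolding rhs[OF x] dn fmat_mult using Ui[OF x] dn by (intro fmat_eqI) (simp add: mm_def)
 qed
 thus ?thesis by blast
qed

end

context haar_group
begin

lemma equivalent_reps_refl:
 assumes "\<pi>' : irreps G (top_of_set (carrier G))"
 shows "equivalent_reps G \<pi>' \<pi>'"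
proof -
 let ?n = "rep_dim G \<pi>'"
 have u: "unitary_mat ?n (\<pi>' x)" if "x : carrier G" for x
  using assms that by (simp add: irreps_def unitary_rep_def)
 have I: "(1\<^sub>m ?n :: complex mat) = fmat ?n (%i j. if i = j then 1 else 0)" by (intro eq_matI) auto
 have "unitary_mat ?n (1\<^sub>m ?n)"
  unfolding I unitary_mat_fmat by (simp add: mm_id adj_def if_distrib[of cnj])
 moreover have "1\<^sub>m ?n * \<pi>' x = \<pi>' x * 1\<^sub>m ?n" if "x : carrier G" for x
  using left_mult_one_mat[OF unitary_matD(1)[OF u[OF that]]] right_mult_one_mat[OF unitary_matD(1)[OF u[OF that]]] by simp
 ultimately show ?thesis unfolding equivalent_reps_def by (intro conjI refl exI[of _ "1\<^sub>m ?n"] ballI)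
qed

lemma equivalent_reps_sym:
 assumes "\<pi>' : irreps G (top_of_set (carrier G))" "rh : irreps G (top_of_set (carrier G))"
  and "equivalent_reps G \<pi>' rh"
 shows "equivalent_reps G rh \<pi>'"
proof -
 define n where "n = rep_dim G \<pi>'"
 obtain S where n: "rep_dim G rh = n" and S: "unitary_mat n S" and e: "!!x. x : carrier G ==> S * \<pi>' x = rh x * S"
  using assms(3) unfolding equivalent_reps_def n_def by auto
 have u: "unitary_mat n (\<pi>' x)" "unitary_mat n (rh x)" if "x : carrier G" for x
  using assms that n by (simp_all add: irreps_def unitary_rep_def n_def)
 note U = unitary_matD[OF S]
 have aa: "mat_adjoint (mat_adjoint S) = S" by (subst (1 2) U(5)) (simp add: fmat_adjoint adj_adj)
 have "mat_adjoint S * rh x = \<pi>' x * mat_adjoint S" if x: "x : carrier G" for x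
 proof -
  note P = unitary_matD(1)[OF u(1)[OF x]] and R = unitary_matD(1)[OF u(2)[OF x]]
  have "mat_adjoint S * rh x = (mat_adjoint S * rh x) * (S * mat_adjoint S)"
  unfolding U(2) using U(4) R by simp
  also have "... = mat_adjoint S * (rh x * S) * mat_adjoint S"
  using U(1,4) R by (simp add: assoc_mult_mat[of _ n n _ n _ n] mult_carrier_mat[of _ n n _ n])
  also have "... = mat_adjoint S * (S * \<pi>' x) * mat_adjoint S" by (simp only: e[OF x])
  also have "... = (mat_adjoint S * S) * \<pi>' x * mat_adjoint S"
  using U(1,4) P by (simp add: assoc_mult_mat[of _ n n _ n _ n] mult_carrier_mat[of _ n n _ n])
  also have "... = \<pi>' x * mat_adjoint S" unfolding U(3) using P by simp
  finally show ?thesis .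
 qed
 moreover have "unitary_mat n (mat_adjoint S)" unfolding unitary_mat_def aa using U by simp
 ultimately show ?thesis unfolding equivalent_reps_def n n_def[symmetric] by blast
qed

lemma equivalent_reps_trans:
 assumes "\<pi>' : irreps G (top_of_set (carrier G))" "rh : irreps G (top_of_set (carrier G))" "sg : irreps G (top_of_set (carrier G))"
  and "equivalent_reps G \<pi>' rh" "equivalent_reps G rh sg"
 shows "equivalent_reps G \<pi>' sg"
proof -
 define n where "n = rep_dim G \<pi>'"
 obtain S where n: "rep_dim G rh = n" and S: "unitary_mat n S" and e: "!!x. x : carrier G ==> S * \<pi>' x = rh x * S"
  using assms(4) unfolding equivalent_reps_def n_def by auto
 obtain T where n': "rep_dim G sg = n" and T: "unitary_mat n T" and e': "!!x. x : carrier G ==> T * rh x = sg x * T"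
  using assms(5) n unfolding equivalent_reps_def by auto
 have u: "unitary_mat n (\<pi>' x)" "unitary_mat n (rh x)" "unitary_mat n (sg x)" if "x : carrier G" for x
  using assms that n n' by (simp_all add: irreps_def unitary_rep_def n_def)
 note U = unitary_matD[OF S] and V = unitary_matD[OF T]
 have "(T * S) * \<pi>' x = sg x * (T * S)" if x: "x : carrier G" for x
 proof -
  note P = unitary_matD(1)[OF u(1)[OF x]] and R = unitary_matD(1)[OF u(2)[OF x]] and Q = unitary_matD(1)[OF u(3)[OF x]]
  have "(T * S) * \<pi>' x = T * (S * \<pi>' x)" by (rule assoc_mult_mat[OF V(1) U(1) P])
  also have "... = (T * rh x) * S" unfolding e[OF x] by (rule assoc_mult_mat[OF V(1) R U(1), symmetric])
  also have "... = sg x * (T * S)" unfolding e'[OF x] by (rule assoc_mult_mat[OF Q V(1) U(1)])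
  finally show ?thesis .
 qed
 moreover have "unitary_mat n (T * S)"
 proof -
  have ST: "S = fmat n (%i j. S $$ (i, j))" "T = fmat n (%i j. T $$ (i, j))" by (rule U(5), rule V(5))
  define A where "A = (%i j. S $$ (i, j))"
  define B where "B = (%i j. T $$ (i, j))"
  have "adj (mm n B A) = mm n (adj A) (adj B)" by (simp add: adj_def mm_def mult.commute)
  hence ad: "mat_adjoint (T * S) = mat_adjoint S * mat_adjoint T"
  using ST unfolding A_def[symmetric] B_def[symmetric] by (simp add: fmat_mult fmat_adjoint)
  have "(T * S) * (mat_adjoint S * mat_adjoint T) = T * (S * mat_adjoint S) * mat_adjoint T"
  using U(1,4) V(1,4) by (simp add: assoc_mult_mat[of _ n n _ n _ n] mult_carrier_mat[of _ n n _ n])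
  also have "... = 1\<^sub>m n" unfolding U(2) using V by simp
  finally have 1: "(T * S) * (mat_adjoint S * mat_adjoint T) = 1\<^sub>m n" .
  have "(mat_adjoint S * mat_adjoint T) * (T * S) = mat_adjoint S * (mat_adjoint T * T) * S"
  using U(1,4) V(1,4) by (simp add: assoc_mult_mat[of _ n n _ n _ n] mult_carrier_mat[of _ n n _ n])
  also have "... = 1\<^sub>m n" unfolding V(3) using U by simp
  finally show ?thesis unfolding unitary_mat_def ad using 1 U V by (auto intro: mult_carrier_mat)
 qed
 ultimately show ?thesis unfolding equivalent_reps_def n' n_def[symmetric] by blast
qed

end

context peter_weyl
begin

abbreviation eqv where
 "eqv \<equiv> {(\<pi>', rh). \<pi>' : irreps G (top_of_set (carrier G)) & rh : irreps G (top_of_set (carrier G)) & equivalent_reps G \<pi>' rh}"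

definition cls :: "nat => ('g => complex mat) set" where
 "cls k = eqv `` {repmat k}"

lemma repmat_inequivalent:
 assumes "equivalent_reps G (repmat k) (repmat l)"
 shows "k = l"
proof (rule ccontr)
 assume kl: "k ~= l"
 obtain S where dd: "d k = d l" and S: "unitary_mat (d l) S" and e: "!!x. x : carrier G ==> S * repmat k x = repmat l x * S"
  using assms unfolding equivalent_reps_def by (auto simp: rep_dim_def)
 define A where "A = (%i j. S $$ (i, j))"
 have SA: "S = fmat (d l) A" unfolding A_def by (rule unitary_matD(5)[OF S])
 have "A i j = 0" if ij: "i < d l" "j < d l" for i j
 proof -
  have eq: "(SUM c<d l. A c j * \<pi> l x i c) = (SUM c<d l. A i c * \<pi> k x c j)" if x: "x : carrier G" for x
  proof -
  have "fmat (d l) (mm (d l) A (\<pi> k x)) $$ (i, j) = fmat (d l) (mm (d l) (\<pi> l x) A) $$ (i, j)"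
  using e[OF x] unfolding SA dd fmat_mult by simp
  thus ?thesis using ij by (simp add: mm_def mult.commute)
  qed
  have "(LINT x|M. (SUM c<d l. A c j * \<pi> l x i c) * cnj (\<pi> l x i i)) = (SUM c<d l. LINT x|M. A c j * (\<pi> l x i c * cnj (\<pi> l x i i)))"
  unfolding sum_distrib_right mult.assoc by (intro integral_sum_cont cintros continuous_on_rep ij) auto
  also have "... = (SUM c<d l. A c j * (if c = i then 1 / of_nat (d l) else 0))"
  using ij by (intro sum.cong refl) (simp add: schurD(3)[OF schur_UNIV])
  also have "... = A i j / of_nat (d l)"
  using ij by (simp only: sum_delta_mult finite_lessThan lessThan_iff) simp
  finally have 1: "(LINT x|M. (SUM c<d l. A c j * \<pi> l x i c) * cnj (\<pi> l x i i)) = A i j / of_nat (d l)" .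
  have "(LINT x|M. (SUM c<d l. A i c * \<pi> k x c j) * cnj (\<pi> l x i i)) = (SUM c<d l. LINT x|M. A i c * (\<pi> k x c j * cnj (\<pi> l x i i)))"
  unfolding sum_distrib_right mult.assoc by (intro integral_sum_cont cintros continuous_on_rep ij) (use ij dd in auto)
  also have "... = 0"
  using ij kl dd by (intro sum.neutral) (simp add: schurD(3)[OF schur_UNIV])
  finally have 2: "(LINT x|M. (SUM c<d l. A i c * \<pi> k x c j) * cnj (\<pi> l x i i)) = 0" .
  have "(LINT x|M. (SUM c<d l. A c j * \<pi> l x i c) * cnj (\<pi> l x i i)) = (LINT x|M. (SUM c<d l. A i c * \<pi> k x c j) * cnj (\<pi> l x i i))"
  by (rule integral_eqI) (simp add: eq space_M)
  thus ?thesis using 1 2 dim_pos[of l] by simp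
 qed
 hence "mm (d l) A (adj A) 0 0 = 0" using dim_pos[of l] by (simp add: mm_def)
 moreover have "mm (d l) A (adj A) 0 0 = 1" using S dim_pos[of l] unfolding SA unitary_mat_fmat by simp
 ultimately show False by simp
qed

lemma cls_bij: "bij_betw cls UNIV (dual_object G (top_of_set (carrier G)))"
 unfolding bij_betw_def
proof
 have mem: "repmat k : cls k" for k
  unfolding cls_def using repmat_irrep[of k] equivalent_reps_refl[OF repmat_irrep[of k]] by simp
 show "inj cls"
 proof (rule injI)
  fix k l assume "cls k = cls l"
  hence "repmat l : cls k" using mem[of l] by simp
  thus "k = l" unfolding cls_def by (intro repmat_inequivalent) simp
 qed
 show "range cls = dual_object G (top_of_set (carrier G))"
 proof (intro equalityI subsetI)
  fix c assume "c : range cls"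
  then obtain k where "c = cls k" by blast
  thus "c : dual_object G (top_of_set (carrier G))"
  unfolding dual_object_def cls_def using quotientI[OF repmat_irrep[of k], of eqv] by simp
 next
  fix c assume "c : dual_object G (top_of_set (carrier G))"
  then obtain sg where sg: "sg : irreps G (top_of_set (carrier G))" "c = eqv `` {sg}"
  unfolding dual_object_def by (rule quotientE) blast
  obtain k where k: "equivalent_reps G (repmat k) sg" using irrep_equivalent[OF sg(1)] by blast
  note k' = equivalent_reps_sym[OF repmat_irrep sg(1) k]
  have "(sg, rh) : eqv \<longleftrightarrow> (repmat k, rh) : eqv" for rh
  using equivalent_reps_trans[OF repmat_irrep[of k] sg(1) _ k, of rh] equivalent_reps_trans[OF sg(1) repmat_irrep[of k] _ k', of rh]
  sg(1) repmat_irrep[of k] by auto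
  hence "c = cls k" unfolding sg(2) cls_def Image_singleton by simp
  thus "c : range cls" by simp
 qed
qed

lemma fourier_term_cls:
 assumes f: "cont_on G f"
 shows "fourier_term G (top_of_set (carrier G)) f (cls k) = ft f k"
proof -
 define rh where "rh = representative (cls k)"
 have "repmat k : cls k"
  unfolding cls_def using repmat_irrep[of k] equivalent_reps_refl[OF repmat_irrep[of k]] by simp
 hence "rh : cls k" unfolding rh_def representative_def by (rule someI[of "%p. p : cls k"])
 hence rh: "rh : irreps G (top_of_set (carrier G))" "equivalent_reps G (repmat k) rh" by (simp_all add: cls_def)
 define n where "n = d k"
 obtain S where dd: "rep_dim G rh = n" and S: "unitary_mat n S" and e: "!!x. x : carrier G ==> S * repmat k x = rh x * S"
  using rh(2) unfolding equivalent_reps_def n_def by (auto simp: rep_dim_def)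
 define A where "A = (%i j. S $$ (i, j))"
 have SA: "S = fmat n A" unfolding A_def by (rule unitary_matD(5)[OF S])
 have A: "!!i j. i < n ==> j < n ==> mm n A (adj A) i j = (if i = j then 1 else 0)"
  "!!i j. i < n ==> j < n ==> mm n (adj A) A i j = (if i = j then 1 else 0)"
  using S unfolding SA unitary_mat_fmat by simp_all
 have rhe: "rh x $$ (i, j) = mm n (mm n A (\<pi> k x)) (adj A) i j" if x: "x : carrier G" and ij: "i < n" "j < n" for x i j
 proof -
  have ux: "unitary_mat n (rh x)" using rh(1) x dd by (simp add: irreps_def unitary_rep_def)
  define R where "R = (%i j. rh x $$ (i, j))"
  have Rx: "rh x = fmat n R" unfolding R_def by (rule unitary_matD(5)[OF ux])
  have "fmat n (mm n A (\<pi> k x)) = fmat n (mm n R A)" using e[OF x] unfolding SA Rx n_def[symmetric] fmat_mult .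
  hence m: "mm n A (\<pi> k x) i j = mm n R A i j" if "i < n" "j < n" for i j using that by (metis fmat_index)
  have "mm n (mm n A (\<pi> k x)) (adj A) i j = mm n (mm n R A) (adj A) i j" by (rule mm_cong) (simp_all add: m ij)
  also have "... = mm n R (mm n A (adj A)) i j" by (simp add: mm_assoc)
  also have "... = R i j" by (rule mm_id(2)[OF A(1) ij(2)])
  finally show ?thesis by (simp add: R_def)
 qed
 define V where "V = (%i j. cnj (A i j))"
 have coeff: "(LINT x|M. f x * cnj (rh x $$ (i, j))) = mm n (mm n V (fc f k)) (adj V) i j" if ij: "i < n" "j < n" for i j
 proof -
  have "(LINT x|M. f x * cnj (rh x $$ (i, j))) = (LINT x|M. (SUM b<n. SUM a<n. (V i a * A j b) * (f x * cnj (\<pi> k x a b))))"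
  proof (rule integral_eqI)
  fix x assume "x : space M"
  hence x: "x : carrier G" by (simp add: space_M)
  show "f x * cnj (rh x $$ (i, j)) = (SUM b<n. SUM a<n. (V i a * A j b) * (f x * cnj (\<pi> k x a b)))"
  unfolding rhe[OF x ij] mm_def adj_def V_def cnj_sum complex_cnj_mult complex_cnj_cnj sum_distrib_left sum_distrib_right
  by (intro sum.cong refl) (simp only: mult_ac)
  qed
  also have "... = (SUM b<n. LINT x|M. (SUM a<n. (V i a * A j b) * (f x * cnj (\<pi> k x a b))))"
  by (intro integral_sum_cont cintros continuous_on_rep f) (auto simp: n_def)
  also have "... = (SUM b<n. SUM a<n. LINT x|M. (V i a * A j b) * (f x * cnj (\<pi> k x a b)))"
  by (rule sum_eqI, intro integral_sum_cont cintros continuous_on_rep f) (auto simp: n_def)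
  also have "... = (SUM b<n. SUM a<n. (V i a * A j b) * fc f k a b)" unfolding fc_def by simp
  also have "... = mm n (mm n V (fc f k)) (adj V) i j"
  unfolding mm_def adj_def V_def sum_distrib_right complex_cnj_cnj by (intro sum.cong refl) (simp only: mult_ac)
  finally show ?thesis .
 qed
 have "fourier_coeff G (top_of_set (carrier G)) f rh = fmat n (mm n (mm n V (fc f k)) (adj V))"
  unfolding fourier_coeff_def haar_measure_eq dd by (rule eq_matI) (simp_all add: coeff)
 hence "fourier_term G (top_of_set (carrier G)) f (cls k) = real n * tnorm n (mm n (mm n V (fc f k)) (adj V))"
  unfolding fourier_term_def rh_def[symmetric] dd tnorm_def by simp
 also have "tnorm n (mm n (mm n V (fc f k)) (adj V)) = tnorm n (fc f k)"
 proof (rule tnorm_conjugate)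
  fix i j assume ij: "i < n" "j < n"
  have "mm n (adj V) V i j = cnj (mm n (adj A) A i j)" "mm n V (adj V) i j = cnj (mm n A (adj A) i j)"
  unfolding mm_def adj_def V_def cnj_sum by (simp_all add: mult.commute)
  thus "mm n (adj V) V i j = (if i = j then 1 else 0)" "mm n V (adj V) i j = (if i = j then 1 else 0)"
  using A ij by simp_all
 qed
 finally show ?thesis by (simp add: ft_def n_def)
qed

lemma has_sum_ft:
 assumes "summable (ft f)"
 shows "infsum (ft f) UNIV = suminf (ft f)"
 using sums_nonneg_imp_has_sum[OF summable_sums[OF assms] ft_ge_0] by (rule infsumI)

theorem fourier_algebra_iff:
 "f : fourier_algebra G (top_of_set (carrier G)) \<longleftrightarrow> (ALL x. x ~: carrier G --> f x = 0) & (EX r. f : Conv G r)"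
proof -
 have "(EX r. f : Conv G r) \<longleftrightarrow> cont_on G f & summable (ft f)"
 proof
  assume "EX r. f : Conv G r"
  then obtain r where "f : Conv G r" by blast
  thus "cont_on G f & summable (ft f)"
  unfolding Conv_iff_sum_ft using summableI_nonneg_bounded[of "ft f" r] ft_ge_0 by blast
 next
  assume *: "cont_on G f & summable (ft f)"
  hence "f : Conv G (suminf (ft f))"
  unfolding Conv_iff_sum_ft using sum_le_suminf[of "ft f"] ft_ge_0 by simp
  thus "EX r. f : Conv G r" by blast
 qed
 moreover have "fourier_term G (top_of_set (carrier G)) f summable_on dual_object G (top_of_set (carrier G)) \<longleftrightarrow> summable (ft f)"
  if "cont_on G f"
  using summable_on_reindex_bij_betw[OF cls_bij, of "fourier_term G (top_of_set (carrier G)) f"]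
  summable_on_UNIV_nonneg_real_iff[of "ft f", OF ft_ge_0] fourier_term_cls[OF that] by simp
 ultimately show ?thesis unfolding fourier_algebra_def mem_Collect_eq continuous_map_iff_continuous by metis
qed

theorem fourier_norm_le_iff:
 assumes "f : fourier_algebra G (top_of_set (carrier G))"
 shows "fourier_norm G (top_of_set (carrier G)) f <= r \<longleftrightarrow> f : Conv G r"
proof -
 obtain r' where r': "f : Conv G r'" using assms unfolding fourier_algebra_iff by blast
 have f: "cont_on G f" by (rule Conv_continuous[OF r'])
 have sm: "summable (ft f)"
  using r' unfolding Conv_iff_sum_ft using summableI_nonneg_bounded[of "ft f" r'] ft_ge_0 by blast
 have "fourier_norm G (top_of_set (carrier G)) f = suminf (ft f)"
  unfolding fourier_norm_def using infsum_reindex_bij_betw[OF cls_bij, of "fourier_term G (top_of_set (carrier G)) f"]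
  fourier_term_cls[OF f] has_sum_ft[OF sm] by simp
 moreover have "suminf (ft f) <= r \<longleftrightarrow> (ALL N. (SUM k<N. ft f k) <= r)"
 proof
  assume "suminf (ft f) <= r"
  thus "ALL N. (SUM k<N. ft f k) <= r"
  using sum_le_suminf[OF sm, of "{..<_}"] ft_ge_0 by (meson finite_lessThan order_trans)
 next
  assume "ALL N. (SUM k<N. ft f k) <= r"
  thus "suminf (ft f) <= r" by (intro suminf_le_const[OF sm]) simp
 qed
 ultimately show ?thesis unfolding Conv_iff_sum_ft using f by simp
qed

end

section \<open>Products and powers of compact groups\<close>

lemma peter_weyl_iff:
 "peter_weyl G M d \<pi> \<longleftrightarrow> haar_group G M & haar_group.schur G M UNIV d \<pi> &
  (ALL f x. cont_on G f -->
  (ALL k i j. i < d k --> j < d k --> (LINT x|M. f x * cnj (\<pi> k x i j)) = 0) --> x : carrier G --> f x = 0)"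
 by (simp only: peter_weyl_def peter_weyl_axioms_def)

lemma unirep_DirProd:
 assumes G: "Group.group G" "Group.group H" and s: "unirep G d s" and t: "unirep H e t"
 shows "unirep (G \<times>\<times> H) (d * e) (%p. ktensor e (s (fst p)) (t (snd p)))"
 unfolding unirep_def
proof (intro conjI ballI allI impI)
 fix a b assume ab: "a < d * e" "b < d * e"
 note [simp] = index_split[OF ab(1)] index_split[OF ab(2)]
 { fix x y assume "x : carrier (G \<times>\<times> H)" "y : carrier (G \<times>\<times> H)"
  thus "ktensor e (s (fst (x \<otimes>\<^bsub>G \<times>\<times> H\<^esub> y))) (t (snd (x \<otimes>\<^bsub>G \<times>\<times> H\<^esub> y))) a b =
  mm (d * e) (ktensor e (s (fst x)) (t (snd x))) (ktensor e (s (fst y)) (t (snd y))) a b"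
  unfolding mm_ktensor[OF ab] by (auto simp add: ktensor_def mult_DirProd' unirepD(1)[OF s] unirepD(1)[OF t]) }
 { fix x assume "x : carrier (G \<times>\<times> H)"
  then obtain g h where x: "x = (g, h)" "g : carrier G" "h : carrier H" by auto
  have "inv\<^bsub>G \<times>\<times> H\<^esub> x = (inv\<^bsub>G\<^esub> g, inv\<^bsub>H\<^esub> h)" unfolding x(1) by (rule inv_DirProd[OF G x(2,3)])
  thus "ktensor e (s (fst (inv\<^bsub>G \<times>\<times> H\<^esub> x))) (t (snd (inv\<^bsub>G \<times>\<times> H\<^esub> x))) a b =
  cnj (ktensor e (s (fst x)) (t (snd x)) b a)"
  using x by (simp add: ktensor_def unirepD(2)[OF s] unirepD(2)[OF t]) }
 show "ktensor e (s (fst \<one>\<^bsub>G \<times>\<times> H\<^esub>)) (t (snd \<one>\<^bsub>G \<times>\<times> H\<^esub>)) a b = (if a = b then 1 else 0)"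
 proof -
  have "a = b \<longleftrightarrow> a div e = b div e & a mod e = b mod e" by (metis div_mult_mod_eq)
  thus ?thesis by (simp add: ktensor_def unirepD(3)[OF s] unirepD(3)[OF t])
 qed
 show "cont_on (G \<times>\<times> H) (%p. ktensor e (s (fst p)) (t (snd p)) a b)"
  unfolding ktensor_def
  by (intro continuous_on_mult continuous_on_compose2[OF unirepD(4)[OF s]] continuous_on_compose2[OF unirepD(4)[OF t]] cintros)
  auto
qed

lemma haar_group_DirProd:
 assumes "haar_group G M" "haar_group H N"
 shows "haar_group (G \<times>\<times> H) (M \<Otimes>\<^sub>M N)"
proof -
 interpret G: haar_group G M by fact
 interpret H: haar_group H N by fact
 interpret GH: Group.group "G \<times>\<times> H" by (rule DirProd_group) unfold_locales
 have sets: "sets (M \<Otimes>\<^sub>M N) = sets (restrict_space borel (carrier G \<times> carrier H))"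
  by (rule sets_pair_restrict_borel[OF G.sets_M H.sets_M])
 have gg: "Group.group G" "Group.group H" by unfold_locales
 show ?thesis
 proof
  show "compact (carrier (G \<times>\<times> H))" by (simp add: compact_Times G.compact_carrier H.compact_carrier)
  have 1: "continuous_on (carrier (G \<times>\<times> H) \<times> carrier (G \<times>\<times> H)) (%p. fst (fst p) \<otimes>\<^bsub>G\<^esub> fst (snd p))"
  by (rule G.continuous_on_mult2) (auto intro!: cintros)
  have 2: "continuous_on (carrier (G \<times>\<times> H) \<times> carrier (G \<times>\<times> H)) (%p. snd (fst p) \<otimes>\<^bsub>H\<^esub> snd (snd p))"
  by (rule H.continuous_on_mult2) (auto intro!: cintros)
  show "continuous_on (carrier (G \<times>\<times> H) \<times> carrier (G \<times>\<times> H)) (%p. fst p \<otimes>\<^bsub>G \<times>\<times> H\<^esub> snd p)"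
  unfolding mult_DirProd' by (rule continuous_on_Pair[OF 1 2])
  have "cont_on (G \<times>\<times> H) (%x. (inv\<^bsub>G\<^esub> (fst x), inv\<^bsub>H\<^esub> (snd x)))"
  by (intro continuous_on_Pair continuous_on_compose2[OF G.continuous_inv] continuous_on_compose2[OF H.continuous_inv] cintros) auto
  thus "cont_on (G \<times>\<times> H) (%x. inv\<^bsub>G \<times>\<times> H\<^esub> x)"
  by (rule continuous_on_eq) (auto simp: inv_DirProd[OF gg])
  show "sets (M \<Otimes>\<^sub>M N) = sets (restrict_space borel (carrier (G \<times>\<times> H)))" by (simp add: sets)
  have "emeasure (M \<Otimes>\<^sub>M N) (carrier G \<times> carrier H) = emeasure M (carrier G) * emeasure N (carrier H)"
  using sets.top[of M] sets.top[of N] by (intro H.emeasure_pair_measure_Times) (simp_all add: G.space_M H.space_M)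
  thus "emeasure (M \<Otimes>\<^sub>M N) (carrier (G \<times>\<times> H)) = 1" by (simp add: G.total_mass H.total_mass)
  fix x assume "x : carrier (G \<times>\<times> H)"
  then obtain g h where x: "x = (g, h)" "g : carrier G" "h : carrier H" by auto
  have mg: "(%y. g \<otimes>\<^bsub>G\<^esub> y) : measurable M M"
  using x by (auto intro!: G.measurable_cont_self G.continuous_on_translate)
  have mh: "(%y. h \<otimes>\<^bsub>H\<^esub> y) : measurable N N"
  using x by (auto intro!: H.measurable_cont_self H.continuous_on_translate)
  have sf: "sigma_finite_measure (distr N N (%y. h \<otimes>\<^bsub>H\<^esub> y))"
  unfolding H.left_invariant[OF x(3)] by unfold_locales
  have "M \<Otimes>\<^sub>M N = distr M M (%y. g \<otimes>\<^bsub>G\<^esub> y) \<Otimes>\<^sub>M distr N N (%y. h \<otimes>\<^bsub>H\<^esub> y)"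
  by (simp only: G.left_invariant[OF x(2)] H.left_invariant[OF x(3)])
  also have "... = distr (M \<Otimes>\<^sub>M N) (M \<Otimes>\<^sub>M N) (%(y, z). (g \<otimes>\<^bsub>G\<^esub> y, h \<otimes>\<^bsub>H\<^esub> z))"
  by (rule pair_measure_distr[OF mg mh sf])
  also have "(%(y, z). (g \<otimes>\<^bsub>G\<^esub> y, h \<otimes>\<^bsub>H\<^esub> z)) = (%y. x \<otimes>\<^bsub>G \<times>\<times> H\<^esub> y)"
  by (auto simp: x mult_DirProd')
  finally show "distr (M \<Otimes>\<^sub>M N) (M \<Otimes>\<^sub>M N) (%y. x \<otimes>\<^bsub>G \<times>\<times> H\<^esub> y) = M \<Otimes>\<^sub>M N" by simp
 qed
qed

lemma schur_DirProd:
 assumes "haar_group G M" "haar_group H N"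
  and s: "haar_group.schur G M A d s" and t: "haar_group.schur H N B e t"
  and inj: "!!k. k : F ==> p k : A & q k : B" "!!k l. k : F ==> l : F ==> p k = p l ==> q k = q l ==> k = l"
 shows "haar_group.schur (G \<times>\<times> H) (M \<Otimes>\<^sub>M N) F (%k. d (p k) * e (q k))
  (%k x. ktensor (e (q k)) (s (p k) (fst x)) (t (q k) (snd x)))"
proof -
 interpret G: haar_group G M by fact
 interpret H: haar_group H N by fact
 interpret GH: haar_group "G \<times>\<times> H" "M \<Otimes>\<^sub>M N" by (rule haar_group_DirProd) fact+
 note sD = G.schurD[OF s] and tD = H.schurD[OF t]
 show ?thesis unfolding GH.schur_def
 proof (intro conjI ballI allI impI)
  fix k assume k: "k : F"
  show "0 < d (p k) * e (q k)" using inj(1)[OF k] sD(1) tD(1) by simp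
  show "unirep (G \<times>\<times> H) (d (p k) * e (q k)) (%x. ktensor (e (q k)) (s (p k) (fst x)) (t (q k) (snd x)))"
  by (rule unirep_DirProd) (use inj(1)[OF k] sD(2) tD(2) G.is_group H.is_group in auto)
  fix l i j m n
  assume l: "l : F" and ij: "i < d (p k) * e (q k)" "j < d (p k) * e (q k)" and mn: "m < d (p l) * e (q l)" "n < d (p l) * e (q l)"
  define i1 i2 j1 j2 m1 m2 n1 n2 where "i1 = i div e (q k)" and "i2 = i mod e (q k)" and "j1 = j div e (q k)" and "j2 = j mod e (q k)"
  and "m1 = m div e (q l)" and "m2 = m mod e (q l)" and "n1 = n div e (q l)" and "n2 = n mod e (q l)"
  note defs = this
  have lt: "i1 < d (p k)" "i2 < e (q k)" "j1 < d (p k)" "j2 < e (q k)" "m1 < d (p l)" "m2 < e (q l)" "n1 < d (p l)" "n2 < e (q l)"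
  using index_split[OF ij(1)] index_split[OF ij(2)] index_split[OF mn(1)] index_split[OF mn(2)] by (simp_all add: defs)
  have pk: "p k : A" "q k : B" "p l : A" "q l : B" using inj(1) k l by simp_all
  let ?f = "%x. s (p k) x i1 j1 * cnj (s (p l) x m1 n1)" and ?g = "%y. t (q k) y i2 j2 * cnj (t (q l) y m2 n2)"
  have cf: "cont_on G ?f" by (intro cintros unirepD(4)[OF sD(2)] pk lt)
  have cg: "cont_on H ?g" by (intro cintros unirepD(4)[OF tD(2)] pk lt)
  have "(\<integral>x. ktensor (e (q k)) (s (p k) (fst x)) (t (q k) (snd x)) i j * cnj (ktensor (e (q l)) (s (p l) (fst x)) (t (q l) (snd x)) m n) \<partial>(M \<Otimes>\<^sub>M N))
  = (\<integral>x. ?f (fst x) * ?g (snd x) \<partial>(M \<Otimes>\<^sub>M N))"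
  unfolding ktensor_def by (simp add: defs mult_ac)
  also have "... = (LINT x|M. (LINT y|N. ?f (fst (x, y)) * ?g (snd (x, y))))"
  by (rule Fubini_continuous(2)[OF G.finite_measure_axioms G.sets_M H.finite_measure_axioms H.sets_M G.compact_carrier H.compact_carrier])
  (intro continuous_on_mult continuous_on_compose2[OF cf] continuous_on_compose2[OF cg] cintros, auto)
  also have "... = (LINT x|M. ?f x) * (LINT y|N. ?g y)" by simp
  also have "... = (if p k = p l & i1 = m1 & j1 = n1 then 1 / of_nat (d (p k)) else 0) * (if q k = q l & i2 = m2 & j2 = n2 then 1 / of_nat (e (q k)) else 0)"
  by (simp only: sD(3)[OF pk(1,3) lt(1,3,5,7)] tD(3)[OF pk(2,4) lt(2,4,6,8)])
  also have "... = (if k = l & i = m & j = n then 1 / of_nat (d (p k) * e (q k)) else 0)"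
  proof (cases "k = l")
  case True
  have "i = m \<longleftrightarrow> i1 = m1 & i2 = m2" "j = n \<longleftrightarrow> j1 = n1 & j2 = n2"
  unfolding defs True by (metis div_mult_mod_eq)+
  thus ?thesis using True by simp
  next
  case False
  hence "~ (p k = p l & q k = q l)" using inj(2)[OF k l] by blast
  thus ?thesis using False by auto
  qed
  finally show "(\<integral>x. ktensor (e (q k)) (s (p k) (fst x)) (t (q k) (snd x)) i j * cnj (ktensor (e (q l)) (s (p l) (fst x)) (t (q l) (snd x)) m n) \<partial>(M \<Otimes>\<^sub>M N))
  = (if k = l & i = m & j = n then 1 / of_nat (d (p k) * e (q k)) else 0)" .
 qed
qed

lemma peter_weyl_DirProd:
 assumes G: "peter_weyl G M d \<pi>" and H: "peter_weyl H N e rh"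
 shows "EX d' \<pi>'. peter_weyl (G \<times>\<times> H) (M \<Otimes>\<^sub>M N) d' \<pi>'"
proof -
 interpret G: peter_weyl G M d \<pi> by fact
 interpret H: peter_weyl H N e rh by fact
 have hg: "haar_group G M" "haar_group H N" by unfold_locales
 interpret GH: haar_group "G \<times>\<times> H" "M \<Otimes>\<^sub>M N" by (rule haar_group_DirProd) fact+
 define p q where "p = (%k. fst (prod_decode k))" and "q = (%k. snd (prod_decode k))"
 define D where "D = (%k. d (p k) * e (q k))"
 define sg where "sg = (%k x. ktensor (e (q k)) (\<pi> (p k) (fst x)) (rh (q k) (snd x)))"
 have sch: "GH.schur UNIV D sg"
  unfolding D_def sg_def
 proof (rule schur_DirProd[OF hg G.schur_UNIV H.schur_UNIV])
  fix k l assume "p k = p l" "q k = q l"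
  hence "prod_decode k = prod_decode l" by (simp add: p_def q_def prod_eq_iff)
  thus "k = l" by (simp add: prod_decode_eq)
 qed simp
 have "peter_weyl (G \<times>\<times> H) (M \<Otimes>\<^sub>M N) D sg"
  unfolding peter_weyl_iff
 proof (intro conjI allI impI)
  show "haar_group (G \<times>\<times> H) (M \<Otimes>\<^sub>M N)" by unfold_locales
  show "GH.schur UNIV D sg" by (rule sch)
  fix f z
  assume f: "cont_on (G \<times>\<times> H) f" and z: "z : carrier (G \<times>\<times> H)"
  and 0: "ALL k i j. i < D k --> j < D k --> (\<integral>x. f x * cnj (sg k x i j) \<partial>(M \<Otimes>\<^sub>M N)) = 0"
  have fc: "continuous_on (carrier G \<times> carrier H) f" using f by simp
  have slice: "cont_on H (%y. f (x, y))" if "x : carrier G" for x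
  by (rule continuous_on_compose2[OF fc]) (use that in \<open>auto intro!: cintros\<close>)
  have g0: "(LINT y|N. f (x, y) * cnj (rh l y a b)) = 0" if ab: "a < e l" "b < e l" and x: "x : carrier G" for x l a b
  proof (rule G.complete[of "%x. (LINT y|N. f (x, y) * cnj (rh l y a b))"])
  have c: "continuous_on (carrier G \<times> carrier H) (%z. f z * cnj (rh l (snd z) a b))"
  by (intro cintros fc continuous_on_compose2[OF H.continuous_on_rep[OF ab]]) auto
  from continuous_on_parametric_integral[OF H.finite_measure_axioms H.sets_M G.compact_carrier H.compact_carrier c]
  show "cont_on G (%x. (LINT y|N. f (x, y) * cnj (rh l y a b)))" by simp
  fix k i j assume ij: "i < d k" "j < d k"
  define \<kappa> where "\<kappa> = prod_encode (k, l)"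
  have kk: "p \<kappa> = k" "q \<kappa> = l" by (simp_all add: p_def q_def \<kappa>_def)
  have lt: "i * e l + a < D \<kappa>" "j * e l + b < D \<kappa>"
  proof -
  have "i * e l + a < Suc i * e l" using ab by simp
  also have "Suc i * e l <= d k * e l" using ij by (intro mult_le_mono1) simp
  finally show "i * e l + a < D \<kappa>" by (simp add: D_def kk)
  next
  have "j * e l + b < Suc j * e l" using ab by simp
  also have "... <= d k * e l" using ij by (intro mult_le_mono1) simp
  finally show "j * e l + b < D \<kappa>" by (simp add: D_def kk)
  qed
  have c2: "continuous_on (carrier G \<times> carrier H) (%z. (f z * cnj (rh l (snd z) a b)) * cnj (\<pi> k (fst z) i j))"
  by (intro continuous_on_mult c continuous_on_cnj continuous_on_compose2[OF G.continuous_on_rep[OF ij]] cintros) auto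
  have "0 = (\<integral>z. f z * cnj (sg \<kappa> z (i * e l + a) (j * e l + b)) \<partial>(M \<Otimes>\<^sub>M N))" using 0 lt by simp
  also have "... = (\<integral>z. (f z * cnj (rh l (snd z) a b)) * cnj (\<pi> k (fst z) i j) \<partial>(M \<Otimes>\<^sub>M N))"
  unfolding sg_def kk ktensor_def using ab by (simp add: mult_ac)
  also have "... = (LINT x|M. (LINT y|N. (f (x, y) * cnj (rh l (snd (x, y)) a b)) * cnj (\<pi> k (fst (x, y)) i j)))"
  by (rule Fubini_continuous(2)[OF G.finite_measure_axioms G.sets_M H.finite_measure_axioms H.sets_M G.compact_carrier H.compact_carrier c2])
  finally show "(LINT x|M. (LINT y|N. f (x, y) * cnj (rh l y a b)) * cnj (\<pi> k x i j)) = 0" by simp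
  qed (rule x)
  obtain x y where zxy: "z = (x, y)" "x : carrier G" "y : carrier H" using z by auto
  show "f z = 0" unfolding zxy(1) by (rule H.complete[OF slice[OF zxy(2)] g0[OF _ _ zxy(2)] zxy(3)])
 qed
 thus ?thesis by blast
qed

text \<open>Haar measure and the family of representations are carried along isomorphic homeomorphisms.\<close>

lemma haar_group_transfer:
 fixes H :: "('h::polish_space, 's) monoid_scheme"
 assumes "haar_group G M" "Group.group H"
  and ph: "!!x. x : carrier G ==> ph x : carrier H" and ps: "!!y. y : carrier H ==> ps y : carrier G"
  and psph: "!!x. x : carrier G ==> ps (ph x) = x" and phps: "!!y. y : carrier H ==> ph (ps y) = y"
  and hom: "!!x x'. x : carrier G ==> x' : carrier G ==> ph (x \<otimes>\<^bsub>G\<^esub> x') = ph x \<otimes>\<^bsub>H\<^esub> ph x'"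
  and cph: "cont_on G ph" and cps: "cont_on H ps"
 shows "haar_group H (distr M (restrict_space borel (carrier H)) ph)"
  and "!!f :: 'h => complex. cont_on H f ==>
  (\<integral>y. f y \<partial>distr M (restrict_space borel (carrier H)) ph) = (LINT x|M. f (ph x))"
  and "!!y. y : carrier H ==> ps (inv\<^bsub>H\<^esub> y) = inv\<^bsub>G\<^esub> (ps y)"
  and "!!y y'. y : carrier H ==> y' : carrier H ==> ps (y \<otimes>\<^bsub>H\<^esub> y') = ps y \<otimes>\<^bsub>G\<^esub> ps y'"
  and "ps \<one>\<^bsub>H\<^esub> = \<one>\<^bsub>G\<^esub>"
proof -
 interpret G: haar_group G M by fact
 interpret H: Group.group H by fact
 let ?R = "restrict_space borel (carrier H)"
 show hom': "ps (y \<otimes>\<^bsub>H\<^esub> y') = ps y \<otimes>\<^bsub>G\<^esub> ps y'" if "y : carrier H" "y' : carrier H" for y y'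
 proof -
  have "ph (ps y \<otimes>\<^bsub>G\<^esub> ps y') = y \<otimes>\<^bsub>H\<^esub> y'" using that by (simp add: hom ps phps)
  hence "ps (y \<otimes>\<^bsub>H\<^esub> y') = ps (ph (ps y \<otimes>\<^bsub>G\<^esub> ps y'))" by simp
  thus ?thesis using that by (simp add: psph ps)
 qed
 show one: "ps \<one>\<^bsub>H\<^esub> = \<one>\<^bsub>G\<^esub>"
 proof -
  have "ps \<one>\<^bsub>H\<^esub> \<otimes>\<^bsub>G\<^esub> ps \<one>\<^bsub>H\<^esub> = ps \<one>\<^bsub>H\<^esub>" using hom'[of "\<one>\<^bsub>H\<^esub>" "\<one>\<^bsub>H\<^esub>"] by simp
  thus ?thesis using G.l_cancel_one[of "ps \<one>\<^bsub>H\<^esub>" "ps \<one>\<^bsub>H\<^esub>"] ps[of "\<one>\<^bsub>H\<^esub>"] by simp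
 qed
 show inv': "ps (inv\<^bsub>H\<^esub> y) = inv\<^bsub>G\<^esub> (ps y)" if y: "y : carrier H" for y
 proof -
  have "ps (inv\<^bsub>H\<^esub> y) \<otimes>\<^bsub>G\<^esub> ps y = \<one>\<^bsub>G\<^esub>" using hom'[of "inv\<^bsub>H\<^esub> y" y] y one by simp
  thus ?thesis using G.inv_equality[of "ps (inv\<^bsub>H\<^esub> y)" "ps y"] y ps by simp
 qed
 have mph: "ph : measurable M ?R"
  by (rule measurable_into_restrict_borel[OF refl G.measurable_cont[OF cph]]) (auto simp: G.space_M ph)
 show int: "(\<integral>y. f y \<partial>distr M ?R ph) = (LINT x|M. f (ph x))" if "cont_on H f" for f :: "'h => complex"
  by (rule integral_distr[OF mph borel_measurable_continuous_on_restrict[OF that]])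
 have spR: "space ?R = carrier H" by (simp add: space_restrict_space)
 show "haar_group H (distr M ?R ph)"
 proof
  have "carrier H = ph ` carrier G"
  proof (intro equalityI subsetI)
  fix y assume "y : carrier H"
  thus "y : ph ` carrier G" using phps ps by (intro image_eqI[of _ _ "ps y"]) simp_all
  qed (use ph in auto)
  thus "compact (carrier H)" using compact_continuous_image[OF cph G.compact_carrier] by simp
  have "continuous_on (carrier H \<times> carrier H) (%p. ph (ps (fst p) \<otimes>\<^bsub>G\<^esub> ps (snd p)))"
  by (intro continuous_on_compose2[OF cph] G.continuous_on_mult2 continuous_on_compose2[OF cps] cintros)
  (auto simp: ps)
  thus "continuous_on (carrier H \<times> carrier H) (%p. fst p \<otimes>\<^bsub>H\<^esub> snd p)"
  by (rule continuous_on_eq) (auto simp: hom ps phps)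
  have "cont_on H (%y. ph (inv\<^bsub>G\<^esub> (ps y)))"
  by (intro continuous_on_compose2[OF cph] continuous_on_compose2[OF G.continuous_inv] cps) (auto simp: ps)
  thus "cont_on H (%y. inv\<^bsub>H\<^esub> y)" by (rule continuous_on_eq) (simp add: inv'[symmetric] phps)
  show "sets (distr M ?R ph) = sets ?R" by simp
  have "prob_space (distr M ?R ph)" by (rule G.prob_space_distr[OF mph])
  thus "emeasure (distr M ?R ph) (carrier H) = 1"
  using prob_space.emeasure_space_1[of "distr M ?R ph"] by (simp add: spR)
  fix y assume y: "y : carrier H"
  have cy: "cont_on H (%z. ph (ps y \<otimes>\<^bsub>G\<^esub> ps z))"
  using y by (intro continuous_on_compose2[OF cph] continuous_on_compose2[OF G.continuous_on_translate(1)] cps) (auto simp: ps)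
  have cy': "cont_on H (%z. y \<otimes>\<^bsub>H\<^esub> z)"
  using cy by (rule continuous_on_eq) (use y in \<open>simp add: hom ps phps\<close>)
  have my: "(%z. y \<otimes>\<^bsub>H\<^esub> z) : measurable ?R ?R"
  by (rule measurable_into_restrict_borel[OF refl borel_measurable_continuous_on_restrict[OF cy']]) (use y spR in auto)
  have mt: "(%x. ps y \<otimes>\<^bsub>G\<^esub> x) : measurable M M"
  using y ps by (auto intro!: G.measurable_cont_self G.continuous_on_translate)
  have "distr (distr M ?R ph) (distr M ?R ph) (%z. y \<otimes>\<^bsub>H\<^esub> z) = distr (distr M ?R ph) ?R (%z. y \<otimes>\<^bsub>H\<^esub> z)"
  by (rule distr_cong) simp_all
  also have "... = distr M ?R ((%z. y \<otimes>\<^bsub>H\<^esub> z) o ph)" by (rule distr_distr[OF my mph])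
  also have "... = distr M ?R (ph o (%x. ps y \<otimes>\<^bsub>G\<^esub> x))"
  by (rule distr_cong) (use y in \<open>simp_all add: G.space_M hom ps phps\<close>)
  also have "... = distr (distr M M (%x. ps y \<otimes>\<^bsub>G\<^esub> x)) ?R ph" by (rule distr_distr[OF mph mt, symmetric])
  also have "... = distr M ?R ph" by (simp only: G.left_invariant[OF ps[OF y]])
  finally show "distr (distr M ?R ph) (distr M ?R ph) (%z. y \<otimes>\<^bsub>H\<^esub> z) = distr M ?R ph" .
 qed
qed

lemma unirep_transfer:
 assumes s: "unirep G d s" and ps: "!!y. y : carrier H ==> ps y : carrier G"
  and inv: "!!y. y : carrier H ==> ps (inv\<^bsub>H\<^esub> y) = inv\<^bsub>G\<^esub> (ps y)"
  and hom: "!!y y'. y : carrier H ==> y' : carrier H ==> ps (y \<otimes>\<^bsub>H\<^esub> y') = ps y \<otimes>\<^bsub>G\<^esub> ps y'"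
  and one: "ps \<one>\<^bsub>H\<^esub> = \<one>\<^bsub>G\<^esub>" and c: "cont_on H ps"
 shows "unirep H d (%y. s (ps y))"
 unfolding unirep_def by (intro conjI ballI allI impI)
  (simp_all add: hom inv one ps unirepD(1-3)[OF s] continuous_on_compose2[OF unirepD(4)[OF s] c] image_subsetI)

lemma schur_transfer:
 fixes H :: "('h::polish_space, 's) monoid_scheme"
 assumes G: "haar_group G M" "Group.group H"
  and ph: "!!x. x : carrier G ==> ph x : carrier H" and ps: "!!y. y : carrier H ==> ps y : carrier G"
  and psph: "!!x. x : carrier G ==> ps (ph x) = x" and phps: "!!y. y : carrier H ==> ph (ps y) = y"
  and hom: "!!x x'. x : carrier G ==> x' : carrier G ==> ph (x \<otimes>\<^bsub>G\<^esub> x') = ph x \<otimes>\<^bsub>H\<^esub> ph x'"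
  and cph: "cont_on G ph" and cps: "cont_on H ps"
  and s: "haar_group.schur G M F D s"
 shows "haar_group.schur H (distr M (restrict_space borel (carrier H)) ph) F D (%k y. s k (ps y))"
proof -
 interpret G: haar_group G M by fact
 note tr = haar_group_transfer[OF G ph ps psph phps hom cph cps]
 interpret H: haar_group H "distr M (restrict_space borel (carrier H)) ph" by (rule tr(1))
 note sD = G.schurD[OF s]
 have u: "unirep H (D k) (%y. s k (ps y))" if "k : F" for k by (rule unirep_transfer[OF sD(2)[OF that] ps tr(3,4,5) cps])
 show ?thesis unfolding H.schur_def
 proof (intro conjI ballI allI impI)
  fix k assume k: "k : F"
  show "0 < D k" "unirep H (D k) (%y. s k (ps y))" using sD(1) u k by simp_all
  fix l i j m n assume *: "l : F" "i < D k" "j < D k" "m < D l" "n < D l"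
  have "(\<integral>y. s k (ps y) i j * cnj (s l (ps y) m n) \<partial>distr M (restrict_space borel (carrier H)) ph)
  = (LINT x|M. s k (ps (ph x)) i j * cnj (s l (ps (ph x)) m n))"
  by (rule tr(2), assumption+) (intro cintros unirepD(4)[OF u[OF k] *(2,3)] unirepD(4)[OF u[OF *(1)] *(4,5)])
  also have "... = (LINT x|M. s k x i j * cnj (s l x m n))" by (rule integral_eqI) (simp add: G.space_M psph)
  finally show "(\<integral>y. s k (ps y) i j * cnj (s l (ps y) m n) \<partial>distr M (restrict_space borel (carrier H)) ph) = (if k = l & i = m & j = n then 1 / of_nat (D k) else 0)"
  unfolding sD(3)[OF k *] .
 qed
qed

lemma peter_weyl_transfer:
 fixes H :: "('h::polish_space, 's) monoid_scheme"
 assumes G: "peter_weyl G M d \<pi>" "Group.group H"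
  and ph: "!!x. x : carrier G ==> ph x : carrier H" and ps: "!!y. y : carrier H ==> ps y : carrier G"
  and psph: "!!x. x : carrier G ==> ps (ph x) = x" and phps: "!!y. y : carrier H ==> ph (ps y) = y"
  and hom: "!!x x'. x : carrier G ==> x' : carrier G ==> ph (x \<otimes>\<^bsub>G\<^esub> x') = ph x \<otimes>\<^bsub>H\<^esub> ph x'"
  and cph: "cont_on G ph" and cps: "cont_on H ps"
 shows "peter_weyl H (distr M (restrict_space borel (carrier H)) ph) d (%k y. \<pi> k (ps y))"
proof -
 interpret G: peter_weyl G M d \<pi> by fact
 have hg: "haar_group G M" by unfold_locales
 note tr = haar_group_transfer[OF hg G(2) ph ps psph phps hom cph cps]
 note sc = schur_transfer[OF hg G(2) ph ps psph phps hom cph cps G.schur_UNIV]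
 interpret H: haar_group H "distr M (restrict_space borel (carrier H)) ph" by (rule tr(1))
 show ?thesis unfolding peter_weyl_iff
 proof (intro conjI allI impI tr(1) sc)
  fix f y
  assume f: "cont_on H f" and y: "y : carrier H"
  and 0: "ALL k i j. i < d k --> j < d k --> (\<integral>x. f x * cnj (\<pi> k (ps x) i j) \<partial>distr M (restrict_space borel (carrier H)) ph) = 0"
  have "f (ph (ps y)) = 0"
  proof (rule G.complete[of "%x. f (ph x)"])
  show "cont_on G (%x. f (ph x))" by (rule continuous_on_compose2[OF f cph]) (use ph in auto)
  fix k i j assume ij: "i < d k" "j < d k"
  have "(LINT x|M. f (ph x) * cnj (\<pi> k x i j)) = (LINT x|M. f (ph x) * cnj (\<pi> k (ps (ph x)) i j))"
  by (rule integral_eqI) (simp add: G.space_M psph)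
  also have "... = (\<integral>y. f y * cnj (\<pi> k (ps y) i j) \<partial>distr M (restrict_space borel (carrier H)) ph)"
  by (rule tr(2)[symmetric], assumption+) (intro cintros f unirepD(4)[OF H.schurD(2)[OF sc]] ij UNIV_I)
  also have "... = 0" using 0 ij by simp
  finally show "(LINT x|M. f (ph x) * cnj (\<pi> k x i j)) = 0" .
  qed (rule ps[OF y])
  thus "f y = 0" using phps[OF y] by simp
 qed
qed

lemma carrier_pow_group: "carrier (pow_group K m) = PiE {..<m} (%_. carrier K)" by (simp add: pow_group_def)

lemma mult_pow_group: "x \<otimes>\<^bsub>pow_group K m\<^esub> y = (\<lambda>i\<in>{..<m}. x i \<otimes>\<^bsub>K\<^esub> y i)"
 by (simp add: pow_group_def)

lemma one_pow_group: "\<one>\<^bsub>pow_group K m\<^esub> = (\<lambda>i\<in>{..<m}. \<one>\<^bsub>K\<^esub>)"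
 by (simp add: pow_group_def)

lemma group_pow_group: "Group.group K ==> Group.group (pow_group K m)"
 unfolding pow_group_def by (rule product_group)

lemma inv_pow_group:
 "Group.group K ==> x : carrier (pow_group K m) ==> inv\<^bsub>pow_group K m\<^esub> x = (\<lambda>i\<in>{..<m}. inv\<^bsub>K\<^esub> x i)"
 unfolding pow_group_def by (subst inv_product_group) auto

lemma pow_top_eq:
 "pow_top (top_of_set (carrier K)) m = top_of_set (carrier (pow_group K m))"
proof -
 let ?S = "carrier (pow_group K m)" and ?P = "pow_top (top_of_set (carrier K)) m"
 have ts: "topspace ?P = ?S" by (simp add: pow_top_def carrier_pow_group)
 have 1: "continuous_map (top_of_set ?S) ?P id"
  unfolding pow_top_def continuous_map_componentwise
 proof (intro conjI ballI)
  show "id ` topspace (top_of_set ?S) \<subseteq> extensional {..<m}" by (auto simp: carrier_pow_group PiE_def)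
  fix i assume i: "i : {..<m}"
  have "continuous_on ?S (%x. x i)" by (rule continuous_on_subset[OF continuous_on_product_coordinates]) simp
  moreover have "(%x. x i) : ?S \<rightarrow> carrier K" using i by (auto simp: carrier_pow_group PiE_iff)
  ultimately show "continuous_map (top_of_set ?S) (top_of_set (carrier K)) (%x. id x i)"
  by (simp add: continuous_map_in_subtopology image_subset_iff_funcset)
 qed
 have 2: "continuous_map ?P (top_of_set ?S) id"
 proof -
  have "continuous_map ?P (product_topology (%_. euclidean) UNIV) id"
  unfolding continuous_map_componentwise
  proof (intro conjI ballI)
  show "id ` topspace ?P \<subseteq> extensional UNIV" by simp
  fix i :: nat
  show "continuous_map ?P euclidean (%x. id x i)"
  proof (cases "i < m")
  case True
  hence "continuous_map ?P (top_of_set (carrier K)) (%x. x i)"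
  unfolding pow_top_def by (intro continuous_map_product_projection) simp
  thus ?thesis by (simp add: continuous_map_in_subtopology)
  next
  case False
  have "continuous_map ?P euclidean (%x. undefined)" by simp
  thus ?thesis
  by (rule continuous_map_eq) (use False ts in \<open>auto simp: carrier_pow_group PiE_def extensional_def\<close>)
  qed
  qed
  thus ?thesis using ts by (simp add: continuous_map_in_subtopology euclidean_product_topology)
 qed
 show ?thesis
 proof (rule topology_eq[THEN iffD2], rule allI)
  fix U
  show "openin ?P U \<longleftrightarrow> openin (top_of_set ?S) U"
  proof
  assume U: "openin ?P U"
  hence "U \<subseteq> ?S" using openin_subset ts by blast
  hence "{x : topspace (top_of_set ?S). id x : U} = U" by auto
  thus "openin (top_of_set ?S) U" using openin_continuous_map_preimage[OF 1 U] by simp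
  next
  assume U: "openin (top_of_set ?S) U"
  hence "U \<subseteq> ?S" using openin_imp_subset by blast
  hence "{x : topspace ?P. id x : U} = U" using ts by auto
  thus "openin ?P U" using openin_continuous_map_preimage[OF 2 U] by simp
  qed
 qed
qed

lemma continuous_on_pow_pair:
 assumes "continuous_on A f" "continuous_on A g"
 shows "continuous_on A (%x. pow_pair m (f x) (g x))"
proof (rule continuous_on_coordinatewise_then_product)
 fix i
 have "continuous_on A (%x. f x i)" "continuous_on A (%x. g x (i - m))"
  using assms by (auto intro: continuous_on_product_then_coordinatewise)
 thus "continuous_on A (%x. pow_pair m (f x) (g x) i)"
  by (cases "i < 2 * m"; cases "i < m") (simp_all add: pow_pair_def restrict_def)
qed

lemma continuous_on_pow_proj: "continuous_on A (pow_fst m)" "continuous_on A (pow_snd m)"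
proof -
 have c: "continuous_on A (%x::nat => 'a. x i)" for i
  by (rule continuous_on_subset[OF continuous_on_product_coordinates]) simp
 show "continuous_on A (pow_fst m :: (nat => 'a) => _)"
 proof (rule continuous_on_coordinatewise_then_product)
  fix i show "continuous_on A (%x::nat => 'a. pow_fst m x i)"
  using c[of i] by (cases "i < m") (simp_all add: pow_fst_def restrict_def)
 qed
 show "continuous_on A (pow_snd m :: (nat => 'a) => _)"
 proof (rule continuous_on_coordinatewise_then_product)
  fix i show "continuous_on A (%x::nat => 'a. pow_snd m x i)"
  using c[of "m + i"] by (cases "i < m") (simp_all add: pow_snd_def restrict_def)
 qed
qed

lemma pow_pair_carrier:
 "s : carrier (pow_group K m) ==> t : carrier (pow_group K m) ==> pow_pair m s t : carrier (pow_group K (2 * m))"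
 unfolding carrier_pow_group pow_pair_def by (rule restrict_PiE_iff[THEN iffD2]) (auto simp: PiE_iff)

lemma pow_proj_carrier:
 assumes "x : carrier (pow_group K (2 * m))"
 shows "pow_fst m x : carrier (pow_group K m)" "pow_snd m x : carrier (pow_group K m)"
 using assms unfolding carrier_pow_group pow_fst_def pow_snd_def by (auto simp: restrict_PiE_iff PiE_iff)

lemma pow_group_arb: "x : carrier (pow_group K m) ==> ~ i < m ==> x i = undefined"
 unfolding carrier_pow_group by (erule PiE_arb) simp

lemma pow_pair_proj:
 assumes "x : carrier (pow_group K (2 * m))"
 shows "pow_pair m (pow_fst m x) (pow_snd m x) = x"
proof
 fix i
 have "i - m < m" if "i < 2 * m" "~ i < m" using that by linarith
 thus "pow_pair m (pow_fst m x) (pow_snd m x) i = x i"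
  using pow_group_arb[OF assms, of i] unfolding pow_pair_def pow_fst_def pow_snd_def
  by (cases "i < 2 * m"; cases "i < m") simp_all
qed

lemma pow_proj_pair:
 assumes "s : carrier (pow_group K m)" "t : carrier (pow_group K m)"
 shows "pow_fst m (pow_pair m s t) = s" "pow_snd m (pow_pair m s t) = t"
proof -
 show "pow_fst m (pow_pair m s t) = s"
 proof
  fix i show "pow_fst m (pow_pair m s t) i = s i"
  using pow_group_arb[OF assms(1), of i] unfolding pow_pair_def pow_fst_def by (cases "i < m") simp_all
 qed
 show "pow_snd m (pow_pair m s t) = t"
 proof
  fix i show "pow_snd m (pow_pair m s t) i = t i"
  using pow_group_arb[OF assms(2), of i] unfolding pow_pair_def pow_snd_def by (cases "i < m") simp_all
 qed
qed

lemma pow_pair_mult: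
 "pow_pair m (s \<otimes>\<^bsub>pow_group K m\<^esub> s') (t \<otimes>\<^bsub>pow_group K m\<^esub> t') = pow_pair m s t \<otimes>\<^bsub>pow_group K (2 * m)\<^esub> pow_pair m s' t'"
proof
 fix i
 have "i - m < m" if "i < 2 * m" "~ i < m" using that by linarith
 thus "pow_pair m (s \<otimes>\<^bsub>pow_group K m\<^esub> s') (t \<otimes>\<^bsub>pow_group K m\<^esub> t') i = (pow_pair m s t \<otimes>\<^bsub>pow_group K (2 * m)\<^esub> pow_pair m s' t') i"
  unfolding mult_pow_group pow_pair_def by (cases "i < 2 * m"; cases "i < m") simp_all
qed

lemma pow_proj_mult:
 "pow_fst m (x \<otimes>\<^bsub>pow_group K (2 * m)\<^esub> y) = pow_fst m x \<otimes>\<^bsub>pow_group K m\<^esub> pow_fst m y"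
 "pow_snd m (x \<otimes>\<^bsub>pow_group K (2 * m)\<^esub> y) = pow_snd m x \<otimes>\<^bsub>pow_group K m\<^esub> pow_snd m y"
proof -
 show "pow_fst m (x \<otimes>\<^bsub>pow_group K (2 * m)\<^esub> y) = pow_fst m x \<otimes>\<^bsub>pow_group K m\<^esub> pow_fst m y"
  unfolding mult_pow_group pow_fst_def by (rule ext, rename_tac i, case_tac "i < m") simp_all
 show "pow_snd m (x \<otimes>\<^bsub>pow_group K (2 * m)\<^esub> y) = pow_snd m x \<otimes>\<^bsub>pow_group K m\<^esub> pow_snd m y"
  unfolding mult_pow_group pow_snd_def by (rule ext, rename_tac i, case_tac "i < m") simp_all
qed

context
 fixes K :: "('a::polish_space, 'r) monoid_scheme" and m :: nat
 assumes K: "Group.group K"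
begin

lemma pow_double_iso:
 shows "!!x. x : carrier (pow_group K m \<times>\<times> pow_group K m) ==> pow_pair m (fst x) (snd x) : carrier (pow_group K (2 * m))"
  and "!!y. y : carrier (pow_group K (2 * m)) ==> (pow_fst m y, pow_snd m y) : carrier (pow_group K m \<times>\<times> pow_group K m)"
  and "!!x. x : carrier (pow_group K m \<times>\<times> pow_group K m) ==> (pow_fst m (pow_pair m (fst x) (snd x)), pow_snd m (pow_pair m (fst x) (snd x))) = x"
  and "!!y. y : carrier (pow_group K (2 * m)) ==> pow_pair m (fst (pow_fst m y, pow_snd m y)) (snd (pow_fst m y, pow_snd m y)) = y"
  and "!!x x'. x : carrier (pow_group K m \<times>\<times> pow_group K m) ==> x' : carrier (pow_group K m \<times>\<times> pow_group K m) ==>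
  pow_pair m (fst (x \<otimes>\<^bsub>pow_group K m \<times>\<times> pow_group K m\<^esub> x')) (snd (x \<otimes>\<^bsub>pow_group K m \<times>\<times> pow_group K m\<^esub> x')) =
  pow_pair m (fst x) (snd x) \<otimes>\<^bsub>pow_group K (2 * m)\<^esub> pow_pair m (fst x') (snd x')"
  and "cont_on (pow_group K m \<times>\<times> pow_group K m) (%x. pow_pair m (fst x) (snd x))"
  and "cont_on (pow_group K (2 * m)) (%y. (pow_fst m y, pow_snd m y))"
proof -
 show "cont_on (pow_group K m \<times>\<times> pow_group K m) (%x. pow_pair m (fst x) (snd x))"
  by (intro continuous_on_pow_pair cintros)
 show "cont_on (pow_group K (2 * m)) (%y. (pow_fst m y, pow_snd m y))" by (intro continuous_on_Pair continuous_on_pow_proj)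
qed (simp_all add: pow_pair_carrier pow_proj_carrier pow_pair_proj[where K = K] pow_proj_pair[where K = K] mult_DirProd' pow_pair_mult mem_Times_iff)

lemma peter_weyl_pow_double:
 assumes "peter_weyl (pow_group K m) M d \<pi>"
 shows "EX M' d' \<pi>'. peter_weyl (pow_group K (2 * m)) M' d' \<pi>'"
proof -
 obtain d' \<pi>' where "peter_weyl (pow_group K m \<times>\<times> pow_group K m) (M \<Otimes>\<^sub>M M) d' \<pi>'"
  using peter_weyl_DirProd[OF assms assms] by blast
 hence "peter_weyl (pow_group K (2 * m)) (distr (M \<Otimes>\<^sub>M M) (restrict_space borel (carrier (pow_group K (2 * m)))) (%x. pow_pair m (fst x) (snd x)))
  d' (%k y. \<pi>' k (pow_fst m y, pow_snd m y))" by (rule peter_weyl_transfer[OF _ group_pow_group[OF K] pow_double_iso])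
 thus ?thesis by (intro exI)
qed

lemma schur_pow_double:
 assumes h: "haar_group (pow_group K m) M" "haar_group (pow_group K (2 * m)) M'"
  and s: "haar_group.schur (pow_group K m) M F D s"
 shows "haar_group.schur (pow_group K (2 * m)) M' F (%k. D k * D k)
  (%k x. ktensor (D k) (s k (pow_fst m x)) (s k (pow_snd m x)))"
proof -
 note hp = haar_group_DirProd[OF h(1) h(1)]
 have 1: "haar_group.schur (pow_group K m \<times>\<times> pow_group K m) (M \<Otimes>\<^sub>M M) F (%k. D k * D k)
  (%k x. ktensor (D k) (s k (fst x)) (s k (snd x)))" by (rule schur_DirProd[OF h(1) h(1) s s, of F "%k. k" "%k. k"]) auto
 note tr = haar_group_transfer(1)[OF hp group_pow_group[OF K] pow_double_iso]
 interpret H: haar_group "pow_group K (2 * m)" M' by fact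
 interpret H': haar_group "pow_group K (2 * m)" "distr (M \<Otimes>\<^sub>M M) (restrict_space borel (carrier (pow_group K (2 * m)))) (%x. pow_pair m (fst x) (snd x))" by (rule tr)
 have "distr (M \<Otimes>\<^sub>M M) (restrict_space borel (carrier (pow_group K (2 * m)))) (%x. pow_pair m (fst x) (snd x)) = M'"
  by (rule H.haar_unique) (simp_all add: H.sets_M H'.total_mass H'.left_invariant)
 moreover have "haar_group.schur (pow_group K (2 * m)) (distr (M \<Otimes>\<^sub>M M) (restrict_space borel (carrier (pow_group K (2 * m)))) (%x. pow_pair m (fst x) (snd x)))
  F (%k. D k * D k) (%k y. ktensor (D k) (s k (fst (pow_fst m y, pow_snd m y))) (s k (snd (pow_fst m y, pow_snd m y))))"
  by (rule schur_transfer[OF hp group_pow_group[OF K] pow_double_iso 1])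
 ultimately show ?thesis by (simp only: fst_conv snd_conv)
qed

end

lemma peter_weyl_pow_one:
 fixes K :: "('a::polish_space, 'r) monoid_scheme"
 assumes "peter_weyl K M d \<pi>"
 shows "EX M'. peter_weyl (pow_group K 1) M' d (%k y. \<pi> k (y 0))"
proof -
 interpret peter_weyl K M d \<pi> by fact
 have c: "continuous_on A (%x::nat => 'a. x i)" for i A
  by (rule continuous_on_subset[OF continuous_on_product_coordinates]) simp
 have "peter_weyl (pow_group K 1) (distr M (restrict_space borel (carrier (pow_group K 1))) (%x. \<lambda>i\<in>{..<1}. x)) d (%k y. \<pi> k (y 0))"
 proof (rule peter_weyl_transfer[OF assms group_pow_group[OF is_group]])
  show "cont_on K (%x. \<lambda>i\<in>{..<1::nat}. x)"
  proof (rule continuous_on_coordinatewise_then_product)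
  fix i show "cont_on K (%x. (\<lambda>i\<in>{..<1::nat}. x) i)" by (cases "i < 1") (auto simp: restrict_def intro: cintros)
  qed
  show "(\<lambda>i\<in>{..<1}. y 0) = y" if "y : carrier (pow_group K 1)" for y
  proof
  fix i show "(\<lambda>i\<in>{..<1}. y 0) i = y i"
  using that unfolding carrier_pow_group by (cases "i = 0") (auto simp: PiE_iff extensional_def)
  qed
  show "(\<lambda>i\<in>{..<1}. x) : carrier (pow_group K 1)" if "x : carrier K" for x
  using that by (simp add: carrier_pow_group)
  show "y 0 : carrier K" if "y : carrier (pow_group K 1)" for y
  using that by (simp add: carrier_pow_group PiE_iff)
  show "(\<lambda>i\<in>{..<1::nat}. x) 0 = x" for x :: 'a by simp
  show "(\<lambda>i\<in>{..<1}. x \<otimes>\<^bsub>K\<^esub> x') = (\<lambda>i\<in>{..<1}. x) \<otimes>\<^bsub>pow_group K 1\<^esub> (\<lambda>i\<in>{..<1}. x')" for x x'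
  unfolding mult_pow_group by (rule restrict_ext) simp
 qed (rule c)
 thus ?thesis by blast
qed

section \<open>Haar measure on \<open>SU(2)\<close>\<close>

abbreviation ent :: "complex ^ 2 ^ 2 => 2 => 2 => complex" where
 "ent A i j \<equiv> vec_nth (vec_nth A i) j"

definition su :: "complex => complex => complex ^ 2 ^ 2" where
 "su a b = (\<chi> i j. if i = 1 then (if j = 1 then a else b) else (if j = 1 then - cnj b else cnj a))"

lemma ent_su [simp]: "ent (su a b) 1 1 = a" "ent (su a b) 1 2 = b" "ent (su a b) 2 1 = - cnj b" "ent (su a b) 2 2 = cnj a"
 by (simp_all add: su_def)

lemma mat2_eqI:
 assumes "ent A 1 1 = ent B 1 1" "ent A 1 2 = ent B 1 2" "ent A 2 1 = ent B 2 1" "ent A 2 2 = ent B 2 2"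
 shows "A = B"
 using assms by (simp add: Finite_Cartesian_Product.vec_eq_iff forall_2)

lemma ent_mult: "ent (A ** B) i j = ent A i 1 * ent B 1 j + ent A i 2 * ent B 2 j"
 by (simp add: matrix_matrix_mult_def sum_2)

lemma su_mult: "su a b ** su a' b' = su (a * a' - b * cnj b') (a * b' + b * cnj a')"
 by (rule mat2_eqI) (simp_all add: ent_mult)

lemma su_norm_mult:
 "(cmod (a * a' - b * cnj b'))^2 + (cmod (a * b' + b * cnj a'))^2 = ((cmod a)^2 + (cmod b)^2) * ((cmod a')^2 + (cmod b')^2)"
proof -
 have "complex_of_real ((cmod (a * a' - b * cnj b'))^2 + (cmod (a * b' + b * cnj a'))^2)
  = of_real (((cmod a)^2 + (cmod b)^2) * ((cmod a')^2 + (cmod b')^2))"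
  unfolding of_real_add of_real_mult complex_norm_square by (simp add: algebra_simps)
 thus ?thesis by (simp only: of_real_eq_iff)
qed

lemma mat_1_su: "(Finite_Cartesian_Product.mat 1 :: complex ^ 2 ^ 2) = su 1 0"
 by (rule mat2_eqI) (simp_all add: Finite_Cartesian_Product.mat_def)

lemma conj_transpose_su: "conj_transpose (su a b) = su (cnj a) (- b)" by (rule mat2_eqI) (simp_all add: conj_transpose_def)

lemma su_cancel:
 assumes "(cmod a)^2 + (cmod b)^2 = 1"
 shows "su (cnj a) (- b) ** su a b = su 1 0" "su a b ** su (cnj a) (- b) = su 1 0"
proof -
 have 1: "a * cnj a + b * cnj b = 1"
  using assms unfolding complex_norm_square[symmetric] of_real_add[symmetric] by simp
 show "su (cnj a) (- b) ** su a b = su 1 0" "su a b ** su (cnj a) (- b) = su 1 0"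
  unfolding su_mult using 1 by (simp_all add: mult.commute)
qed

lemma SU2_carrier_iff: "A : carrier SU2 \<longleftrightarrow> (EX a b. A = su a b & (cmod a)^2 + (cmod b)^2 = 1)"
proof
 assume A: "A : carrier SU2"
 define p q r s where "p = ent A 1 1" and "q = ent A 1 2" and "r = ent A 2 1" and "s = ent A 2 2"
 note d = this
 have det: "p * s - q * r = 1" using A by (simp add: SU2_def det_2 d)
 have AA: "conj_transpose A ** A = Finite_Cartesian_Product.mat 1" using A by (simp add: SU2_def)
 have 1: "cnj p * p + cnj r * r = 1" "cnj p * q + cnj r * s = 0"
  using arg_cong[OF AA, of "%B. ent B 1 1"] arg_cong[OF AA, of "%B. ent B 1 2"]
  by (simp_all add: ent_mult conj_transpose_def d Finite_Cartesian_Product.mat_def)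
 have s: "s = cnj p"
 proof -
  have "cnj p = cnj p * (p * s - q * r)" using det by simp
  also have "... = cnj p * p * s - (cnj p * q) * r" by (simp add: algebra_simps)
  also have "cnj p * q = - (cnj r * s)" using 1(2) by (simp add: eq_neg_iff_add_eq_0)
  also have "cnj p * p * s - - (cnj r * s) * r = (cnj p * p + cnj r * r) * s" by (simp add: algebra_simps)
  finally show ?thesis using 1(1) by simp
 qed
 have r: "r = - cnj q"
 proof -
  have "cnj r = cnj r * (p * s - q * r)" using det by simp
  also have "... = p * (cnj r * s) - cnj r * r * q" by (simp add: algebra_simps)
  also have "cnj r * s = - (cnj p * q)" using 1(2) by (simp add: eq_neg_iff_add_eq_0 add.commute)
  also have "p * - (cnj p * q) - cnj r * r * q = - ((cnj p * p + cnj r * r) * q)" by (simp add: algebra_simps)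
  finally have "cnj r = - q" using 1(1) by simp
  thus ?thesis by (metis complex_cnj_cnj complex_cnj_minus)
 qed
 have "complex_of_real ((cmod p)^2 + (cmod q)^2) = 1"
  unfolding of_real_add complex_norm_square using det by (simp add: s r)
 hence "(cmod p)^2 + (cmod q)^2 = 1" by (simp only: of_real_eq_1_iff)
 moreover have "A = su p q" by (rule mat2_eqI) (simp_all add: s r flip: d)
 ultimately show "EX a b. A = su a b & (cmod a)^2 + (cmod b)^2 = 1" by blast
next
 assume "EX a b. A = su a b & (cmod a)^2 + (cmod b)^2 = 1"
 then obtain a b where A: "A = su a b" and n: "(cmod a)^2 + (cmod b)^2 = 1" by blast
 have "a * cnj a + b * cnj b = 1"
  using n unfolding complex_norm_square[symmetric] of_real_add[symmetric] by simp
 thus "A : carrier SU2"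
  unfolding A SU2_def by (simp add: conj_transpose_su mat_1_su su_cancel[OF n] det_2)
qed

lemma su_in_SU2: "(cmod a)^2 + (cmod b)^2 = 1 ==> su a b : carrier SU2"
 unfolding SU2_carrier_iff by blast

lemma mult_SU2 [simp]: "x \<otimes>\<^bsub>SU2\<^esub> y = x ** y" and one_SU2: "\<one>\<^bsub>SU2\<^esub> = su 1 0"
 by (simp_all add: SU2_def mat_1_su)

lemma group_SU2: "Group.group SU2"
proof (rule groupI)
 fix x y assume "x : carrier SU2" "y : carrier SU2"
 then obtain a b a' b' where "x = su a b" "(cmod a)^2 + (cmod b)^2 = 1" "y = su a' b'" "(cmod a')^2 + (cmod b')^2 = 1"
  unfolding SU2_carrier_iff by blast
 thus "x \<otimes>\<^bsub>SU2\<^esub> y : carrier SU2" using su_norm_mult[of a a' b b'] by (simp add: su_mult su_in_SU2)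
next
 show "\<one>\<^bsub>SU2\<^esub> : carrier SU2" unfolding one_SU2 by (rule su_in_SU2) simp
 fix x y z :: "complex ^ 2 ^ 2"
 show "x \<otimes>\<^bsub>SU2\<^esub> y \<otimes>\<^bsub>SU2\<^esub> z = x \<otimes>\<^bsub>SU2\<^esub> (y \<otimes>\<^bsub>SU2\<^esub> z)" by (simp add: matrix_mul_assoc)
 show "\<one>\<^bsub>SU2\<^esub> \<otimes>\<^bsub>SU2\<^esub> x = x" by (simp add: one_SU2 flip: mat_1_su)
next
 fix x assume "x : carrier SU2"
 then obtain a b where x: "x = su a b" "(cmod a)^2 + (cmod b)^2 = 1" unfolding SU2_carrier_iff by blast
 hence "su (cnj a) (- b) : carrier SU2" by (intro su_in_SU2) simp
 thus "EX y:carrier SU2. y \<otimes>\<^bsub>SU2\<^esub> x = \<one>\<^bsub>SU2\<^esub>"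
  using su_cancel(1)[OF x(2)] by (intro bexI[of _ "su (cnj a) (- b)"]) (simp_all add: x one_SU2)
qed

lemma inv_su: "(cmod a)^2 + (cmod b)^2 = 1 ==> inv\<^bsub>SU2\<^esub> su a b = su (cnj a) (- b)"
 by (rule group.inv_equality[OF group_SU2]) (simp_all add: su_cancel one_SU2 su_in_SU2)

lemma continuous_on_su: "continuous_on UNIV (%p. su (fst p) (snd p))"
 unfolding su_def
proof (intro continuous_on_vec_lambda)
 fix i j :: 2
 show "continuous_on UNIV (%p. if i = 1 then if j = 1 then fst p else snd p else if j = 1 then - cnj (snd p) else cnj (fst p))"
  by (cases "i = 1"; cases "j = 1") (auto intro!: cintros)
qed

lemma compact_SU2: "compact (carrier SU2)"
proof -
 have "carrier SU2 = (%p. su (fst p) (snd p)) ` sphere 0 1"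
 proof (intro equalityI subsetI)
  fix x assume "x : carrier SU2"
  then obtain a b where x: "x = su a b" "(cmod a)^2 + (cmod b)^2 = 1" unfolding SU2_carrier_iff by blast
  hence "(a, b) : sphere 0 1" by (simp add: norm_Pair)
  thus "x : (%p. su (fst p) (snd p)) ` sphere 0 1" using x by (intro image_eqI[of _ _ "(a, b)"]) simp_all
 next
  fix x assume "x : (%p. su (fst p) (snd p)) ` sphere 0 1"
  then obtain a b where "x = su a b" "norm (a, b) = 1" by auto
  thus "x : carrier SU2" by (intro iffD2[OF SU2_carrier_iff] exI[of _ a] exI[of _ b]) (simp add: norm_Pair)
 qed
 moreover have "compact ((%p. su (fst p) (snd p)) ` sphere (0 :: complex \<times> complex) 1)"
  by (intro compact_continuous_image continuous_on_subset[OF continuous_on_su]) auto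
 ultimately show ?thesis by simp
qed

text \<open>The Haar measure is the normalised volume of the unit ball of \<open>\<real>\<^sup>4 = \<complex>\<^sup>2\<close> projected radially to
 the sphere; left translations act on \<open>\<real>\<^sup>4\<close> by rotations.\<close>
definition qa :: "real ^ 4 => complex" where "qa v = Complex (vec_nth v 1) (vec_nth v 2)"
definition qb :: "real ^ 4 => complex" where "qb v = Complex (vec_nth v 3) (vec_nth v 4)"
definition qv :: "complex => complex => real ^ 4" where
 "qv a b = (\<chi> i. if i = 1 then Re a else if i = 2 then Im a else if i = 3 then Re b else Im b)"

lemma q_simps [simp]: "qa (qv a b) = a" "qb (qv a b) = b" "qv (qa v) (qb v) = v"
 by (simp_all add: qa_def qb_def qv_def Finite_Cartesian_Product.vec_eq_iff forall_4)

lemma norm_q: "(norm v)^2 = (cmod (qa v))^2 + (cmod (qb v))^2"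
 unfolding norm_vec_def L2_set_def by (simp add: sum_4 qa_def qb_def cmod_power2 sum_nonneg)

lemma q_linear: "qa (v + w) = qa v + qa w" "qb (v + w) = qb v + qb w" "qa (c *\<^sub>R v) = of_real c * qa v" "qb (c *\<^sub>R v) = of_real c * qb v"
 by (simp_all add: qa_def qb_def complex_eq_iff)

lemma qv_add: "qv (a + a') (b + b') = qv a b + qv a' b'" and qv_scale: "qv (of_real c * a) (of_real c * b) = c *\<^sub>R qv a b"
 by (simp_all add: qv_def Finite_Cartesian_Product.vec_eq_iff forall_4)

definition qrot :: "complex => complex => real ^ 4 => real ^ 4" where
 "qrot al be v = qv (al * qa v - be * cnj (qb v)) (al * qb v + be * cnj (qa v))"

lemma qrot_orthogonal:
 assumes "(cmod al)^2 + (cmod be)^2 = 1"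
 shows "orthogonal_transformation (qrot al be)"
 unfolding orthogonal_transformation
proof (intro conjI allI)
 show "linear (qrot al be)"
 proof (rule linearI)
  fix v w :: "real ^ 4" and c :: real
  show "qrot al be (v + w) = qrot al be v + qrot al be w"
  unfolding qrot_def q_linear qv_add[symmetric] by (simp add: algebra_simps)
  show "qrot al be (c *\<^sub>R v) = c *\<^sub>R qrot al be v"
  unfolding qrot_def q_linear qv_scale[symmetric] by (simp add: algebra_simps)
 qed
 fix v :: "real ^ 4"
 have "(norm (qrot al be v))^2 = (norm v)^2"
  unfolding norm_q qrot_def q_simps su_norm_mult assms by simp
 thus "norm (qrot al be v) = norm v" by (simp add: power2_eq_iff_nonneg)
qed

lemma qrot_inverse:
 assumes "(cmod al)^2 + (cmod be)^2 = 1"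
 shows "qrot (cnj al) (- be) (qrot al be v) = v" "qrot al be (qrot (cnj al) (- be) v) = v"
proof -
 have 1: "al * cnj al + be * cnj be = 1"
  using assms unfolding complex_norm_square[symmetric] of_real_add[symmetric] by simp
 have 2: "cnj al * (al * x - be * y) - - be * (cnj al * y + cnj be * x) = x"
  "al * (cnj al * x + be * y) - be * (al * y - cnj be * x) = x"
  "cnj al * (al * x + be * y) + - be * (cnj al * y - cnj be * x) = x"
  "al * (cnj al * x - be * y) + be * (al * y + cnj be * x) = x" for x y
  using arg_cong[OF 1, of "%z. z * x"] by (simp_all add: algebra_simps)
 show "qrot (cnj al) (- be) (qrot al be v) = v"
  unfolding qrot_def q_simps using 2(1)[of "qa v" "cnj (qb v)"] 2(3)[of "qb v" "cnj (qa v)"] by (simp add: mult.commute)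
 show "qrot al be (qrot (cnj al) (- be) v) = v"
  unfolding qrot_def q_simps using 2(2)[of "qa v" "cnj (qb v)"] 2(4)[of "qb v" "cnj (qa v)"] by (simp add: mult.commute)
qed

definition ball_measure :: "(real ^ 4) measure" where
 "ball_measure = uniform_measure lborel (ball 0 1)"

lemma qrot_ball_measure:
 assumes n: "(cmod al)^2 + (cmod be)^2 = 1"
 shows "distr ball_measure borel (qrot al be) = ball_measure" "qrot al be : borel_measurable borel"
proof -
 note o = qrot_orthogonal[OF n]
 have n': "(cmod (cnj al))^2 + (cmod (- be))^2 = 1" using n by simp
 note o' = qrot_orthogonal[OF n']
 show m: "qrot al be : borel_measurable borel"
  by (intro borel_measurable_continuous_onI linear_continuous_on linear_conv_bounded_linear[THEN iffD1] orthogonal_transformation_linear[OF o])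
 show "distr ball_measure borel (qrot al be) = ball_measure"
 proof (rule measure_eqI)
  show "sets (distr ball_measure borel (qrot al be)) = sets ball_measure" by (simp add: ball_measure_def)
  fix B assume "B : sets (distr ball_measure borel (qrot al be))"
  hence B: "B : sets borel" by simp
  have mb: "qrot al be : measurable ball_measure borel" using m by (simp add: ball_measure_def)
  have vB: "qrot al be -` B : sets borel" using measurable_sets[OF m B] by simp
  have im: "ball 0 1 Int qrot al be -` B = qrot (cnj al) (- be) ` (ball 0 1 Int B)"
  proof (intro equalityI subsetI)
  fix v assume v: "v : ball 0 1 Int qrot al be -` B"
  hence "qrot al be v : ball 0 1 Int B" using orthogonal_transformation_norm[OF o, of v] by simp
  thus "v : qrot (cnj al) (- be) ` (ball 0 1 Int B)"
  using qrot_inverse(1)[OF n, of v] by (intro image_eqI[of _ _ "qrot al be v"]) simp_all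
  next
  fix v assume "v : qrot (cnj al) (- be) ` (ball 0 1 Int B)"
  then obtain w where w: "v = qrot (cnj al) (- be) w" "w : ball 0 1" "w : B" by blast
  thus "v : ball 0 1 Int qrot al be -` B"
  using orthogonal_transformation_norm[OF o', of w] qrot_inverse(2)[OF n, of w] by simp
  qed
  have lm: "X : lmeasurable" if "X : sets borel" "X \<subseteq> ball 0 1" for X :: "(real ^ 4) set"
  by (rule bounded_set_imp_lmeasurable) (use that bounded_subset[OF bounded_ball] in auto)
  have l1: "ball 0 1 Int B : lmeasurable" by (rule lm) (use B in auto)
  have l2: "ball 0 1 Int qrot al be -` B : lmeasurable" by (rule lm) (use vB in auto)
  have e: "emeasure lborel X = ennreal (measure lebesgue X)" if "X : sets borel" "X : lmeasurable" for X :: "(real ^ 4) set"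
  using emeasure_eq_measure2[OF that(2)] that(1) by simp
  have "emeasure lborel (ball 0 1 Int qrot al be -` B) = emeasure lborel (ball 0 1 Int B)"
  proof -
  have "measure lebesgue (ball 0 1 Int qrot al be -` B) = measure lebesgue (ball 0 1 Int B)"
  unfolding im by (rule measure_orthogonal_image[OF o' l1])
  thus ?thesis using e[OF _ l1] e[OF _ l2] B vB by simp
  qed
  thus "emeasure (distr ball_measure borel (qrot al be)) B = emeasure ball_measure B"
  using B vB mb by (subst emeasure_distr) (simp_all add: ball_measure_def)
 qed
qed

definition radial :: "real ^ 4 => complex ^ 2 ^ 2" where
 "radial v = (if v = 0 then su 1 0 else su (qa v / of_real (norm v)) (qb v / of_real (norm v)))"

lemma radial_carrier: "radial v : carrier SU2"
proof (cases "v = 0")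
 case False
 have "(cmod (qa v / of_real (norm v)))^2 + (cmod (qb v / of_real (norm v)))^2 = ((cmod (qa v))^2 + (cmod (qb v))^2) / (norm v)^2"
  by (simp add: norm_divide power_divide add_divide_distrib)
 also have "... = 1" using False by (simp add: norm_q[symmetric])
 finally show ?thesis using False by (simp add: radial_def su_in_SU2)
qed (simp add: radial_def su_in_SU2)

lemma radial_qrot:
 assumes "v ~= 0" "(cmod al)^2 + (cmod be)^2 = 1"
 shows "radial (qrot al be v) = su al be ** radial v"
proof -
 have n: "norm (qrot al be v) = norm v"
  using orthogonal_transformation_norm[OF qrot_orthogonal[OF assms(2)]] .
 hence "qrot al be v ~= 0" using assms(1) by auto
 thus ?thesis using assms(1) n unfolding radial_def
  by (simp add: su_mult) (simp add: qrot_def diff_divide_distrib add_divide_distrib)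
qed

lemma radial_measurable: "radial : borel_measurable borel"
proof -
 have c: "continuous_on UNIV qa" "continuous_on UNIV qb"
  unfolding qa_def[abs_def] qb_def[abs_def] Complex_eq by (intro cintros)+
 have q: "qa : borel_measurable borel" "qb : borel_measurable borel"
  by (rule borel_measurable_continuous_onI[OF c(1)], rule borel_measurable_continuous_onI[OF c(2)])
 have nn: "(%v::real^4. complex_of_real (norm v)) : borel_measurable borel" by (intro borel_measurable_continuous_onI cintros)
 have "(%v. (qa v / of_real (norm v), qb v / of_real (norm v))) : borel_measurable borel"
  by (intro borel_measurable_Pair borel_measurable_divide q nn)
 hence "(%v. su (fst (qa v / of_real (norm v), qb v / of_real (norm v))) (snd (qa v / of_real (norm v), qb v / of_real (norm v)))) : borel_measurable borel"
  by (rule measurable_compose[OF _ borel_measurable_continuous_onI[OF continuous_on_su]])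
 hence 1: "(%v. su (qa v / of_real (norm v)) (qb v / of_real (norm v))) : borel_measurable borel" by simp
 show ?thesis unfolding radial_def[abs_def] by (rule measurable_If[OF _ 1]) simp_all
qed

lemma haar_group_SU2: "haar_group SU2 (distr ball_measure (restrict_space borel (carrier SU2)) radial)"
proof -
 let ?R = "restrict_space borel (carrier SU2)"
 interpret Group.group SU2 by (rule group_SU2)
 have spR: "space ?R = carrier SU2" by (simp add: space_restrict_space)
 have mr: "radial : measurable ball_measure ?R"
  by (rule measurable_into_restrict_borel[OF refl]) (use radial_measurable radial_carrier in \<open>auto simp: ball_measure_def\<close>)
 have pos: "emeasure lborel (ball (0 :: real ^ 4) 1) ~= 0" "emeasure lborel (ball (0 :: real ^ 4) 1) ~= \<infinity>"
 proof -
  have "measure lebesgue (ball (0 :: real ^ 4) 1) > 0" by (simp add: content_ball_pos)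
  thus "emeasure lborel (ball (0 :: real ^ 4) 1) ~= 0" by (auto simp: measure_def)
  show "emeasure lborel (ball (0 :: real ^ 4) 1) ~= \<infinity>"
  using emeasure_bounded_finite[OF bounded_ball, of "0 :: real ^ 4" 1] by simp
 qed
 have ps: "prob_space ball_measure" unfolding ball_measure_def by (rule prob_space_uniform_measure[OF pos])
 show ?thesis
 proof
  show "compact (carrier SU2)" by (rule compact_SU2)
  show "continuous_on (carrier SU2 \<times> carrier SU2) (%p. fst p \<otimes>\<^bsub>SU2\<^esub> snd p)"
  unfolding mult_SU2 matrix_matrix_mult_def by (intro continuous_on_vec_lambda cintros)
  have "cont_on SU2 conj_transpose"
  unfolding conj_transpose_def[abs_def] by (intro continuous_on_vec_lambda cintros)
  thus "cont_on SU2 (%x. inv\<^bsub>SU2\<^esub> x)"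
  by (rule continuous_on_eq) (auto simp: SU2_carrier_iff conj_transpose_su inv_su)
  show "sets (distr ball_measure ?R radial) = sets ?R" by simp
  show "emeasure (distr ball_measure ?R radial) (carrier SU2) = 1"
  using prob_space.emeasure_space_1[OF prob_space.prob_space_distr[OF ps mr]] by (simp add: spR)
  fix x assume x: "x : carrier SU2"
  then obtain al be where x': "x = su al be" "(cmod al)^2 + (cmod be)^2 = 1" unfolding SU2_carrier_iff by blast
  have "cont_on SU2 (%y. x \<otimes>\<^bsub>SU2\<^esub> y)"
  unfolding mult_SU2 matrix_matrix_mult_def by (intro continuous_on_vec_lambda cintros)
  hence mx: "(%y. x \<otimes>\<^bsub>SU2\<^esub> y) : measurable ?R ?R"
  by (intro measurable_into_restrict_borel[OF refl] borel_measurable_continuous_on_restrict)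
  (use x m_closed[OF x] spR in auto)
  have mq: "qrot al be : measurable ball_measure ball_measure"
  using qrot_ball_measure(2)[OF x'(2)] by (simp add: ball_measure_def measurable_cong_sets[OF sets_uniform_measure sets_uniform_measure])
  have "distr (distr ball_measure ?R radial) (distr ball_measure ?R radial) (%y. x \<otimes>\<^bsub>SU2\<^esub> y) = distr (distr ball_measure ?R radial) ?R (%y. x \<otimes>\<^bsub>SU2\<^esub> y)"
  by (rule distr_cong) simp_all
  also have "... = distr ball_measure ?R ((%y. x \<otimes>\<^bsub>SU2\<^esub> y) o radial)" by (rule distr_distr[OF mx mr])
  also have "... = distr ball_measure ?R (radial o qrot al be)"
  proof (rule distr_cong_AE)
  have "AE v in lborel. v ~= (0 :: real ^ 4)" by (rule AE_lborel_singleton)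
  hence "AE v in ball_measure. v ~= 0"
  unfolding ball_measure_def by (intro AE_uniform_measureI) auto
  thus "AE v in ball_measure. ((%y. x \<otimes>\<^bsub>SU2\<^esub> y) o radial) v = (radial o qrot al be) v"
  by eventually_elim (simp add: radial_qrot x')
  show "(%y. x \<otimes>\<^bsub>SU2\<^esub> y) o radial : measurable ball_measure ?R" by (rule measurable_comp[OF mr mx])
  show "radial o qrot al be : measurable ball_measure ?R" by (rule measurable_comp[OF mq mr])
  qed simp_all
  also have "... = distr (distr ball_measure ball_measure (qrot al be)) ?R radial" by (rule distr_distr[OF mr mq, symmetric])
  also have "distr ball_measure ball_measure (qrot al be) = distr ball_measure borel (qrot al be)"
  by (rule distr_cong) (simp_all add: ball_measure_def)
  also have "... = ball_measure" by (rule qrot_ball_measure(1)[OF x'(2)])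
  finally show "distr (distr ball_measure ?R radial) (distr ball_measure ?R radial) (%y. x \<otimes>\<^bsub>SU2\<^esub> y) = distr ball_measure ?R radial" .
 qed
qed

section \<open>The spin representations of \<open>SU(2)\<close>\<close>

text \<open>A matrix acts on polynomials of degree at most \<open>k\<close> by substitution; \<open>pl k A i\<close> is the image of the
 \<open>i\<close>-th power of the variable, \<open>rho k A\<close> the matrix of the action in the basis of powers.  The
 weights in \<open>spin\<close> make this basis orthonormal for the invariant inner product.\<close>
definition pl :: "nat => complex ^ 2 ^ 2 => nat => complex poly" where
 "pl k A i = [:ent A 2 1, ent A 1 1:] ^ i * [:ent A 2 2, ent A 1 2:] ^ (k - i)"

definition rho :: "nat => complex ^ 2 ^ 2 => nat => nat => complex" where
 "rho k A j i = poly.coeff (pl k A i) j"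

definition spin :: "nat => complex ^ 2 ^ 2 => nat => nat => complex" where
 "spin k A j i = of_real (sqrt (real (k choose i) / real (k choose j))) * rho k A j i"

lemma degree_linear_power: "degree ([:a, b :: complex:] ^ n) <= n"
 using degree_power_le[of "[:a, b:]" n] by (auto intro: order_trans)

lemma degree_pl: "i <= k ==> degree (pl k A i) <= k"
proof -
 assume i: "i <= k"
 have "degree (pl k A i) <= i + (k - i)" unfolding pl_def
  by (intro order_trans[OF degree_mult_le] add_mono degree_linear_power)
 thus ?thesis using i by simp
qed

lemma rho_eq_0: "i <= k ==> k < j ==> rho k A j i = 0"
 unfolding rho_def using degree_pl[of i k A] by (intro coeff_eq_0) simp

lemma rho_generating:
 assumes "i <= k"
 shows "(SUM j<=k. rho k A j i * t ^ j) = (ent A 1 1 * t + ent A 2 1) ^ i * (ent A 1 2 * t + ent A 2 2) ^ (k - i)"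
proof -
 have "poly (pl k A i) t = (SUM j<=k. rho k A j i * t ^ j)"
  unfolding rho_def poly_altdef
  by (intro sum.mono_neutral_left) (use degree_pl[OF assms, of A] in \<open>auto simp: coeff_eq_0\<close>)
 thus ?thesis unfolding pl_def by (simp add: poly_power algebra_simps)
qed

lemma rho_generating_hom:
 assumes i: "i <= k"
 shows "(SUM j<=k. rho k A j i * u ^ j * v ^ (k - j)) = (ent A 1 1 * u + ent A 2 1 * v) ^ i * (ent A 1 2 * u + ent A 2 2 * v) ^ (k - i)"
proof (cases "v = 0")
 case True
 have lead: "poly.coeff ([:c, a:] ^ n) n = a ^ n" for a c :: complex and n
 proof (induction n)
  case (Suc n)
  have "poly.coeff ([:c, a:] ^ n) (Suc n) = 0" using degree_linear_power[of c a n] by (intro coeff_eq_0) simp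
  thus ?case using Suc by simp
 qed simp
 have "poly.coeff (p * q) (m + n) = poly.coeff p m * poly.coeff q n" if "degree p <= m" "degree q <= n" for p q :: "complex poly" and m n
 proof -
  have "poly.coeff (p * q) (m + n) = (SUM r<=m + n. if r = m then poly.coeff p m * poly.coeff q n else 0)"
  unfolding coeff_mult
  proof (rule sum_eqI)
  fix r assume "r : {..m + n}"
  show "poly.coeff p r * poly.coeff q (m + n - r) = (if r = m then poly.coeff p m * poly.coeff q n else 0)"
  using that by (cases r m rule: linorder_cases) (simp_all add: coeff_eq_0)
  qed
  thus ?thesis by simp
 qed
 from this[OF degree_linear_power degree_linear_power, of "ent A 2 1" "ent A 1 1" i "ent A 2 2" "ent A 1 2" "k - i"]
 have "rho k A k i = ent A 1 1 ^ i * ent A 1 2 ^ (k - i)"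
  using i unfolding rho_def pl_def lead by simp
 moreover have "(SUM j<=k. rho k A j i * u ^ j * v ^ (k - j)) = (SUM j<=k. if j = k then rho k A k i * u ^ k else 0)"
  using True by (intro sum.cong) auto
 moreover have "u ^ k = u ^ i * u ^ (k - i)" using i by (simp flip: power_add)
 ultimately show ?thesis using True by (simp add: power_mult_distrib)
next
 case False
 have "(SUM j<=k. rho k A j i * u ^ j * v ^ (k - j)) = v ^ k * (SUM j<=k. rho k A j i * (u / v) ^ j)"
  unfolding sum_distrib_left using False by (intro sum.cong) (auto simp: power_divide power_diff)
 also have "... = (v ^ i * v ^ (k - i)) * ((ent A 1 1 * (u / v) + ent A 2 1) ^ i * (ent A 1 2 * (u / v) + ent A 2 2) ^ (k - i))"
  unfolding rho_generating[OF i] using i by (simp flip: power_add)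
 also have "... = (v * (ent A 1 1 * (u / v) + ent A 2 1)) ^ i * (v * (ent A 1 2 * (u / v) + ent A 2 2)) ^ (k - i)"
  unfolding power_mult_distrib by simp
 finally show ?thesis using False by (simp add: distrib_left mult.commute)
qed

lemma rho_mult:
 assumes i: "i <= k"
 shows "rho k (A ** B) l i = (SUM j<=k. rho k A l j * rho k B j i)"
proof -
 have "poly (pl k (A ** B) i) z = poly (SUM j<=k. Polynomial.smult (rho k B j i) (pl k A j)) z" for z
 proof -
  have "poly (SUM j<=k. Polynomial.smult (rho k B j i) (pl k A j)) z =
  (SUM j<=k. rho k B j i * (ent A 1 1 * z + ent A 2 1) ^ j * (ent A 1 2 * z + ent A 2 2) ^ (k - j))"
  by (simp add: poly_sum pl_def poly_power algebra_simps)
  also have "... = poly (pl k (A ** B) i) z"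
  unfolding rho_generating_hom[OF i] pl_def by (simp add: ent_mult poly_power algebra_simps)
  finally show ?thesis by simp
 qed
 hence "pl k (A ** B) i = (SUM j<=k. Polynomial.smult (rho k B j i) (pl k A j))"
  by (intro poly_eq_poly_eq_iff[THEN iffD1] ext)
 thus ?thesis unfolding rho_def by (simp add: coeff_sum mult.commute)
qed

lemma binomial_linear:
 "(SUM i<=k. of_nat (k choose i) * s ^ i * (x ^ i * y ^ (k - i))) = (s * x + y) ^ k" for x y s :: complex
 unfolding binomial_ring by (rule sum.cong) (simp_all add: power_mult_distrib)

lemma polyfun_eqD:
 fixes c d :: "nat => complex"
 assumes "!!t. (SUM i<=n. c i * t ^ i) = (SUM i<=n. d i * t ^ i)" "i <= n"
 shows "c i = d i"
 using polyfun_eq_coeffs[where c = c and d = d and n = n] assms by simp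

text \<open>Both sides are coefficients of the power \<open>(s (a t + c) + b t + d)\<^sup>k\<close>, which is symmetric under transposition
 together with exchange of \<open>s\<close> and \<open>t\<close>.\<close>
lemma rho_transpose:
 assumes j: "j <= k"
 shows "of_nat (k choose i) * rho k A j i = of_nat (k choose j) * rho k (Finite_Cartesian_Product.transpose A) i j"
proof (cases "i <= k")
 case True
 let ?B = "Finite_Cartesian_Product.transpose A"
 have eq: "(SUM i<=k. (SUM j<=k. of_nat (k choose i) * rho k A j i * t ^ j) * s ^ i) =
  (SUM i<=k. (SUM j<=k. of_nat (k choose j) * rho k ?B i j * t ^ j) * s ^ i)" for s t
 proof -
  have "(SUM i<=k. (SUM j<=k. of_nat (k choose i) * rho k A j i * t ^ j) * s ^ i) =
  (SUM i<=k. of_nat (k choose i) * s ^ i * (SUM j<=k. rho k A j i * t ^ j))"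
  unfolding sum_distrib_left sum_distrib_right by (simp add: mult_ac)
  also have "... = (s * (ent A 1 1 * t + ent A 2 1) + (ent A 1 2 * t + ent A 2 2)) ^ k"
  by (subst binomial_linear[symmetric]) (rule sum.cong, simp_all only: rho_generating atMost_iff)
  also have "... = (t * (ent ?B 1 1 * s + ent ?B 2 1) + (ent ?B 1 2 * s + ent ?B 2 2)) ^ k"
  by (simp add: Finite_Cartesian_Product.transpose_def algebra_simps)
  also have "... = (SUM j<=k. of_nat (k choose j) * t ^ j * (SUM i<=k. rho k ?B i j * s ^ i))"
  by (subst binomial_linear[symmetric]) (rule sum.cong, simp_all only: rho_generating atMost_iff)
  also have "... = (SUM i<=k. (SUM j<=k. of_nat (k choose j) * rho k ?B i j * t ^ j) * s ^ i)"
  unfolding sum_distrib_left sum_distrib_right by (subst sum.swap) (simp add: mult_ac)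
  finally show ?thesis .
 qed
 have "(SUM j<=k. of_nat (k choose i) * rho k A j i * t ^ j) = (SUM j<=k. of_nat (k choose j) * rho k ?B i j * t ^ j)" for t
  by (rule polyfun_eqD[OF eq True])
 from polyfun_eqD[OF this j] show ?thesis .
next
 case False
 thus ?thesis using rho_eq_0[OF j, of i] by simp
qed

lemma rho_cnj:
 assumes "i <= k"
 shows "cnj (rho k A j i) = rho k (Finite_Cartesian_Product.transpose (conj_transpose A)) j i"
proof (cases "j <= k")
 case True
 let ?B = "Finite_Cartesian_Product.transpose (conj_transpose A)"
 have "(SUM j<=k. cnj (rho k A j i) * t ^ j) = (SUM j<=k. rho k ?B j i * t ^ j)" for t
 proof -
  have "(SUM j<=k. cnj (rho k A j i) * t ^ j) = cnj (SUM j<=k. rho k A j i * cnj t ^ j)" by simp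
  also have "... = (SUM j<=k. rho k ?B j i * t ^ j)"
  unfolding rho_generating[OF assms] by (simp add: Finite_Cartesian_Product.transpose_def conj_transpose_def)
  finally show ?thesis .
 qed
 from polyfun_eqD[OF this True] show ?thesis .
next
 case False
 thus ?thesis using assms by (simp add: rho_eq_0)
qed

lemma rho_one: "i <= k ==> rho k (su 1 0) j i = (if j = i then 1 else 0)"
proof -
 have "[:0, 1 :: complex:] ^ i = Polynomial.monom 1 i" by (simp add: monom_altdef)
 thus ?thesis unfolding rho_def pl_def by (simp add: pCons_one)
qed

inductive ent_poly :: "nat => (complex ^ 2 ^ 2 => complex) => bool" where
 const: "ent_poly 0 (%A. c)"
| mono: "ent_poly k f ==> ent_poly (Suc k) f" for k
| add: "ent_poly k f ==> ent_poly k g ==> ent_poly k (%A. f A + g A)" for k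
| mult: "ent_poly k f ==> ent_poly (Suc k) (%A. ent A p q * f A)" for k

lemma ent_poly_continuous: "ent_poly k f ==> continuous_on S f" by (induction rule: ent_poly.induct) (auto intro!: cintros)

lemma ent_poly_mono: "ent_poly k f ==> k <= l ==> ent_poly l f"
 by (rotate_tac 1, induction l rule: dec_induct) (auto intro: ent_poly.intros)

lemma ent_poly_scale: "ent_poly k f ==> ent_poly k (%A. c * f A)"
proof (induction rule: ent_poly.induct)
 case (mult k f p q)
 thus ?case using ent_poly.mult[OF mult.IH, of p q] by (simp add: mult.left_commute)
qed (auto intro: ent_poly.intros simp: distrib_left)

lemma ent_poly_mult: "ent_poly k f ==> ent_poly l g ==> ent_poly (k + l) (%A. f A * g A)"
proof (induction rule: ent_poly.induct)
 case (const c)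
 thus ?case using ent_poly_scale[of l g c] by simp
next
 case (mult k f p q)
 thus ?case using ent_poly.mult[of "k + l" "%A. f A * g A" p q] by (simp add: mult.assoc)
qed (auto intro: ent_poly.intros simp: distrib_right)

lemma ent_poly_coeff:
 assumes "!!j. ent_poly k (%A. poly.coeff (f A) j)"
 shows "ent_poly (n + k) (%A. poly.coeff ([:ent A p q, ent A p' q':] ^ n * f A) j)"
proof (induction n arbitrary: j)
 case 0
 thus ?case using assms by simp
next
 case (Suc n)
 let ?f = "%A. [:ent A p q, ent A p' q':] ^ n * f A"
 have gen: "[:c, a:] * X = Polynomial.smult c X + pCons 0 (Polynomial.smult a X)" for c a and X :: "complex poly" by simp
 have e: "[:ent A p q, ent A p' q':] ^ Suc n * f A = Polynomial.smult (ent A p q) (?f A) + pCons 0 (Polynomial.smult (ent A p' q') (?f A))" for A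
  unfolding power_Suc mult.assoc by (rule gen)
 have "ent_poly (Suc (n + k)) (%A. ent A p q * poly.coeff (?f A) j)" for j by (rule ent_poly.mult[OF Suc])
 moreover have "ent_poly (Suc (n + k)) (%A. poly.coeff (pCons 0 (Polynomial.smult (ent A p' q') (?f A))) j)"
  using ent_poly_mono[OF ent_poly.const[of 0], of "Suc (n + k)"] ent_poly.mult[OF Suc, of p' q' "j - 1"] by (cases j) simp_all
 ultimately show ?case unfolding e coeff_add coeff_smult add_Suc
  using ent_poly.add[of "Suc (n + k)" "%A. ent A p q * poly.coeff (?f A) j" "%A. poly.coeff (pCons 0 (Polynomial.smult (ent A p' q') (?f A))) j"] by blast
qed

lemma rho_ent_poly:
 assumes "i <= k"
 shows "ent_poly k (%A. rho k A j i)"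
proof -
 have "ent_poly 0 (%A. poly.coeff (1 :: complex poly) j)" for j by (rule ent_poly.const)
 from ent_poly_coeff[of "k - i + 0" "%A. [:ent A 2 2, ent A 1 2:] ^ (k - i) * 1", OF ent_poly_coeff[of 0 "%A. 1", OF this], of i 2 1 1 1 j]
 show ?thesis using assms unfolding rho_def pl_def by simp
qed

lemma SU2_inv_eq: "A : carrier SU2 ==> inv\<^bsub>SU2\<^esub> A = conj_transpose A"
 unfolding SU2_carrier_iff by (auto simp: inv_su conj_transpose_su)

lemma spin_continuous: "i < Suc k ==> continuous_on S (%A. spin k A j i)"
 unfolding spin_def by (intro cintros ent_poly_continuous[OF rho_ent_poly]) simp

lemma spin_unirep: "unirep SU2 (Suc k) (spin k)"
 unfolding unirep_def
proof (intro conjI ballI allI impI)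
 fix i j assume ij: "i < Suc k" "j < Suc k"
 show "cont_on SU2 (%A. spin k A i j)" by (rule spin_continuous[OF ij(2)])
 show "spin k \<one>\<^bsub>SU2\<^esub> i j = (if i = j then 1 else 0)" using ij by (simp add: spin_def one_SU2 rho_one)
 have c: "real (k choose l) > 0" if "l < Suc k" for l using that by simp
 { fix x y :: "complex ^ 2 ^ 2"
  have "of_real (sqrt (real (k choose l) / real (k choose i))) * of_real (sqrt (real (k choose j) / real (k choose l)))
  = complex_of_real (sqrt (real (k choose j) / real (k choose i)))" if "l < Suc k" for l
  unfolding of_real_mult[symmetric] real_sqrt_mult[symmetric] using c[OF that] by simp
  moreover have "spin k x i l * spin k y l j = (of_real (sqrt (real (k choose l) / real (k choose i))) * of_real (sqrt (real (k choose j) / real (k choose l)))) * (rho k x i l * rho k y l j)" for l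
  unfolding spin_def by (simp only: mult_ac)
  ultimately have "(SUM l<Suc k. spin k x i l * spin k y l j) = (SUM l<Suc k. of_real (sqrt (real (k choose j) / real (k choose i))) * (rho k x i l * rho k y l j))"
  by (intro sum_eqI) (simp only: lessThan_iff)
  thus "spin k (x \<otimes>\<^bsub>SU2\<^esub> y) i j = mm (Suc k) (spin k x) (spin k y) i j"
  unfolding mm_def spin_def[of k "x \<otimes>\<^bsub>SU2\<^esub> y"] using ij by (simp only: rho_mult less_Suc_eq_le mult_SU2 sum_distrib_left lessThan_Suc_atMost) }
 fix A assume A: "A : carrier SU2"
 define a b where "a = real (k choose i)" and "b = real (k choose j)"
 have ab: "a > 0" "b > 0" using c ij by (simp_all add: a_def b_def)
 have "of_real b * rho k (conj_transpose A) i j = of_real a * cnj (rho k A j i)"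
  using rho_transpose[of i k j "conj_transpose A"] rho_cnj[of i k A j] ij by (simp add: a_def b_def)
 hence "rho k (conj_transpose A) i j = of_real (a / b) * cnj (rho k A j i)" using ab by (simp add: eq_divide_eq mult.commute)
 moreover have "of_real (sqrt (b / a)) * (of_real (a / b) * z) = of_real (sqrt (a / b)) * z" for z :: complex
 proof -
  define q where "q = sqrt (a / b)"
  have "sqrt (b / a) = inverse q" unfolding q_def real_sqrt_inverse[symmetric] inverse_divide ..
  moreover have "a / b = q * q" "q ~= 0" using ab by (simp_all add: q_def)
  ultimately have "sqrt (b / a) * (a / b) = q" by simp
  thus ?thesis unfolding mult.assoc[symmetric] of_real_mult[symmetric] q_def by (simp only:)
 qed
 ultimately show "spin k (inv\<^bsub>SU2\<^esub> A) i j = cnj (spin k A j i)"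
  unfolding spin_def SU2_inv_eq[OF A] a_def[symmetric] b_def[symmetric] complex_cnj_mult complex_cnj_complex_of_real by (simp only:)
qed

definition spin_span :: "nat => (complex ^ 2 ^ 2 => complex) set" where
 "spin_span k = {f. EX c. ALL A:carrier SU2. f A = (SUM l<=k. SUM i<=l. SUM j<=l. c l i j * spin l A i j)}"

lemma spin_spanE:
 assumes "f : spin_span k"
 obtains c where "!!A. A : carrier SU2 ==> f A = (SUM l<=k. SUM i<=l. SUM j<=l. c l i j * spin l A i j)"
 using assms unfolding spin_span_def by blast

lemma spin_span_cong: "f : spin_span k ==> (!!A. A : carrier SU2 ==> g A = f A) ==> g : spin_span k"
 unfolding spin_span_def by auto

lemma spin_span_add:
 assumes "f : spin_span k" "g : spin_span k"
 shows "(%A. f A + g A) : spin_span k"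
proof -
 obtain c where c: "!!A. A : carrier SU2 ==> f A = (SUM l<=k. SUM i<=l. SUM j<=l. c l i j * spin l A i j)" using assms(1) by (rule spin_spanE) blast
 obtain d where d: "!!A. A : carrier SU2 ==> g A = (SUM l<=k. SUM i<=l. SUM j<=l. d l i j * spin l A i j)" using assms(2) by (rule spin_spanE) blast
 show ?thesis unfolding spin_span_def
  by (intro CollectI exI[of _ "%l i j. c l i j + d l i j"]) (simp add: c d sum.distrib distrib_right)
qed

lemma spin_span_scale:
 assumes "f : spin_span k"
 shows "(%A. b * f A) : spin_span k"
proof -
 obtain c where c: "!!A. A : carrier SU2 ==> f A = (SUM l<=k. SUM i<=l. SUM j<=l. c l i j * spin l A i j)" using assms(1) by (rule spin_spanE) blast
 show ?thesis unfolding spin_span_def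
  by (intro CollectI exI[of _ "%l i j. b * c l i j"]) (simp add: c sum_distrib_left mult.assoc)
qed

lemma spin_span_sum: "finite I ==> (!!i. i : I ==> f i : spin_span k) ==> (%A. SUM i:I. f i A) : spin_span k"
proof (induction rule: finite_induct)
 case empty
 show ?case unfolding spin_span_def by (intro CollectI exI[of _ "%_ _ _. 0"]) simp
next
 case (insert i I)
 thus ?case by (simp add: spin_span_add)
qed

lemma spin_span_diff: "f : spin_span k ==> g : spin_span k ==> (%A. f A - g A) : spin_span k"
 using spin_span_add[of f k, OF _ spin_span_scale[of g k "-1"]] by simp

lemma spin_in_span:
 assumes "l <= k" "i <= l" "j <= l"
 shows "(%A. spin l A i j) : spin_span k"
proof -
 have "spin l A i j = (SUM l'<=k. SUM i'<=l'. SUM j'<=l'. (if l' = l & i' = i & j' = j then 1 else 0) * spin l' A i' j')" for A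
 proof -
  have "(SUM l'<=k. SUM i'<=l'. SUM j'<=l'. (if l' = l & i' = i & j' = j then 1 else 0) * spin l' A i' j')
  = (SUM l'<=k. if l' = l then spin l A i j else 0)"
  proof (rule sum_eqI)
  fix l' assume "l' : {..k}"
  show "(SUM i'<=l'. SUM j'<=l'. (if l' = l & i' = i & j' = j then 1 else 0) * spin l' A i' j') = (if l' = l then spin l A i j else 0)"
  proof (cases "l' = l")
  case True
  have "(SUM i'<=l. SUM j'<=l. (if i' = i & j' = j then 1 else 0) * spin l A i' j') = (SUM i'<=l. if i' = i then spin l A i j else 0)"
  proof (rule sum_eqI)
  fix i' assume "i' : {..l}"
  have "(SUM j'<=l. (if i' = i & j' = j then 1 else 0) * spin l A i' j') = (SUM j'<=l. if j' = j then (if i' = i then spin l A i j else 0) else 0)"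
  by (rule sum.cong) auto
  thus "(SUM j'<=l. (if i' = i & j' = j then 1 else 0) * spin l A i' j') = (if i' = i then spin l A i j else 0)" using assms by simp
  qed
  thus ?thesis using True assms by simp
  qed simp
  qed
  thus ?thesis using assms by simp
 qed
 thus ?thesis unfolding spin_span_def
  by (intro CollectI exI[of _ "%l' i' j'. if l' = l & i' = i & j' = j then 1 else 0"] ballI)
qed

lemma rho_in_span:
 assumes "l <= k" "i <= l"
 shows "(%A. rho l A j i) : spin_span k"
proof (cases "j <= l")
 case True
 let ?q = "sqrt (real (l choose i) / real (l choose j))"
 have "?q ~= 0" using True assms(2) by simp
 hence "rho l A j i = of_real (inverse ?q) * spin l A j i" for A
  unfolding spin_def mult.assoc[symmetric] of_real_mult[symmetric] by simp
 thus ?thesis using spin_span_scale[OF spin_in_span[OF assms(1) True assms(2)], of "of_real (inverse ?q)"] by simp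
next
 case False
 thus ?thesis using spin_span_sum[of "{}" "%_ _. 0" k] rho_eq_0[OF assms(2), of j] by simp
qed

lemma coeff_linear_mult:
 "poly.coeff ([:c, a:] * q) j = c * poly.coeff q j + (if j = 0 then 0 else a * poly.coeff q (j - 1))" for a c :: complex
 by (cases j) simp_all

lemma SU2_det: "A : carrier SU2 ==> ent A 1 1 * ent A 2 2 - ent A 1 2 * ent A 2 1 = 1" by (simp add: SU2_def det_2)

text \<open>The entries of the spin representation of degree \<open>1\<close> times those of degree \<open>k\<close>: the rows and the
 columns of the degree \<open>k + 1\<close> and \<open>k - 1\<close> representations give linear relations between the
 products that determine all of them.\<close>
lemma ent_rho_in_span:
 assumes i: "i <= k" and j: "j <= k"
 shows "(%A. ent A p q * rho k A j i) : spin_span (Suc k)"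
proof -
 let ?T = "Finite_Cartesian_Product.transpose :: complex ^ 2 ^ 2 => _"
 define B :: "nat => complex" where "B = (%i. of_nat (k choose i))"
 have B: "B i + B (i - 1) ~= 0" if "i <= k" for i
  unfolding B_def of_nat_add[symmetric] of_nat_eq_0_iff using that by simp
 have tr: "B i * rho k A j i = B j * rho k (?T A) i j" for A i
  unfolding B_def by (rule rho_transpose[OF j])
 have rowT: "(%A. B j * rho (Suc k) (?T A) i j') : spin_span (Suc k)" if "j' <= Suc k" for i j'
 proof -
  have "rho (Suc k) (?T A) i j' = of_nat (Suc k choose i) / of_nat (Suc k choose j') * rho (Suc k) A j' i" for A
  using rho_transpose[OF that, of i A] that by (simp add: eq_divide_eq mult.commute)
  hence e: "B j * rho (Suc k) (?T A) i j' = (B j * (of_nat (Suc k choose i) / of_nat (Suc k choose j'))) * rho (Suc k) A j' i" for A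
  by (simp only: mult.assoc)
  show ?thesis
  proof (cases "i <= Suc k")
  case True
  thus ?thesis unfolding e by (intro spin_span_scale rho_in_span) simp
  next
  case False
  thus ?thesis unfolding e using spin_span_sum[of "{}" "%_ _. 0" "Suc k"] by (simp add: binomial_eq_0)
  qed
 qed
 have row: "(%A. B i * (ent A 1 2 * rho k A j i) + (if i = 0 then 0 else B (i - 1) * (ent A 1 1 * rho k A j (i - 1)))) : spin_span (Suc k)"
  "(%A. B i * (ent A 2 2 * rho k A j i) + (if i = 0 then 0 else B (i - 1) * (ent A 2 1 * rho k A j (i - 1)))) : spin_span (Suc k)" for i
 proof -
  have 1: "rho (Suc k) (?T A) i (Suc j) = ent A 1 2 * rho k (?T A) i j + (if i = 0 then 0 else ent A 1 1 * rho k (?T A) (i - 1) j)" for A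
  unfolding rho_def pl_def power_Suc mult.assoc coeff_linear_mult by (simp add: Finite_Cartesian_Product.transpose_def)
  have 2: "rho (Suc k) (?T A) i j = ent A 2 2 * rho k (?T A) i j + (if i = 0 then 0 else ent A 2 1 * rho k (?T A) (i - 1) j)" for A
  unfolding rho_def pl_def Suc_diff_le[OF j] power_Suc mult.left_commute[of _ "[:_, _:]"] coeff_linear_mult
  by (simp add: Finite_Cartesian_Product.transpose_def)
  have e: "B i * (x * rho k A j i) + (if i = 0 then 0 else B (i - 1) * (y * rho k A j (i - 1))) = B j * (x * rho k (?T A) i j + (if i = 0 then 0 else y * rho k (?T A) (i - 1) j))" for x y A
  unfolding distrib_left mult.left_commute[of "B _" x] mult.left_commute[of "B _" y] tr by simp
  show "(%A. B i * (ent A 1 2 * rho k A j i) + (if i = 0 then 0 else B (i - 1) * (ent A 1 1 * rho k A j (i - 1)))) : spin_span (Suc k)"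
  unfolding e 1[symmetric] by (rule rowT) (use j in simp)
  show "(%A. B i * (ent A 2 2 * rho k A j i) + (if i = 0 then 0 else B (i - 1) * (ent A 2 1 * rho k A j (i - 1)))) : spin_span (Suc k)"
  unfolding e 2[symmetric] by (rule rowT) (use j in simp)
 qed
 have col: "(%A. ent A 1 1 * rho k A j (i - 1) - ent A 1 2 * rho k A j i) : spin_span (Suc k)"
  "(%A. ent A 2 2 * rho k A j i - ent A 2 1 * rho k A j (i - 1)) : spin_span (Suc k)" if i: "0 < i" "i <= k" for i
 proof -
  obtain i' k' where ik: "i = Suc i'" "k = Suc k'" "i' <= k'" using i by (metis Suc_le_mono Suc_pred gr0I le_zero_eq)
  have d: "a * (d * x + (if j = 0 then 0 else b * y)) - b * (c * x + (if j = 0 then 0 else a * y)) = (a * d - b * c) * x"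
  "d * (c * x + (if j = 0 then 0 else a * y)) - c * (d * x + (if j = 0 then 0 else b * y)) = (if j = 0 then 0 else (a * d - b * c) * y)" for a b c d x y :: complex
  by (simp_all add: algebra_simps)
  have 1: "rho k A j i = ent A 2 1 * rho k' A j i' + (if j = 0 then 0 else ent A 1 1 * rho k' A (j - 1) i')" for A
  unfolding rho_def pl_def ik power_Suc mult.assoc diff_Suc_Suc coeff_linear_mult ..
  have 2: "rho k A j (i - 1) = ent A 2 2 * rho k' A j i' + (if j = 0 then 0 else ent A 1 2 * rho k' A (j - 1) i')" for A
  unfolding rho_def pl_def ik diff_Suc_1 Suc_diff_le[OF ik(3)] power_Suc mult.left_commute[of _ "[:_, _:]"] coeff_linear_mult ..
  have "ent A 1 1 * rho k A j (i - 1) - ent A 1 2 * rho k A j i = rho k' A j i'"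
  "ent A 2 2 * rho k A j i - ent A 2 1 * rho k A j (i - 1) = (if j = 0 then 0 else rho k' A (j - 1) i')" if "A : carrier SU2" for A
  unfolding 1 2 d SU2_det[OF that] by simp_all
  moreover have "(%A. rho k' A j'' i') : spin_span (Suc k)" for j'' using ik by (intro rho_in_span) simp_all
  moreover have "(%A. 0) : spin_span (Suc k)" using spin_span_sum[of "{}" "%_ _. 0" "Suc k"] by simp
  ultimately show "(%A. ent A 1 1 * rho k A j (i - 1) - ent A 1 2 * rho k A j i) : spin_span (Suc k)"
  "(%A. ent A 2 2 * rho k A j i - ent A 2 1 * rho k A j (i - 1)) : spin_span (Suc k)"
  using spin_span_cong[of "%A. rho k' A j i'" "Suc k" "%A. ent A 1 1 * rho k A j (i - 1) - ent A 1 2 * rho k A j i"]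
  spin_span_cong[of "%A. if j = 0 then 0 else rho k' A (j - 1) i'" "Suc k" "%A. ent A 2 2 * rho k A j i - ent A 2 1 * rho k A j (i - 1)"]
  by (cases "j = 0"; simp)+
 qed
 have second: "(%A. ent A 1 2 * rho k A j i) : spin_span (Suc k)" "(%A. ent A 2 2 * rho k A j i) : spin_span (Suc k)" if i: "i <= k" for i
 proof (atomize(full), cases "i = 0")
  case True
  thus "(%A. ent A 1 2 * rho k A j i) : spin_span (Suc k) & (%A. ent A 2 2 * rho k A j i) : spin_span (Suc k)"
  using row[of 0] by (simp add: B_def)
 next
  case False
  have e: "b * rho k A j i = inverse (B i + B (i - 1)) * ((B i * (b * rho k A j i) + (if i = 0 then 0 else B (i - 1) * (a * rho k A j (i - 1)))) - B (i - 1) * (a * rho k A j (i - 1) - b * rho k A j i))" for a b A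
  proof -
  have "(B i * (b * rho k A j i) + (if i = 0 then 0 else B (i - 1) * (a * rho k A j (i - 1)))) - B (i - 1) * (a * rho k A j (i - 1) - b * rho k A j i) = (B i + B (i - 1)) * (b * rho k A j i)"
  using False by (simp add: algebra_simps)
  thus ?thesis using B[OF i] by simp
  qed
  have e2: "B (i - 1) * (ent A 2 1 * rho k A j (i - 1) - ent A 2 2 * rho k A j i) = - B (i - 1) * (ent A 2 2 * rho k A j i - ent A 2 1 * rho k A j (i - 1))" for A
  by (simp add: algebra_simps)
  have pos: "0 < i" using False by simp
  have "(%A. ent A 1 2 * rho k A j i) : spin_span (Suc k)"
  by (rule spin_span_cong[OF spin_span_scale[OF spin_span_diff[OF row(1)[of i] spin_span_scale[OF col(1)[OF pos i], of "B (i - 1)"]], of "inverse (B i + B (i - 1))"]]) (rule e)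
  moreover have "(%A. ent A 2 2 * rho k A j i) : spin_span (Suc k)"
  by (rule spin_span_cong[OF spin_span_scale[OF spin_span_diff[OF row(2)[of i] spin_span_scale[OF col(2)[OF pos i], of "- B (i - 1)"]], of "inverse (B i + B (i - 1))"]])
  (unfold e2[symmetric], rule e)
  ultimately show "(%A. ent A 1 2 * rho k A j i) : spin_span (Suc k) & (%A. ent A 2 2 * rho k A j i) : spin_span (Suc k)" ..
 qed
 have first: "(%A. ent A 1 1 * rho k A j i) : spin_span (Suc k)" "(%A. ent A 2 1 * rho k A j i) : spin_span (Suc k)"
 proof (atomize(full), cases "i = k")
  case True
  thus "(%A. ent A 1 1 * rho k A j i) : spin_span (Suc k) & (%A. ent A 2 1 * rho k A j i) : spin_span (Suc k)"
  using row[of "Suc k"] by (simp add: B_def binomial_eq_0)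
 next
  case False
  hence ik: "0 < Suc i" "Suc i <= k" using i by simp_all
  show "(%A. ent A 1 1 * rho k A j i) : spin_span (Suc k) & (%A. ent A 2 1 * rho k A j i) : spin_span (Suc k)"
  using spin_span_add[OF col(1)[OF ik] second(1)[OF ik(2)]] spin_span_diff[OF second(2)[OF ik(2)] col(2)[OF ik]] by simp
 qed
 show ?thesis using exhaust_2[of p] exhaust_2[of q] first second[OF i] by auto
qed

lemma spin_span_mono:
 assumes "f : spin_span k" "k <= l"
 shows "f : spin_span l"
proof -
 obtain c where c: "!!A. A : carrier SU2 ==> f A = (SUM l<=k. SUM i<=l. SUM j<=l. c l i j * spin l A i j)" using assms(1) by (rule spin_spanE) blast
 have "(%A. SUM l<=k. SUM i<=l. SUM j<=l. c l i j * spin l A i j) : spin_span l"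
  using assms(2) by (intro spin_span_sum spin_span_scale spin_in_span) auto
 thus ?thesis by (rule spin_span_cong) (rule c)
qed

lemma ent_poly_in_span: "ent_poly k f ==> f : spin_span k"
proof (induction rule: ent_poly.induct)
 case (const c)
 have "(%A. c * rho 0 A 0 0) : spin_span 0" by (intro spin_span_scale rho_in_span) simp_all
 thus ?case by (simp add: rho_def pl_def)
next
 case (mult k f p q)
 obtain c where c: "!!A. A : carrier SU2 ==> f A = (SUM l<=k. SUM i<=l. SUM j<=l. c l i j * spin l A i j)" using mult.IH by (rule spin_spanE) blast
 have "(%A. SUM l<=k. SUM i<=l. SUM j<=l. (c l i j * of_real (sqrt (real (l choose j) / real (l choose i)))) * (ent A p q * rho l A i j)) : spin_span (Suc k)"
  by (intro spin_span_sum spin_span_scale spin_span_mono[OF ent_rho_in_span]) auto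
 thus ?case by (rule spin_span_cong) (simp add: c spin_def sum_distrib_left mult_ac)
qed (auto intro: spin_span_mono spin_span_add)

lemma SU2_polynomial:
 assumes "real_polynomial_function p"
 shows "EX k f. ent_poly k f & (ALL A:carrier SU2. complex_of_real (p A) = f A)"
 using assms
proof (induction rule: real_polynomial_function.induct)
 case (linear p)
 interpret p: bounded_linear p by fact
 define c where "c = (%z w. complex_of_real (p (su z w)))"
 define f where "f = (%A. (c 1 0 / 2) * (ent A 1 1 * 1) + (c 1 0 / 2) * (ent A 2 2 * 1) + (c \<i> 0 / (2 * \<i>)) * (ent A 1 1 * 1) + (- c \<i> 0 / (2 * \<i>)) * (ent A 2 2 * 1)
  + (c 0 1 / 2) * (ent A 1 2 * 1) + (- c 0 1 / 2) * (ent A 2 1 * 1) + (c 0 \<i> / (2 * \<i>)) * (ent A 1 2 * 1) + (c 0 \<i> / (2 * \<i>)) * (ent A 2 1 * 1))"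
 have "ent_poly (Suc 0) f" unfolding f_def by (intro ent_poly.add ent_poly_scale ent_poly.mult ent_poly.const)
 moreover have "complex_of_real (p A) = f A" if mem: "A : carrier SU2" for A
 proof -
  obtain a b where A: "A = su a b" and "(cmod a)^2 + (cmod b)^2 = 1" using mem unfolding SU2_carrier_iff by blast
  have "su a b = Re a *\<^sub>R su 1 0 + Im a *\<^sub>R su \<i> 0 + Re b *\<^sub>R su 0 1 + Im b *\<^sub>R su 0 \<i>"
  by (rule mat2_eqI) (simp_all add: complex_eq_iff)
  hence "p A = Re a * p (su 1 0) + Im a * p (su \<i> 0) + Re b * p (su 0 1) + Im b * p (su 0 \<i>)"
  unfolding A by (simp add: p.add p.scaleR)
  hence "complex_of_real (p A) = of_real (Re a) * c 1 0 + of_real (Im a) * c \<i> 0 + of_real (Re b) * c 0 1 + of_real (Im b) * c 0 \<i>"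
  by (simp add: c_def)
  moreover have "complex_of_real (Re z) * x = z * (x / 2) + cnj z * (x / 2)" "complex_of_real (Im z) * x = z * (x / (2 * \<i>)) - cnj z * (x / (2 * \<i>))" for z x
  unfolding left_diff_distrib[symmetric] distrib_right[symmetric] complex_add_cnj complex_diff_cnj by simp_all
  ultimately have "complex_of_real (p A) = a * (c 1 0 / 2) + cnj a * (c 1 0 / 2) + (a * (c \<i> 0 / (2 * \<i>)) - cnj a * (c \<i> 0 / (2 * \<i>)))
  + (b * (c 0 1 / 2) + cnj b * (c 0 1 / 2)) + (b * (c 0 \<i> / (2 * \<i>)) - cnj b * (c 0 \<i> / (2 * \<i>)))" by (simp only:)
  thus ?thesis unfolding f_def A by (simp only: ent_su mult_1_right mult_minus_left mult_minus_right minus_divide_left[symmetric] minus_minus mult.commute[of "_ / _"]) simp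
 qed
 ultimately show ?case by blast
next
 case (const c)
 thus ?case by (intro exI[of _ 0] exI[of _ "%_. of_real c"]) (simp add: ent_poly.const)
next
 case (add p q)
 then obtain k f l g where f: "ent_poly k f" "ALL A:carrier SU2. complex_of_real (p A) = f A"
  and g: "ent_poly l g" "ALL A:carrier SU2. complex_of_real (q A) = g A" by blast
 have "ent_poly (k + l) (%A. f A + g A)" by (intro ent_poly.add ent_poly_mono[OF f(1)] ent_poly_mono[OF g(1)]) simp_all
 thus ?case using f(2) g(2) by (intro exI conjI) auto
next
 case (mult p q)
 then obtain k f l g where f: "ent_poly k f" "ALL A:carrier SU2. complex_of_real (p A) = f A"
  and g: "ent_poly l g" "ALL A:carrier SU2. complex_of_real (q A) = g A" by blast
 show ?case using ent_poly_mult[OF f(1) g(1)] f(2) g(2) by (intro exI conjI) auto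
qed

lemma spin_torus:
 assumes "i < Suc k"
 shows "spin k (su (cis th) 0) j i = (if j = i then cis ((2 * real i - real k) * th) else 0)"
proof -
 have "pl k (su (cis th) 0) i = Polynomial.monom (cis th ^ i * cnj (cis th) ^ (k - i)) i"
 proof -
  have "[:0, cis th:] ^ i = Polynomial.monom (cis th ^ i) i"
  by (simp add: monom_altdef flip: smult_power[of "cis th" "[:0, 1:]", simplified])
  moreover have "[:z:] ^ n = [:z ^ n:]" for z :: complex and n by (induction n) (simp_all add: pCons_one)
  ultimately show ?thesis unfolding pl_def by (simp add: smult_monom mult.commute)
 qed
 moreover have "cis th ^ i * cnj (cis th) ^ (k - i) = cis ((2 * real i - real k) * th)"
  using assms by (simp add: Complex.DeMoivre cis_cnj cis_mult of_nat_diff algebra_simps)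
 ultimately show ?thesis using assms unfolding spin_def rho_def by simp
qed

lemma su_torus: "su (cis th) 0 : carrier SU2" by (rule su_in_SU2) simp

lemma su_mixing: "su (3/5) (4/5) : carrier SU2" by (rule su_in_SU2) (simp add: power_divide)

lemma spin_mixing: "i < Suc k ==> spin k (su (3/5) (4/5)) 0 i ~= 0"
 by (simp add: spin_def rho_def pl_def coeff_mult_0 coeff_0_power)

context
 fixes M assumes M: "haar_group SU2 M"
begin

interpretation haar_group SU2 M by (rule M)

text \<open>The torus element is chosen so that the weights of both representations have different eigenvalues.\<close>

lemma spin_weights:
 assumes m: "m < Suc k" and n: "n < Suc l" and i: "i < Suc k" and j: "j < Suc l"
  and ne: "2 * real i - real k ~= 2 * real j - real l"
 shows "(LINT x|M. spin k x i m * cnj (spin l x j n)) = 0"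
proof (rule ccontr)
 define th where "th = pi / real (k + l + 1)"
 define S where "S = (LINT x|M. spin k x i m * cnj (spin l x j n))"
 assume "S ~= 0"
 have "(SUM p<Suc k. spin k (su (cis th) 0) i p * (LINT x|M. spin k x p m * cnj (spin l x j n))) = (SUM p<Suc k. if i = p then cis ((2 * real i - real k) * th) * S else 0)"
  by (rule sum_eqI) (simp add: spin_torus S_def)
 also have "... = cis ((2 * real i - real k) * th) * S" using i by (simp del: sum.lessThan_Suc)
 finally have 1: "(SUM p<Suc k. spin k (su (cis th) 0) i p * (LINT x|M. spin k x p m * cnj (spin l x j n))) = cis ((2 * real i - real k) * th) * S" .
 have "(SUM q<Suc l. (LINT x|M. spin k x i m * cnj (spin l x q n)) * spin l (su (cis th) 0) q j) = (SUM q<Suc l. if q = j then S * cis ((2 * real j - real l) * th) else 0)"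
  by (rule sum_eqI) (simp add: spin_torus[OF j] S_def)
 also have "... = S * cis ((2 * real j - real l) * th)" using j by (simp del: sum.lessThan_Suc)
 finally have "cis ((2 * real i - real k) * th) * S = S * cis ((2 * real j - real l) * th)"
  using integral_intertwines[OF spin_unirep spin_unirep su_torus[of th] i m j n] 1 by (simp only:)
 hence eq: "cis ((2 * real i - real k) * th) = cis ((2 * real j - real l) * th)" using \<open>S ~= 0\<close> by simp
 define t where "t = (2 * real i - real k) - (2 * real j - real l)"
 have "cis (t * th) = 1"
 proof -
  have "cis (t * th) = cis ((2 * real i - real k) * th) / cis ((2 * real j - real l) * th)"
  unfolding t_def cis_divide by (simp add: algebra_simps)
  thus ?thesis using eq by simp
 qed
 hence "sin (t * th) = 0" by (simp add: complex_eq_iff)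
 moreover have "\<bar>t * th\<bar> < pi"
 proof -
  have "\<bar>t\<bar> < real (k + l + 1)" using i j by (simp add: t_def abs_less_iff)
  hence "\<bar>t\<bar> * th < real (k + l + 1) * th" by (intro mult_strict_right_mono) (simp_all add: th_def)
  also have "... = pi" by (simp add: th_def)
  finally show ?thesis by (simp add: abs_mult th_def)
 qed
 ultimately have "t * th = 0" using sin_zero_pi_iff by blast
 thus False using ne by (simp add: t_def th_def)
qed

text \<open>The weight of row \<open>0\<close> does not occur in the smaller representation, so that row of the intertwiner vanishes.
 An element whose first row has no zero entry transfers this to the other rows, because each
 column has at most one entry of the right weight.\<close>
lemma spin_orthogonal_gt:
 assumes kl: "l < k" and m: "m < Suc k" and n: "n < Suc l" and i: "i < Suc k" and j: "j < Suc l"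
 shows "(LINT x|M. spin k x i m * cnj (spin l x j n)) = 0"
proof (cases "2 * real i - real k = 2 * real j - real l")
 case True
 let ?S = "%i j. (LINT x|M. spin k x i m * cnj (spin l x j n))"
 have "(SUM p<Suc k. spin k (su (3/5) (4/5)) 0 p * ?S p j) = (SUM q<Suc l. ?S 0 q * spin l (su (3/5) (4/5)) q j)"
  by (rule integral_intertwines[OF spin_unirep spin_unirep su_mixing _ m j n]) simp
 also have "... = 0"
 proof (rule sum.neutral, rule ballI)
  fix q assume "q : {..<Suc l}"
  hence "?S 0 q = 0" using kl by (intro spin_weights m n) simp_all
  thus "?S 0 q * spin l (su (3/5) (4/5)) q j = 0" by simp
 qed
 also have "(SUM p<Suc k. spin k (su (3/5) (4/5)) 0 p * ?S p j) = (SUM p<Suc k. if p = i then spin k (su (3/5) (4/5)) 0 i * ?S i j else 0)"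
 proof (rule sum_eqI)
  fix p assume p: "p : {..<Suc k}"
  show "spin k (su (3/5) (4/5)) 0 p * ?S p j = (if p = i then spin k (su (3/5) (4/5)) 0 i * ?S i j else 0)"
  proof (cases "p = i")
  case False
  hence "?S p j = 0" using True p by (intro spin_weights m n j) auto
  thus ?thesis using False by simp
  qed simp
 qed
 finally show ?thesis using spin_mixing[OF i] i by (simp del: sum.lessThan_Suc)
qed (rule spin_weights[OF m n i j])

lemma spin_orthogonal_same:
 assumes m: "m < Suc k" and n: "n < Suc k" and i: "i < Suc k" and j: "j < Suc k"
 shows "(LINT x|M. spin k x i m * cnj (spin k x j n)) = (if i = j & m = n then 1 / of_nat (Suc k) else 0)"
proof (cases "i = j")
 case True
 let ?S = "%i j. (LINT x|M. spin k x i m * cnj (spin k x j n))"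
 have off: "?S p q = 0" if "p < Suc k" "q < Suc k" "p ~= q" for p q
  using that by (intro spin_weights m n) simp_all
 have diag: "?S p p = ?S 0 0" if p: "p < Suc k" for p
 proof -
  have "(SUM r<Suc k. spin k (su (3/5) (4/5)) 0 r * ?S r p) = (SUM q<Suc k. ?S 0 q * spin k (su (3/5) (4/5)) q p)"
  by (rule integral_intertwines[OF spin_unirep spin_unirep su_mixing _ m p n]) simp
  also have "(SUM r<Suc k. spin k (su (3/5) (4/5)) 0 r * ?S r p) = (SUM r<Suc k. if r = p then spin k (su (3/5) (4/5)) 0 p * ?S p p else 0)"
  by (rule sum_eqI) (use off p in auto)
  also have "(SUM q<Suc k. ?S 0 q * spin k (su (3/5) (4/5)) q p) = (SUM q<Suc k. if q = 0 then ?S 0 0 * spin k (su (3/5) (4/5)) 0 p else 0)"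
  by (rule sum_eqI) (use off p in auto)
  finally show ?thesis using spin_mixing[OF p] p by (simp del: sum.lessThan_Suc)
 qed
 have "(SUM p<Suc k. ?S p p) = (LINT x|M. (SUM p<Suc k. spin k x p m * cnj (spin k x p n)))"
  by (rule integral_sum_cont[symmetric]) (intro cintros spin_continuous m n)
 also have "... = (LINT x|M. (if m = n then 1 else 0))"
 proof (rule integral_eqI)
  fix x assume "x : space M"
  hence x: "x : carrier SU2" by (simp add: space_M)
  hence ix: "inv\<^bsub>SU2\<^esub> x : carrier SU2" by simp
  have "(SUM p<Suc k. spin k x p m * cnj (spin k x p n)) = spin k (inv\<^bsub>SU2\<^esub> x \<otimes>\<^bsub>SU2\<^esub> x) n m"
  unfolding unirepD(1)[OF spin_unirep ix x n m] mm_def by (rule sum_eqI) (use unirepD(2)[OF spin_unirep x n] in simp)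
  also have "... = (if m = n then 1 else 0)" unfolding l_inv[OF x] unirepD(3)[OF spin_unirep n m] by simp
  finally show "(SUM p<Suc k. spin k x p m * cnj (spin k x p n)) = (if m = n then 1 else 0)" .
 qed
 also have "... = (if m = n then 1 else 0)" by (simp add: prob_space)
 also have "(SUM p<Suc k. ?S p p) = (SUM p<Suc k. ?S 0 0)" by (rule sum_eqI) (rule diag, simp)
 finally have "of_nat (Suc k) * ?S 0 0 = (if m = n then 1 else 0)" by (simp only: sum_constant card_lessThan)
 hence "?S 0 0 = (if m = n then 1 else 0) / of_nat (Suc k)" by (simp only: eq_divide_eq of_nat_eq_0_iff mult.commute) simp
 thus ?thesis using diag[OF i] True by simp
next
 case False
 thus ?thesis using spin_weights[OF m n i j] by simp
qed

lemma spin_schur: "schur UNIV Suc spin"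
 unfolding schur_def
proof (intro conjI ballI allI impI)
 fix k l i j m n assume i: "i < Suc k" and j: "j < Suc k" and m: "m < Suc l" and n: "n < Suc l"
 show "(LINT x|M. spin k x i j * cnj (spin l x m n)) = (if k = l & i = m & j = n then 1 / of_nat (Suc k) else 0)"
 proof (cases k l rule: linorder_cases)
  case less
  have "(LINT x|M. spin k x i j * cnj (spin l x m n)) = cnj (LINT x|M. spin l x m n * cnj (spin k x i j))"
  by (simp add: mult.commute flip: Bochner_Integration.integral_cnj)
  thus ?thesis using spin_orthogonal_gt[OF less n j m i] less by simp
 next
  case equal
  thus ?thesis using spin_orthogonal_same[of j k n i m] i j m n by simp
 next
  case greater
  thus ?thesis using spin_orthogonal_gt[OF greater j n i m] by simp
 qed
qed (simp_all add: spin_unirep)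

text \<open>Polynomials in the matrix entries are dense by the theorem of Stone and Weierstrass, and they are
 combinations of entries of the representations.\<close>
lemma spin_peter_weyl: "peter_weyl SU2 M Suc spin"
 unfolding peter_weyl_iff
proof (intro conjI allI impI)
 fix f :: "complex ^ 2 ^ 2 => complex" and x
 assume f: "cont_on SU2 f" and x: "x : carrier SU2"
  and orth: "ALL k i j. i < Suc k --> j < Suc k --> (LINT x|M. f x * cnj (spin k x i j)) = 0"
 have span: "(LINT x|M. f x * cnj (h x)) = 0" if h: "ent_poly k h" for k h
 proof -
  obtain c where c: "!!A. A : carrier SU2 ==> h A = (SUM l<=k. SUM i<=l. SUM j<=l. c l i j * spin l A i j)"
  using ent_poly_in_span[OF h] by (rule spin_spanE) blast
  have cont: "cont_on SU2 (%x. cnj (c l i j) * (f x * cnj (spin l x i j)))" if "j <= l" for l i j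
  by (intro cintros f spin_continuous) (use that in simp)
  have "(LINT x|M. f x * cnj (h x)) = (LINT x|M. (SUM l<=k. SUM i<=l. SUM j<=l. cnj (c l i j) * (f x * cnj (spin l x i j))))"
  by (rule integral_eqI) (simp add: space_M c sum_distrib_left mult_ac)
  also have "... = (SUM l<=k. LINT x|M. (SUM i<=l. SUM j<=l. cnj (c l i j) * (f x * cnj (spin l x i j))))"
  by (rule integral_sum_cont) (intro continuous_on_sum cont, simp)
  also have "... = (SUM l<=k. SUM i<=l. LINT x|M. (SUM j<=l. cnj (c l i j) * (f x * cnj (spin l x i j))))"
  by (rule sum_eqI, rule integral_sum_cont) (intro continuous_on_sum cont, simp)
  also have "... = (SUM l<=k. SUM i<=l. SUM j<=l. LINT x|M. cnj (c l i j) * (f x * cnj (spin l x i j)))"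
  by (rule sum_eqI, rule sum_eqI, rule integral_sum_cont) (intro cont, simp)
  also have "... = 0" using orth by (intro sum.neutral ballI) simp
  finally show ?thesis .
 qed
 obtain B where B: "!!x. x : carrier SU2 ==> cmod (f x) <= B" "B > 0"
  using compact_imp_bounded[OF compact_continuous_image[OF f compact_carrier]] by (auto simp: bounded_pos)
 have small: "(LINT x|M. (cmod (f x))^2) <= B * e" if "e > 0" for e
 proof -
  obtain p where p: "real_polynomial_function p" "!!x. x : carrier SU2 ==> \<bar>Re (f x) - p x\<bar> < e / 2"
  using Stone_Weierstrass_real_polynomial_function[OF compact_carrier, of "%x. Re (f x)" "e / 2"] f \<open>e > 0\<close>
  by (auto intro: cintros)
  obtain q where q: "real_polynomial_function q" "!!x. x : carrier SU2 ==> \<bar>Im (f x) - q x\<bar> < e / 2"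
  using Stone_Weierstrass_real_polynomial_function[OF compact_carrier, of "%x. Im (f x)" "e / 2"] f \<open>e > 0\<close>
  by (auto intro: cintros)
  obtain k g where g: "ent_poly k g" "ALL A:carrier SU2. complex_of_real (p A) = g A" using SU2_polynomial[OF p(1)] by (elim exE conjE)
  obtain l h where h: "ent_poly l h" "ALL A:carrier SU2. complex_of_real (q A) = h A" using SU2_polynomial[OF q(1)] by (elim exE conjE)
  define r where "r = (%A. g A + \<i> * h A)"
  have r: "ent_poly (k + l) r" unfolding r_def
  by (intro ent_poly.add ent_poly_scale ent_poly_mono[OF g(1)] ent_poly_mono[OF h(1)]) simp_all
  have cr: "cont_on SU2 r" by (rule ent_poly_continuous[OF r])
  have near: "cmod (f x - r x) <= e" if "x : carrier SU2" for x
  proof -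
  have "f x - r x = Complex (Re (f x) - p x) (Im (f x) - q x)"
  unfolding r_def using g(2) h(2) that by (auto simp: complex_eq_iff simp flip: )
  hence "cmod (f x - r x) <= \<bar>Re (f x) - p x\<bar> + \<bar>Im (f x) - q x\<bar>" using cmod_le[of "f x - r x"] by simp
  thus ?thesis using p(2)[OF that] q(2)[OF that] by simp
  qed
  have "complex_of_real (LINT x|M. (cmod (f x))^2) = (LINT x|M. f x * cnj (f x))"
  by (simp flip: complex_norm_square integral_complex_of_real)
  also have "... = (LINT x|M. f x * cnj (f x - r x) + f x * cnj (r x))" by (simp add: algebra_simps)
  also have "... = (LINT x|M. f x * cnj (f x - r x)) + (LINT x|M. f x * cnj (r x))"
  by (rule Bochner_Integration.integral_add; rule integrable_cont; intro cintros f cr)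
  finally have "cmod (complex_of_real (LINT x|M. (cmod (f x))^2)) = cmod (LINT x|M. f x * cnj (f x - r x))"
  using span[OF r] by simp
  also have "... <= B * e"
  proof (rule norm_integral_le)
  show "cont_on SU2 (%x. f x * cnj (f x - r x))" by (intro cintros f cr)
  show "cmod (f x * cnj (f x - r x)) <= B * e" if "x : carrier SU2" for x
  unfolding norm_mult complex_mod_cnj using B near[OF that] that by (intro mult_mono) auto
  qed
  finally show ?thesis by simp
 qed
 have "(LINT x|M. (cmod (f x))^2) <= 0"
 proof (rule field_le_epsilon)
  fix e :: real assume "e > 0"
  thus "(LINT x|M. (cmod (f x))^2) <= 0 + e" using small[of "e / B"] B(2) by simp
 qed
 moreover have "(LINT x|M. (cmod (f x))^2) >= 0" by (rule Bochner_Integration.integral_nonneg) simp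
 ultimately have "(LINT x|M. (cmod (f x))^2) = 0" by simp
 hence "(cmod (f x))^2 = 0" by (rule integral_zero_imp_zero[rotated 2, OF _ x]) (auto intro!: cintros f)
 thus "f x = 0" by simp
qed (rule M spin_schur)+

end

section \<open>Averages of coefficient functions\<close>

lemma coef_translate:
 assumes G: "Group.group G" and s: "unirep G d s" and x: "a : carrier G" "x : carrier G" "b : carrier G"
 shows "coef d s u v (a \<otimes>\<^bsub>G\<^esub> x \<otimes>\<^bsub>G\<^esub> b) = coef d s (mv d (s b) u) (mv d (s (inv\<^bsub>G\<^esub> a)) v) x"
proof -
 interpret Group.group G by fact
 have e: "mv d (s (y \<otimes>\<^bsub>G\<^esub> z)) w i = mv d (s y) (mv d (s z) w) i" if "y : carrier G" "z : carrier G" "i < d" for y z w i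
 proof -
  have "mv d (s (y \<otimes>\<^bsub>G\<^esub> z)) w i = mv d (mm d (s y) (s z)) w i"
  unfolding mv_def by (rule sum_eqI) (simp add: unirepD(1)[OF s that])
  thus ?thesis by (simp only: mv_mm)
 qed
 have "coef d s u v (a \<otimes>\<^bsub>G\<^esub> x \<otimes>\<^bsub>G\<^esub> b) = ip d (mv d (s a) (mv d (s x) (mv d (s b) u))) v"
  unfolding coef_def
 proof (rule ip_cong)
  fix i assume i: "i < d"
  have "mv d (s (a \<otimes>\<^bsub>G\<^esub> x \<otimes>\<^bsub>G\<^esub> b)) u i = mv d (s (a \<otimes>\<^bsub>G\<^esub> x)) (mv d (s b) u) i" using x i by (simp add: e)
  also have "... = mv d (s a) (mv d (s x) (mv d (s b) u)) i" using x i by (simp add: e)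
  finally show "mv d (s (a \<otimes>\<^bsub>G\<^esub> x \<otimes>\<^bsub>G\<^esub> b)) u i = mv d (s a) (mv d (s x) (mv d (s b) u)) i" .
 qed simp
 also have "... = ip d (mv d (s x) (mv d (s b) u)) (mv d (adj (s a)) v)" by (rule ip_mv_adj)
 also have "... = coef d s (mv d (s b) u) (mv d (s (inv\<^bsub>G\<^esub> a)) v) x"
  unfolding coef_def
 proof (rule ip_cong)
  fix i assume i: "i < d"
  show "mv d (adj (s a)) v i = mv d (s (inv\<^bsub>G\<^esub> a)) v i"
  unfolding mv_def adj_def by (rule sum_eqI) (simp add: unirepD(2)[OF s x(1) i])
 qed simp
 finally show ?thesis .
qed

lemma continuous_on_sandwich:
 assumes H: "haar_group H N"
  and al: "continuous_on A al" "al ` A \<subseteq> carrier H" and be: "continuous_on A be" "be ` A \<subseteq> carrier H"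
  and W: "cont_on H W" and x: "x : carrier H"
 shows "continuous_on A (%t. W (al t \<otimes>\<^bsub>H\<^esub> x \<otimes>\<^bsub>H\<^esub> be t))"
proof -
 interpret H: haar_group H N by fact
 show ?thesis by (rule continuous_on_compose2[OF W])
  (intro H.continuous_on_mult2 al be continuous_on_const, use al(2) be(2) x in auto)
qed

text \<open>The average of an atom is \<open>\<Sum> C\<^sub>i\<^sub>j s(x)\<^sub>i\<^sub>j\<close> where \<open>C\<close> is an average of rank-one matrices of norm at
 most \<open>1\<close>, hence of trace norm at most \<open>1\<close>.\<close>
lemma Conv_average:
 assumes L: "haar_group L M" and H: "haar_group H N"
  and al: "cont_on L al" "al ` carrier L \<subseteq> carrier H"
  and be: "cont_on L be" "be ` carrier L \<subseteq> carrier H"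
  and W: "W : Conv H r"
 shows "(%x. LINT t|M. W (al t \<otimes>\<^bsub>H\<^esub> x \<otimes>\<^bsub>H\<^esub> be t)) : Conv H r"
proof -
 let ?S = "%x t. al t \<otimes>\<^bsub>H\<^esub> x \<otimes>\<^bsub>H\<^esub> be t"
 interpret L: haar_group L M by fact
 interpret H: haar_group H N by fact
 have gH: "Group.group H" by unfold_locales
 note sw = continuous_on_sandwich[OF H al be]
 have in_H: "al t : carrier H" "be t : carrier H" if "t : carrier L" for t using al(2) be(2) that by auto
 have atom: "(%x. LINT t|M. h (?S x t)) : ahull H 1" if hh: "h : atoms H" for h
 proof -
  obtain d s u v where s: "unirep H d s" and uv: "nrm d u <= 1" "nrm d v <= 1" and h: "!!x. x : carrier H ==> h x = coef d s u v x"
  using hh by (rule atomsE) blast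
  define P where "P = (%t. mv d (s (be t)) u)"
  define Q where "Q = (%t. mv d (s (inv\<^bsub>H\<^esub> al t)) v)"
  define C where "C = (%i j. LINT t|M. P t j * cnj (Q t i))"
  have cP: "cont_on L (%t. P t j)" if "j < d" for j
  unfolding P_def mv_def by (intro cintros continuous_on_compose2[OF unirepD(4)[OF s that] be]) simp
  have cQ: "cont_on L (%t. Q t j)" if "j < d" for j
  proof -
  have "cont_on L (%t. inv\<^bsub>H\<^esub> al t)" by (rule continuous_on_compose2[OF H.continuous_inv al])
  thus ?thesis unfolding Q_def mv_def by (intro cintros continuous_on_compose2[OF unirepD(4)[OF s that]]) (use in_H in auto)
  qed
  have nP: "nrm d (P t) <= 1" and nQ: "nrm d (Q t) <= 1" if "t : carrier L" for t
  using uv in_H[OF that] unfolding P_def Q_def by (simp_all add: unirep_isometry[OF gH s])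
  have nc: "nrm d (%i. cnj (w i)) = nrm d w" for w by (simp add: nrm_def)
  have "tnorm d C <= 1"
  proof (rule tnorm_le)
  fix X assume X: "partial_isometry d X"
  have c: "cont_on L (%t. pairing d (%i j. P t j * cnj (Q t i)) X)"
  unfolding pairing_def by (intro cintros cP cQ) simp_all
  have "pairing d C X = (SUM i<d. SUM j<d. LINT t|M. P t j * cnj (Q t i) * cnj (X i j))"
  unfolding pairing_def C_def by simp
  also have "... = (SUM i<d. LINT t|M. (SUM j<d. P t j * cnj (Q t i) * cnj (X i j)))"
  by (rule sum_eqI, rule L.integral_sum_cont[symmetric]) (intro cintros cP cQ; simp)
  also have "... = (LINT t|M. pairing d (%i j. P t j * cnj (Q t i)) X)"
  unfolding pairing_def by (rule L.integral_sum_cont[symmetric]) (intro cintros cP cQ; simp)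
  also have "cmod ... <= 1"
  proof (rule L.norm_integral_le[OF c])
  fix t assume t: "t : carrier L"
  have "pairing d (%i j. P t j * cnj (Q t i)) X = (SUM a:{()}. 1 * ip d (%i. cnj (Q t i)) (mv d X (%j. cnj (P t j))))"
  by (rule pairing_outer[where s = "%_. 1" and x = "%_ i. cnj (Q t i)" and y = "%_ j. cnj (P t j)"]) simp
  hence "cmod (pairing d (%i j. P t j * cnj (Q t i)) X) <= nrm d (%i. cnj (Q t i)) * nrm d (mv d X (%j. cnj (P t j)))"
  using ip_cauchy_schwarz by simp
  also have "... <= 1 * 1"
  using nQ[OF t] order_trans[OF partial_isometry_contraction[OF X, of "%j. cnj (P t j)"], of 1] nP[OF t]
  by (intro mult_mono) (simp_all add: nc nrm_ge_0)
  finally show "cmod (pairing d (%i j. P t j * cnj (Q t i)) X) <= 1" by simp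
  qed
  finally show "cmod (pairing d C X) <= 1" .
  qed
  hence "(%x. SUM i<d. SUM j<d. C i j * s x i j) : ahull H 1" by (rule hull_mono[OF matrix_coefficients_in_hull[OF s]])
  thus ?thesis
  proof (rule hull_cong)
  fix x assume x: "x : carrier H"
  have "h (?S x t) = (SUM i<d. SUM j<d. s x i j * P t j * cnj (Q t i))" if t: "t : carrier L" for t
  proof -
  have "h (?S x t) = coef d s u v (?S x t)" by (intro h H.m_closed in_H t x)
  also have "... = coef d s (P t) (Q t) x"
  unfolding P_def Q_def by (rule coef_translate[OF gH s in_H(1)[OF t] x in_H(2)[OF t]])
  finally show ?thesis by (simp only: coef_expand)
  qed
  hence "(LINT t|M. h (?S x t)) = (LINT t|M. (SUM i<d. SUM j<d. s x i j * P t j * cnj (Q t i)))"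
  by (intro integral_eqI) (simp only: L.space_M)
  also have "... = (SUM i<d. LINT t|M. (SUM j<d. s x i j * P t j * cnj (Q t i)))"
  by (rule L.integral_sum_cont) (intro cintros cP cQ; simp)
  also have "... = (SUM i<d. SUM j<d. LINT t|M. s x i j * P t j * cnj (Q t i))"
  by (rule sum_eqI, rule L.integral_sum_cont) (intro cintros cP cQ; simp)
  finally show "(LINT t|M. h (?S x t)) = (SUM i<d. SUM j<d. C i j * s x i j)"
  unfolding C_def mult.assoc by (simp add: mult.commute[of "L.expectation _"])
  qed
 qed
 have hull: "(%x. LINT t|M. h (?S x t)) : ahull H r" if hh: "h : ahull H r" for h
 proof -
  obtain n :: nat and c a where a: "!!q. q < n ==> a q : atoms H" and c: "(SUM q<n. cmod (c q)) <= r"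
  and h: "!!x. x : carrier H ==> h x = (SUM q<n. c q * a q x)" using hh by (rule hullE) blast
  have "(%x. SUM q:{..<n}. c q * (LINT t|M. a q (?S x t))) : ahull H (SUM q:{..<n}. cmod (c q) * 1)"
  by (intro hull_sum hull_scale atom a) simp_all
  hence "(%x. SUM q:{..<n}. c q * (LINT t|M. a q (?S x t))) : ahull H r" by (rule hull_mono) (use c in simp)
  thus ?thesis
  proof (rule hull_cong)
  fix x assume x: "x : carrier H"
  have "(LINT t|M. h (?S x t)) = (LINT t|M. (SUM q<n. c q * a q (?S x t)))"
  by (rule integral_eqI) (simp add: L.space_M h x in_H)
  also have "... = (SUM q<n. LINT t|M. c q * a q (?S x t))"
  by (rule L.integral_sum_cont) (intro cintros sw atom_continuous a x; simp)
  finally show "(LINT t|M. h (?S x t)) = (SUM q:{..<n}. c q * (LINT t|M. a q (?S x t)))" by simp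
  qed
 qed
 show ?thesis
 proof (rule ConvI)
  fix e :: real assume "e > 0"
  with W obtain h where h: "h : ahull H r" "!!x. x : carrier H ==> cmod (W x - h x) <= e" by (rule ConvE) blast
  have "cmod ((LINT t|M. W (?S x t)) - (LINT t|M. h (?S x t))) <= e" if x: "x : carrier H" for x
  proof -
  note cc = sw[OF Conv_continuous[OF W] x] sw[OF hull_continuous[OF h(1)] x]
  have "(LINT t|M. W (?S x t)) - (LINT t|M. h (?S x t)) =
  (LINT t|M. W (?S x t) - h (?S x t))" by (rule Bochner_Integration.integral_diff[symmetric]; rule L.integrable_cont; rule cc)
  also have "cmod ... <= e" by (rule L.norm_integral_le) (intro cintros cc, simp add: h(2) x in_H)
  finally show ?thesis .
  qed
  thus "EX h:ahull H r. ALL x:carrier H. cmod ((LINT t|M. W (?S x t)) - h x) <= e" by (intro bexI[OF _ hull[OF h(1)]] ballI)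
 qed
qed

section \<open>The algebras \<open>A\<^bsub>\<gamma>\<^esub>\<^sup>n\<close> as functions on powers\<close>

text \<open>The product of all \<open>2\<^sup>n\<close> factors.  The points \<open>lmap K n m g\<close> and \<open>rmap K n m g\<close> have \<open>g\<close> as their first,
 respectively last factor and are trivial otherwise; multiplying by them from the left,
 respectively right, multiplies the product by \<open>g\<close>.\<close>
fun prodmap :: "('a, 'r) monoid_scheme => nat => nat => (nat => 'a) => nat => 'a" where
 "prodmap K 0 m x = x"
| "prodmap K (Suc n) m x =
  pow_fst m (prodmap K n (2 * m) x) \<otimes>\<^bsub>pow_group K m\<^esub> pow_snd m (prodmap K n (2 * m) x)"

fun lmap :: "('a, 'r) monoid_scheme => nat => nat => (nat => 'a) => nat => 'a" where
 "lmap K 0 m g = g"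
| "lmap K (Suc n) m g = lmap K n (2 * m) (pow_pair m g \<one>\<^bsub>pow_group K m\<^esub>)"

fun rmap :: "('a, 'r) monoid_scheme => nat => nat => (nat => 'a) => nat => 'a" where
 "rmap K 0 m g = g"
| "rmap K (Suc n) m g = rmap K n (2 * m) (pow_pair m \<one>\<^bsub>pow_group K m\<^esub> g)"

lemma pow_Suc_mult: "2 ^ Suc n * m = 2 ^ n * (2 * m :: nat)" by simp

lemma lmap_continuous: "continuous_on A f ==> continuous_on A (%x. lmap K n m (f x))"
proof (induction n arbitrary: m f)
 case (Suc n)
 have "continuous_on A (%x. pow_pair m (f x) \<one>\<^bsub>pow_group K m\<^esub>)"
  by (intro continuous_on_pow_pair continuous_on_const Suc.prems)
 from Suc.IH[OF this] show ?case by simp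
qed simp

lemma rmap_continuous: "continuous_on A f ==> continuous_on A (%x. rmap K n m (f x))"
proof (induction n arbitrary: m f)
 case (Suc n)
 have "continuous_on A (%x. pow_pair m \<one>\<^bsub>pow_group K m\<^esub> (f x))"
  by (intro continuous_on_pow_pair continuous_on_const Suc.prems)
 from Suc.IH[OF this] show ?case by simp
qed simp

definition gamma_ball :: "('a::topological_space, 'r) monoid_scheme => nat => nat => real => ((nat => 'a) => complex) set" where
 "gamma_ball K n m r = {u. (ALL x. x ~: carrier (pow_group K m) --> u x = 0) &
  (%x. u (prodmap K n m x)) : Conv (pow_group K (2 ^ n * m)) r}"

locale compact_powers =
 fixes K :: "('a::polish_space, 'r) monoid_scheme"
 assumes K: "Group.group K" and pw: "!!j. EX M d \<pi>. peter_weyl (pow_group K (2 ^ j)) M d \<pi>"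
begin

abbreviation G where "G m \<equiv> pow_group K m"
abbreviation T where "T \<equiv> top_of_set (carrier K)"
abbreviation mu where "mu m \<equiv> haar_measure (G m) (pow_top T m)"

lemma gG: "Group.group (G m)" by (rule group_pow_group[OF K])

lemma pw_pow: "EX d \<pi>. peter_weyl (G (2 ^ j)) (mu (2 ^ j)) d \<pi>"
proof -
 obtain M d \<pi> where p: "peter_weyl (G (2 ^ j)) M d \<pi>" using pw by blast
 then interpret peter_weyl "G (2 ^ j)" M d \<pi> .
 have "mu (2 ^ j) = M" unfolding pow_top_eq by (rule haar_measure_eq)
 thus ?thesis using p by (intro exI) (simp only:)
qed

lemma haar_pow: "haar_group (G (2 ^ j)) (mu (2 ^ j))"
proof -
 obtain d \<pi> where "peter_weyl (G (2 ^ j)) (mu (2 ^ j)) d \<pi>" using pw_pow[of j] by blast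
 thus ?thesis unfolding peter_weyl_iff by (rule conjunct1)
qed

lemma one_pow [simp, intro]: "\<one>\<^bsub>G m\<^esub> : carrier (G m)"
 using gG by (rule Group.group.is_monoid[THEN monoid.one_closed])

lemma mult_pow [simp, intro]: "x : carrier (G m) ==> y : carrier (G m) ==> x \<otimes>\<^bsub>G m\<^esub> y : carrier (G m)"
 using gG by (rule Group.group.is_monoid[THEN monoid.m_closed])

lemma prodmap_carrier: "x : carrier (G (2 ^ n * m)) ==> prodmap K n m x : carrier (G m)"
proof (induction n arbitrary: m)
 case (Suc n)
 hence "prodmap K n (2 * m) x : carrier (G (2 * m))" unfolding pow_Suc_mult by (intro Suc.IH)
 thus ?case by (simp add: pow_proj_carrier)
qed simp

lemma lmap_carrier: "g : carrier (G m) ==> lmap K n m g : carrier (G (2 ^ n * m))"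
 by (induction n arbitrary: m g) (simp_all only: lmap.simps pow_Suc_mult pow_pair_carrier one_pow mult_1 power_0)

lemma rmap_carrier: "g : carrier (G m) ==> rmap K n m g : carrier (G (2 ^ n * m))"
 by (induction n arbitrary: m g) (simp_all only: rmap.simps pow_Suc_mult pow_pair_carrier one_pow mult_1 power_0)

lemma prodmap_translate:
 assumes "x : carrier (G (2 ^ n * m))" "g : carrier (G m)" "h : carrier (G m)"
 shows "prodmap K n m (lmap K n m g \<otimes>\<^bsub>G (2 ^ n * m)\<^esub> x \<otimes>\<^bsub>G (2 ^ n * m)\<^esub> rmap K n m h) = g \<otimes>\<^bsub>G m\<^esub> prodmap K n m x \<otimes>\<^bsub>G m\<^esub> h"
 using assms
proof (induction n arbitrary: m g h)
 case (Suc n)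
 interpret Gm: Group.group "G m" by (rule gG)
 let ?p = "pow_pair m g \<one>\<^bsub>G m\<^esub>" and ?q = "pow_pair m \<one>\<^bsub>G m\<^esub> h"
 have x: "x : carrier (G (2 ^ n * (2 * m)))" using Suc.prems(1) unfolding pow_Suc_mult .
 have pq: "?p : carrier (G (2 * m))" "?q : carrier (G (2 * m))" using Suc.prems by (auto intro: pow_pair_carrier)
 define y where "y = prodmap K n (2 * m) x"
 have y: "pow_fst m y : carrier (G m)" "pow_snd m y : carrier (G m)"
  unfolding y_def by (rule pow_proj_carrier[OF prodmap_carrier[OF x]])+
 have "prodmap K n (2 * m) (lmap K (Suc n) m g \<otimes>\<^bsub>G (2 ^ Suc n * m)\<^esub> x \<otimes>\<^bsub>G (2 ^ Suc n * m)\<^esub> rmap K (Suc n) m h) = ?p \<otimes>\<^bsub>G (2 * m)\<^esub> y \<otimes>\<^bsub>G (2 * m)\<^esub> ?q"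
  unfolding lmap.simps rmap.simps pow_Suc_mult y_def by (rule Suc.IH[OF x pq])
 thus ?case
  unfolding prodmap.simps y_def[symmetric] using y Suc.prems by (simp add: pow_proj_mult pow_proj_pair[where K = K] Gm.m_assoc)
qed simp

lemma prodmap_one: "prodmap K n m \<one>\<^bsub>G (2 ^ n * m)\<^esub> = \<one>\<^bsub>G m\<^esub>"
proof (induction n arbitrary: m)
 case (Suc n)
 interpret Gm: Group.group "G m" by (rule gG)
 have "\<one>\<^bsub>G (2 * m)\<^esub> = pow_pair m \<one>\<^bsub>G m\<^esub> \<one>\<^bsub>G m\<^esub>"
  unfolding one_pow_group pow_pair_def by (rule restrict_ext) auto
 thus ?case unfolding prodmap.simps pow_Suc_mult Suc by (simp add: pow_proj_pair[where K = K])
qed simp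

definition sect :: "nat => nat => (nat => 'a) => nat => 'a" where
 "sect n m g = lmap K n m g \<otimes>\<^bsub>G (2 ^ n * m)\<^esub> \<one>\<^bsub>G (2 ^ n * m)\<^esub> \<otimes>\<^bsub>G (2 ^ n * m)\<^esub> rmap K n m \<one>\<^bsub>G m\<^esub>"

lemma sect:
 assumes "g : carrier (G m)"
 shows "sect n m g : carrier (G (2 ^ n * m))" "prodmap K n m (sect n m g) = g"
proof -
 interpret Gm: Group.group "G m" by (rule gG)
 show "sect n m g : carrier (G (2 ^ n * m))"
  unfolding sect_def by (intro mult_pow lmap_carrier rmap_carrier one_pow assms)
 show "prodmap K n m (sect n m g) = g"
  unfolding sect_def prodmap_translate[OF one_pow assms one_pow] prodmap_one using assms by simp
qed

lemma prodmap_continuous: "cont_on (G (2 ^ n * 2 ^ j)) (prodmap K n (2 ^ j))"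
proof (induction n arbitrary: j)
 case 0
 show ?case by (simp add: continuous_on_id)
next
 case (Suc n)
 interpret haar_group "G (2 ^ j)" "mu (2 ^ j)" by (rule haar_pow)
 have "cont_on (G (2 ^ n * 2 ^ Suc j)) (prodmap K n (2 ^ Suc j))" by (rule Suc.IH)
 hence c: "continuous_on (carrier (G (2 ^ n * (2 * 2 ^ j)))) (prodmap K n (2 * 2 ^ j))" by (simp only: power_Suc)
 show ?case
  unfolding prodmap.simps[abs_def] pow_Suc_mult
  by (intro continuous_on_mult2 continuous_on_compose2[OF continuous_on_pow_proj(1)[of UNIV] c] continuous_on_compose2[OF continuous_on_pow_proj(2)[of UNIV] c])
  (auto intro: pow_proj_carrier prodmap_carrier)
qed

lemma gamma_embed_eq:
 assumes "!!x. x ~: carrier (G m) ==> u x = 0"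
 shows "gamma_embed K n m u = zero_ext (carrier (G (2 ^ n * m))) (%x. u (prodmap K n m x))"
 using assms
proof (induction n arbitrary: m u)
 case 0
 thus ?case by (auto simp: zero_ext_def fun_eq_iff)
next
 case (Suc n)
 have "gamma_embed K (Suc n) m u = zero_ext (carrier (G (2 ^ n * (2 * m)))) (%x. N_check K m u (prodmap K n (2 * m) x))"
  unfolding gamma_embed.simps by (rule Suc.IH) (simp add: N_check_def zero_ext_def)
 also have "... = zero_ext (carrier (G (2 ^ Suc n * m))) (%x. u (prodmap K (Suc n) m x))"
  unfolding pow_Suc_mult zero_ext_def N_check_def by (rule ext) (simp add: prodmap_carrier)
 finally show ?case .
qed

lemma gamma_ball_0: "u : gamma_ball K 0 m r \<longleftrightarrow> (ALL x. x ~: carrier (G m) --> u x = 0) & u : Conv (G m) r"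
 by (simp add: gamma_ball_def)

lemma gamma_ball_N_check:
 assumes "u : gamma_ball K (Suc n) m r"
 shows "N_check K m u : gamma_ball K n (2 * m) r"
proof -
 have u: "(%x. u (prodmap K (Suc n) m x)) : Conv (G (2 ^ n * (2 * m))) r"
  using assms unfolding gamma_ball_def pow_Suc_mult by simp
 have "(%x. N_check K m u (prodmap K n (2 * m) x)) : Conv (G (2 ^ n * (2 * m))) r"
  by (rule Conv_cong[OF u]) (simp add: N_check_def zero_ext_def prodmap_carrier)
 thus ?thesis by (simp add: gamma_ball_def N_check_def zero_ext_def)
qed

lemma Q_N_check:
 assumes u: "!!x. x ~: carrier (G (2 ^ j)) ==> u x = 0"
 shows "Q_check K T (2 ^ j) (N_check K (2 ^ j) u) = u"
proof
 interpret haar_group "G (2 ^ j)" "mu (2 ^ j)" by (rule haar_pow)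
 fix s
 show "Q_check K T (2 ^ j) (N_check K (2 ^ j) u) s = u s"
 proof (cases "s : carrier (G (2 ^ j))")
  case True
  have "(LINT t|mu (2 ^ j). N_check K (2 ^ j) u (pow_pair (2 ^ j) (s \<otimes>\<^bsub>G (2 ^ j)\<^esub> t) (inv\<^bsub>G (2 ^ j)\<^esub> t))) = (LINT t|mu (2 ^ j). u s)"
  proof (rule integral_eqI)
  fix t assume "t : space (mu (2 ^ j))"
  hence t: "t : carrier (G (2 ^ j))" by (simp add: space_M)
  have "pow_pair (2 ^ j) (s \<otimes>\<^bsub>G (2 ^ j)\<^esub> t) (inv\<^bsub>G (2 ^ j)\<^esub> t) : carrier (G (2 * 2 ^ j))"
  using True t by (intro pow_pair_carrier) auto
  moreover have "s \<otimes>\<^bsub>G (2 ^ j)\<^esub> t \<otimes>\<^bsub>G (2 ^ j)\<^esub> inv\<^bsub>G (2 ^ j)\<^esub> t = s" using True t by (simp add: m_assoc)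
  ultimately show "N_check K (2 ^ j) u (pow_pair (2 ^ j) (s \<otimes>\<^bsub>G (2 ^ j)\<^esub> t) (inv\<^bsub>G (2 ^ j)\<^esub> t)) = u s"
  using True t by (simp add: N_check_def zero_ext_def pow_proj_pair[where K = K])
  qed
  thus ?thesis using True by (simp add: Q_check_def Let_def zero_ext_def prob_space)
 next
  case False
  thus ?thesis using u by (simp add: Q_check_def Let_def zero_ext_def)
 qed
qed

text \<open>By invariance of Haar measure \<open>Q w (a b) = \<integral> w (a t, t\<^sup>-\<^sup>1 b) dt\<close>, and \<open>(a t, t\<^sup>-\<^sup>1 b)\<close> is the translate
 \<open>(1, t\<^sup>-\<^sup>1) (a, b) (t, 1)\<close>.\<close>
lemma gamma_ball_Q_check:
 assumes w: "w : gamma_ball K n (2 * 2 ^ j) r"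
 shows "Q_check K T (2 ^ j) w : gamma_ball K (Suc n) (2 ^ j) r"
proof -
 let ?m = "2 ^ j :: nat"
 let ?H = "G (2 ^ n * (2 * ?m))"
 interpret L: haar_group "G ?m" "mu ?m" by (rule haar_pow)
 have eq: "2 ^ n * (2 * ?m) = 2 ^ (n + Suc j)" by (simp add: power_add)
 have H: "haar_group ?H (mu (2 ^ n * (2 * ?m)))" unfolding eq by (rule haar_pow)
 interpret H: haar_group ?H "mu (2 ^ n * (2 * ?m))" by (rule H)
 define W where "W = (%x. w (prodmap K n (2 * ?m) x))"
 have W: "W : Conv ?H r" using w by (simp add: gamma_ball_def W_def)
 define al where "al = (%t. lmap K n (2 * ?m) (pow_pair ?m \<one>\<^bsub>G ?m\<^esub> (inv\<^bsub>G ?m\<^esub> t)))"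
 define be where "be = (%t. rmap K n (2 * ?m) (pow_pair ?m t \<one>\<^bsub>G ?m\<^esub>))"
 have al: "cont_on (G ?m) al" "al ` carrier (G ?m) \<subseteq> carrier ?H"
  unfolding al_def by (intro lmap_continuous continuous_on_pow_pair continuous_on_const L.continuous_inv)
  (auto intro!: lmap_carrier pow_pair_carrier)
 have be: "cont_on (G ?m) be" "be ` carrier (G ?m) \<subseteq> carrier ?H"
  unfolding be_def by (intro rmap_continuous continuous_on_pow_pair continuous_on_const continuous_on_id)
  (auto intro!: rmap_carrier pow_pair_carrier)
 have "(%x. LINT t|mu ?m. W (al t \<otimes>\<^bsub>?H\<^esub> x \<otimes>\<^bsub>?H\<^esub> be t)) : Conv ?H r"
  by (rule Conv_average[OF L.haar_group_axioms H al be W])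
 hence "(%x. Q_check K T ?m w (prodmap K (Suc n) ?m x)) : Conv ?H r"
 proof (rule Conv_cong)
  fix x assume x: "x : carrier ?H"
  define y where "y = prodmap K n (2 * ?m) x"
  define a b where "a = pow_fst ?m y" and "b = pow_snd ?m y"
  have y: "y : carrier (G (2 * ?m))" unfolding y_def by (rule prodmap_carrier[OF x])
  have ab: "a : carrier (G ?m)" "b : carrier (G ?m)" unfolding a_def b_def by (rule pow_proj_carrier[OF y])+
  have yab: "y = pow_pair ?m a b" unfolding a_def b_def by (rule pow_pair_proj[OF y, symmetric])
  define f where "f = (%t. W (al t \<otimes>\<^bsub>?H\<^esub> x \<otimes>\<^bsub>?H\<^esub> be t))"
  have cf: "cont_on (G ?m) f"
  unfolding f_def by (rule continuous_on_sandwich[OF H al be Conv_continuous[OF W] x])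
  have f: "f t = w (pow_pair ?m (a \<otimes>\<^bsub>G ?m\<^esub> t) (inv\<^bsub>G ?m\<^esub> t \<otimes>\<^bsub>G ?m\<^esub> b))" if t: "t : carrier (G ?m)" for t
  proof -
  have p: "pow_pair ?m \<one>\<^bsub>G ?m\<^esub> (inv\<^bsub>G ?m\<^esub> t) : carrier (G (2 * ?m))" "pow_pair ?m t \<one>\<^bsub>G ?m\<^esub> : carrier (G (2 * ?m))"
  using t by (auto intro: pow_pair_carrier)
  have "f t = w (pow_pair ?m \<one>\<^bsub>G ?m\<^esub> (inv\<^bsub>G ?m\<^esub> t) \<otimes>\<^bsub>G (2 * ?m)\<^esub> y \<otimes>\<^bsub>G (2 * ?m)\<^esub> pow_pair ?m t \<one>\<^bsub>G ?m\<^esub>)"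
  unfolding f_def W_def al_def be_def prodmap_translate[OF x p] y_def ..
  also have "... = w (pow_pair ?m (a \<otimes>\<^bsub>G ?m\<^esub> t) (inv\<^bsub>G ?m\<^esub> t \<otimes>\<^bsub>G ?m\<^esub> b))"
  unfolding yab pow_pair_mult[symmetric] using t ab by simp
  finally show ?thesis .
  qed
  have "prodmap K (Suc n) ?m x = a \<otimes>\<^bsub>G ?m\<^esub> b" by (simp add: a_def b_def y_def)
  hence "Q_check K T ?m w (prodmap K (Suc n) ?m x) = (LINT t|mu ?m. w (pow_pair ?m (a \<otimes>\<^bsub>G ?m\<^esub> b \<otimes>\<^bsub>G ?m\<^esub> t) (inv\<^bsub>G ?m\<^esub> t)))"
  using ab by (simp add: Q_check_def Let_def zero_ext_def)
  also have "... = (LINT t|mu ?m. f (b \<otimes>\<^bsub>G ?m\<^esub> t))"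
  proof (rule integral_eqI)
  fix t assume "t : space (mu ?m)"
  hence t: "t : carrier (G ?m)" by (simp add: L.space_M)
  have "inv\<^bsub>G ?m\<^esub> (b \<otimes>\<^bsub>G ?m\<^esub> t) \<otimes>\<^bsub>G ?m\<^esub> b = inv\<^bsub>G ?m\<^esub> t"
  using ab t by (simp add: L.inv_mult_group L.m_assoc)
  thus "w (pow_pair ?m (a \<otimes>\<^bsub>G ?m\<^esub> b \<otimes>\<^bsub>G ?m\<^esub> t) (inv\<^bsub>G ?m\<^esub> t)) = f (b \<otimes>\<^bsub>G ?m\<^esub> t)"
  using ab t by (simp add: f L.m_assoc)
  qed
  also have "... = (LINT t|mu ?m. f t)" by (rule L.integral_left[OF cf ab(2)])
  finally show "Q_check K T ?m w (prodmap K (Suc n) ?m x) = (LINT t|mu ?m. W (al t \<otimes>\<^bsub>?H\<^esub> x \<otimes>\<^bsub>?H\<^esub> be t))" unfolding f_def .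
 qed
 thus ?thesis
  unfolding gamma_ball_def pow_Suc_mult by (simp add: Q_check_def Let_def zero_ext_def)
qed

lemma gamma_ball_ge_0: "u : gamma_ball K n m r ==> 0 <= r"
 unfolding gamma_ball_def using Conv_ge_0 by blast

lemma gamma_ball_right_continuous:
 assumes "!!e. e > 0 ==> u : gamma_ball K n m (r + e)" and r: "0 <= r"
 shows "u : gamma_ball K n m r"
proof -
 have u1: "ALL x. x ~: carrier (G m) --> u x = 0"
  using assms(1)[of 1] unfolding gamma_ball_def mem_Collect_eq by simp
 have u2: "(%x. u (prodmap K n m x)) : Conv (G (2 ^ n * m)) (r + e)" if "e > 0" for e
  using assms(1)[OF that] unfolding gamma_ball_def mem_Collect_eq by (rule conjunct2)
 show ?thesis
  unfolding gamma_ball_def by (intro CollectI conjI u1 Conv_right_continuous[OF gG u2 r])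
qed

text \<open>Both inclusions use the maps between the levels: \<open>Q\<close> does not increase the radius, and \<open>N u\<close> is a
 preimage of \<open>u\<close> under \<open>Q\<close> with the same radius.  So the infimum in the quotient norm is attained.\<close>
lemma A_gamma_iff_aux:
 "(u : A_gamma K T n (2 ^ j) \<longleftrightarrow> (EX r. u : gamma_ball K n (2 ^ j) r)) &
 (u : A_gamma K T n (2 ^ j) --> (ALL r. A_gamma_norm K T n (2 ^ j) u <= r \<longleftrightarrow> u : gamma_ball K n (2 ^ j) r))"
proof (induction n arbitrary: j u)
 case 0
 obtain d \<pi> where "peter_weyl (G (2 ^ j)) (mu (2 ^ j)) d \<pi>" using pw_pow by blast
 then interpret peter_weyl "G (2 ^ j)" "mu (2 ^ j)" d \<pi> .
 have 1: "u : A_gamma K T 0 (2 ^ j) \<longleftrightarrow> (EX r. u : gamma_ball K 0 (2 ^ j) r)"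
  unfolding A_gamma.simps gamma_ball_0 pow_top_eq fourier_algebra_iff by simp
 have "A_gamma_norm K T 0 (2 ^ j) u <= r \<longleftrightarrow> u : gamma_ball K 0 (2 ^ j) r" if "u : A_gamma K T 0 (2 ^ j)" for r
  using that fourier_norm_le_iff[of u r] fourier_algebra_iff[of u]
  unfolding A_gamma.simps A_gamma_norm.simps gamma_ball_0 pow_top_eq by simp
 thus ?case using 1 by simp
next
 case (Suc n)
 let ?m = "2 ^ j :: nat"
 have iff: "w : A_gamma K T n (2 * ?m) \<longleftrightarrow> (EX r. w : gamma_ball K n (2 * ?m) r)" for w
  using Suc.IH[of w "Suc j"] by simp
 have nrm: "A_gamma_norm K T n (2 * ?m) w <= r \<longleftrightarrow> w : gamma_ball K n (2 * ?m) r" if "w : A_gamma K T n (2 * ?m)" for w r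
  using Suc.IH[of w "Suc j"] that by simp
 have NN: "N_check K ?m u : A_gamma K T n (2 * ?m)" "Q_check K T ?m (N_check K ?m u) = u" if "u : gamma_ball K (Suc n) ?m r" for u r
 proof -
  show "N_check K ?m u : A_gamma K T n (2 * ?m)" unfolding iff using gamma_ball_N_check[OF that] by blast
  show "Q_check K T ?m (N_check K ?m u) = u" using that by (intro Q_N_check) (simp add: gamma_ball_def)
 qed
 have 1: "u : A_gamma K T (Suc n) ?m \<longleftrightarrow> (EX r. u : gamma_ball K (Suc n) ?m r)"
  proof
  assume "u : A_gamma K T (Suc n) ?m"
  then obtain w where w: "u = Q_check K T ?m w" "w : A_gamma K T n (2 * ?m)" by auto
  then obtain r where "w : gamma_ball K n (2 * ?m) r" using iff by blast
  from gamma_ball_Q_check[OF this] show "EX r. u : gamma_ball K (Suc n) ?m r" unfolding w(1) by blast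
  next
  assume "EX r. u : gamma_ball K (Suc n) ?m r"
  then obtain r where r: "u : gamma_ball K (Suc n) ?m r" by blast
  from NN[OF r] show "u : A_gamma K T (Suc n) ?m" by (simp add: image_eqI[of u "Q_check K T ?m" "N_check K ?m u"])
  qed
 have "A_gamma_norm K T (Suc n) ?m u <= r \<longleftrightarrow> u : gamma_ball K (Suc n) ?m r" if mem: "u : A_gamma K T (Suc n) ?m" for r
 proof -
  define S where "S = {w : A_gamma K T n (2 * ?m). Q_check K T ?m w = u}"
  have norm: "A_gamma_norm K T (Suc n) ?m u = (INF w\<in>S. A_gamma_norm K T n (2 * ?m) w)" by (simp add: S_def)
  have S: "S ~= {}" using mem by (auto simp: S_def)
  have pos: "0 <= A_gamma_norm K T n (2 * ?m) w" if "w : S" for w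
  using nrm[of w "A_gamma_norm K T n (2 * ?m) w"] that gamma_ball_ge_0 by (auto simp: S_def)
  hence bdd: "bdd_below (A_gamma_norm K T n (2 * ?m) ` S)" by (intro bdd_belowI2[of _ 0])
  show ?thesis
  proof
  assume le: "A_gamma_norm K T (Suc n) ?m u <= r"
  have "0 <= A_gamma_norm K T (Suc n) ?m u" unfolding norm by (rule cINF_greatest[OF S pos])
  hence r: "0 <= r" using le by simp
  show "u : gamma_ball K (Suc n) ?m r"
  proof (rule gamma_ball_right_continuous[OF _ r])
  fix e :: real assume "e > 0"
  hence "(INF w\<in>S. A_gamma_norm K T n (2 * ?m) w) < r + e" using le norm by simp
  then obtain w where w: "w : S" "A_gamma_norm K T n (2 * ?m) w < r + e"
  using cINF_less_iff[OF S bdd] by blast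
  hence "w : gamma_ball K n (2 * ?m) (r + e)" using nrm[of w "r + e"] by (auto simp: S_def)
  from gamma_ball_Q_check[OF this] show "u : gamma_ball K (Suc n) ?m (r + e)" using w(1) by (simp add: S_def)
  qed
  next
  assume u: "u : gamma_ball K (Suc n) ?m r"
  have "N_check K ?m u : S" using NN[OF u] by (simp add: S_def)
  hence "A_gamma_norm K T (Suc n) ?m u <= A_gamma_norm K T n (2 * ?m) (N_check K ?m u)"
  unfolding norm by (rule cINF_lower[OF bdd])
  also have "... <= r" using nrm[OF NN(1)[OF u]] gamma_ball_N_check[OF u] by blast
  finally show "A_gamma_norm K T (Suc n) ?m u <= r" .
  qed
 qed
 thus ?case using 1 by blast
qed

theorem A_gamma_iff: "u : A_gamma K T n (2 ^ j) \<longleftrightarrow> (EX r. u : gamma_ball K n (2 ^ j) r)"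
 using A_gamma_iff_aux by blast

theorem A_gamma_norm_le_iff:
 "u : A_gamma K T n (2 ^ j) ==> A_gamma_norm K T n (2 ^ j) u <= r \<longleftrightarrow> u : gamma_ball K n (2 ^ j) r"
 using A_gamma_iff_aux by blast

end

lemma compact_powersI:
 fixes K :: "('a::polish_space, 'r) monoid_scheme"
 assumes "peter_weyl K M d \<pi>"
 shows "compact_powers K"
proof -
 interpret peter_weyl K M d \<pi> by fact
 have K: "Group.group K" by unfold_locales
 have "EX M d \<pi>. peter_weyl (pow_group K (2 ^ j)) M d \<pi>" for j
 proof (induction j)
  case 0
  show ?case using peter_weyl_pow_one[OF assms] unfolding power_0 by blast
 next
  case (Suc j)
  then obtain M' d' \<pi>' where "peter_weyl (pow_group K (2 ^ j)) M' d' \<pi>'" by blast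
  from peter_weyl_pow_double[OF K this] show ?case by (simp only: power_Suc)
 qed
 thus ?thesis using K by (intro compact_powers.intro)
qed

section \<open>Banach algebras of functions given by their balls\<close>

lemma cscale_vector_space: "Vector_Spaces.vector_space cscale"
 by unfold_locales (simp_all add: cscale_def fun_eq_iff algebra_simps)

interpretation cs: Vector_Spaces.vector_space "cscale :: complex => ('x => complex) => _" by (rule cscale_vector_space)

text \<open>An algebra of functions with a norm given by its closed balls.  Closedness of the balls under
 uniform approximation makes the norm complete.\<close>
locale ball_family =
 fixes X :: "'x set" and R :: "real => ('x => complex) set"
  and V :: "('x => complex) set" and N :: "('x => complex) => real"
 assumes in_V: "f : V \<longleftrightarrow> (EX r. f : R r)"
  and N_le: "f : V ==> N f <= r \<longleftrightarrow> f : R r"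
  and outside: "f : R r ==> x ~: X ==> f x = 0"
  and ball_ge_0: "f : R r ==> 0 <= r"
  and bound: "f : R r ==> x : X ==> cmod (f x) <= r"
  and zero_ball: "(%x. 0) : R 0"
  and add_ball: "f : R r ==> g : R r' ==> (%x. f x + g x) : R (r + r')"
  and scale_ball: "f : R r ==> (%x. c * f x) : R (cmod c * r)"
  and mult_ball: "f : R r ==> g : R r' ==> (%x. f x * g x) : R (r * r')"
  and closed_ball: "(!!x. x ~: X ==> f x = 0) ==> (!!e. e > 0 ==> EX g:R r. ALL x:X. cmod (f x - g x) <= e) ==> f : R r"
begin

lemma V_ball: "f : V ==> f : R (N f)"
 using N_le[of f "N f"] by simp

lemma ball_V: "f : R r ==> f : V"
 unfolding in_V by (rule exI)

lemma ball_N: "f : R r ==> N f <= r"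
 using N_le[OF ball_V] by simp

lemma N_ge_0: "f : V ==> 0 <= N f" by (rule ball_ge_0[OF V_ball])

lemma V_bound: "f : V ==> cmod (f x) <= N f"
 using bound[OF V_ball, of f x] outside[OF V_ball, of f x] N_ge_0[of f] by (cases "x : X") auto

lemma V_outside: "f : V ==> x ~: X ==> f x = 0" by (rule outside[OF V_ball])

lemma add_V: "f : V ==> g : V ==> f + g : V" and N_add: "f : V ==> g : V ==> N (f + g) <= N f + N g"
 using add_ball[OF V_ball V_ball, of f g] ball_V ball_N unfolding plus_fun_def by blast+

lemma scale_V: "f : V ==> cscale c f : V" and N_scale_le: "f : V ==> N (cscale c f) <= cmod c * N f"
 using scale_ball[OF V_ball, of f c] ball_V ball_N unfolding cscale_def by blast+

lemma mult_V: "f : V ==> g : V ==> f * g : V" and N_mult: "f : V ==> g : V ==> N (f * g) <= N f * N g"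
 using mult_ball[OF V_ball V_ball, of f g] ball_V ball_N unfolding times_fun_def by blast+

lemma zero_V: "0 : V" and N_zero: "N 0 = 0"
proof -
 have z: "(0 :: 'x => complex) : R 0" using zero_ball unfolding zero_fun_def .
 show "0 : V" by (rule ball_V[OF z])
 thus "N 0 = 0" using ball_N[OF z] N_ge_0[of 0] by simp
qed

lemma uminus_cscale: "- f = cscale (-1) f" for f :: "'x => complex" by (simp add: cscale_def fun_eq_iff)

lemma diff_V: "f : V ==> g : V ==> f - g : V"
 using add_V[of f "cscale (-1) g"] scale_V[of g "-1"] by (simp flip: uminus_cscale)

lemma N_diff: "f : V ==> g : V ==> N (f - g) <= N f + N g"
 using N_add[of f "cscale (-1) g"] scale_V[of g "-1"] N_scale_le[of g "-1"] by (simp flip: uminus_cscale)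

lemma sum_V: "finite I ==> (!!i. i : I ==> f i : V) ==> (SUM i:I. f i) : V"
 by (induction rule: finite_induct) (simp_all add: zero_V add_V)

lemma N_sum: "finite I ==> (!!i. i : I ==> f i : V) ==> N (SUM i:I. f i) <= (SUM i:I. N (f i))"
proof (induction rule: finite_induct)
 case (insert i I)
 have "N (f i + (SUM i:I. f i)) <= N (f i) + N (SUM i:I. f i)" using insert by (intro N_add sum_V) auto
 moreover have "N (SUM i:I. f i) <= (SUM i:I. N (f i))" by (rule insert.IH) (simp add: insert.prems)
 ultimately show ?case unfolding sum.insert[OF insert.hyps] by linarith
qed (simp add: N_zero)

lemma N_scale: "f : V ==> N (cscale c f) = cmod c * N f"
proof (cases "c = 0")
 case True
 hence "cscale c f = 0" by (simp add: cscale_def fun_eq_iff)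
 thus ?thesis using True N_zero by simp
next
 case False
 assume f: "f : V"
 have "cscale (inverse c) (cscale c f) = f" using False by (simp add: cscale_def fun_eq_iff)
 hence "N f <= cmod (inverse c) * N (cscale c f)" using N_scale_le[OF scale_V[OF f], of "inverse c" c] by simp
 hence "cmod c * N f <= cmod c * (cmod (inverse c) * N (cscale c f))" by (rule mult_left_mono) simp
 moreover have "cmod c * (cmod (inverse c) * x) = x" for x
  using False unfolding mult.assoc[symmetric] norm_inverse by simp
 ultimately have "cmod c * N f <= N (cscale c f)" by simp
 thus ?thesis using N_scale_le[OF f, of c] by simp
qed

lemma subspace_V: "Modules.module.subspace cscale V"
 unfolding cs.subspace_def using zero_V add_V scale_V by blast

lemma norm_on_V: "norm_on V N"
 unfolding norm_on_def
proof (intro conjI ballI allI)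
 fix f assume f: "f : V"
 show "0 <= N f" by (rule N_ge_0[OF f])
 show "(N f = 0) = (f = 0)"
 proof
  assume "N f = 0"
  thus "f = 0" using V_bound[OF f] by (simp add: fun_eq_iff)
 qed (simp add: N_zero)
qed (simp_all add: N_scale N_add)

lemma complete_on_V: "complete_on V N"
 unfolding complete_on_def
proof (intro allI impI, elim conjE)
 fix F :: "nat => 'x => complex"
 assume F: "ALL k. F k : V" and cauchy: "ALL e>0. EX K. ALL j>=K. ALL k>=K. N (F j - F k) < e"
 have pt: "cmod (F j x - F k x) <= N (F j - F k)" for j k x
  using V_bound[OF diff_V, of "F j" "F k" x] F by simp
 define f where "f = (%x. lim (%k. F k x))"
 have lim: "(%k. F k x) \<longlonglongrightarrow> f x" for x
 proof -
  have "Cauchy (%k. F k x)"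
  proof (rule CauchyI)
  fix e :: real assume "e > 0"
  then obtain K where "ALL j>=K. ALL k>=K. N (F j - F k) < e" using cauchy by blast
  thus "EX K. ALL m>=K. ALL n>=K. cmod (F m x - F n x) < e" by (intro exI[of _ K] allI impI order_le_less_trans[OF pt]) simp
  qed
  thus ?thesis unfolding f_def by (simp add: Cauchy_convergent_iff convergent_LIMSEQ_iff)
 qed
 have near: "EX K. ALL k>=K. F k - f : R e" if e: "e > 0" for e
 proof -
  obtain K where K: "ALL j>=K. ALL k>=K. N (F j - F k) < e" using cauchy e by blast
  have "F k - f : R e" if k: "k >= K" for k
  proof (rule closed_ball)
  fix x assume "x ~: X"
  hence z: "F k x = 0" for k using F V_outside by blast
  hence "f x = 0" using lim[of x] LIMSEQ_unique[OF _ tendsto_const] by simp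
  thus "(F k - f) x = 0" using z by simp
  next
  fix e' :: real assume "e' > 0"
  then obtain K' where K': "ALL i>=K'. ALL j>=K'. N (F i - F j) < e'" using cauchy by blast
  define j where "j = max K K'"
  have "cmod (F j x - f x) <= e'" for x
  proof (rule tendsto_upperbound[OF tendsto_norm[OF tendsto_diff[OF tendsto_const lim]]])
  show "\<forall>\<^sub>F i in sequentially. cmod (F j x - F i x) <= e'"
  using eventually_ge_at_top[of K']
  proof eventually_elim
  case (elim i)
  have "N (F j - F i) < e'" using K' elim by (simp add: j_def)
  thus ?case using pt[of j x i] by simp
  qed
  qed simp
  hence "ALL x:X. cmod ((F k - f) x - (F k - F j) x) <= e'" by simp
  moreover have "F k - F j : R e"
  using N_le[OF diff_V, of "F k" "F j" e] F K k by (simp add: j_def less_imp_le)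
  ultimately show "EX g:R e. ALL x:X. cmod ((F k - f) x - g x) <= e'" by (rule bexI)
  qed
  thus ?thesis by (intro exI[of _ K] allI impI)
 qed
 obtain K where "ALL k>=K. F k - f : R 1" using near[of 1] by auto
 hence "F K - f : V" by (auto intro: ball_V)
 hence fV: "f : V" using diff_V[of "F K" "F K - f"] F by simp
 have "(%k. N (F k - f)) \<longlonglongrightarrow> 0"
 proof (rule LIMSEQ_I)
  fix e :: real assume "e > 0"
  then obtain K where K: "ALL k>=K. F k - f : R (e / 2)" using near[of "e / 2"] by auto
  have "norm (N (F k - f) - 0) < e" if "k >= K" for k
  using ball_N[of "F k - f" "e / 2"] N_ge_0[OF diff_V, of "F k" f] K F fV that \<open>e > 0\<close> by simp
  thus "EX K. ALL k>=K. norm (N (F k - f) - 0) < e" by blast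
 qed
 thus "EX f:V. (%k. N (F k - f)) \<longlonglongrightarrow> 0" using fV by (rule bexI)
qed

theorem banach_algebra: "banach_algebra_on V N (*)"
 unfolding banach_algebra_on_def by (intro conjI ballI allI subspace_V norm_on_V complete_on_V mult_V N_mult)
  (simp_all add: fun_eq_iff cscale_def algebra_simps)

end

section \<open>A criterion for Arens regularity\<close>

lemma dual_spaceD:
 assumes "ph : dual_space V N"
 shows "f ~: V ==> ph f = 0" "f : V ==> g : V ==> ph (f + g) = ph f + ph g" "f : V ==> ph (cscale c f) = c * ph f"
  and "EX C>=0. ALL f:V. 0 <= N f --> cmod (ph f) <= C * N f"
proof -
 obtain C where C: "ALL f:V. cmod (ph f) <= C * N f" using assms by (auto simp: dual_space_def)
 have "cmod (ph f) <= max C 0 * N f" if "f : V" "0 <= N f" for f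
  using C that mult_right_mono[of C "max C 0" "N f"] by fastforce
 thus "EX C>=0. ALL f:V. 0 <= N f --> cmod (ph f) <= C * N f" by (intro exI[of _ "max C 0"]) simp
qed (use assms in \<open>auto simp: dual_space_def\<close>)

context ball_family
begin

lemma zero_ext_V [simp]: "f : V ==> zero_ext V ph f = ph f" by (simp add: zero_ext_def)

lemma dualI:
 assumes "!!f g. f : V ==> g : V ==> ph (f + g) = ph f + ph g" "!!c f. f : V ==> ph (cscale c f) = c * ph f"
  "!!f. f : V ==> cmod (ph f) <= C * N f"
 shows "zero_ext V ph : dual_space V N"
 unfolding dual_space_def
proof (intro CollectI conjI allI impI ballI exI[of _ C])
 show "zero_ext V ph f = 0" if "f ~: V" for f using that by (simp add: zero_ext_def)
qed (simp_all add: assms add_V scale_V)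

lemma dual_norm_le:
 assumes "!!f. f : V ==> cmod (ph f) <= C * N f" "0 <= C"
 shows "dual_norm V N ph <= C"
 unfolding dual_norm_def
proof (rule cSUP_least)
 show "{f : V. N f <= 1} ~= {}" using zero_V N_zero by force
 fix f assume "f : {f : V. N f <= 1}"
 thus "cmod (ph f) <= C" using assms(1)[of f] mult_left_mono[of "N f" 1 C] assms(2) by auto
qed

lemma dual_norm_ge_0:
 assumes "ph : dual_space V N"
 shows "0 <= dual_norm V N ph"
proof -
 obtain C where C: "C >= 0" "ALL f:V. 0 <= N f --> cmod (ph f) <= C * N f" using dual_spaceD(4)[OF assms] by blast
 have "bdd_above ((%f. cmod (ph f)) ` {f : V. N f <= 1})"
 proof (rule bdd_aboveI2)
  fix f assume "f : {f : V. N f <= 1}"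
  thus "cmod (ph f) <= C" using C(2) N_ge_0[of f] mult_left_mono[of "N f" 1 C] C(1) by force
 qed
 hence "cmod (ph 0) <= dual_norm V N ph"
  unfolding dual_norm_def by (rule cSUP_upper[rotated]) (simp add: zero_V N_zero)
 thus ?thesis using norm_ge_zero order_trans by blast
qed

lemma bidual_split:
 assumes m: "m : bidual_space V N" and B: "finite B" and e: "!!b. b : B ==> e b : dual_space V N"
  and ps: "ps : dual_space V N" and L: "!!g. g : V ==> L g = (SUM b:B. a b * e b g) + ps g"
 shows "m (zero_ext V L) = (SUM b:B. a b * m (e b)) + m ps"
proof -
 let ?D = "dual_space V N"
 note mD = dual_spaceD[OF m[unfolded bidual_space_def]]
 have add: "ph + ph' : ?D" if d: "ph : ?D" and d': "ph' : ?D" for ph ph'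
 proof -
  obtain C where C: "C >= 0" "ALL f:V. 0 <= N f --> cmod (ph f) <= C * N f" using dual_spaceD(4)[OF d] by blast
  obtain C' where C': "C' >= 0" "ALL f:V. 0 <= N f --> cmod (ph' f) <= C' * N f" using dual_spaceD(4)[OF d'] by blast
  have "zero_ext V (ph + ph') : ?D"
  proof (rule dualI)
  show "cmod ((ph + ph') f) <= (C + C') * N f" if "f : V" for f
  using C(2) C'(2) N_ge_0[OF that] that norm_triangle_ineq[of "ph f" "ph' f"] by (force simp: distrib_right)
  qed (simp_all add: dual_spaceD(2,3)[OF d] dual_spaceD(2,3)[OF d'] algebra_simps)
  moreover have "zero_ext V (ph + ph') = ph + ph'"
  using dual_spaceD(1)[OF d] dual_spaceD(1)[OF d'] by (auto simp: zero_ext_def fun_eq_iff)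
  ultimately show ?thesis by simp
 qed
 have scale: "cscale c ph : ?D" if d: "ph : ?D" for c ph
 proof -
  obtain C where C: "C >= 0" "ALL f:V. 0 <= N f --> cmod (ph f) <= C * N f" using dual_spaceD(4)[OF d] by blast
  have "zero_ext V (cscale c ph) : ?D"
  proof (rule dualI)
  show "cmod (cscale c ph f) <= (cmod c * C) * N f" if "f : V" for f
  using C(2) N_ge_0[OF that] that by (simp add: cscale_def norm_mult mult.assoc mult_left_mono)
  qed (simp_all add: cscale_def dual_spaceD(2)[OF d] dual_spaceD(3)[OF d, unfolded cscale_def] algebra_simps)
  moreover have "zero_ext V (cscale c ph) = cscale c ph"
  using dual_spaceD(1)[OF d] by (auto simp: zero_ext_def fun_eq_iff cscale_def)
  ultimately show ?thesis by simp
 qed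
 have "(SUM b:B. cscale (a b) (e b)) + ps : ?D & m ((SUM b:B. cscale (a b) (e b)) + ps) = (SUM b:B. a b * m (e b)) + m ps"
  using B e
 proof (induction rule: finite_induct)
  case empty
  thus ?case using ps by simp
 next
  case (insert b B)
  have IHc: "(SUM b:B. cscale (a b) (e b)) + ps : ?D & m ((SUM b:B. cscale (a b) (e b)) + ps) = (SUM b:B. a b * m (e b)) + m ps"
  by (rule insert.IH) (rule insert.prems, rule insertI2)
  note IH = conjunct1[OF IHc] conjunct2[OF IHc]
  have eb: "e b : ?D" using insert by simp
  have "m (cscale (a b) (e b) + ((SUM b:B. cscale (a b) (e b)) + ps)) = a b * m (e b) + ((SUM b:B. a b * m (e b)) + m ps)"
  unfolding mD(2)[OF scale[OF eb] IH(1)] mD(3)[OF eb] IH(2) ..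
  thus ?case unfolding sum.insert[OF insert.hyps] add.assoc by (rule conjI[OF add[OF scale[OF eb] IH(1)]])
 qed
 moreover have "zero_ext V L = (SUM b:B. cscale (a b) (e b)) + ps"
 proof
  fix g
  have sum: "(SUM b:B. cscale (a b) (e b)) g = (SUM b:B. a b * e b g)"
  using B by (induction rule: finite_induct) (simp_all add: cscale_def)
  show "zero_ext V L g = ((SUM b:B. cscale (a b) (e b)) + ps) g"
  using L[of g] dual_spaceD(1)[OF ps] dual_spaceD(1)[OF e] by (simp add: sum zero_ext_def)
 qed
 ultimately show ?thesis by simp
qed

lemma bidual_bound:
 assumes "m : bidual_space V N"
 obtains C where "C >= 0" "!!ps c. ps : dual_space V N ==> 0 <= c ==> (!!f. f : V ==> cmod (ps f) <= c * N f) ==> cmod (m ps) <= C * c"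
proof -
 obtain C where C: "C >= 0" "ALL ps:dual_space V N. 0 <= dual_norm V N ps --> cmod (m ps) <= C * dual_norm V N ps"
  using dual_spaceD(4)[OF assms[unfolded bidual_space_def]] by blast
 have "cmod (m ps) <= C * c" if "ps : dual_space V N" "0 <= c" "!!f. f : V ==> cmod (ps f) <= c * N f" for ps c
  using C that(1) dual_norm_ge_0[OF that(1)] mult_left_mono[OF dual_norm_le[OF that(3,2)] C(1)] by force
 thus ?thesis using that C(1) by blast
qed

text \<open>Iterated application of two elements of the bidual to a bilinear form that is of finite rank up to a
 remainder of norm at most \<open>\<epsilon>\<close>: up to a multiple of \<open>\<epsilon>\<close> the result is that of the finite-rank form,
 which does not depend on the order of application.\<close>
lemma iterated_finite_rank:
 assumes m: "m : bidual_space V N" and n: "n : bidual_space V N"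
  and Cm: "C >= 0" "!!ps c. ps : dual_space V N ==> 0 <= c ==> (!!f. f : V ==> cmod (ps f) <= c * N f) ==> cmod (m ps) <= C * c"
  and Cn: "C' >= 0" "!!ps c. ps : dual_space V N ==> 0 <= c ==> (!!f. f : V ==> cmod (ps f) <= c * N f) ==> cmod (n ps) <= C' * c"
  and B: "finite B" and c: "!!b. b : B ==> c b : dual_space V N" and e: "!!b. b : B ==> e b : dual_space V N"
  and D1: "!!f g h. f : V ==> g : V ==> h : V ==> D f (g + h) = D f g + D f h" "!!f g z. f : V ==> g : V ==> D f (cscale z g) = z * D f g"
  and D2: "!!f g h. f : V ==> g : V ==> h : V ==> D (g + h) f = D g f + D h f" "!!f g z. f : V ==> g : V ==> D (cscale z g) f = z * D g f"
  and ep: "0 <= ep" "!!f g. f : V ==> g : V ==> cmod (D f g) <= ep * N f * N g"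
  and S: "!!f g. f : V ==> g : V ==> S f g = (SUM b:B. c b f * e b g) + D f g"
 shows "cmod (m (zero_ext V (%f. n (zero_ext V (%g. S f g)))) - (SUM b:B. n (e b) * m (c b))) <= C * (C' * ep)"
proof -
 note nD = dual_spaceD[OF n[unfolded bidual_space_def]]
 have Df: "zero_ext V (D f) : dual_space V N" if "f : V" for f
  by (rule dualI[where C = "ep * N f"]) (use D1 ep that in simp_all)
 have nS: "n (zero_ext V (%g. S f g)) = (SUM b:B. c b f * n (e b)) + n (zero_ext V (D f))" if f: "f : V" for f
  by (rule bidual_split[OF n B e Df[OF f]]) (simp_all add: S f)
 have nD_bound: "cmod (n (zero_ext V (D f))) <= C' * ep * N f" if "f : V" for f
  using Cn(2)[OF Df[OF that], of "ep * N f"] ep that N_ge_0[OF that] by (simp add: mult.assoc)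
 have "zero_ext V (%f. n (zero_ext V (D f))) : dual_space V N"
 proof (rule dualI)
  fix f g assume fg: "f : V" "g : V"
  have "zero_ext V (D (f + g)) = zero_ext V (D f) + zero_ext V (D g)"
  using D2(1) fg by (auto simp: zero_ext_def fun_eq_iff)
  thus "n (zero_ext V (D (f + g))) = n (zero_ext V (D f)) + n (zero_ext V (D g))"
  using nD(2)[OF Df[OF fg(1)] Df[OF fg(2)]] by simp
 next
  fix z f assume f: "f : V"
  have "zero_ext V (D (cscale z f)) = cscale z (zero_ext V (D f))"
  using D2(2) f by (auto simp: zero_ext_def fun_eq_iff cscale_def)
  thus "n (zero_ext V (D (cscale z f))) = z * n (zero_ext V (D f))"
  using nD(3)[OF Df[OF f]] by simp
 qed (rule nD_bound)
 note dual = this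
 have "m (zero_ext V (%f. n (zero_ext V (%g. S f g)))) = (SUM b:B. n (e b) * m (c b)) + m (zero_ext V (%f. n (zero_ext V (D f))))"
  by (rule bidual_split[OF m B c dual]) (simp_all add: nS mult.commute)
 moreover have "cmod (m (zero_ext V (%f. n (zero_ext V (D f))))) <= C * (C' * ep)"
  by (rule Cm(2)[OF dual]) (use nD_bound Cn(1) ep(1) in simp_all)
 ultimately show ?thesis by simp
qed

text \<open>For the finite-rank map \<open>P f = \<Sum> c\<^sub>b(f) p\<^sub>b\<close>, the form \<open>\<phi> (f g)\<close> is \<open>\<phi> (P f (g - P g)) + \<phi> (f P g)\<close>, of finite
 rank, plus the remainder \<open>\<phi> ((f - P f) (g - P g))\<close>.\<close>
theorem arens_regular_finite_rank:
 assumes approx: "!!ep. ep > 0 ==> EX (B :: 'b set) c p. finite B & (ALL b:B. c b : dual_space V N & p b : V) &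
  (ALL f:V. ALL g:V. N ((f - (SUM b:B. cscale (c b f) (p b))) * (g - (SUM b:B. cscale (c b g) (p b)))) <= ep * N f * N g)"
 shows "arens_regular V N (*)"
 unfolding arens_regular_def
proof (intro conjI ballI banach_algebra ext)
 fix m n ph assume m: "m : bidual_space V N" and n: "n : bidual_space V N"
 show "arens_first V N (*) m n ph = arens_second V N (*) m n ph"
 proof (cases "ph : dual_space V N")
  case False
  thus ?thesis by (simp add: arens_first_def arens_second_def zero_ext_def)
 next
  case True
  note ph = dual_spaceD[OF True]
  obtain A where A: "A >= 0" "ALL f:V. 0 <= N f --> cmod (ph f) <= A * N f" using ph(4) by blast
  obtain C where C: "C >= 0" "!!ps c. ps : dual_space V N ==> 0 <= c ==> (!!f. f : V ==> cmod (ps f) <= c * N f) ==> cmod (m ps) <= C * c"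
  using bidual_bound[OF m] by blast
  obtain C' where C': "C' >= 0" "!!ps c. ps : dual_space V N ==> 0 <= c ==> (!!f. f : V ==> cmod (ps f) <= c * N f) ==> cmod (n ps) <= C' * c"
  using bidual_bound[OF n] by blast
  define F where "F = m (zero_ext V (%f. n (zero_ext V (%g. ph (f * g)))))"
  define S where "S = n (zero_ext V (%f. m (zero_ext V (%g. ph (g * f)))))"
  have small: "cmod (F - S) <= 2 * (C * (C' * (A * ep)))" if ep: "ep > 0" for ep
  proof -
  obtain B :: "'b set" and c p where B: "finite B" and cp: "ALL b:B. c b : dual_space V N & p b : V"
  and est: "ALL f:V. ALL g:V. N ((f - (SUM b:B. cscale (c b f) (p b))) * (g - (SUM b:B. cscale (c b g) (p b)))) <= ep * N f * N g"
  using approx[OF ep] by (elim exE conjE)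
  have c: "c b : dual_space V N" and p: "p b : V" if "b : B" for b using cp that by blast+
  define P where "P = (%f. SUM b:B. cscale (c b f) (p b))"
  have PV: "P f : V" for f unfolding P_def by (intro sum_V B scale_V p)
  have P_add: "P (f + g) = P f + P g" if "f : V" "g : V" for f g
  unfolding P_def sum.distrib[symmetric] using that dual_spaceD(2)[OF c]
  by (intro sum.cong refl) (simp add: cscale_def fun_eq_iff distrib_right)
  have P_scale: "P (cscale z f) = cscale z (P f)" if "f : V" for z f
  proof -
  have "cscale z (P f) = (SUM b:B. cscale z (cscale (c b f) (p b)))" unfolding P_def by (rule cs.scale_sum_right)
  also have "... = P (cscale z f)"
  unfolding P_def using that dual_spaceD(3)[OF c] by (intro sum.cong refl) (simp add: cscale_def fun_eq_iff mult.assoc)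
  finally show ?thesis by simp
  qed
  have P_bound: "EX q>=0. ALL f:V. N (P f) <= q * N f"
  proof -
  have "ALL b:B. EX q>=0. ALL f:V. 0 <= N f --> cmod (c b f) <= q * N f" using dual_spaceD(4)[OF c] by blast
  then obtain q where q: "!!b. b : B ==> q b >= 0" "!!b f. b : B ==> f : V ==> cmod (c b f) <= q b * N f"
  using N_ge_0 by metis
  have "N (P f) <= (SUM b:B. q b * N (p b)) * N f" if f: "f : V" for f
  proof -
  have "N (P f) <= (SUM b:B. N (cscale (c b f) (p b)))" unfolding P_def by (rule N_sum[OF B]) (intro scale_V p)
  also have "... <= (SUM b:B. q b * N f * N (p b))" by (rule sum_mono) (simp add: N_scale p q f N_ge_0 mult_right_mono)
  finally show ?thesis unfolding sum_distrib_right by (simp only: mult_ac)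
  qed
  moreover have "0 <= (SUM b:B. q b * N (p b))" by (intro sum_nonneg mult_nonneg_nonneg q N_ge_0 p)
  ultimately show ?thesis by blast
  qed
  then obtain q where q: "q >= 0" "!!f. f : V ==> N (P f) <= q * N f" by blast
  have ph_bound: "cmod (ph f) <= A * N f" if "f : V" for f using A(2) that N_ge_0[OF that] by blast
  have dfun: "f * (g + h) = f * g + f * h" "(f + g) * h = f * h + g * h" "f * cscale z g = cscale z (f * g)" "cscale z f * g = cscale z (f * g)"
  "f + g - (h + k) = (f - h) + (g - k)" "cscale z f - cscale z g = cscale z (f - g)" for f g h k :: "'x => complex" and z
  by (simp_all add: fun_eq_iff cscale_def algebra_simps)
  define D where "D = (%f g. ph ((f - P f) * (g - P g)))"
  define cc where "cc = case_sum c (%b. zero_ext V (%f. ph (f * p b)))"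
  define ee where "ee = case_sum (%b. zero_ext V (%g. ph (p b * (g - P g)))) c"
  have e1: "zero_ext V (%f. ph (f * p b)) : dual_space V N" if b: "b : B" for b
  proof (rule dualI)
  show "cmod (ph (f * p b)) <= (A * N (p b)) * N f" if f: "f : V" for f
  using order_trans[OF ph_bound[OF mult_V[OF f p[OF b]]] mult_left_mono[OF N_mult[OF f p[OF b]] A(1)]] by (simp add: mult_ac)
  qed (simp_all add: dfun ph(2,3) mult_V p b)
  have e2: "zero_ext V (%g. ph (p b * (g - P g))) : dual_space V N" if b: "b : B" for b
  proof (rule dualI)
  fix g assume g: "g : V"
  have gP: "g - P g : V" by (intro diff_V g PV)
  have "N (g - P g) <= (1 + q) * N g" using N_diff[OF g PV, of g] q(2)[OF g] by (simp add: distrib_right)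
  hence "N (p b * (g - P g)) <= N (p b) * ((1 + q) * N g)"
  using order_trans[OF N_mult[OF p[OF b] gP] mult_left_mono[OF _ N_ge_0[OF p[OF b]]]] by blast
  thus "cmod (ph (p b * (g - P g))) <= (A * (N (p b) * (1 + q))) * N g"
  using order_trans[OF ph_bound[OF mult_V[OF p[OF b] gP]] mult_left_mono[OF _ A(1)]] by (simp add: mult.assoc)
  qed (simp_all add: dfun P_add P_scale ph(2,3) mult_V p b diff_V PV)
  have BB: "finite (B <+> B)" using B by simp
  have ccD: "cc b : dual_space V N" if "b : B <+> B" for b using that c e1 by (auto simp: cc_def)
  have eeD: "ee b : dual_space V N" if "b : B <+> B" for b using that c e2 by (auto simp: ee_def)
  have ph_sum: "ph (SUM b:B. h b) = (SUM b:B. ph (h b))" if "!!b. b : B ==> h b : V" for h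
  using B that
  proof (induction rule: finite_induct)
  case empty
  have "ph (cscale 0 0) = 0" using ph(3)[OF zero_V, of 0] by simp
  thus ?case by (simp add: cscale_def zero_fun_def)
  next
  case (insert b B)
  have "h b : V" "(SUM b:B. h b) : V" using insert by (auto intro!: sum_V)
  moreover have "ph (SUM b:B. h b) = (SUM b:B. ph (h b))" by (rule insert.IH) (rule insert.prems, rule insertI2)
  ultimately show ?case unfolding sum.insert[OF insert.hyps] by (simp only: ph(2))
  qed
  have split: "ph (f * g) = (SUM b:B <+> B. cc b f * ee b g) + D f g" if fg: "f : V" "g : V" for f g
  proof -
  have gP: "g - P g : V" by (intro diff_V fg PV)
  have "f * g = P f * (g - P g) + (f * P g + (f - P f) * (g - P g))" by (simp add: fun_eq_iff algebra_simps)
  hence "ph (f * g) = ph (P f * (g - P g)) + (ph (f * P g) + D f g)"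
  unfolding D_def using fg PV by (simp add: ph(2) mult_V diff_V add_V)
  moreover have "ph (P f * (g - P g)) = (SUM b:B. c b f * ph (p b * (g - P g)))"
  proof -
  have "P f * h = (SUM b:B. cscale (c b f) (p b * h))" for h unfolding P_def sum_distrib_right by (simp only: dfun(4))
  hence "P f * (g - P g) = (SUM b:B. cscale (c b f) (p b * (g - P g)))" .
  thus ?thesis using gP p by (simp add: ph_sum scale_V mult_V ph(3))
  qed
  moreover have "ph (f * P g) = (SUM b:B. c b g * ph (f * p b))"
  proof -
  have "f * P g = (SUM b:B. cscale (c b g) (f * p b))" unfolding P_def sum_distrib_left by (simp only: dfun(3))
  thus ?thesis using fg p by (simp add: ph_sum scale_V mult_V ph(3))
  qed
  ultimately show ?thesis using fg by (simp add: sum.Plus B cc_def ee_def mult.commute)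
  qed
  have D_lin: "D f (g + h) = D f g + D f h" "D (g + h) f = D g f + D h f" "D f (cscale z g) = z * D f g" "D (cscale z g) f = z * D g f"
  if "f : V" "g : V" "h : V" for f g h z
  unfolding D_def using that PV by (simp_all add: P_add P_scale dfun ph(2,3) mult_V diff_V)
  have D_bound: "cmod (D f g) <= (A * ep) * N f * N g" if "f : V" "g : V" for f g
  proof -
  have "cmod (D f g) <= A * N ((f - P f) * (g - P g))" unfolding D_def using that PV by (intro ph_bound mult_V diff_V)
  also have "... <= A * (ep * N f * N g)" using est that A(1) unfolding P_def by (intro mult_left_mono) simp_all
  finally show ?thesis by (simp add: mult.assoc)
  qed
  have D_bound': "cmod (D g f) <= (A * ep) * N f * N g" if "f : V" "g : V" for f g
  using D_bound[OF that(2,1)] by (simp only: mult_ac)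
  have split': "ph (g * f) = (SUM b:B <+> B. ee b f * cc b g) + D g f" if "f : V" "g : V" for f g
  using split[OF that(2,1)] by (simp only: mult.commute[of "ee _ _"])
  have Aep: "0 <= A * ep" using A(1) ep by simp
  have 1: "cmod (F - (SUM b:B <+> B. n (ee b) * m (cc b))) <= C * (C' * (A * ep))"
  unfolding F_def
  by (rule iterated_finite_rank[where D = D, OF m n C C' BB ccD eeD]) (use D_lin D_bound Aep split in \<open>simp_all\<close>)
  have 2: "cmod (S - (SUM b:B <+> B. m (cc b) * n (ee b))) <= C' * (C * (A * ep))"
  unfolding S_def by (rule iterated_finite_rank[where D = "%f g. D g f", OF n m C' C BB eeD ccD])
  (use D_lin D_bound' Aep split' in simp_all)
  have "cmod (F - S) <= cmod (F - (SUM b:B <+> B. n (ee b) * m (cc b))) + cmod (S - (SUM b:B <+> B. m (cc b) * n (ee b)))"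
  using norm_triangle_ineq4[of "F - (SUM b:B <+> B. n (ee b) * m (cc b))" "S - (SUM b:B <+> B. n (ee b) * m (cc b))"]
  by (simp add: mult.commute)
  thus ?thesis using 1 2 by (simp add: mult.left_commute)
  qed
  have "cmod (F - S) <= 0"
  proof (rule field_le_epsilon)
  fix e :: real assume e: "e > 0"
  define k where "k = 2 * (C * (C' * A)) + 1"
  have k: "k > 0" using C(1) C'(1) A(1) by (simp add: k_def add_nonneg_pos)
  have "cmod (F - S) <= 2 * (C * (C' * A)) * (e / k)" using small[of "e / k"] e k by (simp add: mult.assoc)
  also have "... <= k * (e / k)" using e k by (intro mult_right_mono) (simp_all add: k_def)
  finally show "cmod (F - S) <= 0 + e" using k by simp
  qed
  thus ?thesis using True by (simp add: arens_first_def arens_second_def zero_ext_def[of "dual_space V N"] F_def S_def)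
 qed
qed

end

section \<open>The norm of \<open>A\<^bsub>\<gamma>\<^esub>\<^sup>n\<close> in terms of Fourier coefficients\<close>

text \<open>The matrix of the bilinear map \<open>(A, B) \<mapsto> tr (X\<^sup>T A B)\<close> in terms of the Kronecker product of \<open>A\<close> and \<open>B\<close>;
 up to a permutation of the coordinates it is \<open>X \<otimes> 1\<close>.\<close>
definition twist :: "nat => (nat => nat => complex) => nat => nat => complex" where
 "twist D X a b = (if a mod D = b div D then X (a div D) (b mod D) else 0)"

lemma twist_index:
 "l' < D ==> j < D ==> twist D X (i * D + l') (l * D + j) = (if l' = l then X i j else 0)"
 by (simp add: twist_def div_mod_index)

lemma twist_sum:
 "(SUM a<D * D. SUM b<D * D. twist D X a b * ktensor D A B a b) = (SUM i<D. SUM j<D. X i j * mm D A B i j)"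
proof -
 have "(SUM a<D * D. SUM b<D * D. twist D X a b * ktensor D A B a b) =
  (SUM i<D. SUM l'<D. SUM l<D. SUM j<D. (if l' = l then X i j * (A i l * B l' j) else 0))"
  unfolding sum_lessThan_mult by (rule sum_eqI)+ (simp add: twist_index ktensor_def div_mod_index)
 also have "... = (SUM i<D. SUM l'<D. SUM j<D. X i j * (A i l' * B l' j))"
 proof (rule sum_eqI, rule sum_eqI)
  fix i l' assume "l' : {..<D}"
  have "(SUM l<D. SUM j<D. (if l' = l then X i j * (A i l * B l' j) else 0)) = (SUM l<D. if l = l' then (SUM j<D. X i j * (A i l' * B l' j)) else 0)"
  by (rule sum_eqI) auto
  thus "(SUM l<D. SUM j<D. (if l' = l then X i j * (A i l * B l' j) else 0)) = (SUM j<D. X i j * (A i l' * B l' j))"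
  using \<open>l' : {..<D}\<close> by simp
 qed
 also have "... = (SUM i<D. SUM j<D. X i j * mm D A B i j)"
  unfolding mm_def sum_distrib_left by (rule sum_eqI, rule sum.swap)
 finally show ?thesis .
qed

lemma twist_partial_isometry:
 assumes "partial_isometry D X"
 shows "partial_isometry (D * D) (twist D X)"
proof -
 have XX: "mm (D * D) (twist D X) (adj (twist D X)) a b = (if a mod D = b mod D then mm D X (adj X) (a div D) (b div D) else 0)"
  if ab: "a < D * D" "b < D * D" for a b
 proof -
  note i = index_split[OF ab(1)] index_split[OF ab(2)]
  have "mm (D * D) (twist D X) (adj (twist D X)) a b =
  (SUM p<D. SUM q<D. (if p = a mod D then (if a mod D = b mod D then X (a div D) q * cnj (X (b div D) q) else 0) else 0))"
  unfolding mm_def sum_lessThan_mult by (rule sum_eqI)+ (auto simp: twist_def adj_def div_mod_index)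
  also have "... = (SUM p<D. if p = a mod D then (SUM q<D. if a mod D = b mod D then X (a div D) q * cnj (X (b div D) q) else 0) else 0)"
  by (rule sum_eqI) auto
  also have "... = (if a mod D = b mod D then mm D X (adj X) (a div D) (b div D) else 0)"
  using i by (simp add: mm_def adj_def)
  finally show ?thesis .
 qed
 show ?thesis
  unfolding partial_isometry_def
 proof (intro allI impI)
  fix a b assume ab: "a < D * D" "b < D * D"
  note i = index_split[OF ab(1)] index_split[OF ab(2)]
  have "mm (D * D) (mm (D * D) (twist D X) (adj (twist D X))) (twist D X) a b =
  (SUM c<D * D. (if a mod D = c mod D then mm D X (adj X) (a div D) (c div D) else 0) * twist D X c b)"
  unfolding mm_def[of "D * D" "mm _ _ _"] by (rule sum_eqI) (simp add: XX ab)
  also have "... = (SUM r<D. SUM s<D. if s = a mod D then (if a mod D = b div D then mm D X (adj X) (a div D) r * X r (b mod D) else 0) else 0)"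
  unfolding sum_lessThan_mult by (rule sum_eqI)+ (auto simp: twist_def div_mod_index)
  also have "... = (SUM r<D. if a mod D = b div D then mm D X (adj X) (a div D) r * X r (b mod D) else 0)"
  using i by (intro sum.cong refl) simp
  also have "... = (if a mod D = b div D then mm D (mm D X (adj X)) X (a div D) (b mod D) else 0)"
  by (simp add: mm_def[of D "mm _ _ _"])
  also have "... = twist D X a b"
  using assms i by (simp add: partial_isometry_def twist_def)
  finally show "mm (D * D) (mm (D * D) (twist D X) (adj (twist D X))) (twist D X) a b = twist D X a b" .
 qed
qed

lemma tnorm_twist_le: "tnorm (D * D) (twist D C) <= real D * tnorm D C"
proof -
 obtain sg u v where s: "ALL a<D. 0 <= sg a" and u: "ALL a<D. nrm D (u a) <= 1" and v: "ALL a<D. nrm D (v a) <= 1"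
  and C: "ALL i<D. ALL j<D. C i j = (SUM a<D. of_real (sg a) * u a i * cnj (v a j))"
  and t: "tnorm D C = (SUM a<D. sg a)"
  using tnorm_decomposition[of D C] by (elim exE conjE)
 define e :: "nat => nat => complex" where "e = (%k l. if l = k then 1 else 0)"
 have ne: "nrm D (e k) = 1" if "k < D" for k
 proof -
  have "(SUM i<D. (cmod (e k i))^2) = (SUM i<D. if i = k then 1 else 0)" by (rule sum.cong) (auto simp: e_def)
  thus ?thesis using that by (simp add: nrm_def)
 qed
 have "tnorm (D * D) (twist D C) <= (SUM p:{..<D} \<times> {..<D}. cmod (of_real (sg (fst p))) * (nrm (D * D) (vtensor D (u (fst p)) (e (snd p))) * nrm (D * D) (vtensor D (e (snd p)) (v (fst p)))))"
 proof (rule tnorm_outer_le)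
  fix a b assume ab: "a < D * D" "b < D * D"
  note i = index_split[OF ab(1)] index_split[OF ab(2)]
  have "(SUM p:{..<D} \<times> {..<D}. of_real (sg (fst p)) * vtensor D (u (fst p)) (e (snd p)) a * cnj (vtensor D (e (snd p)) (v (fst p)) b))
  = (SUM q<D. SUM l<D. if l = a mod D then (if a mod D = b div D then of_real (sg q) * u q (a div D) * cnj (v q (b mod D)) else 0) else 0)"
  unfolding sum.cartesian_product' by (rule sum_eqI)+ (auto simp: vtensor_def e_def)
  also have "... = (SUM q<D. if a mod D = b div D then of_real (sg q) * u q (a div D) * cnj (v q (b mod D)) else 0)"
  using i by (intro sum.cong refl) simp
  also have "... = twist D C a b" using C i by (simp add: twist_def)
  finally show "twist D C a b = (SUM p:{..<D} \<times> {..<D}. of_real (sg (fst p)) * vtensor D (u (fst p)) (e (snd p)) a * cnj (vtensor D (e (snd p)) (v (fst p)) b))" by simp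
 qed
 also have "... <= (SUM p:{..<D} \<times> {..<D}. sg (fst p) * 1)"
 proof (rule sum_mono)
  fix p assume p: "p : {..<D} \<times> {..<D}"
  hence "nrm D (u (fst p)) * nrm D (v (fst p)) <= 1 * 1" using u v by (intro mult_mono) (auto simp: nrm_ge_0)
  hence "nrm (D * D) (vtensor D (u (fst p)) (e (snd p))) * nrm (D * D) (vtensor D (e (snd p)) (v (fst p))) <= 1"
  using p ne[of "snd p"] by (auto simp: nrm_vtensor)
  thus "cmod (of_real (sg (fst p))) * (nrm (D * D) (vtensor D (u (fst p)) (e (snd p))) * nrm (D * D) (vtensor D (e (snd p)) (v (fst p)))) <= sg (fst p) * 1"
  using mult_left_mono[of _ 1 "sg (fst p)"] s p by auto
 qed
 also have "... = (SUM q<D. SUM l<D. sg q)" by (simp only: sum.cartesian_product' fst_conv mult_1_right)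
 also have "... = real D * tnorm D C" by (simp add: t sum_distrib_left)
 finally show ?thesis .
qed

lemma (in haar_group) dual_ball_cong:
 assumes p: "p : dual_ball" and eq: "!!x. x : carrier G ==> q x = p x"
 shows "q : dual_ball"
proof -
 have "cont_on G q" using p eq by (auto simp: dual_ball_def cong: continuous_on_cong)
 moreover have "(LINT x|M. h x * cnj (q x)) = (LINT x|M. h x * cnj (p x))" for h
  by (rule Bochner_Integration.integral_cong) (simp_all add: space_M eq)
 ultimately show ?thesis using p by (simp add: dual_ball_def)
qed

lemma unirep_pow_double:
 assumes K: "Group.group K" and s: "unirep (pow_group K m) D s"
 shows "unirep (pow_group K (2 * m)) (D * D) (%x. ktensor D (s (pow_fst m x)) (s (pow_snd m x)))"
proof (rule unirep_ktensor)
 show "unirep (pow_group K (2 * m)) D (%x. s (pow_fst m x))"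
 proof (rule unirep_transfer[OF s])
  fix y y' assume y: "y : carrier (pow_group K (2 * m))"
  show "pow_fst m y : carrier (pow_group K m)" by (rule pow_proj_carrier[OF y])
  show "pow_fst m (inv\<^bsub>pow_group K (2 * m)\<^esub> y) = inv\<^bsub>pow_group K m\<^esub> pow_fst m y"
  unfolding inv_pow_group[OF K y] inv_pow_group[OF K pow_proj_carrier(1)[OF y]]
  by (rule ext) (simp add: pow_fst_def restrict_def)
  show "pow_fst m (y \<otimes>\<^bsub>pow_group K (2 * m)\<^esub> y') = pow_fst m y \<otimes>\<^bsub>pow_group K m\<^esub> pow_fst m y'"
  by (rule pow_proj_mult)
 next
  show "pow_fst m \<one>\<^bsub>pow_group K (2 * m)\<^esub> = \<one>\<^bsub>pow_group K m\<^esub>"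
  by (rule ext) (simp add: one_pow_group pow_fst_def restrict_def)
 qed (rule continuous_on_pow_proj)
 show "unirep (pow_group K (2 * m)) D (%x. s (pow_snd m x))"
 proof (rule unirep_transfer[OF s])
  fix y y' assume y: "y : carrier (pow_group K (2 * m))"
  show "pow_snd m y : carrier (pow_group K m)" by (rule pow_proj_carrier[OF y])
  show "pow_snd m (inv\<^bsub>pow_group K (2 * m)\<^esub> y) = inv\<^bsub>pow_group K m\<^esub> pow_snd m y"
  unfolding inv_pow_group[OF K y] inv_pow_group[OF K pow_proj_carrier(2)[OF y]]
  by (rule ext) (simp add: pow_snd_def restrict_def)
  show "pow_snd m (y \<otimes>\<^bsub>pow_group K (2 * m)\<^esub> y') = pow_snd m y \<otimes>\<^bsub>pow_group K m\<^esub> pow_snd m y'"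
  by (rule pow_proj_mult)
 next
  show "pow_snd m \<one>\<^bsub>pow_group K (2 * m)\<^esub> = \<one>\<^bsub>pow_group K m\<^esub>"
  by (rule ext) (simp add: one_pow_group pow_snd_def restrict_def)
 qed (rule continuous_on_pow_proj)
qed

context compact_powers
begin

lemma haar_pow_mult: "haar_group (G (2 ^ n * 2 ^ j)) (mu (2 ^ n * 2 ^ j))"
 using haar_pow[of "n + j"] by (simp only: power_add)

lemma sect_continuous: "cont_on (G (2 ^ j)) (sect n (2 ^ j))"
proof -
 interpret haar_group "G (2 ^ n * 2 ^ j)" "mu (2 ^ n * 2 ^ j)" by (rule haar_pow_mult)
 show ?thesis unfolding sect_def[abs_def]
  by (intro continuous_on_mult2 lmap_continuous continuous_on_id continuous_on_const) (auto intro!: lmap_carrier rmap_carrier mult_pow)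
qed

lemma gamma_ball_continuous:
 assumes "u : gamma_ball K n (2 ^ j) r"
 shows "cont_on (G (2 ^ j)) u"
proof -
 have "cont_on (G (2 ^ n * 2 ^ j)) (%x. u (prodmap K n (2 ^ j) x))"
  using assms Conv_continuous unfolding gamma_ball_def by blast
 hence "cont_on (G (2 ^ j)) (%g. u (prodmap K n (2 ^ j) (sect n (2 ^ j) g)))"
  by (rule continuous_on_compose2[OF _ sect_continuous]) (use sect in auto)
 thus ?thesis by (rule continuous_on_eq) (simp add: sect)
qed

lemma gamma_ball_family:
 "ball_family (carrier (G (2 ^ j))) (gamma_ball K n (2 ^ j)) (A_gamma K T n (2 ^ j)) (A_gamma_norm K T n (2 ^ j))"
proof (rule ball_family.intro)
 let ?B = "gamma_ball K n (2 ^ j)" and ?C = "Conv (G (2 ^ n * 2 ^ j))"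
 note d = gamma_ball_def[of K n "2 ^ j"]
 show "f : A_gamma K T n (2 ^ j) \<longleftrightarrow> (EX r. f : ?B r)" for f by (rule A_gamma_iff)
 show "A_gamma_norm K T n (2 ^ j) f <= r \<longleftrightarrow> f : ?B r" if "f : A_gamma K T n (2 ^ j)" for f r by (rule A_gamma_norm_le_iff[OF that])
 show "f x = 0" if "f : ?B r" "x ~: carrier (G (2 ^ j))" for f r x using that by (simp add: d)
 show "0 <= r" if "f : ?B r" for f r by (rule gamma_ball_ge_0[OF that])
 show "cmod (f x) <= r" if "f : ?B r" "x : carrier (G (2 ^ j))" for f r x
  using Conv_bound[OF gG, of "%x. f (prodmap K n (2 ^ j) x)" "2 ^ n * 2 ^ j" r "sect n (2 ^ j) x"] that sect[OF that(2)] by (simp add: d)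
 show "(%x. 0) : ?B 0" using hull_subset_Conv[OF zero_in_hull[of 0]] by (simp add: d)
 show "(%x. f x + g x) : ?B (r + r')" if "f : ?B r" "g : ?B r'" for f g r r' using that by (simp add: d Conv_add)
 show "(%x. c * f x) : ?B (cmod c * r)" if "f : ?B r" for f r c using that by (simp add: d Conv_scale)
 show "(%x. f x * g x) : ?B (r * r')" if "f : ?B r" "g : ?B r'" for f g r r' using that by (simp add: d Conv_mult[OF gG])
 show "f : ?B r" if z: "!!x. x ~: carrier (G (2 ^ j)) ==> f x = 0"
  and e: "!!e. e > 0 ==> EX g:?B r. ALL x:carrier (G (2 ^ j)). cmod (f x - g x) <= e" for f r
 proof -
  have "(%x. f (prodmap K n (2 ^ j) x)) : ?C r"
  proof (rule Conv_uniform_closed)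
  fix e :: real assume "e > 0"
  then obtain g where g: "g : ?B r" "ALL x:carrier (G (2 ^ j)). cmod (f x - g x) <= e" using e by blast
  show "EX g:?C r. ALL x:carrier (G (2 ^ n * 2 ^ j)). cmod (f (prodmap K n (2 ^ j) x) - g x) <= e"
  by (rule bexI[of _ "%x. g (prodmap K n (2 ^ j) x)"]) (use g prodmap_carrier in \<open>auto simp: d\<close>)
  qed
  thus ?thesis using z by (simp add: d)
 qed
qed

text \<open>The product map carries Haar measure to Haar measure: average over a translation.\<close>

lemma integral_prodmap:
 assumes f: "cont_on (G (2 ^ j)) f"
 shows "(LINT x|mu (2 ^ n * 2 ^ j). f (prodmap K n (2 ^ j) x)) = (LINT x|mu (2 ^ j). (f x :: complex))"
proof -
 let ?m = "2 ^ j :: nat" and ?H = "G (2 ^ n * 2 ^ j)"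
 interpret L: haar_group "G ?m" "mu ?m" by (rule haar_pow)
 interpret H: haar_group ?H "mu (2 ^ n * ?m)" by (rule haar_pow_mult)
 note pc = prodmap_continuous[of n j]
 have cF: "cont_on ?H (%x. f (prodmap K n ?m x))" by (rule continuous_on_compose2[OF f pc]) (auto intro: prodmap_carrier)
 have shift: "(LINT x|mu (2 ^ n * ?m). f (t \<otimes>\<^bsub>G ?m\<^esub> prodmap K n ?m x)) = (LINT x|mu (2 ^ n * ?m). f (prodmap K n ?m x))" if t: "t : carrier (G ?m)" for t
 proof -
  let ?l = "lmap K n ?m t" and ?r = "rmap K n ?m \<one>\<^bsub>G ?m\<^esub>"
  have lr: "?l : carrier ?H" "?r : carrier ?H" by (intro lmap_carrier rmap_carrier t one_pow)+
  have "(LINT x|mu (2 ^ n * ?m). f (t \<otimes>\<^bsub>G ?m\<^esub> prodmap K n ?m x)) = (LINT x|mu (2 ^ n * ?m). f (prodmap K n ?m (?l \<otimes>\<^bsub>?H\<^esub> x \<otimes>\<^bsub>?H\<^esub> ?r)))"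
  by (rule integral_eqI) (simp add: H.space_M prodmap_translate t prodmap_carrier)
  also have "... = (LINT x|mu (2 ^ n * ?m). f (prodmap K n ?m (x \<otimes>\<^bsub>?H\<^esub> ?r)))"
  by (rule H.integral_left[OF _ lr(1), of "%x. f (prodmap K n ?m (x \<otimes>\<^bsub>?H\<^esub> ?r))"])
  (rule continuous_on_compose2[OF cF H.continuous_on_translate(2)[OF lr(2) lr(2)]], use lr in auto)
  also have "... = (LINT x|mu (2 ^ n * ?m). f (prodmap K n ?m x))" by (rule H.integral_right[OF cF lr(2)])
  finally show ?thesis .
 qed
 have c2: "continuous_on (carrier (G ?m) \<times> carrier ?H) (%p. f (fst p \<otimes>\<^bsub>G ?m\<^esub> prodmap K n ?m (snd p)))"
  by (rule continuous_on_compose2[OF f])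
  (intro L.continuous_on_mult2 continuous_on_fst continuous_on_id continuous_on_compose2[OF pc continuous_on_snd[OF continuous_on_id]], auto intro!: mult_pow prodmap_carrier)
 have "(LINT x|mu (2 ^ n * ?m). f (prodmap K n ?m x)) = (LINT t|mu ?m. (LINT x|mu (2 ^ n * ?m). f (prodmap K n ?m x)))" by (simp add: L.prob_space)
 also have "... = (LINT t|mu ?m. (LINT x|mu (2 ^ n * ?m). f (t \<otimes>\<^bsub>G ?m\<^esub> prodmap K n ?m x)))"
  by (rule integral_eqI) (simp add: L.space_M shift)
 also have "... = (LINT x|mu (2 ^ n * ?m). (LINT t|mu ?m. f (t \<otimes>\<^bsub>G ?m\<^esub> prodmap K n ?m x)))"
  using Fubini_continuous(1)[OF L.finite_measure_axioms L.sets_M H.finite_measure_axioms H.sets_M L.compact_carrier H.compact_carrier c2] by simp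
 also have "... = (LINT x|mu (2 ^ n * ?m). (LINT t|mu ?m. f t))"
  by (rule integral_eqI) (simp add: H.space_M L.integral_right[OF f] prodmap_carrier)
 also have "... = (LINT t|mu ?m. f t)" by (simp add: H.prob_space)
 finally show ?thesis .
qed

lemma twist_prodmap:
 assumes s: "unirep (G m) D s" and x: "x : carrier (G (2 ^ Suc n * m))"
 shows "(SUM i<D. SUM j<D. X i j * s (prodmap K (Suc n) m x) i j) =
  (SUM a<D * D. SUM b<D * D. twist D X a b * ktensor D (s (pow_fst m (prodmap K n (2 * m) x))) (s (pow_snd m (prodmap K n (2 * m) x))) a b)"
proof -
 have y: "prodmap K n (2 * m) x : carrier (G (2 * m))" using x unfolding pow_Suc_mult by (rule prodmap_carrier)
 show ?thesis unfolding twist_sum prodmap.simps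
  by (rule sum_eqI, rule sum_eqI) (simp add: unirepD(1)[OF s pow_proj_carrier[OF y]])
qed

text \<open>Each doubling replaces \<open>s\<close> by the representation \<open>s \<otimes> s\<close> of \<open>G \<times> G\<close>, of dimension \<open>D\<^sup>2\<close>, and \<open>X\<close> by its
 twist, so the weight \<open>D\<close> of a representation in \<open>tpoly\<close> is squared.\<close>
lemma prodmap_in_dual_ball:
 assumes F: "finite F" and s: "haar_group.schur (G (2 ^ j)) (mu (2 ^ j)) F D s"
  and X: "!!k. k : F ==> partial_isometry (D k) (X k)"
 shows "(%x. SUM k:F. of_nat (D k) ^ (2 ^ n) * (SUM i<D k. SUM l<D k. X k i l * s k (prodmap K n (2 ^ j) x) i l))
  : haar_group.dual_ball (G (2 ^ n * 2 ^ j)) (mu (2 ^ n * 2 ^ j))"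
 using s X
proof (induction n arbitrary: j D s X)
 case 0
 interpret haar_group "G (2 ^ j)" "mu (2 ^ j)" by (rule haar_pow)
 show ?case using tpoly_in_dual_ball[OF F 0] by (simp add: tpoly_def[abs_def])
next
 case (Suc n)
 let ?m = "2 ^ j :: nat"
 interpret L: haar_group "G ?m" "mu ?m" by (rule haar_pow)
 interpret H: haar_group "G (2 ^ n * (2 * ?m))" "mu (2 ^ n * (2 * ?m))" using haar_pow_mult[of n "Suc j"] by (simp only: power_Suc)
 let ?s = "%k x. ktensor (D k) (s k (pow_fst ?m x)) (s k (pow_snd ?m x))"
 have "haar_group.schur (G (2 ^ Suc j)) (mu (2 ^ Suc j)) F (%k. D k * D k) ?s"
  using schur_pow_double[OF K haar_pow[of j] _ Suc.prems(1)] haar_pow[of "Suc j"] by (simp only: power_Suc)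
 from Suc.IH[OF this twist_partial_isometry[OF Suc.prems(2)]]
 have "(%x. SUM k:F. of_nat (D k * D k) ^ (2 ^ n) * (SUM a<D k * D k. SUM b<D k * D k. twist (D k) (X k) a b * ?s k (prodmap K n (2 * ?m) x) a b)) : H.dual_ball"
  by (simp only: power_Suc)
 hence "(%x. SUM k:F. of_nat (D k) ^ (2 ^ Suc n) * (SUM i<D k. SUM l<D k. X k i l * s k (prodmap K (Suc n) ?m x) i l)) : H.dual_ball"
 proof (rule H.dual_ball_cong)
  fix x assume "x : carrier (G (2 ^ n * (2 * ?m)))"
  hence x: "x : carrier (G (2 ^ Suc n * ?m))" unfolding pow_Suc_mult .
  show "(SUM k:F. of_nat (D k) ^ (2 ^ Suc n) * (SUM i<D k. SUM l<D k. X k i l * s k (prodmap K (Suc n) ?m x) i l)) =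
  (SUM k:F. of_nat (D k * D k) ^ (2 ^ n) * (SUM a<D k * D k. SUM b<D k * D k. twist (D k) (X k) a b * ?s k (prodmap K n (2 * ?m) x) a b))"
  proof (rule sum_eqI)
  fix k assume k: "k : F"
  have p: "(of_nat (D k * D k) :: complex) ^ (2 ^ n) = of_nat (D k) ^ (2 ^ Suc n)" by (simp add: power_mult power2_eq_square)
  show "of_nat (D k) ^ (2 ^ Suc n) * (SUM i<D k. SUM l<D k. X k i l * s k (prodmap K (Suc n) ?m x) i l) =
  of_nat (D k * D k) ^ (2 ^ n) * (SUM a<D k * D k. SUM b<D k * D k. twist (D k) (X k) a b * ?s k (prodmap K n (2 * ?m) x) a b)"
  unfolding p twist_prodmap[OF L.schurD(2)[OF Suc.prems(1) k] x] ..
  qed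
 qed
 thus ?case unfolding pow_Suc_mult .
qed

text \<open>Writing \<open>s(x y)\<close> as \<open>s(x) s(y)\<close> squares the dimension and multiplies the trace norm by \<open>D\<close>, the number of
 intermediate indices: the exponent \<open>2\<^sup>n - 1\<close> satisfies this recursion.\<close>
lemma prodmap_in_hull:
 assumes s: "unirep (G m) D s"
 shows "(%x. SUM i<D. SUM j<D. C i j * s (prodmap K n m x) i j) : ahull (G (2 ^ n * m)) (real D ^ (2 ^ n - 1) * tnorm D C)"
 using s
proof (induction n arbitrary: m D s C)
 case 0
 show ?case using matrix_coefficients_in_hull[OF 0] by simp
next
 case (Suc n)
 have "(%x. SUM a<D * D. SUM b<D * D. twist D C a b * ktensor D (s (pow_fst m (prodmap K n (2 * m) x))) (s (pow_snd m (prodmap K n (2 * m) x))) a b)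
  : ahull (G (2 ^ n * (2 * m))) (real (D * D) ^ (2 ^ n - 1) * tnorm (D * D) (twist D C))"
  by (rule Suc.IH[OF unirep_pow_double[OF K Suc.prems]])
 hence "(%x. SUM i<D. SUM j<D. C i j * s (prodmap K (Suc n) m x) i j)
  : ahull (G (2 ^ n * (2 * m))) (real (D * D) ^ (2 ^ n - 1) * tnorm (D * D) (twist D C))"
  by (rule hull_cong) (rule twist_prodmap[OF Suc.prems], unfold pow_Suc_mult)
 moreover have "real (D * D) ^ (2 ^ n - 1) * tnorm (D * D) (twist D C) <= real D ^ (2 ^ Suc n - 1) * tnorm D C"
 proof -
  have "real (D * D) ^ (2 ^ n - 1) * tnorm (D * D) (twist D C) <= real (D * D) ^ (2 ^ n - 1) * (real D * tnorm D C)"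
  by (rule mult_left_mono[OF tnorm_twist_le]) simp
  also have "... = real D ^ (2 * (2 ^ n - 1)) * (real D * tnorm D C)" by (simp add: power_mult power2_eq_square)
  also have "... = real D ^ Suc (2 * (2 ^ n - 1)) * tnorm D C" by simp
  also have "Suc (2 * (2 ^ n - 1)) = 2 ^ Suc n - (1::nat)" using one_le_power[of "2::nat" n] by (simp only: power_Suc) arith
  finally show ?thesis .
 qed
 ultimately show ?case unfolding pow_Suc_mult by (rule hull_mono)
qed

end

locale gamma_weyl = compact_powers K + W: peter_weyl "pow_group K (2 ^ j)" "haar_measure (pow_group K (2 ^ j)) (pow_top (top_of_set (carrier K)) (2 ^ j))" d \<pi>
 for K :: "('a::polish_space, 'r) monoid_scheme" and j d \<pi>
begin

text \<open>The sum is bounded by testing against the polar parts of the Fourier coefficients, as densities in the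
 dual ball of the power; conversely the components of \<open>f\<close> lie in hulls of the stated radii and sum
 up to \<open>f\<close> uniformly.\<close>
theorem gamma_ball_iff:
 "f : gamma_ball K n (2 ^ j) r \<longleftrightarrow>
  (ALL x. x ~: carrier (G (2 ^ j)) --> f x = 0) & cont_on (G (2 ^ j)) f &
  (ALL N. (SUM k<N. real (d k) ^ (2 ^ n - 1) * W.ft f k) <= r)"
proof (intro iffI conjI)
 assume f: "f : gamma_ball K n (2 ^ j) r"
 show "ALL x. x ~: carrier (G (2 ^ j)) --> f x = 0" using f by (simp add: gamma_ball_def)
 show cf: "cont_on (G (2 ^ j)) f" by (rule gamma_ball_continuous[OF f])
 show "ALL N. (SUM k<N. real (d k) ^ (2 ^ n - 1) * W.ft f k) <= r"
 proof
  fix N :: nat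
  interpret H: haar_group "G (2 ^ n * 2 ^ j)" "mu (2 ^ n * 2 ^ j)" by (rule haar_pow_mult)
  obtain X where X: "ALL k:{..<N}. partial_isometry (d k) (X k)"
  and eq: "(LINT x|mu (2 ^ j). f x * cnj (tpoly {..<N} d \<pi> (%k i j. of_real (real (d k) ^ (2 ^ n - 1)) * X k i j) x)) =
  of_real (SUM k<N. real (d k) ^ (2 ^ n - 1) * W.ft f k)"
  using W.sum_ft_pairing[OF finite_lessThan cf, of N "%k. real (d k) ^ (2 ^ n - 1)"] by (elim exE conjE)
  define p where "p = (%x. SUM k<N. of_nat (d k) ^ (2 ^ n) * (SUM i<d k. SUM l<d k. X k i l * \<pi> k x i l))"
  have "tpoly {..<N} d \<pi> (%k i j. of_real (real (d k) ^ (2 ^ n - 1)) * X k i j) x = p x" for x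
  proof -
  have "Suc (2 ^ n - 1) = (2 :: nat) ^ n" by simp
  hence pw: "z * z ^ (2 ^ n - 1) = z ^ (2 ^ n)" for z :: complex by (metis power_Suc)
  have "of_nat (d k) * (SUM i<d k. SUM l<d k. of_real (real (d k) ^ (2 ^ n - 1)) * X k i l * \<pi> k x i l) =
  of_nat (d k) ^ (2 ^ n) * (SUM i<d k. SUM l<d k. X k i l * \<pi> k x i l)" for k
  unfolding pw[symmetric] mult.assoc sum_distrib_left[symmetric] of_real_power of_real_of_nat_eq ..
  thus ?thesis unfolding tpoly_def p_def by simp
  qed
  hence eq': "(LINT x|mu (2 ^ j). f x * cnj (p x)) = of_real (SUM k<N. real (d k) ^ (2 ^ n - 1) * W.ft f k)" using eq by simp
  have cp: "cont_on (G (2 ^ j)) p"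
  unfolding p_def by (intro cintros W.continuous_on_rep) simp_all
  have "(%x. p (prodmap K n (2 ^ j) x)) : H.dual_ball"
  unfolding p_def by (rule prodmap_in_dual_ball[OF finite_lessThan W.schur_any]) (use X in simp)
  hence "cmod (LINT x|mu (2 ^ n * 2 ^ j). f (prodmap K n (2 ^ j) x) * cnj (p (prodmap K n (2 ^ j) x))) <= r"
  by (rule H.dual_ball_Conv) (use f in \<open>simp add: gamma_ball_def\<close>)
  also have "(LINT x|mu (2 ^ n * 2 ^ j). f (prodmap K n (2 ^ j) x) * cnj (p (prodmap K n (2 ^ j) x))) = (LINT x|mu (2 ^ j). f x * cnj (p x))"
  by (rule integral_prodmap[of j "%x. f x * cnj (p x)"]) (intro cintros cf cp)
  finally show "(SUM k<N. real (d k) ^ (2 ^ n - 1) * W.ft f k) <= r" unfolding eq' norm_of_real by linarith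
 qed
next
 assume A: "(ALL x. x ~: carrier (G (2 ^ j)) --> f x = 0) & cont_on (G (2 ^ j)) f &
  (ALL N. (SUM k<N. real (d k) ^ (2 ^ n - 1) * W.ft f k) <= r)"
 hence cf: "cont_on (G (2 ^ j)) f" and r: "!!N. (SUM k<N. real (d k) ^ (2 ^ n - 1) * W.ft f k) <= r" by blast+
 have "(SUM k<N. W.ft f k) <= r" for N
 proof -
  have "W.ft f k <= real (d k) ^ (2 ^ n - 1) * W.ft f k" for k
  using mult_right_mono[OF one_le_power[of "real (d k)" "2 ^ n - 1"] W.ft_ge_0[of f k]] W.dim_pos[of k] by simp
  hence "(SUM k<N. W.ft f k) <= (SUM k<N. real (d k) ^ (2 ^ n - 1) * W.ft f k)" by (intro sum_mono)
  also note r
  finally show ?thesis .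
 qed
 note lim = W.fourier_inversion[OF cf this]
 have "(%x. f (prodmap K n (2 ^ j) x)) : Conv (G (2 ^ n * 2 ^ j)) r"
 proof (rule ConvI)
  fix e :: real assume "e > 0"
  hence "\<forall>\<^sub>F N in sequentially. ALL x:carrier (G (2 ^ j)). dist (SUM k<N. W.block f k x) (f x) < e"
  using lim unfolding uniform_limit_iff by simp
  then obtain N where N: "ALL x:carrier (G (2 ^ j)). dist (SUM k<N. W.block f k x) (f x) < e"
  unfolding eventually_sequentially by blast
  have "(%x. SUM k:{..<N}. W.block f k (prodmap K n (2 ^ j) x)) : ahull (G (2 ^ n * 2 ^ j)) (SUM k:{..<N}. real (d k) ^ (2 ^ n - 1) * W.ft f k)"
  proof (rule hull_sum)
  fix k
  have "(%x. of_nat (d k) * (SUM i<d k. SUM l<d k. W.fc f k i l * \<pi> k (prodmap K n (2 ^ j) x) i l)) : ahull (G (2 ^ n * 2 ^ j)) (cmod (of_nat (d k)) * (real (d k) ^ (2 ^ n - 1) * tnorm (d k) (W.fc f k)))"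
  by (rule hull_scale[OF prodmap_in_hull[OF W.rep]])
  thus "(%x. W.block f k (prodmap K n (2 ^ j) x)) : ahull (G (2 ^ n * 2 ^ j)) (real (d k) ^ (2 ^ n - 1) * W.ft f k)"
  by (simp add: W.block_def tpoly_def W.ft_def mult_ac)
  qed simp
  hence "(%x. SUM k:{..<N}. W.block f k (prodmap K n (2 ^ j) x)) : ahull (G (2 ^ n * 2 ^ j)) r" by (rule hull_mono[OF _ r])
  thus "EX h:ahull (G (2 ^ n * 2 ^ j)) r. ALL x:carrier (G (2 ^ n * 2 ^ j)). cmod (f (prodmap K n (2 ^ j) x) - h x) <= e"
  proof (rule bexI[rotated], intro ballI)
  fix x assume "x : carrier (G (2 ^ n * 2 ^ j))"
  hence "dist (SUM k<N. W.block f k (prodmap K n (2 ^ j) x)) (f (prodmap K n (2 ^ j) x)) < e" using N prodmap_carrier by blast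
  thus "cmod (f (prodmap K n (2 ^ j) x) - (SUM k:{..<N}. W.block f k (prodmap K n (2 ^ j) x))) <= e"
  by (simp add: dist_norm norm_minus_commute)
  qed
 qed
 thus "f : gamma_ball K n (2 ^ j) r" using A by (simp add: gamma_ball_def)
qed

end

section \<open>The embedding into the Fourier algebra\<close>

context compact_powers
begin

lemma unital_A_gamma: "unital_on (A_gamma K T n (2 ^ j)) (*)"
proof -
 interpret B: ball_family "carrier (G (2 ^ j))" "gamma_ball K n (2 ^ j)" "A_gamma K T n (2 ^ j)" "A_gamma_norm K T n (2 ^ j)"
  by (rule gamma_ball_family)
 let ?e = "zero_ext (carrier (G (2 ^ j))) (%x. 1)"
 have "(%x. 1) : Conv (G (2 ^ n * 2 ^ j)) 1" by (rule hull_subset_Conv[OF atom_in_hull[OF one_in_atoms]])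
 hence "(%x. ?e (prodmap K n (2 ^ j) x)) : Conv (G (2 ^ n * 2 ^ j)) 1"
  by (rule Conv_cong) (simp add: zero_ext_def prodmap_carrier)
 hence "?e : gamma_ball K n (2 ^ j) 1" by (simp add: gamma_ball_def zero_ext_def)
 hence "?e : A_gamma K T n (2 ^ j)" by (rule B.ball_V)
 moreover have "?e * f = f & f * ?e = f" if "f : A_gamma K T n (2 ^ j)" for f
  using B.V_outside[OF that] by (auto simp: fun_eq_iff zero_ext_def)
 ultimately show ?thesis unfolding unital_on_def by (intro bexI[of _ ?e] ballI)
qed

lemma gamma_embed_in_ball_iff:
 assumes u: "!!x. x ~: carrier (G (2 ^ j)) ==> u x = 0"
 shows "gamma_embed K n (2 ^ j) u : gamma_ball K 0 (2 ^ n * 2 ^ j) r \<longleftrightarrow> u : gamma_ball K n (2 ^ j) r"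
proof -
 have eq: "gamma_embed K n (2 ^ j) u = zero_ext (carrier (G (2 ^ n * 2 ^ j))) (%x. u (prodmap K n (2 ^ j) x))"
  by (rule gamma_embed_eq) (rule u)
 have "gamma_embed K n (2 ^ j) u : Conv (G (2 ^ n * 2 ^ j)) r \<longleftrightarrow> (%x. u (prodmap K n (2 ^ j) x)) : Conv (G (2 ^ n * 2 ^ j)) r"
  unfolding eq by (rule iffI; erule Conv_cong) (simp_all add: zero_ext_def)
 thus ?thesis using u by (simp add: gamma_ball_def eq zero_ext_def)
qed

lemma gamma_embed_isometric:
 "isometric_algebra_hom (A_gamma K T n (2 ^ j)) (A_gamma_norm K T n (2 ^ j)) (*)
  (A_gamma K T 0 (2 ^ n * 2 ^ j)) (A_gamma_norm K T 0 (2 ^ n * 2 ^ j)) (*) (gamma_embed K n (2 ^ j))"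
 unfolding isometric_algebra_hom_def
proof (intro conjI ballI allI)
 interpret B: ball_family "carrier (G (2 ^ j))" "gamma_ball K n (2 ^ j)" "A_gamma K T n (2 ^ j)" "A_gamma_norm K T n (2 ^ j)"
  by (rule gamma_ball_family)
 interpret C: ball_family "carrier (G (2 ^ n * 2 ^ j))" "gamma_ball K 0 (2 ^ n * 2 ^ j)" "A_gamma K T 0 (2 ^ n * 2 ^ j)" "A_gamma_norm K T 0 (2 ^ n * 2 ^ j)"
  using gamma_ball_family[where n = 0 and j = "n + j"] by (simp only: power_add)
 let ?J = "gamma_embed K n (2 ^ j)"
 have J: "?J u = zero_ext (carrier (G (2 ^ n * 2 ^ j))) (%x. u (prodmap K n (2 ^ j) x))" if "u : A_gamma K T n (2 ^ j)" for u
  by (rule gamma_embed_eq) (rule B.V_outside[OF that])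
 fix f assume f: "f : A_gamma K T n (2 ^ j)"
 have iff: "?J f : gamma_ball K 0 (2 ^ n * 2 ^ j) r \<longleftrightarrow> f : gamma_ball K n (2 ^ j) r" for r
  by (rule gamma_embed_in_ball_iff) (rule B.V_outside[OF f])
 show JV: "?J f : A_gamma K T 0 (2 ^ n * 2 ^ j)"
  by (rule C.ball_V[of _ "A_gamma_norm K T n (2 ^ j) f"]) (simp only: iff B.V_ball[OF f])
 have "A_gamma_norm K T 0 (2 ^ n * 2 ^ j) (?J f) <= r \<longleftrightarrow> A_gamma_norm K T n (2 ^ j) f <= r" for r
  unfolding C.N_le[OF JV] B.N_le[OF f] by (rule iff)
 thus "A_gamma_norm K T 0 (2 ^ n * 2 ^ j) (?J f) = A_gamma_norm K T n (2 ^ j) f" by (meson order_antisym order_refl)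
 show "?J (cscale c f) = cscale c (?J f)" for c
  unfolding J[OF B.scale_V[OF f]] J[OF f] by (auto simp: zero_ext_def cscale_def)
 fix g assume g: "g : A_gamma K T n (2 ^ j)"
 show "?J (f + g) = ?J f + ?J g" "?J (f * g) = ?J f * ?J g"
  unfolding J[OF B.add_V[OF f g]] J[OF B.mult_V[OF f g]] J[OF f] J[OF g] by (auto simp: zero_ext_def fun_eq_iff)
qed

text \<open>A limit is constant on the fibres of the product map, since it is a pointwise limit of functions
 that are; it therefore is the image of its composition with the section.\<close>
lemma gamma_embed_closed:
 "closed_subalgebra (gamma_embed K n (2 ^ j) ` A_gamma K T n (2 ^ j))
  (A_gamma K T 0 (2 ^ n * 2 ^ j)) (A_gamma_norm K T 0 (2 ^ n * 2 ^ j)) (*)"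
 unfolding closed_subalgebra_def
proof (intro conjI allI impI ballI)
 let ?A = "A_gamma K T n (2 ^ j)" and ?A' = "A_gamma K T 0 (2 ^ n * 2 ^ j)" and ?N' = "A_gamma_norm K T 0 (2 ^ n * 2 ^ j)"
 let ?J = "gamma_embed K n (2 ^ j)" and ?H = "G (2 ^ n * 2 ^ j)"
 interpret B: ball_family "carrier (G (2 ^ j))" "gamma_ball K n (2 ^ j)" ?A "A_gamma_norm K T n (2 ^ j)"
  by (rule gamma_ball_family)
 interpret C: ball_family "carrier ?H" "gamma_ball K 0 (2 ^ n * 2 ^ j)" ?A' ?N'
  using gamma_ball_family[where n = 0 and j = "n + j"] by (simp only: power_add)
 note hom = gamma_embed_isometric[of n j, unfolded isometric_algebra_hom_def]
 show sub: "?J ` ?A \<subseteq> ?A'" using hom by auto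
 have J: "?J u = zero_ext (carrier ?H) (%x. u (prodmap K n (2 ^ j) x))" if "u : ?A" for u
  by (rule gamma_embed_eq) (rule B.V_outside[OF that])
 show "Modules.module.subspace cscale (?J ` ?A)"
  unfolding cs.subspace_def
 proof (intro conjI ballI allI)
  have "?J 0 = 0" unfolding J[OF B.zero_V] by (simp add: zero_ext_def fun_eq_iff)
  thus "0 : ?J ` ?A" using B.zero_V by (intro image_eqI[of _ _ 0]) simp_all
  fix F assume "F : ?J ` ?A"
  then obtain f where f: "F = ?J f" "f : ?A" by blast
  show "cscale c F : ?J ` ?A" for c using hom f B.scale_V[OF f(2)] by (intro image_eqI[of _ _ "cscale c f"]) simp_all
  fix H assume "H : ?J ` ?A"
  then obtain h where h: "H = ?J h" "h : ?A" by blast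
  have "?J (f + h) = F + H" using hom f h by simp
  thus "F + H : ?J ` ?A" using B.add_V[OF f(2) h(2)] by (metis image_eqI)
 qed
 { fix F H assume "F : ?J ` ?A" "H : ?J ` ?A"
  then obtain f h where fh: "F = ?J f" "f : ?A" "H = ?J h" "h : ?A" by blast
  have "?J (f * h) = F * H" using hom fh by simp
  thus "F * H : ?J ` ?A" using B.mult_V[OF fh(2,4)] by (metis image_eqI) }
 fix F :: "nat => (nat => 'a) => complex" and f
 assume "(ALL k. F k : ?J ` ?A) & f : ?A' & (%k. ?N' (F k - f)) \<longlonglongrightarrow> 0"
 hence F: "!!k. F k : ?J ` ?A" and f: "f : ?A'" and lim: "(%k. ?N' (F k - f)) \<longlonglongrightarrow> 0" by blast+
 have pt: "(%k. F k x) \<longlonglongrightarrow> f x" for x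
 proof (rule LIM_zero_cancel, rule Lim_null_comparison[OF _ lim], rule always_eventually, rule allI)
  fix k
  have "F k - f : ?A'" using F[of k] sub f by (intro C.diff_V) auto
  from C.V_bound[OF this, of x] show "norm (F k x - f x) <= ?N' (F k - f)" by simp
 qed
 define u where "u = zero_ext (carrier (G (2 ^ j))) (%g. f (sect n (2 ^ j) g))"
 have fiber: "f x = u (prodmap K n (2 ^ j) x)" if x: "x : carrier ?H" for x
 proof -
  have px: "prodmap K n (2 ^ j) x : carrier (G (2 ^ j))" by (rule prodmap_carrier[OF x])
  have "F k x = F k (sect n (2 ^ j) (prodmap K n (2 ^ j) x))" for k
  proof -
  obtain v where v: "F k = ?J v" "v : ?A" using F[of k] by blast
  show ?thesis unfolding v(1) J[OF v(2)] using x sect[OF px, of n] by (simp add: zero_ext_def)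
  qed
  hence "(%k. F k x) \<longlonglongrightarrow> f (sect n (2 ^ j) (prodmap K n (2 ^ j) x))" using pt by presburger
  thus ?thesis using LIMSEQ_unique[OF pt] px by (simp add: u_def zero_ext_def)
 qed
 have u0: "u x = 0" if "x ~: carrier (G (2 ^ j))" for x using that by (simp add: u_def zero_ext_def)
 have fJ: "f = ?J u"
 proof
  have eq: "?J u = zero_ext (carrier ?H) (%x. u (prodmap K n (2 ^ j) x))" by (rule gamma_embed_eq) (rule u0)
  fix x show "f x = ?J u x"
  unfolding eq using fiber[of x] C.V_outside[OF f, of x] by (simp add: zero_ext_def)
 qed
 have "f : gamma_ball K 0 (2 ^ n * 2 ^ j) (?N' f)" by (rule C.V_ball[OF f])
 hence "u : gamma_ball K n (2 ^ j) (?N' f)" unfolding fJ using gamma_embed_in_ball_iff[where u = u and j = j and n = n, OF u0] by blast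
 hence "u : ?A" by (rule B.ball_V)
 thus "f : ?J ` ?A" using fJ by (intro image_eqI)
qed

end

context gamma_weyl
begin

lemma matrix_coefficients_in_ball:
 "zero_ext (carrier (G (2 ^ j))) (%y. SUM i<d k. SUM l<d k. C i l * \<pi> k y i l) : gamma_ball K n (2 ^ j) (real (d k) ^ (2 ^ n - 1) * tnorm (d k) C)"
proof -
 have "(%x. SUM i<d k. SUM l<d k. C i l * \<pi> k (prodmap K n (2 ^ j) x) i l) : Conv (G (2 ^ n * 2 ^ j)) (real (d k) ^ (2 ^ n - 1) * tnorm (d k) C)"
  by (rule hull_subset_Conv[OF prodmap_in_hull[OF W.rep]])
 hence "(%x. zero_ext (carrier (G (2 ^ j))) (%y. SUM i<d k. SUM l<d k. C i l * \<pi> k y i l) (prodmap K n (2 ^ j) x)) : Conv (G (2 ^ n * 2 ^ j)) (real (d k) ^ (2 ^ n - 1) * tnorm (d k) C)"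
  by (rule Conv_cong) (simp add: zero_ext_def prodmap_carrier)
 thus ?thesis by (simp add: gamma_ball_def zero_ext_def)
qed

lemma entry_in_A_gamma:
 assumes "i < d k" "l < d k"
 shows "zero_ext (carrier (G (2 ^ j))) (%y. c * \<pi> k y i l) : A_gamma K T n (2 ^ j)"
proof -
 have "(SUM i'<d k. SUM l'<d k. (if l' = l then (if i' = i then c else 0) else 0) * \<pi> k y i' l') = c * \<pi> k y i l" for y
 proof -
  have "(SUM i'<d k. SUM l'<d k. (if l' = l then (if i' = i then c else 0) else 0) * \<pi> k y i' l') = (SUM i'<d k. if i' = i then c * \<pi> k y i l else 0)"
  proof (rule sum_eqI)
  fix i' assume "i' : {..<d k}"
  have "(SUM l'<d k. (if l' = l then (if i' = i then c else 0) else 0) * \<pi> k y i' l') = (SUM l'<d k. if l' = l then (if i' = i then c * \<pi> k y i l else 0) else 0)"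
  by (rule sum.cong) auto
  thus "(SUM l'<d k. (if l' = l then (if i' = i then c else 0) else 0) * \<pi> k y i' l') = (if i' = i then c * \<pi> k y i l else 0)" using assms by simp
  qed
  thus ?thesis using assms by simp
 qed
 thus ?thesis
  unfolding A_gamma_iff using matrix_coefficients_in_ball[where k = k and C = "%i' l'. if l' = l then (if i' = i then c else 0) else 0" and n = n] by (intro exI) simp
qed

lemma infinite_dimensional_A_gamma: "infinite_dimensional (A_gamma K T n (2 ^ j))"
 unfolding infinite_dimensional_def
proof
 let ?A = "A_gamma K T n (2 ^ j)" and ?G = "G (2 ^ j)" and ?M = "mu (2 ^ j)"
 assume "EX S. finite S & S \<subseteq> ?A & ?A \<subseteq> Modules.module.span cscale S"
 then obtain S where S: "finite S" "?A \<subseteq> Modules.module.span cscale S" by blast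
 define u where "u = (%k. zero_ext (carrier ?G) (%y. 1 * \<pi> k y 0 0))"
 have uA: "u k : ?A" for k unfolding u_def by (rule entry_in_A_gamma[OF W.dim_pos W.dim_pos])
 have orth: "(\<integral>x. u l x * cnj (\<pi> k x 0 0) \<partial>?M) = (if l = k then 1 / of_nat (d k) else 0)" for k l
 proof -
  have "(\<integral>x. u l x * cnj (\<pi> k x 0 0) \<partial>?M) = (\<integral>x. \<pi> l x 0 0 * cnj (\<pi> k x 0 0) \<partial>?M)"
  by (rule Bochner_Integration.integral_cong) (simp_all add: W.space_M u_def zero_ext_def)
  thus ?thesis using W.schurD(3)[OF W.schur_UNIV, of l k 0 0 0 0] W.dim_pos by simp
 qed
 have inj: "inj u"
 proof (rule injI)
  fix k l assume "u k = u l"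
  hence "(\<integral>x. u k x * cnj (\<pi> k x 0 0) \<partial>?M) = (\<integral>x. u l x * cnj (\<pi> k x 0 0) \<partial>?M)" by simp
  thus "k = l" using W.dim_pos[of k] unfolding orth by (simp split: if_splits)
 qed
 have indep: "~ Modules.module.dependent cscale (range u)"
  unfolding cs.dependent_explicit
 proof
  assume "EX t c. finite t & t \<subseteq> range u & (SUM v:t. cscale (c v) v) = 0 & (EX v:t. c v ~= 0)"
  then obtain t c v where t: "finite t" "t \<subseteq> range u" "(SUM v:t. cscale (c v) v) = 0" "v : t" "c v ~= 0" by blast
  obtain k where k: "v = u k" using t by blast
  have ap: "(SUM v:t. cscale (c v) v) x = (SUM v:t. c v * v x)" for x
  using t(1) by (induction rule: finite_induct) (simp_all add: cscale_def)
  have cont: "cont_on ?G w" if w: "w : t" for w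
  proof -
  obtain l where l: "w = u l" using w t(2) by blast
  have "cont_on ?G (%y. \<pi> l y 0 0)" by (rule W.continuous_on_rep[OF W.dim_pos W.dim_pos])
  thus ?thesis unfolding l u_def by (rule continuous_on_eq) (simp add: zero_ext_def)
  qed
  have "(\<integral>x. (SUM w:t. c w * (w x * cnj (\<pi> k x 0 0))) \<partial>?M) = (\<integral>x. 0 \<partial>?M)"
  proof (rule integral_eqI)
  fix x
  have "(SUM w:t. c w * w x) = 0" using fun_cong[OF t(3), of x] unfolding ap by simp
  thus "(SUM w:t. c w * (w x * cnj (\<pi> k x 0 0))) = 0"
  unfolding mult.assoc[symmetric] sum_distrib_right[symmetric] by simp
  qed
  moreover have "(\<integral>x. (SUM w:t. c w * (w x * cnj (\<pi> k x 0 0))) \<partial>?M) = (SUM w:t. \<integral>x. c w * (w x * cnj (\<pi> k x 0 0)) \<partial>?M)"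
  by (rule W.integral_sum_cont) (intro cintros cont W.continuous_on_rep W.dim_pos)
  moreover have "... = (SUM w:t. if w = v then c v * (1 / of_nat (d k)) else 0)"
  proof (rule sum_eqI)
  fix w assume "w : t"
  then obtain l where l: "w = u l" using t(2) by blast
  show "(\<integral>x. c w * (w x * cnj (\<pi> k x 0 0)) \<partial>?M) = (if w = v then c v * (1 / of_nat (d k)) else 0)"
  using orth[of l k] inj by (simp add: l k inj_eq)
  qed
  moreover have "... = c v * (1 / of_nat (d k))" using t by simp
  ultimately have "c v * (1 / of_nat (d k)) = 0" by simp
  thus False using t(5) W.dim_pos[of k] by simp
 qed
 have "range u \<subseteq> Modules.module.span cscale S" using uA S(2) by blast
 hence "finite (range u)" using cs.independent_span_bound[OF S(1) indep] by blast
 thus False using inj by (simp add: finite_image_iff)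
qed

end

section \<open>Arens regularity for \<open>SU(2)\<close>\<close>

lemma ent_poly_sum: "finite I ==> (!!i. i : I ==> ent_poly k (f i)) ==> ent_poly k (%A. SUM i:I. f i A)"
proof (induction rule: finite_induct)
 case empty
 show ?case using ent_poly_mono[OF ent_poly.const[of 0], of k] by simp
next
 case (insert i I)
 thus ?case using ent_poly.add[of k "f i" "%A. SUM i:I. f i A"] by simp
qed

lemma spin_ent_poly: "i < Suc k ==> ent_poly k (%A. spin k A j i)"
 unfolding spin_def by (intro ent_poly_scale rho_ent_poly) simp

lemma power_ratio_bound:
 fixes K k l a :: nat
 assumes "K <= k" "K <= l" "1 <= a" "2 / real (Suc K) <= ep"
 shows "real (Suc (k + l)) ^ a <= ep * (real (Suc k) ^ a * real (Suc l) ^ a)"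
proof -
 define P where "P = real (Suc k) * real (Suc l)"
 define q where "q = real (Suc (k + l)) / P"
 have P: "P > 0" by (simp add: P_def)
 have "real (Suc (k + l)) <= P" by (simp add: P_def algebra_simps)
 hence q: "0 <= q" "q <= 1" using P by (simp_all add: q_def)
 have "real (Suc K) * real (Suc l) <= P" "real (Suc k) * real (Suc K) <= P"
  unfolding P_def using assms(1,2) by (intro mult_mono; simp)+
 hence "real (Suc (k + l)) * real (Suc K) <= 2 * P" by (simp add: algebra_simps)
 hence "q <= 2 / real (Suc K)" unfolding q_def using P by (simp add: field_simps)
 hence "q <= ep" using assms(4) by simp
 moreover have "q ^ a <= q" using power_decreasing[OF assms(3) q] by simp
 ultimately have "q ^ a * P ^ a <= ep * P ^ a" using P by (intro mult_right_mono) simp_all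
 thus ?thesis using P by (simp add: q_def P_def power_divide power_mult_distrib)
qed

context
 fixes n s :: nat
 assumes n: "n >= 1"
  and SW: "gamma_weyl SU2 s Suc (%k y. spin k (y 0))"
begin

interpretation gamma_weyl SU2 s Suc "%k y. spin k (y 0)" by (rule SW)

abbreviation (input) G1 where "G1 \<equiv> G (2 ^ s)"
abbreviation (input) V where "V \<equiv> A_gamma SU2 T n (2 ^ s)"
abbreviation (input) N where "N \<equiv> A_gamma_norm SU2 T n (2 ^ s)"
abbreviation (input) al :: nat where "al \<equiv> 2 ^ n - 1"

interpretation B: ball_family "carrier G1" "gamma_ball SU2 n (2 ^ s)" V N by (rule gamma_ball_family)

definition bl :: "((nat => complex ^ 2 ^ 2) => complex) => nat => (nat => complex ^ 2 ^ 2) => complex" where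
 "bl f k = zero_ext (carrier G1) (W.block f k)"

lemma V_continuous: "f : V ==> cont_on G1 f" by (rule gamma_ball_continuous[OF B.V_ball])

lemma V_weights: "f : V ==> (SUM k<L. real (Suc k) ^ al * W.ft f k) <= N f"
 using B.V_ball[of f] unfolding gamma_ball_iff by blast

lemma block_ent_poly: "EX h. ent_poly k h & (ALL y. W.block f k y = h (y 0))"
 by (intro exI[of _ "%A. SUM k:{k}. of_nat (Suc k) * (SUM i<Suc k. SUM j<Suc k. W.fc f k i j * spin k A i j)"] conjI)
  (auto simp: W.block_def tpoly_def intro!: ent_poly_scale ent_poly_sum spin_ent_poly simp del: sum.lessThan_Suc)

lemma ft_ent_poly:
 assumes h: "ent_poly k h" and q: "k < q" and f: "!!y. y : carrier G1 ==> f y = h (y 0)"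
 shows "W.ft f q = 0"
proof -
 obtain c where c: "!!A. A : carrier SU2 ==> h A = (SUM l<=k. SUM i<=l. SUM j<=l. c l i j * spin l A i j)"
  using ent_poly_in_span[OF h] by (rule spin_spanE) blast
 have y0: "y 0 : carrier SU2" if "y : carrier G1" for y
  using that unfolding carrier_pow_group by (rule PiE_mem) simp
 have fc0: "W.fc f q a b = 0" if ab: "a < Suc q" "b < Suc q" for a b
 proof -
  have cont: "cont_on G1 (%y. c l i j * (spin l (y 0) i j * cnj (spin q (y 0) a b)))" if "i <= l" "j <= l" for l i j
  by (intro cintros W.continuous_on_rep ab) (use that in simp_all)
  have "W.fc f q a b = (LINT y|mu (2 ^ s). (SUM l<=k. SUM i<=l. SUM j<=l. c l i j * (spin l (y 0) i j * cnj (spin q (y 0) a b))))"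
  unfolding W.fc_def by (rule integral_eqI) (simp add: W.space_M f c y0 sum_distrib_right mult.assoc)
  also have "... = (SUM l<=k. LINT y|mu (2 ^ s). (SUM i<=l. SUM j<=l. c l i j * (spin l (y 0) i j * cnj (spin q (y 0) a b))))"
  by (rule W.integral_sum_cont) (intro continuous_on_sum cont; simp)
  also have "... = (SUM l<=k. SUM i<=l. LINT y|mu (2 ^ s). (SUM j<=l. c l i j * (spin l (y 0) i j * cnj (spin q (y 0) a b))))"
  by (rule sum_eqI, rule W.integral_sum_cont) (intro continuous_on_sum cont; simp)
  also have "... = (SUM l<=k. SUM i<=l. SUM j<=l. LINT y|mu (2 ^ s). c l i j * (spin l (y 0) i j * cnj (spin q (y 0) a b)))"
  by (rule sum_eqI, rule sum_eqI, rule W.integral_sum_cont) (intro cont; simp)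
  also have "... = 0"
  proof (intro sum.neutral ballI)
  fix l i j assume l: "l : {..k}" "i : {..l}" "j : {..l}"
  have "(LINT y|mu (2 ^ s). spin l (y 0) i j * cnj (spin q (y 0) a b)) = 0"
  using W.schurD(3)[OF W.schur_UNIV, of l q i j a b] l q ab by simp
  thus "(LINT y|mu (2 ^ s). c l i j * (spin l (y 0) i j * cnj (spin q (y 0) a b))) = 0" by simp
  qed
  finally show ?thesis .
 qed
 have "tnorm (Suc q) (W.fc f q) <= 0" by (rule tnorm_le) (simp add: pairing_def fc0 del: sum.lessThan_Suc)
 hence "tnorm (Suc q) (W.fc f q) = 0" using tnorm_ge_0[of "Suc q" "W.fc f q"] by linarith
 thus ?thesis by (simp add: W.ft_def)
qed

text \<open>The components of the product are at most \<open>k + l\<close>, so its weights are at most those of \<open>k + l\<close>, and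
 the unweighted norm is submultiplicative.\<close>
lemma block_mult:
 "bl f k * bl g l : gamma_ball SU2 n (2 ^ s) (real (Suc (k + l)) ^ al * (W.ft f k * W.ft g l))"
 unfolding gamma_ball_iff
proof (intro conjI allI impI)
 let ?h = "bl f k * bl g l"
 have hC: "?h : Conv G1 (W.ft f k * W.ft g l)"
  by (rule Conv_cong[OF Conv_mult[OF gG hull_subset_Conv[OF W.block_in_hull] hull_subset_Conv[OF W.block_in_hull]]])
  (simp add: bl_def zero_ext_def)
 show "?h x = 0" if "x ~: carrier G1" for x using that by (simp add: bl_def zero_ext_def)
 show "cont_on G1 ?h" by (rule Conv_continuous[OF hC])
 fix L :: nat
 obtain p where p: "ent_poly k p" "ALL y. W.block f k y = p (y 0)" using block_ent_poly[of k f] by (elim exE conjE)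
 obtain q where q: "ent_poly l q" "ALL y. W.block g l y = q (y 0)" using block_ent_poly[of l g] by (elim exE conjE)
 have vanish: "W.ft ?h r = 0" if "k + l < r" for r
  by (rule ft_ent_poly[OF ent_poly_mult[OF p(1) q(1)] that]) (simp add: bl_def zero_ext_def p(2) q(2))
 have "(SUM r<L. real (Suc r) ^ al * W.ft ?h r) <= (SUM r<L. real (Suc (k + l)) ^ al * W.ft ?h r)"
 proof (rule sum_mono)
  fix r
  show "real (Suc r) ^ al * W.ft ?h r <= real (Suc (k + l)) ^ al * W.ft ?h r"
  proof (cases "r <= k + l")
  case True
  thus ?thesis using W.ft_ge_0[of ?h r] by (intro mult_right_mono power_mono) simp_all
  next
  case False
  thus ?thesis using vanish[of r] by simp
  qed
 qed
 also have "... <= real (Suc (k + l)) ^ al * (W.ft f k * W.ft g l)"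
  unfolding sum_distrib_left[symmetric] using hC W.Conv_iff_sum_ft by (intro mult_left_mono) auto
 finally show "(SUM r<L. real (Suc r) ^ al * W.ft ?h r) <= real (Suc (k + l)) ^ al * (W.ft f k * W.ft g l)" .
qed

lemma bl_V: "bl f k : V"
proof -
 have "bl f k = zero_ext (carrier G1) (%y. SUM i<Suc k. SUM l<Suc k. (of_nat (Suc k) * W.fc f k i l) * spin k (y 0) i l)"
  unfolding bl_def W.block_def tpoly_def by (simp only: sum.insert[OF finite.emptyI] empty_iff not_False_eq_True sum.empty add_0_right sum_distrib_left mult.assoc)
 thus ?thesis using matrix_coefficients_in_ball[where k = k and C = "%i l. of_nat (Suc k) * W.fc f k i l" and n = n] B.ball_V by simp
qed

lemma fun_sum_apply: "(SUM i:I. F i) x = (SUM i:I. F i x)" for F :: "'i => 'x => complex"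
 by (induction I rule: infinite_finite_induct) simp_all

lemma tail_product:
 assumes f: "f : V" and g: "g : V" and K: "2 / real (Suc K) <= ep"
 shows "(SUM k:{K..<L}. bl f k) * (SUM l:{K..<L}. bl g l) : gamma_ball SU2 n (2 ^ s) (ep * N f * N g)"
proof -
 have e: "ep >= 0" using K by (rule order_trans[rotated]) simp
 have a: "1 <= al" using n power_increasing[of 1 n "2::nat"] by simp
 define A where "A = (%f k. real (Suc k) ^ al * W.ft f k)"
 have A0: "0 <= A h k" for h k by (simp add: A_def W.ft_ge_0)
 have A_sum: "(SUM k:{K..<L}. A h k) <= N h" if "h : V" for h
 proof -
  have "(SUM k:{K..<L}. A h k) <= (SUM k<L. A h k)" by (rule sum_mono2) (auto intro: A0)
  also have "... <= N h" unfolding A_def by (rule V_weights[OF that])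
  finally show ?thesis .
 qed
 have mV: "bl f k * bl g l : V" for k l by (intro B.mult_V bl_V)
 have eq: "(SUM k:{K..<L}. bl f k) * (SUM l:{K..<L}. bl g l) = (SUM k:{K..<L}. SUM l:{K..<L}. bl f k * bl g l)"
  by (rule sum_product)
 have inner: "(SUM l:{K..<L}. bl f k * bl g l) : V" for k by (intro B.sum_V mV) simp
 have "N (SUM k:{K..<L}. SUM l:{K..<L}. bl f k * bl g l) <= (SUM k:{K..<L}. N (SUM l:{K..<L}. bl f k * bl g l))"
  by (rule B.N_sum) (simp_all only: finite_atLeastLessThan inner)
 also have "... <= (SUM k:{K..<L}. SUM l:{K..<L}. N (bl f k * bl g l))"
  by (rule sum_mono, rule B.N_sum) (simp_all only: finite_atLeastLessThan mV)
 also have "... <= (SUM k:{K..<L}. SUM l:{K..<L}. ep * (A f k * A g l))"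
 proof (rule sum_mono, rule sum_mono)
  fix k l assume k: "k : {K..<L}" and l: "l : {K..<L}"
  have "N (bl f k * bl g l) <= real (Suc (k + l)) ^ al * (W.ft f k * W.ft g l)" by (rule B.ball_N[OF block_mult])
  also have "... <= (ep * (real (Suc k) ^ al * real (Suc l) ^ al)) * (W.ft f k * W.ft g l)"
  by (rule mult_right_mono[OF power_ratio_bound[OF _ _ a K]]) (use k l in \<open>simp_all add: W.ft_ge_0\<close>)
  also have "... = ep * (A f k * A g l)" unfolding A_def by (simp only: mult_ac)
  finally show "N (bl f k * bl g l) <= ep * (A f k * A g l)" .
 qed
 also have "... = ep * ((SUM k:{K..<L}. A f k) * (SUM l:{K..<L}. A g l))"
  unfolding sum_product by (simp only: sum_distrib_left)
 also have "... <= ep * (N f * N g)" by (intro mult_left_mono mult_mono A_sum f g B.N_ge_0 sum_nonneg A0 e)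
 finally have "N (SUM k:{K..<L}. SUM l:{K..<L}. bl f k * bl g l) <= ep * N f * N g" by (simp only: mult.assoc)
 moreover have "(SUM k:{K..<L}. SUM l:{K..<L}. bl f k * bl g l) : V" by (intro B.sum_V inner) simp
 ultimately show ?thesis unfolding eq using B.N_le by blast
qed

text \<open>The remainders are uniform limits of sums of components between \<open>K\<close> and \<open>L\<close>, for which \<open>tail_product\<close> gives
 a bound that does not depend on \<open>L\<close>.\<close>
lemma truncation_product:
 assumes f: "f : V" and g: "g : V" and K: "2 / real (Suc K) <= ep"
 shows "(f - (SUM k<K. bl f k)) * (g - (SUM k<K. bl g k)) : gamma_ball SU2 n (2 ^ s) (ep * N f * N g)"
proof (rule B.closed_ball)
 let ?u = "%f. f - (SUM k<K. bl f k)" and ?t = "%f L. SUM k:{K..<L}. bl f k"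
 have uV: "?u h : V" if "h : V" for h by (intro B.diff_V that B.sum_V bl_V) simp
 show "(?u f * ?u g) x = 0" if "x ~: carrier G1" for x
  using B.V_outside[OF uV[OF f] that] by simp
 fix e :: real assume e: "e > 0"
 define b where "b = N (?u f) + N (?u g) + 1"
 have b: "b >= 1" using B.N_ge_0[OF uV[OF f]] B.N_ge_0[OF uV[OF g]] by (simp add: b_def)
 define de where "de = min 1 (e / b)"
 have de: "de > 0" "de <= 1" "de * b <= e" using e b by (auto simp: de_def min_def field_simps)
 have ev: "\<forall>\<^sub>F L in sequentially. ALL y:carrier G1. cmod (?u h y - ?t h L y) < de" if h: "h : V" for h
 proof -
  have "(SUM k<L. W.ft h k) <= N h" for L
  proof -
  have "(SUM k<L. W.ft h k) <= (SUM k<L. real (Suc k) ^ al * W.ft h k)"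
  proof (rule sum_mono)
  fix k show "W.ft h k <= real (Suc k) ^ al * W.ft h k"
  using mult_right_mono[OF one_le_power[of "real (Suc k)" al] W.ft_ge_0[of h k]] by simp
  qed
  also have "... <= N h" by (rule V_weights[OF h])
  finally show ?thesis .
  qed
  from W.fourier_inversion[OF V_continuous[OF h] this]
  have "\<forall>\<^sub>F L in sequentially. ALL y:carrier G1. dist (SUM k<L. W.block h k y) (h y) < de"
  using de(1) unfolding uniform_limit_iff by blast
  thus ?thesis using eventually_ge_at_top[of K]
  proof eventually_elim
  case (elim L)
  show ?case
  proof
  fix y assume y: "y : carrier G1"
  have "(SUM k<L. bl h k y) = (SUM k<K. bl h k y) + (SUM k:{K..<L}. bl h k y)"
  using elim(2) by (simp add: lessThan_atLeast0 sum.atLeastLessThan_concat)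
  moreover have "(SUM k<L. bl h k y) = (SUM k<L. W.block h k y)" by (rule sum.cong) (use y in \<open>simp_all add: bl_def zero_ext_def\<close>)
  ultimately have eq: "?u h y - ?t h L y = h y - (SUM k<L. W.block h k y)" by (simp add: fun_sum_apply)
  show "cmod (?u h y - ?t h L y) < de"
  unfolding eq norm_minus_commute[of "h y"] using bspec[OF elim(1) y] by (simp only: dist_norm)
  qed
  qed
 qed
 obtain L where L: "ALL y:carrier G1. cmod (?u f y - ?t f L y) < de" "ALL y:carrier G1. cmod (?u g y - ?t g L y) < de"
  using eventually_conj[OF ev[OF f] ev[OF g]] unfolding eventually_sequentially by blast
 have "cmod ((?u f * ?u g) y - (?t f L * ?t g L) y) <= e" if y: "y : carrier G1" for y
 proof -
  define a c a' c' where "a = ?u f y" and "c = ?u g y" and "a' = ?t f L y" and "c' = ?t g L y"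
  have ac: "cmod a <= N (?u f)" "cmod c <= N (?u g)" unfolding a_def c_def by (rule B.V_bound[OF uV[OF f]], rule B.V_bound[OF uV[OF g]])
  have d: "cmod (a - a') < de" "cmod (c - c') < de" using L y by (simp_all add: a_def c_def a'_def c'_def)
  have "a * c - a' * c' = (a - a') * c + (a - (a - a')) * (c - c')" by (simp add: algebra_simps)
  hence "cmod (a * c - a' * c') <= cmod (a - a') * cmod c + cmod (a - (a - a')) * cmod (c - c')"
  by (metis norm_mult norm_triangle_ineq)
  also have "... <= de * N (?u g) + (N (?u f) + 1) * de"
  proof (intro add_mono mult_mono)
  show "cmod (a - (a - a')) <= N (?u f) + 1" using norm_triangle_ineq4[of a "a - a'"] ac(1) d(1) de(2) by linarith
  qed (use ac d de B.N_ge_0[OF uV[OF f]] in simp_all)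
  also have "... = de * b" by (simp add: b_def algebra_simps)
  finally show ?thesis using de(3) by (simp add: a_def c_def a'_def c'_def)
 qed
 thus "EX h:gamma_ball SU2 n (2 ^ s) (ep * N f * N g). ALL y:carrier G1. cmod ((?u f * ?u g) y - h y) <= e"
  by (intro bexI[OF _ tail_product[OF f g K, of L]] ballI)
qed

lemma fc_dual:
 assumes ij: "i < Suc k" "j < Suc k"
 shows "zero_ext V (%f. W.fc f k i j) : dual_space V N"
proof (rule B.dualI[where C = 1])
 note c = W.continuous_on_rep[OF ij]
 fix f assume f: "f : V"
 note cf = V_continuous[OF f]
 show "W.fc (cscale c f) k i j = c * W.fc f k i j" for c by (simp add: W.fc_def cscale_def mult.assoc)
 show "cmod (W.fc f k i j) <= 1 * N f"
  unfolding W.fc_def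
 proof (rule W.norm_integral_le)
  show "cont_on G1 (%y. f y * cnj (spin k (y 0) i j))" by (intro cintros cf c)
  fix y assume y: "y : carrier G1"
  have "cmod (f y) * cmod (spin k (y 0) i j) <= N f * 1"
  using B.V_bound[OF f] unirep_entry_bound[OF gG W.rep y ij] by (intro mult_mono B.N_ge_0 f) simp_all
  thus "cmod (f y * cnj (spin k (y 0) i j)) <= 1 * N f" by (simp add: norm_mult)
 qed
 fix g assume g: "g : V"
 have "W.fc (f + g) k i j = (LINT y|mu (2 ^ s). f y * cnj (spin k (y 0) i j) + g y * cnj (spin k (y 0) i j))"
  by (simp add: W.fc_def distrib_right)
 also have "... = W.fc f k i j + W.fc g k i j"
  unfolding W.fc_def by (rule Bochner_Integration.integral_add; rule W.integrable_cont; intro cintros cf c V_continuous[OF g])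
 finally show "W.fc (f + g) k i j = W.fc f k i j + W.fc g k i j" .
qed

lemma A_gamma_SU2_arens_regular: "arens_regular V N (*)"
proof (rule B.arens_regular_finite_rank)
 fix ep :: real assume "ep > 0"
 obtain K :: nat where "2 / ep <= real K" using real_arch_simple by blast
 hence K: "2 / real (Suc K) <= ep" using \<open>ep > 0\<close> by (simp add: field_simps)
 define I where "I = (SIGMA k:{..<K}. {..<Suc k} \<times> {..<Suc k})"
 define c where "c = (%(k, i, j). zero_ext V (%f. W.fc f k i j))"
 define p where "p = (%(k, i, j). zero_ext (carrier G1) (%y. of_nat (Suc k) * spin k (y 0) i j))"
 have I: "finite I" by (simp add: I_def)
 have "c b : dual_space V N & p b : V" if "b : I" for b
 proof -
  obtain k i j where b: "b = (k, i, j)" by (cases b)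
  hence ij: "i < Suc k" "j < Suc k" using that by (simp_all add: I_def)
  show ?thesis unfolding b c_def p_def prod.case by (intro conjI fc_dual entry_in_A_gamma ij)
 qed
 moreover have P: "(SUM b:I. cscale (c b f) (p b)) = (SUM k<K. bl f k)" if f: "f : V" for f
 proof
  fix y
  have "(SUM b:I. cscale (c b f) (p b)) y = (SUM b:I. c b f * p b y)" by (simp add: fun_sum_apply cscale_def)
  also have "... = (SUM k<K. SUM i<Suc k. SUM j<Suc k. c (k, i, j) f * p (k, i, j) y)"
  proof -
  have "(SUM k<K. SUM q:{..<Suc k} \<times> {..<Suc k}. c (k, q) f * p (k, q) y) = (SUM b:I. c b f * p b y)"
  unfolding I_def by (subst sum.Sigma) (simp_all add: case_prod_beta')
  thus ?thesis unfolding sum.cartesian_product' by simp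
  qed
  also have "... = (SUM k<K. bl f k y)"
  proof (rule sum_eqI)
  fix k
  show "(SUM i<Suc k. SUM j<Suc k. c (k, i, j) f * p (k, i, j) y) = bl f k y"
  using f by (cases "y : carrier G1")
  (simp_all add: c_def p_def bl_def W.block_def tpoly_def zero_ext_def sum_distrib_left mult_ac del: sum.lessThan_Suc)
  qed
  finally show "(SUM b:I. cscale (c b f) (p b)) y = (SUM k<K. bl f k) y" by (simp only: fun_sum_apply)
 qed
 moreover have "N ((f - (SUM k<K. bl f k)) * (g - (SUM k<K. bl g k))) <= ep * N f * N g" if "f : V" "g : V" for f g
  by (rule B.ball_N[OF truncation_product[OF that K]])
 ultimately show "EX (B :: (nat \<times> nat \<times> nat) set) c p. finite B & (ALL b:B. c b : dual_space V N & p b : V) &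
  (ALL f:V. ALL g:V. N ((f - (SUM b:B. cscale (c b f) (p b))) * (g - (SUM b:B. cscale (c b g) (p b)))) <= ep * N f * N g)"
  using I by (intro exI[of _ I] exI[of _ c] exI[of _ p]) simp
qed

end

lemma gamma_weyl_SU2: "gamma_weyl SU2 0 Suc (%k y. spin k (y 0))"
proof -
 note spw = spin_peter_weyl[OF haar_group_SU2]
 interpret compact_powers SU2 by (rule compact_powersI[OF spw])
 obtain M' where M': "peter_weyl (pow_group SU2 1) M' Suc (%k y. spin k (y 0))"
  using peter_weyl_pow_one[OF spw] by blast
 then interpret P: peter_weyl "pow_group SU2 1" M' Suc "%k y. spin k (y 0)" .
 have "mu 1 = M'" unfolding pow_top_eq by (rule P.haar_measure_eq)
 hence "peter_weyl (G (2 ^ 0)) (mu (2 ^ 0)) Suc (%k y. spin k (y 0))" using M' by simp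
 thus ?thesis by (intro gamma_weyl.intro compact_powers_axioms)
qed

theorem theorem4p4:
  fixes n :: nat
  assumes "n \<ge> 1"
  shows "let A = A_gamma SU2 SU2_top n 1;
             A_norm = A_gamma_norm SU2 SU2_top n 1;
             G\<^sub>n = pow_group SU2 (2 ^ n);
             T\<^sub>n = pow_top SU2_top (2 ^ n);
             J = gamma_embed SU2 n 1
         in unital_on A (*) \<and> infinite_dimensional A \<and> arens_regular A A_norm (*) \<and>
            isometric_algebra_hom A A_norm (*)
              (fourier_algebra G\<^sub>n T\<^sub>n) (fourier_norm G\<^sub>n T\<^sub>n) (*) J \<and>
            closed_subalgebra (J ` A) (fourier_algebra G\<^sub>n T\<^sub>n) (fourier_norm G\<^sub>n T\<^sub>n) (*)"
proof -
 interpret gamma_weyl SU2 0 Suc "%k y. spin k (y 0)" by (rule gamma_weyl_SU2)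
 have fn: "A_gamma_norm SU2 T 0 m = fourier_norm (pow_group SU2 m) (pow_top T m)" for m by (rule ext) simp
 show ?thesis
  unfolding Let_def SU2_top_def
  using unital_A_gamma[of n 0] infinite_dimensional_A_gamma[of n] A_gamma_SU2_arens_regular[OF assms gamma_weyl_SU2]
  gamma_embed_isometric[of n 0] gamma_embed_closed[of n 0]
  unfolding power_0 mult_1_right A_gamma.simps(1) fn by blast
qed

end
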